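(* Let $S=\begin{pmatrix}A&B\\C&D\end{pmatrix}\in\mathrm{Sp}(d,\mathbb{R})$ with $d\times d$ real blocks, let $\widehat S$ be a metaplectic operator on $L^2(\mathbb{R}^d)$ with projection $S$, and assume $1\le r=\mathrm{rank}(B)\le d$. Fix an orthonormal basis $\{v_1,\dots,v_r\}$ of $\ker(B)^\perp$ and denote by $w^{(j)}$ the $j$-th component of $w\in\ker(B)^\perp$ with respect to this basis. Let $1<p<2$ and let $q$ be the conjugate exponent, $\frac1p+\frac1q=1$. For $f\in L^2(\mathbb{R}^d)$, $j\in\{1,\dots,r\}$ and $a,b>0$ consider the two conditions $$\int_{\ker(B)^\perp}|f(x_1+x_2)|\,e^{\frac{2\pi a^p}{p}|x_1^{(j)}|^p}\,dx_1<\infty\quad\text{for a.e. }x_2\in D^TA(\ker(B)),\qquad(\ast)$$ $$\int_{\ker(B)^\perp}|\widehat Sf(B\zeta_1+\xi_2)|\,e^{\frac{2\pi b^q}{q}|\zeta_1^{(j)}|^q}\,d\zeta_1<\infty\quad\text{for a.e. }\xi_2\in A(\ker(B)).\qquad(\ast\ast)$$ (i) If $f\in L^2(\mathbb{R}^d)$ satisfies $(\ast)$ and $(\ast\ast)$ for some $j\in\{1,\dots,r\}$ and some $a,b>0$ with $ab>|\cos(p\pi/2)|^{1/p}$, then $f=0$. (ii) If $a,b>0$ and $ab<|\cos(p\pi/2)|^{1/p}$, then there exists a dense subset of $L^2(\mathbb{R}^d)$ all of whose elements satisfy $(\ast)$ and $(\ast\ast)$ for all $j=1,\dots,r$.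
   Context: A real matrix $S=\begin{pmatrix}A&B\\C&D\end{pmatrix}$ with $d\times d$ blocks is symplectic, $S\in\mathrm{Sp}(d,\mathbb{R})$, if $A^TC=C^TA$, $B^TD=D^TB$ and $A^TD-C^TB=I_d$. $R(B)$ is the range of $B$ and $B^+$ its Moore-Penrose inverse. The dot denotes the Euclidean inner product. For a $d\times d$ matrix $M$ and a linear subspace $L\subseteq\mathbb{R}^d$ with orthonormal basis forming the columns of a matrix $E$, $q_L(M)=\sqrt{\det(E^TM^TME)}$; if $L=\{0\}$, $q_L(M)=1$. Let $\sigma(B)$ be the product of the non-zero singular values of $B$ and $\mu_S=\bigl(q_{R(B)^\perp}(A^T)\,\sigma(B)\bigr)^{-1/2}$. For $B\neq0$, the metaplectic operator with projection $S$ is, up to a unimodular constant, the unitary operator on $L^2(\mathbb{R}^d)$ extending $$\widehat Sf(x)=\mu_Se^{i\pi DC^Tx\cdot x}\int_{\ker(B)^\perp}f(y+D^Tx)\,e^{i\pi B^+Ay\cdot y}\,e^{2\pi iC^Tx\cdot y}\,dy,\qquad f\in\mathcal{S}(\mathbb{R}^d).$$ Known facts making the statement meaningful: $\mathbb{R}^d=\ker(B)^\perp\oplus D^TA(\ker(B))$ and $\mathbb{R}^d=R(B)\oplus A(\ker(B))$ (direct sums, not necessarily orthogonal). Linear subspaces carry their Lebesgue measure (a point mass for $\{0\}$). *)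

theory Defs
  imports "HOL-Analysis.Analysis"
begin

section \<open>Linear algebra\<close>

definition symplectic_blocks ::
    "real^'n^'n \<Rightarrow> real^'n^'n \<Rightarrow> real^'n^'n \<Rightarrow> real^'n^'n \<Rightarrow> bool" where
  "symplectic_blocks A B C D \<longleftrightarrow>
     transpose A ** C = transpose C ** A \<and>
     transpose B ** D = transpose D ** B \<and>
     transpose A ** D - transpose C ** B = mat 1"

definition mat_ker :: "real^'n^'n \<Rightarrow> (real^'n) set" where
  "mat_ker M = {x. M *v x = 0}"

definition mat_range :: "real^'n^'n \<Rightarrow> (real^'n) set" where
  "mat_range M = range (\<lambda>x. M *v x)"

text \<open>The Moore-Penrose inverse is the unique solution of the four Penrose equations.\<close>

definition moore_penrose :: "real^'n^'n \<Rightarrow> real^'n^'n" where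
  "moore_penrose B = (THE X. B ** X ** B = B \<and> X ** B ** X = X \<and>
     transpose (B ** X) = B ** X \<and> transpose (X ** B) = X ** B)"

text \<open>An orthonormal basis, as a set of vectors. The choice is immaterial
  in both places where it is used below.\<close>

definition is_onb :: "'a::euclidean_space set \<Rightarrow> 'a set \<Rightarrow> bool" where
  "is_onb L E \<longleftrightarrow> pairwise orthogonal E \<and> (\<forall>e\<in>E. norm e = 1) \<and> span E = L"

definition some_onb :: "'a::euclidean_space set \<Rightarrow> 'a set" where
  "some_onb L = (SOME E. is_onb L E)"

lemma is_onb_some_onb:
  assumes "subspace L"
  shows "is_onb L (some_onb L)"
proof -
  obtain E where "pairwise orthogonal E" "\<And>x. x \<in> E \<Longrightarrow> norm x = 1" "span E = L"
    using orthonormal_basis_subspace[OF assms] by metis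
  then have "is_onb L E"
    by (simp add: is_onb_def)
  then show ?thesis
    unfolding some_onb_def by (rule someI)
qed

text \<open>The determinant of a square matrix whose rows and columns are indexed by a
  finite set \<open>I\<close> rather than by a type. It is 1 if \<open>I\<close> is empty.\<close>

definition det_on :: "'i set \<Rightarrow> ('i \<Rightarrow> 'i \<Rightarrow> real) \<Rightarrow> real" where
  "det_on I K = (\<Sum>\<pi> | \<pi> permutes I. of_int (sign \<pi>) * (\<Prod>i\<in>I. K i (\<pi> i)))"

lemma det_on_UNIV: "det_on UNIV (\<lambda>i j. M $ i $ j) = det M"
  by (simp add: det_on_def det_def)

lemma det_on_empty: "det_on {} K = 1"
  by (simp add: det_on_def)

text \<open>If the columns of \<open>E\<close> are the basis vectors, the entry of \<open>E\<^sup>T M\<^sup>T M E\<close>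
  at \<open>(e, e')\<close> is \<open>M e \<bullet> M e'\<close>.\<close>

definition q_vol :: "(real^'n) set \<Rightarrow> real^'n^'n \<Rightarrow> real" where
  "q_vol L M = sqrt (det_on (some_onb L) (\<lambda>e e'. (M *v e) \<bullet> (M *v e')))"

text \<open>The singular values of \<open>B\<close> are the square roots of the eigenvalues of \<open>B\<^sup>T B\<close>;
  the multiplicity of \<open>s\<close> is the dimension of the eigenspace for \<open>s\<^sup>2\<close>.\<close>

definition singular_space :: "real^'n^'n \<Rightarrow> real \<Rightarrow> (real^'n) set" where
  "singular_space B s = {x. (transpose B ** B) *v x = s\<^sup>2 *\<^sub>R x}"

definition sigma_prod :: "real^'n^'n \<Rightarrow> real" where
  "sigma_prod B = (\<Prod>s \<in> {s. s > 0 \<and> singular_space B s \<noteq> {0}}. s ^ dim (singular_space B s))"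

definition mu_S :: "real^'n^'n \<Rightarrow> real^'n^'n \<Rightarrow> real" where
  "mu_S A B = (q_vol ((mat_range B)\<^sup>\<bottom>) (transpose A) * sigma_prod B) powr (- 1 / 2)"


section \<open>Lebesgue measure on a linear subspace\<close>

text \<open>Lebesgue measure in orthonormal coordinates of \<open>L\<close>, as a Borel measure on the whole
  space that is concentrated on \<open>L\<close>. For \<open>L = {0}\<close> it is the point mass at 0. A property holds
  \<open>AE\<close> with respect to it iff it holds at almost every point of \<open>L\<close>.\<close>

definition subspace_lebesgue :: "'a::euclidean_space set \<Rightarrow> 'a measure" where
  "subspace_lebesgue L =
     distr (Pi\<^sub>M (some_onb L) (\<lambda>_. lborel :: real measure)) borel
       (\<lambda>c. \<Sum>e\<in>some_onb L. c e *\<^sub>R e)"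


section \<open>Square-integrable and Schwartz functions\<close>

text \<open>Elements of \<open>L\<^sup>2\<close> are given by Borel representatives; two representatives of the same
  element are equal almost everywhere.\<close>

definition L2 :: "(real^'n \<Rightarrow> complex) set" where
  "L2 = {f \<in> borel_measurable borel. integrable lborel (\<lambda>x. (norm (f x))\<^sup>2)}"

definition L2_inner :: "(real^'n \<Rightarrow> complex) \<Rightarrow> (real^'n \<Rightarrow> complex) \<Rightarrow> complex" where
  "L2_inner f g = (LINT x|lborel. f x * cnj (g x))"

definition L2_norm :: "(real^'n \<Rightarrow> complex) \<Rightarrow> real" where
  "L2_norm f = sqrt (LINT x|lborel. (norm (f x))\<^sup>2)"

definition L2_dense :: "(real^'n \<Rightarrow> complex) set \<Rightarrow> bool" where
  "L2_dense G \<longleftrightarrow> G \<subseteq> L2 \<and> (\<forall>g\<in>L2. \<forall>\<epsilon>>0. \<exists>f\<in>G. L2_norm (\<lambda>x. f x - g x) < \<epsilon>)"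

text \<open>A unitary operator on \<open>L\<^sup>2\<close>, acting on representatives.\<close>

definition L2_unitary :: "((real^'n \<Rightarrow> complex) \<Rightarrow> (real^'n \<Rightarrow> complex)) \<Rightarrow> bool" where
  "L2_unitary T \<longleftrightarrow>
     (\<forall>f\<in>L2. T f \<in> L2) \<and>
     (\<forall>f\<in>L2. \<forall>g\<in>L2. (AE x in lborel. f x = g x) \<longrightarrow> (AE x in lborel. T f x = T g x)) \<and>
     (\<forall>f\<in>L2. \<forall>g\<in>L2. AE x in lborel. T (\<lambda>y. f y + g y) x = T f x + T g x) \<and>
     (\<forall>f\<in>L2. \<forall>c. AE x in lborel. T (\<lambda>y. c * f y) x = c * T f x) \<and>
     (\<forall>f\<in>L2. \<forall>g\<in>L2. L2_inner (T f) (T g) = L2_inner f g) \<and>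
     (\<forall>g\<in>L2. \<exists>f\<in>L2. AE x in lborel. T f x = g x)"

text \<open>Iterated partial derivatives; the list gives the successive coordinate directions.\<close>

fun iter_partial :: "'n list \<Rightarrow> (real^'n \<Rightarrow> complex) \<Rightarrow> (real^'n \<Rightarrow> complex)" where
  "iter_partial [] f = f"
| "iter_partial (i # is) f = iter_partial is (\<lambda>x. frechet_derivative f (at x) (axis i 1))"

definition schwartz :: "(real^'n \<Rightarrow> complex) set" where
  "schwartz = {f. \<forall>is.
     (\<forall>x. iter_partial is f differentiable (at x)) \<and>
     (\<forall>k::nat. bounded (range (\<lambda>x. norm x ^ k *\<^sub>R iter_partial is f x)))}"


section \<open>Metaplectic operators\<close>

definition metaplectic_formula ::
    "real^'n^'n \<Rightarrow> real^'n^'n \<Rightarrow> real^'n^'n \<Rightarrow> real^'n^'n \<Rightarrow>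
     (real^'n \<Rightarrow> complex) \<Rightarrow> real^'n \<Rightarrow> complex" where
  "metaplectic_formula A B C D f x =
     complex_of_real (mu_S A B) *
     exp (\<i> * complex_of_real (pi * (((D ** transpose C) *v x) \<bullet> x))) *
     (LINT y|subspace_lebesgue ((mat_ker B)\<^sup>\<bottom>).
        f (y + transpose D *v x) *
        exp (\<i> * complex_of_real (pi * (((moore_penrose B ** A) *v y) \<bullet> y))) *
        exp (\<i> * complex_of_real (2 * pi * ((transpose C *v x) \<bullet> y))))"

text \<open>For \<open>B \<noteq> 0\<close>: \<open>T\<close> is a metaplectic operator whose projection is the symplectic matrix with
  blocks \<open>A\<close>, \<open>B\<close>, \<open>C\<close>, \<open>D\<close>. As Schwartz functions are dense in \<open>L\<^sup>2\<close>, this determines \<open>T\<close> up to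
  the unimodular constant and almost everywhere equality.\<close>

definition metaplectic_op ::
    "real^'n^'n \<Rightarrow> real^'n^'n \<Rightarrow> real^'n^'n \<Rightarrow> real^'n^'n \<Rightarrow>
     ((real^'n \<Rightarrow> complex) \<Rightarrow> (real^'n \<Rightarrow> complex)) \<Rightarrow> bool" where
  "metaplectic_op A B C D T \<longleftrightarrow>
     L2_unitary T \<and>
     (\<exists>c::complex. norm c = 1 \<and>
        (\<forall>f\<in>schwartz. AE x in lborel. T f x = c * metaplectic_formula A B C D f x))"


section \<open>The two decay conditions\<close>

text \<open>Here \<open>u\<close> is the basis vector of \<open>(mat_ker B)\<^sup>\<bottom>\<close> that singles out the component. Changing
  \<open>f\<close> (or \<open>F\<close>) on a null set does not affect the conditions, by Fubini's theorem.\<close>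

definition decay_f ::
    "real^'n^'n \<Rightarrow> real^'n^'n \<Rightarrow> real^'n^'n \<Rightarrow> real^'n \<Rightarrow> real \<Rightarrow> real \<Rightarrow>
     (real^'n \<Rightarrow> complex) \<Rightarrow> bool" where
  "decay_f A B D u p a f \<longleftrightarrow>
     (AE x2 in subspace_lebesgue ((\<lambda>x. (transpose D ** A) *v x) ` mat_ker B).
        (\<integral>\<^sup>+ x1. ennreal (norm (f (x1 + x2)) *
              exp (2 * pi * a powr p / p * \<bar>x1 \<bullet> u\<bar> powr p))
           \<partial>subspace_lebesgue ((mat_ker B)\<^sup>\<bottom>)) < \<infinity>)"

definition decay_Sf ::
    "real^'n^'n \<Rightarrow> real^'n^'n \<Rightarrow> real^'n \<Rightarrow> real \<Rightarrow> real \<Rightarrow>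
     (real^'n \<Rightarrow> complex) \<Rightarrow> bool" where
  "decay_Sf A B u q b F \<longleftrightarrow>
     (AE \<xi>2 in subspace_lebesgue ((\<lambda>x. A *v x) ` mat_ker B).
        (\<integral>\<^sup>+ \<zeta>1. ennreal (norm (F (B *v \<zeta>1 + \<xi>2)) *
              exp (2 * pi * b powr q / q * \<bar>\<zeta>1 \<bullet> u\<bar> powr q))
           \<partial>subspace_lebesgue ((mat_ker B)\<^sup>\<bottom>)) < \<infinity>)"

end

theory Submission
  imports Defs "HOL-Probability.Probability" "HOL-Complex_Analysis.Complex_Analysis" "HOL-Real_Asymp.Real_Asymp"
begin

text \<open>In linear coordinates adapted to the splittings $\ker(B)^\perp \oplus D^T A(\ker B)$ and
  $R(B) \oplus A(\ker B)$ a metaplectic operator is, up to chirps and a constant, the Fourier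
  transform in the first \<open>r\<close> variables. On Gaussians times characters this is the integral
  formula; testing against Gaussians and using density it extends to every \<open>f\<close> in \<open>L\<^sup>2\<close> with
  integrable fibres.

  Part (i) is then Morgan's theorem in the \<open>j\<close>-th variable, fibre by fibre. The Fourier transform
  \<open>G\<close> of a fibre is entire with $|G(z)| \le C e^{M |\mathrm{Im} z|^q}$ and decays on the real line
  faster than the critical rate, and a Phragmen-Lindelof argument in sectors gives \<open>G = 0\<close>.

  For part (ii) a Wright function \<open>g\<close>, written as an integral over two rays, attains the critical
  rates for itself and its Fourier transform simultaneously; the transform is estimated by moving
  the rays to a vertical line through the saddle point. Products of copies of \<open>g\<close> and Gaussians
  vanish almost nowhere, so their multiples by trigonometric polynomials are dense.\<close>

section \<open>Density of trigonometric polynomials\<close>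

text \<open>The threshold \<open>\<bar>cos (p * pi / 2)\<bar> powr (1 / p)\<close> enters both parts
  through an angle. In (i), Young's inequality bounds the transform by exp (M |Im z|^q) with M = 2
  pi a^(-q) / q. At the angle pi / (2 (q - 1)) = (p - 1) pi / 2 the power z^(q-1) is purely
  imaginary, and a decay rate N on the axis forces the zero function once N exceeds M times the
  (q-1)-th power of the sine of this angle, which is |cos (p pi / 2)|. In (ii), the rays at the
  angles p pi / 4 and - p pi / 4 are those on which both terms of the exponent decay with the same
  factor c = - cos (p pi / 2).

  Two obstacles shape the rest. The decay conditions hold fibre by fibre without any uniform bound,
  so \<open>f\<close> need not be integrable, and the formula known on Schwartz functions cannot be
  carried over to \<open>f\<close> by pointwise limits; hence the weak identity, localised to unions
  of fibres. The decay of the transform is moreover given as an integral, while the sector argument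
  needs a pointwise bound; increments of a primitive provide it.\<close>

inductive_set trig_poly :: "('a::euclidean_space \<Rightarrow> complex) set" where
  char: "(\<lambda>x. cis (s \<bullet> x)) \<in> trig_poly"
| add: "f \<in> trig_poly \<Longrightarrow> g \<in> trig_poly \<Longrightarrow> (\<lambda>x. f x + g x) \<in> trig_poly"
| scale: "f \<in> trig_poly \<Longrightarrow> (\<lambda>x. c * f x) \<in> trig_poly"

lemma trig_poly_measurable: "f \<in> trig_poly \<Longrightarrow> f \<in> borel_measurable borel"
proof (induction rule: trig_poly.induct)
  case (char s)
  have "continuous_on UNIV (\<lambda>x. cis (s \<bullet> x))"
    by (intro continuous_intros)
  then show ?case by (rule borel_measurable_continuous_onI)
qed auto

lemma trig_poly_bounded: "f \<in> trig_poly \<Longrightarrow> \<exists>B. \<forall>x. norm (f x) \<le> B"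
proof (induction rule: trig_poly.induct)
  case (add f g)
  then obtain B B' where "\<forall>x. norm (f x) \<le> B" "\<forall>x. norm (g x) \<le> B'" by blast
  then have "\<forall>x. norm (f x + g x) \<le> B + B'"
    by (meson add_mono norm_triangle_ineq order_trans)
  then show ?case by blast
next
  case (scale f c)
  then obtain B where "\<forall>x. norm (f x) \<le> B" by blast
  then have "\<forall>x. norm (c * f x) \<le> norm c * B"
    by (simp add: norm_mult mult_left_mono)
  then show ?case by blast
qed (auto intro: exI[of _ 1])

lemma trig_poly_mult: "f \<in> trig_poly \<Longrightarrow> g \<in> trig_poly \<Longrightarrow> (\<lambda>x. f x * g x) \<in> trig_poly"
proof (induction rule: trig_poly.induct)
  case (char s)
  from char show ?case
  proof (induction rule: trig_poly.induct)
    case (char t)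
    have "(\<lambda>x. cis (s \<bullet> x) * cis (t \<bullet> x)) = (\<lambda>x. cis ((s + t) \<bullet> x))"
      by (simp add: cis_mult inner_add_left)
    then show ?case by (metis trig_poly.char)
  next
    case (add f g)
    then show ?case using trig_poly.add[OF add.IH] by (simp add: distrib_left)
  next
    case (scale f c)
    then show ?case using trig_poly.scale[OF scale.IH, of c] by (simp add: mult.left_commute)
  qed
next
  case (add f1 f2)
  then show ?case using trig_poly.add[of "\<lambda>x. f1 x * g x" "\<lambda>x. f2 x * g x"] by (simp add: distrib_right)
next
  case (scale f c)
  then show ?case using trig_poly.scale[of "\<lambda>x. f x * g x" c] by (simp add: mult.assoc)
qed

text \<open>A triangle inequality for squared L2 distances; the factor 2 is harmless because all
  distances are made arbitrarily small.\<close>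

lemma norm_add_sq_le:
  fixes a b :: "'a::real_normed_vector"
  shows "(norm (a + b))\<^sup>2 \<le> 2 * (norm a)\<^sup>2 + 2 * (norm b)\<^sup>2"
proof -
  have "(norm (a + b))\<^sup>2 \<le> (norm a + norm b)\<^sup>2"
    by (intro power_mono norm_triangle_ineq) auto
  also have "\<dots> \<le> 2 * (norm a)\<^sup>2 + 2 * (norm b)\<^sup>2"
    using sum_squares_bound[of "norm a" "norm b"] by (simp add: power2_sum)
  finally show ?thesis .
qed

section \<open>The L2 closure of the trigonometric polynomials and its multipliers\<close>

locale finite_borel_measure = finite_measure \<nu> for \<nu> :: "'a::euclidean_space measure" +
  assumes sets_borel[measurable_cong]: "sets \<nu> = sets borel"
begin

definition sq_integrable :: "('a \<Rightarrow> complex) \<Rightarrow> bool" where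
  "sq_integrable h \<longleftrightarrow> h \<in> borel_measurable borel \<and> integrable \<nu> (\<lambda>x. (norm (h x))\<^sup>2)"

definition approximable :: "('a \<Rightarrow> complex) set" where
  "approximable = {h. sq_integrable h \<and> (\<forall>e>0. \<exists>t\<in>trig_poly. (LINT x|\<nu>. (norm (h x - t x))\<^sup>2) < e)}"

text \<open>Multipliers form an algebra that contains the characters and is closed under bounded
  pointwise limits. This lets indicators of Borel sets be reached from sines by limits alone,
  although characters do not decay and the space is not compact.\<close>

definition multiplier :: "('a \<Rightarrow> complex) set" where
  "multiplier = {h \<in> borel_measurable borel. (\<exists>B. \<forall>x. norm (h x) \<le> B) \<and>
     (\<forall>g\<in>approximable. bounded (range g) \<longrightarrow> (\<lambda>x. h x * g x) \<in> approximable)}"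

lemma sq_integrableD: "sq_integrable h \<Longrightarrow> integrable \<nu> (\<lambda>x. (norm (h x))\<^sup>2)"
  by (simp add: sq_integrable_def)

lemma sq_integrable_bounded:
  assumes "h \<in> borel_measurable borel" "\<And>x. norm (h x) \<le> B"
  shows "sq_integrable h"
  unfolding sq_integrable_def
proof (intro conjI assms)
  have "integrable \<nu> (\<lambda>x. B\<^sup>2)" by simp
  moreover have "(\<lambda>x. (norm (h x))\<^sup>2) \<in> borel_measurable \<nu>" using assms(1) by measurable
  moreover have "AE x in \<nu>. norm ((norm (h x))\<^sup>2) \<le> norm (B\<^sup>2)"
    using assms(2) by (simp add: power_mono)
  ultimately show "integrable \<nu> (\<lambda>x. (norm (h x))\<^sup>2)" by (rule Bochner_Integration.integrable_bound)
qed

lemma sq_integrable_trig: "t \<in> trig_poly \<Longrightarrow> sq_integrable t"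
  using trig_poly_bounded sq_integrable_bounded trig_poly_measurable by blast

lemma sq_integrable_add:
  assumes "sq_integrable f" "sq_integrable g"
  shows "sq_integrable (\<lambda>x. f x + g x)"
  unfolding sq_integrable_def
proof (intro conjI)
  have [measurable]: "f \<in> borel_measurable borel" "g \<in> borel_measurable borel"
    using assms by (auto simp: sq_integrable_def)
  show m: "(\<lambda>x. f x + g x) \<in> borel_measurable borel" by measurable
  show "integrable \<nu> (\<lambda>x. (norm (f x + g x))\<^sup>2)"
  proof (rule Bochner_Integration.integrable_bound)
    show "integrable \<nu> (\<lambda>x. 2 * (norm (f x))\<^sup>2 + 2 * (norm (g x))\<^sup>2)"
      using assms unfolding sq_integrable_def by simp
    show "(\<lambda>x. (norm (f x + g x))\<^sup>2) \<in> borel_measurable \<nu>" using m by measurable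
  qed (use norm_add_sq_le in auto)
qed

lemma sq_integrable_cmult:
  assumes "sq_integrable f"
  shows "sq_integrable (\<lambda>x. c * f x)"
  using assms unfolding sq_integrable_def by (auto simp: norm_mult power_mult_distrib)

lemma sq_integrable_diff:
  assumes "sq_integrable f" "sq_integrable g"
  shows "sq_integrable (\<lambda>x. f x - g x)"
  using sq_integrable_add[OF assms(1) sq_integrable_cmult[OF assms(2), of "-1"]] by simp

lemma sq_integral_diff_triangle:
  assumes "sq_integrable f" "sq_integrable g" "sq_integrable h"
  shows "(LINT x|\<nu>. (norm (f x - h x))\<^sup>2)
    \<le> 2 * (LINT x|\<nu>. (norm (f x - g x))\<^sup>2) + 2 * (LINT x|\<nu>. (norm (g x - h x))\<^sup>2)"
proof -
  have i: "integrable \<nu> (\<lambda>x. (norm (f x - g x))\<^sup>2)" "integrable \<nu> (\<lambda>x. (norm (g x - h x))\<^sup>2)"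
    "integrable \<nu> (\<lambda>x. (norm (f x - h x))\<^sup>2)"
    using sq_integrable_diff assms unfolding sq_integrable_def by blast+
  have "(LINT x|\<nu>. (norm (f x - h x))\<^sup>2) \<le> (LINT x|\<nu>. 2 * (norm (f x - g x))\<^sup>2 + 2 * (norm (g x - h x))\<^sup>2)"
    using i norm_add_sq_le[of "f x - g x" "g x - h x" for x] by (intro integral_mono) auto
  then show ?thesis using i by simp
qed

lemma approximable_limit:
  assumes ap: "\<And>e. 0 < e \<Longrightarrow> \<exists>g\<in>approximable. (LINT x|\<nu>. (norm (h x - g x))\<^sup>2) < e"
    and sq: "sq_integrable h"
  shows "h \<in> approximable"
  unfolding approximable_def mem_Collect_eq
proof (intro conjI sq allI impI)
  fix e :: real assume "e > 0"
  then obtain g where g: "g \<in> approximable" "(LINT x|\<nu>. (norm (h x - g x))\<^sup>2) < e / 4"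
    using ap[of "e/4"] by auto
  then obtain t where t: "t \<in> trig_poly" "(LINT x|\<nu>. (norm (g x - t x))\<^sup>2) < e / 4"
    using \<open>e > 0\<close> unfolding approximable_def by (auto dest: spec[of _ "e/4"])
  have "(LINT x|\<nu>. (norm (h x - t x))\<^sup>2) < e"
    using sq_integral_diff_triangle[of h g t] sq g t sq_integrable_trig[OF t(1)]
    unfolding approximable_def by auto
  with t show "\<exists>t\<in>trig_poly. (LINT x|\<nu>. (norm (h x - t x))\<^sup>2) < e" by blast
qed

lemma approximable_trig: "t \<in> trig_poly \<Longrightarrow> t \<in> approximable"
  unfolding approximable_def by (auto simp: sq_integrable_trig intro!: bexI[of _ t])

lemma approximable_dominated:
  assumes ap: "\<And>k. h k \<in> approximable" and h: "h0 \<in> borel_measurable borel"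
    and lim: "\<And>x. (\<lambda>k. h k x) \<longlonglongrightarrow> h0 x"
    and bd: "\<And>k x. norm (h k x) \<le> w x" and w: "integrable \<nu> (\<lambda>x. (w x)\<^sup>2)" "w \<in> borel_measurable borel"
  shows "h0 \<in> approximable"
proof (rule approximable_limit)
  have hm: "h k \<in> borel_measurable borel" for k using ap[of k] by (auto simp: approximable_def sq_integrable_def)
  have b0: "norm (h0 x) \<le> w x" for x
    by (rule LIMSEQ_le_const2[OF tendsto_norm[OF lim]]) (use bd in blast)
  show "sq_integrable h0"
    unfolding sq_integrable_def
  proof (intro conjI h)
    show "integrable \<nu> (\<lambda>x. (norm (h0 x))\<^sup>2)"
    proof (rule Bochner_Integration.integrable_bound[OF w(1)])
      show "(\<lambda>x. (norm (h0 x))\<^sup>2) \<in> borel_measurable \<nu>" using h by measurable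
    qed (use b0 in \<open>auto intro!: AE_I2 power_mono\<close>)
  qed
  have "(\<lambda>k. LINT x|\<nu>. (norm (h0 x - h k x))\<^sup>2) \<longlonglongrightarrow> (LINT x|\<nu>. 0)"
  proof (rule integral_dominated_convergence[where w="\<lambda>x. 4 * (w x)\<^sup>2"])
    show "(\<lambda>x. (norm (h0 x - h k x))\<^sup>2) \<in> borel_measurable \<nu>" for k using h hm by measurable
    show "integrable \<nu> (\<lambda>x. 4 * (w x)\<^sup>2)" using w by simp
    have "(\<lambda>k. (norm (h0 x - h k x))\<^sup>2) \<longlonglongrightarrow> (norm (h0 x - h0 x))\<^sup>2" for x
      by (intro tendsto_intros lim)
    then show "AE x in \<nu>. (\<lambda>k. (norm (h0 x - h k x))\<^sup>2) \<longlonglongrightarrow> 0" by simp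
    have "norm ((norm (h0 x - h k x))\<^sup>2) \<le> 4 * (w x)\<^sup>2" for k x
    proof -
      have "norm (h0 x - h k x) \<le> 2 * w x"
        using norm_triangle_ineq4[of "h0 x" "h k x"] b0[of x] bd[of k x] by linarith
      then have "(norm (h0 x - h k x))\<^sup>2 \<le> (2 * w x)\<^sup>2" by (intro power_mono) auto
      then show ?thesis by (simp add: power_mult_distrib)
    qed
    then show "AE x in \<nu>. norm ((norm (h0 x - h k x))\<^sup>2) \<le> 4 * (w x)\<^sup>2" for k by blast
  qed auto
  then have "\<forall>\<^sub>F k in sequentially. (LINT x|\<nu>. (norm (h0 x - h k x))\<^sup>2) < e" if "e > 0" for e
    using order_tendstoD(2)[of _ 0 sequentially e] that by simp
  then show "\<exists>g\<in>approximable. (LINT x|\<nu>. (norm (h0 x - g x))\<^sup>2) < e" if "e > 0" for e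
    using that ap eventually_happens'[OF sequentially_bot] by blast
qed

lemma approximable_add:
  assumes "f \<in> approximable" "g \<in> approximable"
  shows "(\<lambda>x. f x + g x) \<in> approximable"
  unfolding approximable_def mem_Collect_eq
proof (intro conjI allI impI)
  have sq: "sq_integrable f" "sq_integrable g" using assms by (auto simp: approximable_def)
  then show "sq_integrable (\<lambda>x. f x + g x)" by (rule sq_integrable_add)
  fix e :: real assume e: "e > 0"
  obtain s where s: "s \<in> trig_poly" "(LINT x|\<nu>. (norm (f x - s x))\<^sup>2) < e / 4"
    using e assms(1) unfolding approximable_def by (auto dest: spec[of _ "e/4"])
  obtain t where t: "t \<in> trig_poly" "(LINT x|\<nu>. (norm (g x - t x))\<^sup>2) < e / 4"
    using e assms(2) unfolding approximable_def by (auto dest: spec[of _ "e/4"])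
  have i: "integrable \<nu> (\<lambda>x. (norm (f x - s x))\<^sup>2)" "integrable \<nu> (\<lambda>x. (norm (g x - t x))\<^sup>2)"
     "integrable \<nu> (\<lambda>x. (norm (f x + g x - (s x + t x)))\<^sup>2)"
    by (intro sq_integrableD sq_integrable_diff sq_integrable_add sq sq_integrable_trig s(1) t(1))+
  have "(norm (f x + g x - (s x + t x)))\<^sup>2 \<le> 2 * (norm (f x - s x))\<^sup>2 + 2 * (norm (g x - t x))\<^sup>2" for x
    using norm_add_sq_le[of "f x - s x" "g x - t x"] by (simp only: add_diff_add)
  then have "(LINT x|\<nu>. (norm (f x + g x - (s x + t x)))\<^sup>2) \<le> (LINT x|\<nu>. 2 * (norm (f x - s x))\<^sup>2 + 2 * (norm (g x - t x))\<^sup>2)"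
    by (intro integral_mono Bochner_Integration.integrable_add integrable_mult_right i)
  also have "\<dots> = 2 * (LINT x|\<nu>. (norm (f x - s x))\<^sup>2) + 2 * (LINT x|\<nu>. (norm (g x - t x))\<^sup>2)"
    using i(1,2) by simp
  also have "\<dots> < e" using s(2) t(2) by linarith
  finally show "\<exists>t\<in>trig_poly. (LINT x|\<nu>. (norm (f x + g x - t x))\<^sup>2) < e"
    by (rule bexI[OF _ trig_poly.add[OF s(1) t(1)]])
qed

text \<open>Multiplication by \<open>s\<close> is bounded for the L2 norm and maps trigonometric
  polynomials to trigonometric polynomials, so it preserves their closure.\<close>

lemma approximable_trig_mult:
  assumes "s \<in> trig_poly" "g \<in> approximable"
  shows "(\<lambda>x. s x * g x) \<in> approximable"
  unfolding approximable_def mem_Collect_eq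
proof (intro conjI allI impI)
  obtain B0 where B0: "\<And>x. norm (s x) \<le> B0" using trig_poly_bounded[OF assms(1)] by blast
  define B where "B = 1 + \<bar>B0\<bar>"
  have B: "B > 0" "norm (s x) \<le> B" for x using B0[of x] unfolding B_def by auto
  have bd: "(norm (s x * h))\<^sup>2 \<le> B\<^sup>2 * (norm h)\<^sup>2" for x h
    using B by (simp add: norm_mult power_mult_distrib mult_right_mono power_mono)
  have sq: "sq_integrable (\<lambda>x. s x * h x)" if "sq_integrable h" for h
    unfolding sq_integrable_def
  proof
    show m: "(\<lambda>x. s x * h x) \<in> borel_measurable borel"
      using that trig_poly_measurable[OF assms(1)] unfolding sq_integrable_def
      by (intro borel_measurable_times) auto
    show "integrable \<nu> (\<lambda>x. (norm (s x * h x))\<^sup>2)"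
    proof (rule Bochner_Integration.integrable_bound)
      show "integrable \<nu> (\<lambda>x. B\<^sup>2 * (norm (h x))\<^sup>2)" using that by (simp add: sq_integrable_def)
      show "(\<lambda>x. (norm (s x * h x))\<^sup>2) \<in> borel_measurable \<nu>" using m by measurable
    qed (use bd in auto)
  qed
  have g: "sq_integrable g" using assms(2) by (simp add: approximable_def)
  then show "sq_integrable (\<lambda>x. s x * g x)" by (rule sq)
  fix e :: real assume "e > 0"
  then obtain t where t: "t \<in> trig_poly" "(LINT x|\<nu>. (norm (g x - t x))\<^sup>2) < e / B\<^sup>2"
    using assms(2) B unfolding approximable_def by (auto dest: spec[of _ "e/B\<^sup>2"])
  have gt: "sq_integrable (\<lambda>x. g x - t x)" using g sq_integrable_trig[OF t(1)] sq_integrable_diff by blast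
  have "(LINT x|\<nu>. (norm (s x * (g x - t x)))\<^sup>2) \<le> (LINT x|\<nu>. B\<^sup>2 * (norm (g x - t x))\<^sup>2)"
    using sq[OF gt] gt bd by (intro integral_mono) (auto simp: sq_integrable_def)
  also have "\<dots> < e" using t(2) B by (simp add: field_simps)
  finally show "\<exists>t\<in>trig_poly. (LINT x|\<nu>. (norm (s x * g x - t x))\<^sup>2) < e"
    using trig_poly_mult[OF assms(1) t(1)] by (auto simp: right_diff_distrib intro!: bexI)
qed

lemma approximable_scale: "g \<in> approximable \<Longrightarrow> (\<lambda>x. c * g x) \<in> approximable"
  using approximable_trig_mult[OF trig_poly.scale[OF trig_poly.char[of 0]]] by simp

lemma bounded_range_mult:
  assumes "\<And>x. norm (h x) \<le> B" "bounded (range g)"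
  shows "bounded (range (\<lambda>x::'a. h x * g x :: complex))"
proof -
  obtain B' where B': "\<And>x. norm (g x) \<le> B'" using assms(2) by (auto simp: bounded_iff)
  have "norm (h x * g x) \<le> B * B'" for x
    using assms(1)[of x] B'[of x] by (simp add: norm_mult mult_mono')
  then show ?thesis by (auto simp: bounded_iff)
qed

lemma multiplierD:
  "h \<in> multiplier \<Longrightarrow> g \<in> approximable \<Longrightarrow> bounded (range g) \<Longrightarrow> (\<lambda>x. h x * g x) \<in> approximable"
  unfolding multiplier_def by blast

lemma multiplier_trig: "t \<in> trig_poly \<Longrightarrow> t \<in> multiplier"
  unfolding multiplier_def using approximable_trig_mult trig_poly_bounded trig_poly_measurable by auto

lemma multiplier_const: "(\<lambda>x. c) \<in> multiplier"
  using multiplier_trig[OF trig_poly.scale[OF trig_poly.char[of 0]]] by simp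

lemma multiplier_add:
  assumes "f \<in> multiplier" "g \<in> multiplier"
  shows "(\<lambda>x. f x + g x) \<in> multiplier"
proof -
  obtain B B' where "\<forall>x. norm (f x) \<le> B" "\<forall>x. norm (g x) \<le> B'"
    using assms unfolding multiplier_def by blast
  then have "\<forall>x. norm (f x + g x) \<le> B + B'"
    by (meson add_mono norm_triangle_ineq order_trans)
  then show ?thesis
    using assms approximable_add unfolding multiplier_def
    by (auto simp: distrib_right)
qed

lemma multiplier_mult:
  assumes "f \<in> multiplier" "g \<in> multiplier"
  shows "(\<lambda>x. f x * g x) \<in> multiplier"
proof -
  obtain B B' where B: "\<And>x. norm (f x) \<le> B" "\<And>x. norm (g x) \<le> B'"
    using assms unfolding multiplier_def by blast
  have "\<forall>x. norm (f x * g x) \<le> B * B'"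
    using B by (simp add: norm_mult mult_mono')
  moreover have "(\<lambda>x. f x * g x * h x) \<in> approximable" if "h \<in> approximable" "bounded (range h)" for h
    using assms that bounded_range_mult[of g B' h, OF B(2)] unfolding multiplier_def by (auto simp: mult.assoc)
  ultimately show ?thesis
    using assms unfolding multiplier_def by auto
qed

lemma multiplier_diff:
  assumes "f \<in> multiplier" "g \<in> multiplier"
  shows "(\<lambda>x. f x - g x) \<in> multiplier"
  using multiplier_add[OF assms(1) multiplier_mult[OF multiplier_const[of "-1"] assms(2)]] by simp

lemma multiplier_power: "f \<in> multiplier \<Longrightarrow> (\<lambda>x. f x ^ n) \<in> multiplier"
  by (induction n) (auto intro: multiplier_mult multiplier_const)

text \<open>Dominated convergence with the majorant \<open>B * norm (g x)\<close>, which is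
  square-integrable.\<close>

lemma multiplier_limit:
  assumes m: "\<And>k. h k \<in> multiplier" and bd: "\<And>k x. norm (h k x) \<le> B"
    and lim: "\<And>x. (\<lambda>k. h k x) \<longlonglongrightarrow> h0 x"
  shows "h0 \<in> multiplier"
  unfolding multiplier_def mem_Collect_eq
proof (intro conjI ballI impI)
  have hm: "h k \<in> borel_measurable borel" for k using m by (auto simp: multiplier_def)
  show h0: "h0 \<in> borel_measurable borel" by (rule borel_measurable_LIMSEQ_metric[OF hm lim])
  have "norm (h0 x) \<le> B" for x
    by (rule LIMSEQ_le_const2[OF tendsto_norm[OF lim]]) (use bd in blast)
  then show "\<exists>B. \<forall>x. norm (h0 x) \<le> B" by blast
  fix g assume g: "g \<in> approximable" "bounded (range g)"
  then have gm: "g \<in> borel_measurable borel" "integrable \<nu> (\<lambda>x. (norm (g x))\<^sup>2)"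
    by (auto simp: approximable_def sq_integrable_def)
  show "(\<lambda>x. h0 x * g x) \<in> approximable"
  proof (rule approximable_dominated[where h="\<lambda>k x. h k x * g x" and w="\<lambda>x. B * norm (g x)"])
    show "(\<lambda>x. h k x * g x) \<in> approximable" for k using m g by (auto simp: multiplier_def)
    show "(\<lambda>k. h k x * g x) \<longlonglongrightarrow> h0 x * g x" for x by (intro tendsto_intros lim)
    show "norm (h k x * g x) \<le> B * norm (g x)" for k x
      using bd by (simp add: norm_mult mult_right_mono)
    show "integrable \<nu> (\<lambda>x. (B * norm (g x))\<^sup>2)" using gm by (simp add: power_mult_distrib)
  qed (use h0 gm in measurable)
qed

end

text \<open>These polynomials in \<open>s\<close> approximate a step at 1/2: Bernoulli's inequality
  gives the lower bound 1 - (2 s)^n, and 1 - y \<le> exp (- y) gives the upper bound exp (- (2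
  s)^n). At s = 1/2 the expression is (1 - 2^(-n))^(2^n), whence the value exp (-1).\<close>

lemma one_minus_power_power_tendsto:
  fixes s :: real
  assumes "0 \<le> s" "s \<le> 1"
  shows "(\<lambda>n. (1 - s ^ n) ^ (2 ^ n)) \<longlonglongrightarrow> (if s < 1/2 then 1 else if s = 1/2 then exp (-1) else 0)"
proof -
  have s1: "s ^ n \<le> 1" for n using assms by (simp add: power_le_one)
  consider "s < 1/2" | "s = 1/2" | "s > 1/2" by linarith
  then show ?thesis
  proof cases
    case 1
    have lo: "1 - (2 * s) ^ n \<le> (1 - s ^ n) ^ (2 ^ n)" for n
      using Bernoulli_inequality[of "- (s ^ n)" "2 ^ n"] s1[of n] by (simp add: power_mult_distrib)
    have hi: "(1 - s ^ n) ^ (2 ^ n) \<le> 1" for n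
      using assms s1[of n] by (intro power_le_one) auto
    have "(\<lambda>n. 1 - (2 * s) ^ n) \<longlonglongrightarrow> 1 - 0"
      using 1 assms by (intro tendsto_intros LIMSEQ_realpow_zero) auto
    then have "(\<lambda>n. (1 - s ^ n) ^ (2 ^ n)) \<longlonglongrightarrow> 1"
      using lo hi tendsto_sandwich[of "\<lambda>n. 1 - (2 * s) ^ n" "\<lambda>n. (1 - s ^ n) ^ (2 ^ n)" sequentially "\<lambda>_. 1" 1] by auto
    with 1 show ?thesis by simp
  next
    case 2
    have "(\<lambda>n. (1 + (-1) / real (2 ^ n)) ^ (2 ^ n)) \<longlonglongrightarrow> exp (-1::real)"
      using LIMSEQ_subseq_LIMSEQ[OF tendsto_exp_limit_sequentially[of "-1"], of "\<lambda>n. 2 ^ n"]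
      by (auto simp: strict_mono_def o_def)
    moreover have "s = 1 / 2" by fact
    ultimately show ?thesis by (simp only: power_divide) simp
  next
    case 3
    have lo: "0 \<le> (1 - s ^ n) ^ (2 ^ n)" for n using s1[of n] by simp
    have hi: "(1 - s ^ n) ^ (2 ^ n) \<le> exp (- ((2 * s) ^ n))" for n
    proof -
      have "(1 - s ^ n) ^ (2 ^ n) \<le> (exp (- (s ^ n))) ^ (2 ^ n)"
        using s1[of n] exp_ge_add_one_self[of "- (s ^ n)"] by (intro power_mono) auto
      also have "\<dots> = exp (- ((2 * s) ^ n))"
        by (simp add: exp_of_nat_mult[symmetric] power_mult_distrib)
      finally show ?thesis .
    qed
    have "filterlim (\<lambda>n. (2 * s) ^ n) at_top sequentially"
      using 3 by real_asymp
    then have "(\<lambda>n. exp (- ((2 * s) ^ n))) \<longlonglongrightarrow> 0"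
      by (intro filterlim_compose[OF exp_at_bot] filterlim_compose[OF filterlim_uminus_at_bot_at_top])
    then have "(\<lambda>n. (1 - s ^ n) ^ (2 ^ n)) \<longlonglongrightarrow> 0"
      using lo hi tendsto_sandwich[of "\<lambda>n. 0" "\<lambda>n. (1 - s ^ n) ^ (2 ^ n)" sequentially "\<lambda>n. exp (- ((2 * s) ^ n))" 0] by auto
    with 3 show ?thesis by simp
  qed
qed

section \<open>From sines to indicators of Borel sets\<close>

context finite_borel_measure
begin

lemma multiplier_sin: "(\<lambda>x. complex_of_real ((1 + sin (s \<bullet> x + c)) / 2)) \<in> multiplier"
proof -
  have 1: "(\<lambda>x. cis c * cis (s \<bullet> x)) \<in> multiplier" "(\<lambda>x. cis (-c) * cis ((-s) \<bullet> x)) \<in> multiplier"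
    by (intro multiplier_trig trig_poly.intros)+
  have "(\<lambda>x. 1 / 2 + (- \<i> / 4) * (cis c * cis (s \<bullet> x) - cis (-c) * cis ((-s) \<bullet> x))) \<in> multiplier"
    by (intro multiplier_add multiplier_mult multiplier_diff 1 multiplier_const)
  moreover have "1 / 2 + (- \<i> / 4) * (cis c * cis (s \<bullet> x) - cis (-c) * cis ((-s) \<bullet> x))
      = complex_of_real ((1 + sin (s \<bullet> x + c)) / 2)" for x
  proof -
    have "cis c * cis (s \<bullet> x) = cis (s \<bullet> x + c)" "cis (-c) * cis ((-s) \<bullet> x) = cis (- (s \<bullet> x + c))"
      by (simp_all add: cis_mult add.commute)
    moreover have "1 / 2 + (- \<i> / 4) * (cis t - cis (- t)) = complex_of_real ((1 + sin t) / 2)" for t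
      by (simp add: complex_eq_iff)
    ultimately show ?thesis by metis
  qed
  ultimately show ?thesis by (simp only:)
qed

text \<open>The step polynomials applied to the sine normalised to [0, 1] converge to a square wave;
  the zeros of the sine are the points where the normalised sine equals 1/2 and therefore receive
  exp (-1).\<close>

lemma multiplier_wave:
  "(\<lambda>x. complex_of_real (if sin (s \<bullet> x + c) < 0 then 1 else if sin (s \<bullet> x + c) = 0 then exp (-1) else 0)) \<in> multiplier"
proof (rule multiplier_limit)
  let ?u = "\<lambda>x. (1 + sin (s \<bullet> x + c)) / 2"
  have u: "0 \<le> ?u x" "?u x \<le> 1" for x
  proof -
    have "0 \<le> (1 + sin t) / 2" "(1 + sin t) / 2 \<le> 1" for t :: real
      using sin_ge_minus_one[of t] sin_le_one[of t] by (simp_all, linarith+)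
    then show "0 \<le> ?u x" "?u x \<le> 1" by blast+
  qed
  show "(\<lambda>x. (1 - complex_of_real (?u x) ^ n) ^ (2 ^ n)) \<in> multiplier" for n :: nat
    by (intro multiplier_power multiplier_diff multiplier_const multiplier_sin)
  show "norm ((1 - complex_of_real (?u x) ^ n) ^ (2 ^ n)) \<le> 1" for n :: nat and x
  proof -
    have "0 \<le> 1 - ?u x ^ n" "1 - ?u x ^ n \<le> 1" using u[of x] by (auto intro: power_le_one)
    then have "\<bar>(1 - ?u x ^ n) ^ (2 ^ n)\<bar> \<le> 1" by (auto simp: power_abs[symmetric] intro: power_le_one)
    moreover have "(1 - complex_of_real (?u x) ^ n) ^ (2 ^ n) = of_real ((1 - ?u x ^ n) ^ (2 ^ n))" by simp
    ultimately show ?thesis by (metis norm_of_real)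
  qed
  fix x
  have "(\<lambda>n. complex_of_real ((1 - ?u x ^ n) ^ (2 ^ n))) \<longlonglongrightarrow>
     complex_of_real (if ?u x < 1/2 then 1 else if ?u x = 1/2 then exp (-1) else 0)"
    by (intro tendsto_of_real one_minus_power_power_tendsto u)
  moreover have "(?u x < 1/2) = (sin (s \<bullet> x + c) < 0)" "(?u x = 1/2) = (sin (s \<bullet> x + c) = 0)" by auto
  ultimately show "(\<lambda>n. (1 - complex_of_real (?u x) ^ n) ^ (2 ^ n)) \<longlonglongrightarrow>
     complex_of_real (if sin (s \<bullet> x + c) < 0 then 1 else if sin (s \<bullet> x + c) = 0 then exp (-1) else 0)"
    by (simp only: of_real_power of_real_diff of_real_1)
qed

text \<open>Stretch the square wave: at a fixed \<open>x\<close> the argument (x \<bullet> i - a) /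
  (k + 1) eventually lies within one half period of 0, where the sine has the sign of x \<bullet> i
  - a.\<close>

lemma multiplier_halfspace_smooth:
  "(\<lambda>x. complex_of_real (if x \<bullet> i < a then 1 else if x \<bullet> i = a then exp (-1) else 0)) \<in> multiplier"
proof (rule multiplier_limit)
  let ?L = "\<lambda>k::nat. real (Suc k)"
  show "(\<lambda>x. complex_of_real (if sin ((i /\<^sub>R ?L k) \<bullet> x + (- a / ?L k)) < 0 then 1
      else if sin ((i /\<^sub>R ?L k) \<bullet> x + (- a / ?L k)) = 0 then exp (-1) else 0)) \<in> multiplier" for k
    by (rule multiplier_wave)
  show "norm (complex_of_real (if sin ((i /\<^sub>R ?L k) \<bullet> x + (- a / ?L k)) < 0 then 1
      else if sin ((i /\<^sub>R ?L k) \<bullet> x + (- a / ?L k)) = 0 then exp (-1) else 0)) \<le> 1" for k x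
    by auto
  fix x
  define d where "d = x \<bullet> i - a"
  have eq: "(i /\<^sub>R ?L k) \<bullet> x + (- a / ?L k) = d / ?L k" for k
    by (simp add: d_def inner_commute[of i] divide_inverse algebra_simps del: of_nat_Suc)
  have "eventually (\<lambda>k. \<bar>d\<bar> < ?L k) sequentially"
    using eventually_gt_at_top[of "nat \<lceil>\<bar>d\<bar>\<rceil>"] by eventually_elim linarith
  then have "eventually (\<lambda>k. sgn (sin (d / ?L k)) = sgn d) sequentially"
  proof eventually_elim
    case (elim k)
    then have "\<bar>d / ?L k\<bar> < 1" by (simp del: of_nat_Suc)
    then have b: "\<bar>d / ?L k\<bar> < pi" using pi_gt3 by linarith
    consider "d > 0" | "d = 0" | "d < 0" by linarith
    then show ?case
    proof cases
      case 1
      then have "sin (d / ?L k) > 0" using b by (intro sin_gt_zero) (auto simp del: of_nat_Suc)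
      with 1 show ?thesis by simp
    next
      case 3
      then have "sin (- (d / ?L k)) > 0" using b by (intro sin_gt_zero) (auto simp: divide_neg_pos simp del: of_nat_Suc)
      with 3 show ?thesis by simp
    qed simp
  qed
  then have "eventually (\<lambda>k. complex_of_real (if sin (d / ?L k) < 0 then 1 else if sin (d / ?L k) = 0 then exp (-1) else 0)
    = complex_of_real (if d < 0 then 1 else if d = 0 then exp (-1) else 0)) sequentially"
  proof eventually_elim
    case (elim k)
    then have "(sin (d / ?L k) < 0) = (d < 0)" "(sin (d / ?L k) = 0) = (d = 0)"
      by (metis sgn_less)(metis elim sgn_zero_iff)
    then show ?case by simp
  qed
  then have "(\<lambda>k. complex_of_real (if sin (d / ?L k) < 0 then 1 else if sin (d / ?L k) = 0 then exp (-1) else 0))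
    \<longlonglongrightarrow> complex_of_real (if d < 0 then 1 else if d = 0 then exp (-1) else 0)"
    by (rule tendsto_eventually)
  moreover have "(x \<bullet> i < a) = (d < 0)" "(x \<bullet> i = a) = (d = 0)" by (auto simp: d_def)
  ultimately show "(\<lambda>k. complex_of_real (if sin ((i /\<^sub>R ?L k) \<bullet> x + (- a / ?L k)) < 0 then 1
      else if sin ((i /\<^sub>R ?L k) \<bullet> x + (- a / ?L k)) = 0 then exp (-1) else 0))
    \<longlonglongrightarrow> complex_of_real (if x \<bullet> i < a then 1 else if x \<bullet> i = a then exp (-1) else 0)"
    unfolding eq by (simp only:)
qed

text \<open>Moving the boundary inwards from a + 1 / (k + 1) to \<open>a\<close> puts every point of
  the closed half-space strictly inside, so the boundary value exp (-1) disappears in the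
  limit.\<close>

lemma multiplier_halfspace: "indicator {x. x \<bullet> i \<le> a} \<in> multiplier"
proof (rule multiplier_limit)
  let ?a = "\<lambda>k::nat. a + inverse (real (Suc k))"
  show "(\<lambda>x. complex_of_real (if x \<bullet> i < ?a k then 1 else if x \<bullet> i = ?a k then exp (-1) else 0)) \<in> multiplier" for k
    by (rule multiplier_halfspace_smooth)
  show "norm (complex_of_real (if x \<bullet> i < ?a k then 1 else if x \<bullet> i = ?a k then exp (-1) else 0)) \<le> 1" for k x
    by auto
  fix x
  have "eventually (\<lambda>k. complex_of_real (if x \<bullet> i < ?a k then 1 else if x \<bullet> i = ?a k then exp (-1) else 0)
    = indicator {x. x \<bullet> i \<le> a} x) sequentially"
  proof (cases "x \<bullet> i \<le> a")
    case True
    then have "x \<bullet> i < ?a k" for k by (simp add: add_strict_increasing2 order_le_less_trans[OF True])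
    then show ?thesis using True by simp
  next
    case False
    then have "eventually (\<lambda>k. inverse (real (Suc k)) < x \<bullet> i - a) sequentially"
      by (intro order_tendstoD(2)[OF LIMSEQ_inverse_real_of_nat]) simp
    then show ?thesis by eventually_elim (use False in auto)
  qed
  then show "(\<lambda>k. complex_of_real (if x \<bullet> i < ?a k then 1 else if x \<bullet> i = ?a k then exp (-1) else 0))
    \<longlonglongrightarrow> indicator {x. x \<bullet> i \<le> a} x"
    by (rule tendsto_eventually)
qed

text \<open>Half-spaces generate the Borel sets. Complements and products of multipliers are
  multipliers, so finite unions are covered by the complement of a product of complements, and
  countable unions are bounded pointwise limits of these.\<close>

lemma multiplier_indicator:
  assumes "A \<in> sets borel"
  shows "indicator A \<in> multiplier"
proof -
  have "A \<in> sigma_sets UNIV ((\<lambda>(a, i). {x::'a. x \<bullet> i \<le> a}) ` (UNIV \<times> Basis))"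
    using assms by (subst (asm) borel_eq_halfspace_le) (simp add: sets_measure_of)
  then show ?thesis
  proof (induction rule: sigma_sets.induct)
    case (Basic A)
    then show ?case using multiplier_halfspace by auto
  next
    case Empty
    show ?case using multiplier_const[of 0] by (simp add: indicator_def fun_eq_iff)
  next
    case (Compl A)
    have "(\<lambda>x. 1 - indicator A x) \<in> multiplier" by (intro multiplier_diff multiplier_const Compl.IH)
    moreover have "(\<lambda>x. 1 - indicator A x :: complex) = indicator (UNIV - A)" by (auto simp: indicator_def)
    ultimately show ?case by simp
  next
    case (Union A)
    have p: "(\<lambda>x. \<Prod>j<n. 1 - indicator (A j) x) \<in> multiplier" for n :: nat
      by (induction n) (auto intro!: multiplier_mult multiplier_diff multiplier_const Union.IH)
    show ?case
    proof (rule multiplier_limit)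
      show "(\<lambda>x. 1 - (\<Prod>j<n. 1 - indicator (A j) x)) \<in> multiplier" for n
        by (intro multiplier_diff multiplier_const p)
      have *: "1 - (\<Prod>j<n. 1 - indicator (A j) x) = (indicator (\<Union>j<n. A j) x :: complex)" for n x
        by (induction n) (auto simp: indicator_def lessThan_Suc)
      show "norm (1 - (\<Prod>j<n. 1 - indicator (A j) x) :: complex) \<le> 1" for n x
        unfolding * by (simp add: indicator_def)
      show "(\<lambda>n. 1 - (\<Prod>j<n. 1 - indicator (A j) x) :: complex) \<longlonglongrightarrow> indicator (\<Union>i. A i) x" for x
        unfolding * by (rule LIMSEQ_indicator_UN)
    qed
  qed
qed

lemma approximable_indicator:
  assumes "A \<in> sets borel"
  shows "indicator A \<in> approximable"
proof -
  have "(\<lambda>x. cis (0 \<bullet> x)) \<in> approximable" by (rule approximable_trig[OF trig_poly.char])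
  then have "(\<lambda>x. 1) \<in> approximable" by (simp only: inner_zero_left cis_zero)
  moreover have "bounded (range (\<lambda>x::'a. 1 :: complex))" by simp
  ultimately have "(\<lambda>x. indicator A x * 1) \<in> approximable"
    by (rule multiplierD[OF multiplier_indicator[OF assms]])
  then show ?thesis by simp
qed

lemma approximable_simple:
  assumes "simple_function borel f"
  shows "f \<in> approximable"
proof -
  have fin: "finite (range f)" using assms by (auto simp: simple_function_def)
  have "(\<lambda>x. \<Sum>y\<in>Y. y * indicator (f -` {y}) x) \<in> approximable" if "finite Y" "Y \<subseteq> range f" for Y
    using that
  proof (induction Y)
    case empty
    then show ?case using approximable_scale[OF approximable_indicator[of "{}"], of 0] by simp
  next
    case (insert y Y)
    have "f -` {y} \<in> sets borel" using assms insert.prems by (auto simp: simple_function_def)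
    then have "(\<lambda>x. y * indicator (f -` {y}) x + (\<Sum>y\<in>Y. y * indicator (f -` {y}) x)) \<in> approximable"
      using insert by (intro approximable_add approximable_scale approximable_indicator) auto
    moreover have "(\<lambda>x. \<Sum>y\<in>insert y Y. y * indicator (f -` {y}) x) =
        (\<lambda>x. y * indicator (f -` {y}) x + (\<Sum>y\<in>Y. y * indicator (f -` {y}) x))"
      using insert.hyps by (subst sum.insert) auto
    ultimately show ?case by (simp only:)
  qed
  from this[OF fin] have "(\<lambda>x. \<Sum>y\<in>range f. y * indicator (f -` {y}) x) \<in> approximable" by simp
  moreover have "(\<Sum>y\<in>range f. y * indicator (f -` {y}) x) = f x" for x
  proof -
    have "(\<Sum>y\<in>range f. y * indicator (f -` {y}) x) = (\<Sum>y\<in>range f. if y = f x then y else 0)"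
      by (intro sum.cong) (auto simp: indicator_def)
    then show ?thesis using fin by simp
  qed
  ultimately show ?thesis by simp
qed

theorem trig_poly_dense:
  assumes f: "f \<in> borel_measurable borel" "integrable \<nu> (\<lambda>x. (norm (f x))\<^sup>2)" and e: "e > 0"
  obtains t where "t \<in> trig_poly" "(LINT x|\<nu>. (norm (f x - t x))\<^sup>2) < e"
proof -
  obtain F where F: "\<And>i. simple_function borel (F i)" "\<And>x. (\<lambda>i. F i x) \<longlonglongrightarrow> f x"
    "\<And>i x. dist (F i x) 0 \<le> 2 * dist (f x) 0"
    using borel_measurable_implies_sequence_metric[OF f(1), of 0] by auto
  have "f \<in> approximable"
  proof (rule approximable_dominated[where h=F and w="\<lambda>x. 2 * norm (f x)"])
    show "F k \<in> approximable" for k using F(1) by (rule approximable_simple)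
    show "integrable \<nu> (\<lambda>x. (2 * norm (f x))\<^sup>2)" using f by (simp add: power_mult_distrib)
  qed (use f F in \<open>auto simp: dist_norm\<close>)
  with e that show thesis by (auto simp: approximable_def)
qed

end

text \<open>Orthogonality to the characters extends to every trigonometric polynomial
  \<open>t\<close>, so the integral of |g|^2 equals that of g (cnj g - t), and \<open>t\<close> can
  be taken close to cnj g.\<close>

lemma (in finite_borel_measure) trig_integrals_zero_imp:
  assumes g: "g \<in> borel_measurable borel" "\<And>x. norm (g x) \<le> 1"
    and z: "\<And>s. (LINT x|\<nu>. g x * cis (s \<bullet> x)) = 0"
  shows "(LINT x|\<nu>. (norm (g x))\<^sup>2) = 0"
proof -
  have int: "integrable \<nu> (\<lambda>x. g x * h x)" if h: "h \<in> borel_measurable borel" "\<And>x. norm (h x) \<le> B" for h B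
  proof (rule integrable_const_bound[where B=B])
    have "norm (g x * h x) \<le> 1 * B" for x
      unfolding norm_mult by (intro mult_mono g h) auto
    then show "AE x in \<nu>. norm (g x * h x) \<le> B" by simp
    show "(\<lambda>x. g x * h x) \<in> borel_measurable \<nu>" using g h by measurable
  qed
  have tz: "(LINT x|\<nu>. g x * t x) = 0" if "t \<in> trig_poly" for t
    using that
  proof (induction rule: trig_poly.induct)
    case (char s)
    show ?case by (rule z)
  next
    case (add a b)
    have "integrable \<nu> (\<lambda>x. g x * a x)" "integrable \<nu> (\<lambda>x. g x * b x)"
      using add.hyps trig_poly_bounded trig_poly_measurable int by blast+
    then show ?case using add by (simp add: distrib_left)
  next
    case (scale a c)
    have "(LINT x|\<nu>. g x * (c * a x)) = (LINT x|\<nu>. c * (g x * a x))" by (simp add: mult.left_commute)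
    then show ?case using scale by simp
  qed
  have gc: "(\<lambda>x. cnj (g x)) \<in> borel_measurable borel"
    using measurable_compose[OF g(1) borel_measurable_continuous_onI[OF continuous_on_cnj[OF continuous_on_id]]] by simp
  define N where "N = (LINT x|\<nu>. (norm (g x))\<^sup>2)"
  define m where "m = measure \<nu> (space \<nu>)"
  have gi: "integrable \<nu> (\<lambda>x. (norm (g x))\<^sup>2)"
    using sq_integrable_bounded[OF g] by (simp add: sq_integrable_def)
  \<comment> \<open>The middle summand is zero. The bound d m + d comes from r \<le> d + r^2 / d
    with r = |cnj g - t|, in place of the Cauchy-Schwarz inequality.\<close>
  have "N \<le> d * m + (1 + 1 / d) * 0 + d" if "d > 0" for d
  proof -
    obtain t where t: "t \<in> trig_poly" "(LINT x|\<nu>. (norm (cnj (g x) - t x))\<^sup>2) < d\<^sup>2"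
      using trig_poly_dense[of "\<lambda>x. cnj (g x)" "d\<^sup>2"] gc gi \<open>d > 0\<close> by auto
    have sq: "integrable \<nu> (\<lambda>x. (norm (cnj (g x) - t x))\<^sup>2)"
      using sq_integrable_diff[of "\<lambda>x. cnj (g x)" t] sq_integrable_bounded[of "\<lambda>x. cnj (g x)" 1] sq_integrable_trig[OF t(1)] g gc
      by (simp add: sq_integrable_def)
    obtain B where B: "\<And>x. norm (t x) \<le> B" using trig_poly_bounded[OF t(1)] by blast
    have i1: "integrable \<nu> (\<lambda>x. g x * t x)" using int[OF trig_poly_measurable[OF t(1)] B] .
    have i2: "integrable \<nu> (\<lambda>x. g x * cnj (g x))" using int[of "\<lambda>x. cnj (g x)" 1] g gc by simp
    have "complex_of_real N = (LINT x|\<nu>. g x * cnj (g x))"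
      unfolding N_def by (simp add: complex_norm_square[symmetric] del: of_real_power flip: integral_complex_of_real)
    also have "\<dots> = (LINT x|\<nu>. g x * (cnj (g x) - t x))"
      using i1 i2 tz[OF t(1)] by (simp add: right_diff_distrib)
    finally have "norm (complex_of_real N) \<le> (LINT x|\<nu>. norm (g x * (cnj (g x) - t x)))"
      by (simp only: integral_norm_bound)
    also have "\<dots> \<le> (LINT x|\<nu>. d + (norm (cnj (g x) - t x))\<^sup>2 / d)"
    proof (rule integral_mono)
      show "integrable \<nu> (\<lambda>x. norm (g x * (cnj (g x) - t x)))"
        using i1 i2 by (simp add: right_diff_distrib)
      show "integrable \<nu> (\<lambda>x. d + (norm (cnj (g x) - t x))\<^sup>2 / d)" using sq by simp
      fix x
      have "norm (g x * (cnj (g x) - t x)) \<le> norm (cnj (g x) - t x)"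
        using g(2)[of x] by (simp add: norm_mult mult_left_le_one_le)
      also have "\<dots> \<le> d + (norm (cnj (g x) - t x))\<^sup>2 / d"
      proof -
        have "2 * d * r \<le> d\<^sup>2 + r\<^sup>2" "0 \<le> d * r" if "r \<ge> 0" for r
          using \<open>d > 0\<close> that sum_squares_bound[of d r] by auto
        from this[of "norm (cnj (g x) - t x)"] have "d * norm (cnj (g x) - t x) \<le> d\<^sup>2 + (norm (cnj (g x) - t x))\<^sup>2" by simp
        then show ?thesis using \<open>d > 0\<close> by (simp add: field_simps power2_eq_square)
      qed
      finally show "norm (g x * (cnj (g x) - t x)) \<le> d + (norm (cnj (g x) - t x))\<^sup>2 / d" .
    qed
    also have "\<dots> = d * m + (LINT x|\<nu>. (norm (cnj (g x) - t x))\<^sup>2) / d"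
      using sq by (simp add: m_def mult.commute)
    also have "\<dots> \<le> d * m + d"
      using t(2) \<open>d > 0\<close> by (simp add: field_simps power2_eq_square)
    finally show ?thesis by simp
  qed
  then have "N \<le> d * (m + 1)" if "d > 0" for d using that by (simp add: distrib_left)
  moreover have "m \<ge> 0" by (simp add: m_def)
  ultimately have "N \<le> 0 + e" if "e > 0" for e
    using that \<open>\<And>d. d > 0 \<Longrightarrow> N \<le> d * (m + 1)\<close>[of "e / (m + 1)"] by simp
  then have "N \<le> 0" by (rule field_le_epsilon)
  moreover have "N \<ge> 0" unfolding N_def by simp
  ultimately show ?thesis unfolding N_def by simp
qed

text \<open>Polar decomposition: U dx = sgn U d\<nu> with the finite measure d\<nu> = |U| dx. The
  bounded function sgn U is then orthogonal to all characters in L2(\<nu>), and its squared norm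
  there is the integral of |U|.\<close>

theorem fourier_integrals_zero_imp_AE_zero:
  fixes U :: "'a::euclidean_space \<Rightarrow> complex"
  assumes U: "integrable lborel U" and z: "\<And>s. (LINT x|lborel. U x * cis (s \<bullet> x)) = 0"
  shows "AE x in lborel. U x = 0"
proof -
  define \<nu> where "\<nu> = density lborel (\<lambda>x. ennreal (norm (U x)))"
  have Um[measurable]: "U \<in> borel_measurable borel" using borel_measurable_integrable[OF U] by simp
  have "emeasure \<nu> (space \<nu>) = (\<integral>\<^sup>+x. ennreal (norm (U x)) \<partial>lborel)"
    unfolding \<nu>_def by (subst emeasure_density) (auto intro!: nn_integral_cong)
  also have "\<dots> < \<infinity>" using U unfolding integrable_iff_bounded by blast
  finally have fin: "emeasure \<nu> (space \<nu>) \<noteq> \<infinity>" by simp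
  interpret finite_borel_measure \<nu>
    by (intro finite_borel_measure.intro finite_measureI fin finite_borel_measure_axioms.intro) (simp add: \<nu>_def)
  define g where "g x = sgn (U x)" for x
  have gm: "g \<in> borel_measurable borel" unfolding g_def sgn_div_norm using Um by measurable
  have g1: "norm (g x) \<le> 1" for x unfolding g_def by (simp add: norm_sgn)
  have e: "norm (U x) *\<^sub>R g x = U x" for x by (cases "U x = 0") (simp_all add: g_def sgn_div_norm)
  have "(LINT x|\<nu>. g x * cis (s \<bullet> x)) = 0" for s
  proof -
    have "(\<lambda>x. cis (s \<bullet> x)) \<in> borel_measurable borel"
      by (rule trig_poly_measurable[OF trig_poly.char])
    then have "(LINT x|\<nu>. g x * cis (s \<bullet> x)) = (LINT x|lborel. norm (U x) *\<^sub>R (g x * cis (s \<bullet> x)))"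
      unfolding \<nu>_def using gm Um by (intro integral_density) auto
    also have "\<dots> = (LINT x|lborel. U x * cis (s \<bullet> x))"
      using e by (intro Bochner_Integration.integral_cong) (simp_all flip: mult_scaleR_left)
    finally show ?thesis using z by simp
  qed
  then have "(LINT x|\<nu>. (norm (g x))\<^sup>2) = 0" by (rule trig_integrals_zero_imp[OF gm g1])
  moreover have "(LINT x|\<nu>. (norm (g x))\<^sup>2) = (LINT x|lborel. norm (U x) *\<^sub>R (norm (g x))\<^sup>2)"
    unfolding \<nu>_def using gm Um by (intro integral_density) auto
  moreover have "(LINT x|lborel. norm (U x) *\<^sub>R (norm (g x))\<^sup>2) = (LINT x|lborel. norm (U x))"
    by (intro Bochner_Integration.integral_cong) (auto simp: g_def norm_sgn)
  ultimately have "(LINT x|lborel. norm (U x)) = 0" by simp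
  then show ?thesis
    using integral_nonneg_eq_0_iff_AE[OF integrable_norm[OF U]] by simp
qed

section \<open>Morgan's theorem on the line\<close>

text \<open>Only the integrand is dominated locally, not its derivative. Cauchy's inequality on
  discs of radius r / 2 turns the majorant \<open>w\<close> into the majorant 2 w / r for the
  difference quotients, and dominated convergence applies.\<close>

lemma holomorphic_on_integral_param:
  fixes F :: "complex \<Rightarrow> 'b \<Rightarrow> complex"
  assumes meas: "\<And>z. z \<in> S \<Longrightarrow> F z \<in> borel_measurable M"
    and hol: "\<And>t. t \<in> space M \<Longrightarrow> (\<lambda>z. F z t) holomorphic_on S"
    and dom: "\<And>z. z \<in> S \<Longrightarrow> \<exists>r>0. \<exists>w. cball z r \<subseteq> S \<and> integrable M w \<and>
                (\<forall>u\<in>cball z r. \<forall>t\<in>space M. norm (F u t) \<le> w t)"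
  shows "(\<lambda>z. LINT t|M. F z t) holomorphic_on S"
proof (rule holomorphic_onI)
  fix z assume "z \<in> S"
  from dom[OF this] obtain r w where r: "r > 0" "cball z r \<subseteq> S" and w: "integrable M w"
    and bd: "\<And>u t. u \<in> cball z r \<Longrightarrow> t \<in> space M \<Longrightarrow> norm (F u t) \<le> w t" by blast
  define D where "D t = deriv (\<lambda>z. F z t) z" for t
  have int: "integrable M (F u)" if "u \<in> cball z r" for u
    by (rule Bochner_Integration.integrable_bound[OF w]) (use that r meas bd in \<open>force intro!: AE_I2\<close>)+
  have der: "((\<lambda>z. F z t) has_field_derivative deriv (\<lambda>z. F z t) u) (at u)" if "u \<in> ball z r" "t \<in> space M" for u t
  proof (rule holomorphic_derivI[of _ "ball z r"])
    show "(\<lambda>z. F z t) holomorphic_on ball z r"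
      using holomorphic_on_subset[OF hol[OF that(2)], of "ball z r"] r(2) ball_subset_cball by blast
  qed (use that in auto)
  have quot: "norm (F u t - F z t) \<le> (2 * w t / r) * norm (u - z)" if u: "u \<in> cball z (r/2)" and t: "t \<in> space M" for u t
  proof (rule field_differentiable_bound[of "cball z (r/2)" "\<lambda>z. F z t" "deriv (\<lambda>z. F z t)"])
    fix v assume v: "v \<in> cball z (r/2)"
    then have "v \<in> ball z r" using r by auto
    then show "((\<lambda>z. F z t) has_field_derivative deriv (\<lambda>z. F z t) v) (at v within cball z (r/2))"
      using der t by (blast intro: has_field_derivative_at_within)
    have sub: "cball v (r/2) \<subseteq> cball z r"
      using v by (auto simp: dist_norm) (smt (verit, best) dist_norm dist_triangle field_sum_of_halves)
    have "norm ((deriv ^^ 1) (\<lambda>z. F z t) v) \<le> fact 1 * w t / (r/2) ^ 1"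
    proof (rule Cauchy_inequality)
      have h: "(\<lambda>z. F z t) holomorphic_on cball v (r/2)"
        using hol[OF t] sub r by (blast intro: holomorphic_on_subset)
      then show "(\<lambda>z. F z t) holomorphic_on ball v (r/2)" using ball_subset_cball holomorphic_on_subset by blast
      show "continuous_on (cball v (r/2)) (\<lambda>z. F z t)" using h by (rule holomorphic_on_imp_continuous_on)
      fix x assume "norm (v - x) = r / 2"
      then have "x \<in> cball v (r/2)" by (simp add: dist_norm)
      then show "norm (F x t) \<le> w t" using sub bd t by blast
    qed (use r in auto)
    then show "norm (deriv (\<lambda>z. F z t) v) \<le> 2 * w t / r" by (simp add: field_simps)
  qed (use u r in auto)
  have "((\<lambda>y. ((LINT t|M. F y t) - (LINT t|M. F z t)) / (y - z)) \<longlongrightarrow> (LINT t|M. D t)) (at z)"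
    unfolding tendsto_at_iff_sequentially o_def
  proof (intro allI impI)
    fix X assume X: "\<forall>i. X i \<in> UNIV - {z}" "X \<longlonglongrightarrow> z"
    have "eventually (\<lambda>i. X i \<in> ball z (r/2)) sequentially"
      using X(2) r by (intro topological_tendstoD) auto
    then obtain N where N: "\<And>i. X (i + N) \<in> cball z (r/2)"
      by (metis (no_types, lifting) eventually_sequentially ball_subset_cball le_add2 subsetD)
    have Nr: "X (i + N) \<in> cball z r" for i using N[of i] r by auto
    have zr: "z \<in> cball z r" using r by auto
    have "(\<lambda>i. LINT t|M. (F (X (i + N)) t - F z t) / (X (i + N) - z)) \<longlonglongrightarrow> (LINT t|M. D t)"
    proof (rule integral_dominated_convergence[where w="\<lambda>t. 2 * w t / r"])
      show Fm: "(\<lambda>t. (F (X (i + N)) t - F z t) / (X (i + N) - z)) \<in> borel_measurable M" for i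
        using int[OF Nr, of i] int[OF zr] by auto
      have lim: "(\<lambda>i. (F (X (i + N)) t - F z t) / (X (i + N) - z)) \<longlonglongrightarrow> D t" if "t \<in> space M" for t
      proof -
        have "((\<lambda>y. (F y t - F z t) / (y - z)) \<longlongrightarrow> D t) (at z)"
          using der[of z t] that r unfolding D_def has_field_derivative_iff by simp
        then have "(\<lambda>i. (F (X i) t - F z t) / (X i - z)) \<longlonglongrightarrow> D t"
          using X unfolding tendsto_at_iff_sequentially o_def by blast
        then show ?thesis by (rule LIMSEQ_ignore_initial_segment)
      qed
      then show "AE t in M. (\<lambda>i. (F (X (i + N)) t - F z t) / (X (i + N) - z)) \<longlonglongrightarrow> D t" by simp
      show "D \<in> borel_measurable M" by (rule borel_measurable_LIMSEQ_metric[OF Fm lim])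
      show "integrable M (\<lambda>t. 2 * w t / r)" using w by simp
      have "norm ((F (X (i + N)) t - F z t) / (X (i + N) - z)) \<le> 2 * w t / r" if "t \<in> space M" for i t
        using quot[OF N that, of i] X(1) by (simp add: norm_divide divide_le_eq)
      then show "AE t in M. norm ((F (X (i + N)) t - F z t) / (X (i + N) - z)) \<le> 2 * w t / r" for i by simp
    qed
    moreover have "(LINT t|M. (F (X (i + N)) t - F z t) / (X (i + N) - z))
       = ((LINT t|M. F (X (i + N)) t) - (LINT t|M. F z t)) / (X (i + N) - z)" for i
      using int[OF Nr, of i] int[OF zr] by simp
    ultimately have "(\<lambda>i. ((LINT t|M. F (X (i + N)) t) - (LINT t|M. F z t)) / (X (i + N) - z)) \<longlonglongrightarrow> (LINT t|M. D t)"
      by (simp only:)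
    then show "(\<lambda>i. ((LINT t|M. F (X i) t) - (LINT t|M. F z t)) / (X i - z)) \<longlonglongrightarrow> (LINT t|M. D t)"
      by (rule LIMSEQ_offset)
  qed
  then have "((\<lambda>z. LINT t|M. F z t) has_field_derivative (LINT t|M. D t)) (at z)"
    by (simp add: has_field_derivative_iff)
  then show "(\<lambda>z. LINT t|M. F z t) field_differentiable at z within S"
    using field_differentiable_at_within field_differentiable_def by blast
qed

text \<open>The comparison function for the Phragmen-Lindelof argument: its real part grows like an
  exponential of |Re w| as long as the strip, scaled by \<open>s\<close>, stays inside |Im| < pi /
  2.\<close>

lemma Re_cosh_strip_ge:
  assumes "s * \<bar>Im w\<bar> \<le> \<phi>" "\<phi> < pi / 2" "0 < s"
  shows "Re (cosh (of_real s * w)) \<ge> exp (s * \<bar>Re w\<bar>) * cos \<phi> / 2"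
proof -
  have "\<phi> \<ge> 0" using assms by (smt (verit) mult_nonneg_nonneg abs_ge_zero)
  have c: "cos \<phi> \<le> cos (s * Im w)"
  proof -
    have "cos \<phi> \<le> cos \<bar>s * Im w\<bar>"
    proof (rule cos_monotone_0_pi_le)
      show "\<phi> \<le> pi" using assms(2) pi_gt_zero by linarith
    qed (use assms in \<open>simp_all add: abs_mult\<close>)
    then show ?thesis by (simp add: cos_abs_real)
  qed
  have c0: "0 \<le> cos \<phi>" using assms \<open>\<phi> \<ge> 0\<close> by (intro cos_ge_zero) auto
  have e: "exp (s * \<bar>Re w\<bar>) \<le> exp (s * Re w) + exp (- (s * Re w))"
    by (cases "Re w \<ge> 0") (auto intro: add_increasing add_increasing2)
  have "Re (cosh (of_real s * w)) = (exp (s * Re w) + exp (- (s * Re w))) * cos (s * Im w) / 2"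
    by (simp add: cosh_field_def Re_exp Re_divide_numeral algebra_simps)
  also have "\<dots> \<ge> exp (s * \<bar>Re w\<bar>) * cos \<phi> / 2"
    using mult_mono[OF e c] c0 by (simp add: add_nonneg_nonneg)
  finally show ?thesis .
qed

text \<open>Multiply \<open>F\<close> by exp (- e cosh (w u)). This factor has modulus at most 1 on
  the strip and defeats the growth of \<open>F\<close> at its far ends, so the maximum principle on
  a long rectangle gives the bound \<open>C\<close>; then e tends to 0.\<close>

lemma phragmen_lindelof_strip_pos:
  fixes F :: "complex \<Rightarrow> complex"
  assumes hol: "F holomorphic_on UNIV" and ab: "al < be" and C: "C > 0"
    and bd: "\<And>z. Im z = al \<or> Im z = be \<Longrightarrow> norm (F z) \<le> C"
    and gr: "\<And>z. al \<le> Im z \<Longrightarrow> Im z \<le> be \<Longrightarrow> norm (F z) \<le> exp (A * exp (s * \<bar>Re z\<bar>))"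
    and s: "0 < s" "s * (be - al) < pi"
    and z: "al \<le> Im z" "Im z \<le> be"
  shows "norm (F z) \<le> C"
proof -
  define m where "m = (al + be) / 2"
  \<comment> \<open>A rate strictly between the growth rate of \<open>F\<close> and the critical
    rate pi / (be - al): above the first to win at infinity, below the second to keep the real part
    of cosh positive.\<close>
  obtain s' where s': "s < s'" "s' < pi / (be - al)"
    using dense[of s "pi / (be - al)"] s ab by (auto simp: field_simps)
  define \<phi> where "\<phi> = s' * (be - al) / 2"
  have \<phi>: "\<phi> < pi / 2" "0 < \<phi>" using s' ab s by (auto simp: \<phi>_def field_simps)
  have cphi: "cos \<phi> > 0" using \<phi> by (intro cos_gt_zero) auto
  define w where "w u = of_real s' * (u - \<i> * of_real m)" for u :: complex
  define H where "H e u = F u * exp (- of_real e * cosh (w u))" for e :: real and u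
  have cosh_ge: "Re (cosh (w u)) \<ge> exp (s' * \<bar>Re u\<bar>) * cos \<phi> / 2" if "al \<le> Im u" "Im u \<le> be" for u
  proof -
    have "\<bar>Im u - m\<bar> \<le> (be - al) / 2" using that by (auto simp: m_def abs_if field_simps)
    then have "s' * \<bar>Im u - m\<bar> \<le> \<phi>" using s s' unfolding \<phi>_def
      by (metis less_trans mult_left_mono order_less_imp_le times_divide_eq_right)
    then show ?thesis
      using Re_cosh_strip_ge[of s' "u - \<i> * of_real m" \<phi>] \<phi> s s' by (simp add: w_def)
  qed
  have Hn: "norm (H e u) = norm (F u) * exp (- e * Re (cosh (w u)))" for e u
    by (simp add: H_def norm_mult)
  have key: "norm (H e z) \<le> C" if e: "e > 0" for e
  proof -
    define A' where "A' = max A 0"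
    define d where "d = e * cos \<phi> / 2"
    have d: "d > 0" using e cphi by (simp add: d_def)
    \<comment> \<open>Half the length of the rectangle. It ensures A' + |ln C| \<le> d exp ((s' - s)
      X), which makes the exponent A exp (s X) - d exp (s' X) at most ln C on the vertical
      sides.\<close>
    define X where "X = max (\<bar>Re z\<bar>) ((A' + \<bar>ln C\<bar>) / (d * (s' - s)))"
    have X: "X \<ge> 0" "\<bar>Re z\<bar> \<le> X" by (auto simp: X_def)
    have "(A' + \<bar>ln C\<bar>) / (d * (s' - s)) \<le> X" by (simp add: X_def)
    then have "A' + \<bar>ln C\<bar> \<le> X * (d * (s' - s))" using d s' by (subst (asm) pos_divide_le_eq) auto
    also have "\<dots> \<le> d * exp ((s' - s) * X)"
    proof -
      have "(s' - s) * X \<le> exp ((s' - s) * X)" using exp_ge_add_one_self[of "(s' - s) * X"] by linarith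
      then have "d * ((s' - s) * X) \<le> d * exp ((s' - s) * X)" using d by (intro mult_left_mono) auto
      then show ?thesis by (simp only: mult.assoc mult.left_commute mult.commute)
    qed
    finally have Xb: "A' + \<bar>ln C\<bar> \<le> d * exp ((s' - s) * X)" .
    have far: "norm (H e u) \<le> C" if u: "al \<le> Im u" "Im u \<le> be" "\<bar>Re u\<bar> = X" for u
    proof -
      have "norm (H e u) \<le> exp (A * exp (s * X)) * exp (- e * (exp (s' * X) * cos \<phi> / 2))"
        unfolding Hn using gr[OF u(1,2)] cosh_ge[OF u(1,2)] u(3) e by (intro mult_mono) auto
      also have "\<dots> = exp (A * exp (s * X) - d * exp (s' * X))"
        by (simp add: exp_add[symmetric] d_def mult.commute mult.left_commute)
      finally have 1: "norm (H e u) \<le> exp (A * exp (s * X) - d * exp (s' * X))" .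
      have "A * exp (s * X) \<le> A' * exp (s * X)" by (simp add: A'_def mult_right_mono)
      then have "A * exp (s * X) - d * exp (s' * X) \<le> A' * exp (s * X) - d * exp (s' * X)" by linarith
      also have "A' * exp (s * X) - d * exp (s' * X) = exp (s * X) * (A' - d * exp ((s' - s) * X))"
        by (simp add: algebra_simps exp_add[symmetric])
      also have "\<dots> \<le> 1 * (A' - d * exp ((s' - s) * X))"
        using Xb X s by (intro mult_right_mono_neg) auto
      also have "\<dots> \<le> ln C"
      proof -
        have "A' - T \<le> ln C" if "A' + \<bar>ln C\<bar> \<le> T" for T
          using that abs_ge_minus_self[of "ln C"] by linarith
        from this[OF Xb] show ?thesis by simp
      qed
      finally have "exp (A * exp (s * X) - d * exp (s' * X)) \<le> exp (ln C)" by (simp only: exp_le_cancel_iff)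
      with 1 show ?thesis using C by simp
    qed
    show ?thesis
    proof (rule maximum_modulus_frontier[where f="H e" and S="cbox (Complex (-X) al) (Complex X be)"])
      let ?R = "cbox (Complex (-X) al) (Complex X be)"
      have "H e holomorphic_on UNIV" unfolding H_def w_def
        by (intro holomorphic_intros hol) (auto simp: cosh_field_def intro!: holomorphic_intros)
      then show "H e holomorphic_on interior ?R" "continuous_on (closure ?R) (H e)"
        by (auto intro: holomorphic_on_subset holomorphic_on_imp_continuous_on continuous_on_subset)
      show "bounded ?R" by simp
      show "z \<in> ?R" using z X by (auto simp: in_cbox_complex_iff)
      fix u assume "u \<in> frontier ?R"
      then have u: "al \<le> Im u" "Im u \<le> be" "\<bar>Re u\<bar> = X \<or> Im u = al \<or> Im u = be"
        by (auto simp: frontier_cbox in_cbox_complex_iff in_box_complex_iff)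
      have "exp (- e * Re (cosh (w u))) \<le> 1"
      proof -
        have "0 \<le> Re (cosh (w u))" using cosh_ge[OF u(1,2)] cphi by (smt (verit) divide_nonneg_nonneg exp_gt_zero mult_pos_pos)
        then show ?thesis using e by simp
      qed
      then have "norm (H e u) \<le> norm (F u)" unfolding Hn by (simp add: mult_left_le)
      then show "norm (H e u) \<le> C" using u far bd[of u] by fastforce
    qed
  qed
  have "((\<lambda>e. norm (F z) * exp (- e * Re (cosh (w z)))) \<longlongrightarrow> norm (F z) * exp (- 0 * Re (cosh (w z)))) (at_right 0)"
    by (intro tendsto_intros)
  then have "norm (F z) * exp (- 0 * Re (cosh (w z))) \<le> C"
    by (rule tendsto_upperbound) (use key Hn in \<open>auto simp: eventually_at_right_field intro!: exI[of _ 1]\<close>)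
  then show ?thesis by simp
qed

lemma phragmen_lindelof_strip:
  fixes F :: "complex \<Rightarrow> complex"
  assumes hol: "F holomorphic_on UNIV" and ab: "al < be"
    and bd: "\<And>z. Im z = al \<or> Im z = be \<Longrightarrow> norm (F z) \<le> C"
    and gr: "\<And>z. al \<le> Im z \<Longrightarrow> Im z \<le> be \<Longrightarrow> norm (F z) \<le> exp (A * exp (s * \<bar>Re z\<bar>))"
    and s: "0 < s" "s * (be - al) < pi"
    and z: "al \<le> Im z" "Im z \<le> be"
  shows "norm (F z) \<le> C"
proof (rule field_le_epsilon)
  fix e :: real assume e: "e > 0"
  have "0 \<le> C" using bd[of "Complex 0 al"] by (metis complex.sel(2) norm_ge_zero order_trans)
  then show "norm (F z) \<le> C + e"
    using e by (intro phragmen_lindelof_strip_pos[OF hol ab _ _ gr s z]) (auto intro: order_trans[OF bd])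
qed

text \<open>In the logarithmic coordinate z of a point w = exp z, this is the modulus of exp (K
  w^q).\<close>

lemma norm_exp_of_real_mult_exp:
  "norm (exp (of_real K * exp (of_real q * z))) = exp (K * (exp (Re z) powr q * cos (q * Im z)))"
  by (simp add: Re_exp exp_powr_real mult.commute)

text \<open>Multiplying by \<open>exp (k * z powr (q - 1))\<close>, which is unimodular on the two
  boundary rays, turns the Gaussian-type decay on the positive axis into a bound by \<open>C\<close>
  that is independent of \<open>k\<close>.\<close>

lemma entire_vanishes_on_ray:
  fixes G :: "complex \<Rightarrow> complex"
  assumes hol: "G holomorphic_on UNIV" and q: "q > 2" and M: "M > 0" and C: "C \<ge> 1"
    and gr: "\<And>z. norm (G z) \<le> C * exp (M * \<bar>Im z\<bar> powr q)"
    and dec: "\<And>x. x > 0 \<Longrightarrow> norm (G (of_real x)) \<le> C * exp (- N * x powr q)"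
    and N: "N > M * sin (pi / (2 * (q - 1))) powr (q - 1)" and x: "x > 0"
  shows "G (of_real x) = 0"
proof -
  \<comment> \<open>Chosen so that (q - 1) \<theta> = pi / 2 and q \<theta> = pi / 2 + \<theta>. On
    the rays of angle \<theta> and - \<theta> the power z^(q-1) is thus imaginary, while the real
    part of z^q is - |z|^q sin \<theta>.\<close>
  define \<theta> where "\<theta> = pi / (2 * (q - 1))"
  define s where "s = sin \<theta>"
  \<comment> \<open>With this constant the factor exp (K z^q) cancels the growth exp (M |Im z|^q)
    exactly on the two rays, since M (R s)^q = K R^q s. The surplus \<delta> = N - K of decay
    remains on the axis.\<close>
  define K where "K = M * s powr (q - 1)"
  define \<delta> where "\<delta> = N - K"
  have t3: "(q - 1) * \<theta> = pi / 2"
  proof -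
    have "k * (pi / (2 * k)) = pi / 2" if "k \<noteq> 0" for k :: real using that by simp
    from this[of "q - 1"] show ?thesis using q by (simp add: \<theta>_def)
  qed
  moreover have t4: "q * \<theta> = pi / 2 + \<theta>" using t3 by (simp add: left_diff_distrib)
  moreover have t1: "0 < \<theta>" using q by (simp add: \<theta>_def)
  moreover have "\<theta> < pi / 2"
  proof -
    have "1 * \<theta> < (q - 1) * \<theta>" using q t1 by (intro mult_strict_right_mono) auto
    then show ?thesis using t3 by simp
  qed
  ultimately have \<theta>: "0 < \<theta>" "\<theta> < pi / 2" "(q - 1) * \<theta> = pi / 2" "q * \<theta> = pi / 2 + \<theta>"
    by blast+
  have s: "0 < s" "s \<le> 1" using sin_gt_zero[of \<theta>] t1 \<theta>(2) pi_gt_zero by (simp_all add: s_def)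
  have K: "K > 0" using M s by (simp add: K_def)
  have \<delta>: "\<delta> > 0" using N by (simp add: \<delta>_def K_def s_def \<theta>_def)
  \<comment> \<open>In the coordinate u = log z, sectors around the positive axis become horizontal
    strips and growth of order q becomes growth like exp (q |Re u|).\<close>
  define E where "E u = G (exp u) * exp (of_real K * exp (of_real q * u))" for u
  define E2 where "E2 k u = E u * exp (of_real k * exp (of_real (q - 1) * u))" for k :: real and u
  have holE: "E holomorphic_on UNIV" unfolding E_def
    by (intro holomorphic_intros holomorphic_on_compose_gen[OF _ hol, unfolded o_def]) auto
  have holE2: "E2 k holomorphic_on UNIV" for k unfolding E2_def
    by (intro holomorphic_intros holE)
  have nE: "norm (E u) = norm (G (exp u)) * exp (K * (exp (Re u) powr q * cos (q * Im u)))" for u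
    unfolding E_def norm_mult norm_exp_of_real_mult_exp ..
  have nE2: "norm (E2 k u) = norm (E u) * exp (k * (exp (Re u) powr (q - 1) * cos ((q - 1) * Im u)))" for k u
    unfolding E2_def norm_mult norm_exp_of_real_mult_exp ..
  have bd1: "norm (E u) \<le> C" if "\<bar>Im u\<bar> = \<theta>" for u
  proof -
    let ?R = "exp (Re u)"
    have im: "\<bar>Im (exp u)\<bar> = ?R * s"
    proof -
      have "Im u = \<theta> \<or> Im u = - \<theta>" using that by linarith
      then have "\<bar>sin (Im u)\<bar> = s" using s by (auto simp: s_def)
      then show ?thesis by (simp add: Im_exp abs_mult)
    qed
    have c: "cos (q * Im u) = - s"
    proof -
      have "Im u = \<theta> \<or> Im u = - \<theta>" using that by linarith
      then have "cos (q * Im u) = cos (q * \<theta>)" by auto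
      then show ?thesis using \<theta>(4) by (simp add: s_def cos_add)
    qed
    have sq: "s powr q = s powr (q - 1) * s" using s by (simp add: powr_mult_base[symmetric] mult.commute flip: powr_add) (simp add: powr_diff)
    have "norm (E u) \<le> C * exp (M * (?R * s) powr q) * exp (K * (?R powr q * (- s)))"
      unfolding nE c using gr[of "exp u"] unfolding im by (intro mult_right_mono) auto
    also have "\<dots> = C * exp (M * (?R * s) powr q + K * (?R powr q * (- s)))"
      by (simp only: exp_add mult.assoc)
    also have "M * (?R * s) powr q + K * (?R powr q * (- s)) = 0"
      using s by (simp add: powr_mult K_def sq)
    finally show ?thesis by simp
  qed
  have bd0: "norm (E u) \<le> C * exp (- \<delta> * exp (Re u) powr q)" if "Im u = 0" for u
  proof -
    let ?R = "exp (Re u)"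
    have "exp u = of_real ?R" using that by (simp add: complex_eq_iff Re_exp Im_exp)
    then have "norm (E u) \<le> C * exp (- N * ?R powr q) * exp (K * (?R powr q))"
      unfolding nE using dec[of ?R] that by simp
    also have "\<dots> = C * exp (- \<delta> * ?R powr q)"
      by (simp add: \<delta>_def exp_add[symmetric] algebra_simps)
    finally show ?thesis .
  qed
  have bd0': "norm (E u) \<le> C" if "Im u = 0" for u
  proof -
    have "exp (- \<delta> * exp (Re u) powr q) \<le> 1" using \<delta> by simp
    then show ?thesis using bd0[OF that] C by (smt (verit, ccfv_SIG) mult_left_le)
  qed
  have grE: "norm (E u) \<le> exp ((ln C + (M + K)) * exp (q * \<bar>Re u\<bar>))" for u
  proof -
    let ?R = "exp (Re u)"
    have e1: "?R powr q \<le> exp (q * \<bar>Re u\<bar>)" using q by (simp add: exp_powr_real mult.commute)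
    have "\<bar>Im (exp u)\<bar> \<le> ?R" unfolding Im_exp by (simp add: abs_mult mult_left_le)
    then have "\<bar>Im (exp u)\<bar> powr q \<le> ?R powr q" using q by (intro powr_mono2) auto
    then have m: "M * \<bar>Im (exp u)\<bar> powr q \<le> M * ?R powr q" using M by simp
    have k: "K * (?R powr q * cos (q * Im u)) \<le> K * ?R powr q"
      using K by (intro mult_left_mono) (auto simp: mult_left_le)
    have "norm (E u) \<le> C * exp (M * \<bar>Im (exp u)\<bar> powr q) * exp (K * (?R powr q * cos (q * Im u)))"
      unfolding nE by (intro mult_right_mono gr) auto
    also have "\<dots> = exp (ln C + (M * \<bar>Im (exp u)\<bar> powr q + K * (?R powr q * cos (q * Im u))))"
      using C by (simp add: exp_add)
    also have "\<dots> \<le> exp (ln C + (M + K) * exp (q * \<bar>Re u\<bar>))"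
    proof -
      have "M * \<bar>Im (exp u)\<bar> powr q + K * (?R powr q * cos (q * Im u)) \<le> (M + K) * ?R powr q"
        using m k by (simp add: distrib_right)
      also have "\<dots> \<le> (M + K) * exp (q * \<bar>Re u\<bar>)" using e1 M K by (intro mult_left_mono) auto
      finally show ?thesis by simp
    qed
    also have "\<dots> \<le> exp ((ln C + (M + K)) * exp (q * \<bar>Re u\<bar>))"
    proof -
      have "ln C * 1 \<le> ln C * exp (q * \<bar>Re u\<bar>)" using C q by (intro mult_left_mono) auto
      then show ?thesis by (simp add: distrib_right)
    qed
    finally show ?thesis .
  qed
  have qt: "q * \<theta> < pi" using \<theta>(2,4) by simp
  have qt': "(q - 1) * \<theta> < pi" unfolding \<theta>(3) by simp
  have bdC: "norm (E u) \<le> C" if "Im u = - \<theta> \<or> Im u = 0 \<or> Im u = \<theta>" for u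
    using bd1[of u] bd0'[of u] that \<theta>(1) by auto
  \<comment> \<open>The full sector has width 2 \<theta>, and q * 2 \<theta> = pi + 2 \<theta> is
    beyond the critical value, so each half is treated separately, with the axis as a boundary ray;
    there q \<theta> < pi.\<close>
  have E_up: "norm (E u) \<le> C" if "0 \<le> Im u" "Im u \<le> \<theta>" for u
    by (rule phragmen_lindelof_strip[OF holE \<theta>(1) _ grE _ _ that]) (use bdC \<theta>(1) q qt in \<open>simp_all, blast?\<close>)
  have E_down: "norm (E u) \<le> C" if "- \<theta> \<le> Im u" "Im u \<le> 0" for u
    by (rule phragmen_lindelof_strip[OF holE _ _ grE _ _ that]) (use bdC \<theta>(1) q qt in \<open>simp_all, blast?\<close>)
  have E_all: "norm (E u) \<le> C" if "\<bar>Im u\<bar> \<le> \<theta>" for u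
    using E_up[of u] E_down[of u] that by linarith
  have main: "norm (E u) * exp (k * (exp (Re u) powr (q - 1))) \<le> C" if u: "Im u = 0" and k: "k > 0" for u k
  proof -
    \<comment> \<open>On the axis the exponent R^(q-1) (k - \<delta> R) is negative once R > k /
      \<delta>, and below that point it is at most k (k / \<delta>)^(q-1). The resulting bound
      depends on \<open>k\<close>, which the last application of Phragmen-Lindelof repairs.\<close>
    define Ck where "Ck = C * exp (k * (k / \<delta>) powr (q - 1))"
    have Ck: "Ck \<ge> 1" "C \<le> Ck"
    proof -
      have "C * 1 \<le> Ck" unfolding Ck_def using C k by (intro mult_left_mono) auto
      then show "C \<le> Ck" "Ck \<ge> 1" using C by auto
    qed
    have b0: "norm (E2 k v) \<le> Ck" if "Im v = 0" for v
    proof -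
      let ?R = "exp (Re v)"
      have "norm (E2 k v) \<le> C * exp (- \<delta> * ?R powr q) * exp (k * ?R powr (q - 1))"
        unfolding nE2 using bd0[OF that] that by simp
      also have "\<dots> = C * exp (?R powr (q - 1) * (k - \<delta> * ?R))"
      proof -
        have "?R powr q = ?R powr (q - 1) * ?R" by (simp add: powr_diff)
        then show ?thesis by (simp add: mult.assoc exp_add[symmetric] algebra_simps)
      qed
      also have "?R powr (q - 1) * (k - \<delta> * ?R) \<le> k * (k / \<delta>) powr (q - 1)"
      proof (cases "?R \<le> k / \<delta>")
        case True
        have "?R powr (q - 1) * (k - \<delta> * ?R) \<le> ?R powr (q - 1) * k"
          using \<delta> by (intro mult_left_mono) auto
        also have "\<dots> \<le> (k / \<delta>) powr (q - 1) * k"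
          using True k q by (intro mult_right_mono powr_mono2) auto
        finally show ?thesis by (simp add: mult.commute)
      next
        case False
        then have "k - \<delta> * ?R \<le> 0" using \<delta> by (simp add: field_simps)
        then have "?R powr (q - 1) * (k - \<delta> * ?R) \<le> 0" by (intro mult_nonneg_nonpos) auto
        also have "0 \<le> k * (k / \<delta>) powr (q - 1)" using k by simp
        finally show ?thesis .
      qed
      finally show ?thesis using C by (simp add: Ck_def)
    qed
    have b1: "norm (E2 k v) \<le> C" if "\<bar>Im v\<bar> = \<theta>" for v
    proof -
      have "Im v = \<theta> \<or> Im v = - \<theta>" using that by linarith
      then have "cos ((q - 1) * Im v) = cos ((q - 1) * \<theta>)" 
        by (elim disjE) (simp_all only: mult_minus_right cos_minus)
      also have "\<dots> = 0" unfolding \<theta>(3) by simp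
      finally show ?thesis using bd1[OF that] by (simp add: nE2)
    qed
    have g: "norm (E2 k v) \<le> exp ((ln C + k) * exp ((q - 1) * \<bar>Re v\<bar>))" if "\<bar>Im v\<bar> \<le> \<theta>" for v
    proof -
      have "norm (E2 k v) \<le> C * exp (k * exp (Re v) powr (q - 1))"
        unfolding nE2 using E_all[OF that] C k by (intro mult_mono) (auto simp: mult_left_le)
      also have "\<dots> = exp (ln C + k * exp (Re v) powr (q - 1))" using C by (simp add: exp_add)
      also have "\<dots> \<le> exp (ln C * exp ((q - 1) * \<bar>Re v\<bar>) + k * exp ((q - 1) * \<bar>Re v\<bar>))"
      proof -
        have "ln C * 1 \<le> ln C * exp ((q - 1) * \<bar>Re v\<bar>)" using C q by (intro mult_left_mono) auto
        moreover have "exp (Re v) powr (q - 1) \<le> exp ((q - 1) * \<bar>Re v\<bar>)"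
          using q by (simp add: exp_powr_real mult.commute)
        ultimately show ?thesis using k by (simp add: add_mono)
      qed
      finally show ?thesis by (simp add: distrib_right)
    qed
    have b1': "norm (E2 k v) \<le> Ck" if "\<bar>Im v\<bar> = \<theta>" for v using b1[OF that] Ck(2) by linarith
    have bdC': "norm (E2 k u) \<le> Ck" if "Im u = - \<theta> \<or> Im u = 0 \<or> Im u = \<theta>" for u
      using b1'[of u] b0[of u] that \<theta>(1) by auto
    have up: "norm (E2 k v) \<le> Ck" if "0 \<le> Im v" "Im v \<le> \<theta>" for v
      by (rule phragmen_lindelof_strip[OF holE2 \<theta>(1) _ g _ _ that])
         (use bdC' \<theta>(1) q qt' in \<open>simp_all, blast?\<close>)
    have down: "norm (E2 k v) \<le> Ck" if "- \<theta> \<le> Im v" "Im v \<le> 0" for v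
      by (rule phragmen_lindelof_strip[OF holE2 _ _ g _ _ that])
         (use bdC' \<theta>(1) q qt' in \<open>simp_all, blast?\<close>)
    \<comment> \<open>Boundedness, now established on the whole strip, is a growth bound of any
      positive order. Order (q - 1) / 2 is used because q - 1 itself is exactly critical for the
      width 2 \<theta>. On the two outer rays alone the bound is \<open>C\<close>, independent of
      \<open>k\<close>.\<close>
    have all: "norm (E2 k v) \<le> exp (ln Ck * exp ((q - 1) / 2 * \<bar>Re v\<bar>))" if "- \<theta> \<le> Im v" "Im v \<le> \<theta>" for v
    proof -
      have "norm (E2 k v) \<le> Ck" using up[of v] down[of v] that by linarith
      also have "\<dots> = exp (ln Ck * 1)" using Ck by simp
      also have "\<dots> \<le> exp (ln Ck * exp ((q - 1) / 2 * \<bar>Re v\<bar>))"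
        unfolding exp_le_cancel_iff using Ck q by (intro mult_left_mono) auto
      finally show ?thesis .
    qed
    have "(q - 1) / 2 * (\<theta> - - \<theta>) = (q - 1) * \<theta>" by simp
    also have "\<dots> < pi" by (rule qt')
    finally have w: "(q - 1) / 2 * (\<theta> - - \<theta>) < pi" .
    have b2: "norm (E2 k z) \<le> C" if "Im z = - \<theta> \<or> Im z = \<theta>" for z
      using b1[of z] that \<theta>(1) by auto
    have "norm (E2 k u) \<le> C"
      by (rule phragmen_lindelof_strip[OF holE2 _ _ all _ w]) (use b2 \<theta>(1) q u in simp_all)
    then show ?thesis using u by (simp add: nE2)
  qed
  define u where "u = complex_of_real (ln x)"
  have eu: "exp u = of_real x" "Im u = 0" "exp (Re u) = x"
    using x by (auto simp: u_def exp_of_real)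
  have "E u = 0"
  proof (rule ccontr)
    assume "E u \<noteq> 0"
    define e where "e = norm (E u)"
    have e: "e > 0" using \<open>E u \<noteq> 0\<close> by (simp add: e_def)
    define y where "y = x powr (q - 1)"
    have y: "y > 0" using x by (simp add: y_def)
    \<comment> \<open>For this \<open>k\<close> the bound e exp (k y) \<le> C contradicts exp (k y)
      > k y = C / e.\<close>
    define k where "k = C / (e * y)"
    have "k > 0" using C e y by (simp add: k_def)
    from main[OF eu(2) this] have "e * exp (k * y) \<le> C" by (simp add: e_def y_def eu)
    moreover have "e * exp (k * y) > e * (k * y)" using e exp_ge_add_one_self[of "k * y"] by (intro mult_strict_left_mono) linarith+
    moreover have "e * (k * y) = C" using e y by (simp add: k_def)
    ultimately show False by simp
  qed
  then show ?thesis by (simp add: E_def eu)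
qed

text \<open>Turns integral decay of \<open>G\<close> into pointwise decay: on [x, x + e] the weight
  is at least exp (N x^q), so the increment of a primitive is at most exp (- N x^q) times the
  weighted integral.\<close>

lemma primitive_increment_le:
  fixes P G :: "complex \<Rightarrow> complex"
  assumes P: "\<And>z. (P has_field_derivative G z) (at z)" and G: "continuous_on UNIV G"
    and int: "integrable lborel (\<lambda>t. norm (G (of_real t)) * exp (N * \<bar>t\<bar> powr q))"
    and q: "q > 0" and N: "N \<ge> 0" and x: "x > 0" and e: "e > 0"
  shows "norm (P (of_real x + of_real e) - P (of_real x))
    \<le> (LINT t|lborel. norm (G (of_real t)) * exp (N * \<bar>t\<bar> powr q)) * exp (- N * x powr q)"
proof -
  let ?w = "\<lambda>t. norm (G (of_real t)) * exp (N * \<bar>t\<bar> powr q)"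
  have G': "continuous_on S (\<lambda>t. G (complex_of_real t))" for S
    by (rule continuous_on_compose2[OF G]) (auto intro: continuous_intros)
  have hi: "((\<lambda>t. G (of_real t)) has_integral (P (of_real (x + e)) - P (of_real x))) {x..x+e}"
  proof (rule fundamental_theorem_of_calculus)
    fix t assume "t \<in> {x..x+e}"
    have "((\<lambda>t. P (of_real t)) has_vector_derivative G (of_real t)) (at t)"
      by (rule has_vector_derivative_real_field[OF P])
    then show "((\<lambda>t. P (of_real t)) has_vector_derivative G (of_real t)) (at t within {x..x+e})"
      by (rule has_vector_derivative_at_within)
  qed (use e in auto)
  have sint: "set_integrable lborel {x..x+e} ?w"
    using integrable_mult_indicator[OF _ int, of "{x..x+e}"] by (simp add: set_integrable_def)
  note si = set_borel_integral_eq_integral[OF sint]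
  have ci: "(\<lambda>t. norm (G (of_real t))) integrable_on {x..x+e}"
    by (intro integrable_continuous_interval continuous_on_norm G')
  have le: "norm (G (of_real t)) \<le> exp (- N * x powr q) * ?w t" if "t \<in> {x..x+e}" for t
  proof -
    have "x powr q \<le> \<bar>t\<bar> powr q" using that x q by (intro powr_mono2) auto
    then have "N * x powr q \<le> N * \<bar>t\<bar> powr q" using N by (rule mult_left_mono)
    then have "1 \<le> exp (- N * x powr q) * exp (N * \<bar>t\<bar> powr q)"
      by (simp add: exp_add[symmetric])
    from mult_left_mono[OF this norm_ge_zero[of "G (of_real t)"]] show ?thesis by (simp add: mult_ac)
  qed
  have "norm (P (of_real (x + e)) - P (of_real x)) = norm (integral {x..x+e} (\<lambda>t. G (of_real t)))"
    using hi by (simp add: integral_unique)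
  also have "\<dots> \<le> integral {x..x+e} (\<lambda>t. exp (- N * x powr q) * ?w t)"
    using hi si(1) le by (intro Henstock_Kurzweil_Integration.integral_norm_bound_integral)
      (auto intro!: integrable_on_mult_right)
  also have "\<dots> = exp (- N * x powr q) * (LINT t:{x..x+e}|lborel. ?w t)"
    using si by simp
  also have "(LINT t:{x..x+e}|lborel. ?w t) \<le> (LINT t|lborel. ?w t)"
    unfolding set_lebesgue_integral_def
  proof (rule integral_mono[OF _ int])
    show "integrable lborel (\<lambda>t. indicat_real {x..x + e} t *\<^sub>R ?w t)" using sint by (simp add: set_integrable_def)
  qed (auto simp: indicator_def)
  finally show ?thesis by (simp add: mult.commute)
qed

text \<open>The increments P (z + e) - P z of a primitive inherit the growth of \<open>G\<close> and
  have pointwise decay, so they vanish at \<open>x\<close> for every e > 0; hence the derivative of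
  \<open>P\<close> at \<open>x\<close> vanishes.\<close>

lemma entire_integrable_decay_zero_pos:
  fixes G :: "complex \<Rightarrow> complex"
  assumes hol: "G holomorphic_on UNIV" and q: "q > 2" and M: "M > 0"
    and gr: "\<And>z. norm (G z) \<le> C * exp (M * \<bar>Im z\<bar> powr q)"
    and int: "integrable lborel (\<lambda>t. norm (G (of_real t)) * exp (N * \<bar>t\<bar> powr q))"
    and N: "N > M * sin (pi / (2 * (q - 1))) powr (q - 1)" and x: "x > 0"
  shows "G (of_real x) = 0"
proof -
  have cont: "continuous_on UNIV G" using hol by (rule holomorphic_on_imp_continuous_on)
  obtain P where P: "\<And>z. (P has_field_derivative G z) (at z)"
    using holomorphic_convex_primitive'[OF _ _ hol] by auto
  define D where "D = (LINT t|lborel. norm (G (of_real t)) * exp (N * \<bar>t\<bar> powr q))"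
  have "0 \<le> M * sin (pi / (2 * (q - 1))) powr (q - 1)" using M by simp
  then have N0: "N \<ge> 0" using N by simp
  have zero: "P (of_real x + of_real e) - P (of_real x) = 0" if e: "e > 0" for e
  proof -
    define H where "H z = P (z + of_real e) - P z" for z
    define C' where "C' = max (max (C * e) D) 1"
    have "H (of_real x) = 0"
    proof (rule entire_vanishes_on_ray[OF _ q M _ _ _ N x, of H C'])
      have "P field_differentiable at z" for z using P field_differentiable_def by blast
      then have Ph: "P holomorphic_on S" for S
        by (simp add: holomorphic_on_def field_differentiable_at_within)
      show "H holomorphic_on UNIV" unfolding H_def
        by (intro holomorphic_intros holomorphic_on_compose_gen[OF _ Ph, unfolded o_def, of _ _ UNIV]) auto
      show "C' \<ge> 1" by (simp add: C'_def)
      show "norm (H z) \<le> C' * exp (M * \<bar>Im z\<bar> powr q)" for z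
      proof -
        \<comment> \<open>The mean value bound is taken along a horizontal line, on which the growth
          bound for \<open>G\<close> is constant.\<close>
        have "convex {w. Im w = Im z}"
          by (simp add: convex_def algebra_simps flip: distrib_right)
        then have "norm (P (z + of_real e) - P z) \<le> (C * exp (M * \<bar>Im z\<bar> powr q)) * norm (z + of_real e - z)"
          by (rule field_differentiable_bound[where f'=G])
             (use P gr in \<open>auto intro: has_field_derivative_at_within\<close>, metis gr)
        also have "\<dots> = (C * e) * exp (M * \<bar>Im z\<bar> powr q)" using e by simp
        also have "\<dots> \<le> C' * exp (M * \<bar>Im z\<bar> powr q)" by (intro mult_right_mono) (auto simp: C'_def)
        finally show ?thesis by (simp add: H_def)
      qed
      show "norm (H (of_real y)) \<le> C' * exp (- N * y powr q)" if "y > 0" for y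
      proof -
        have "norm (H (of_real y)) \<le> D * exp (- N * y powr q)"
          unfolding H_def D_def using q by (intro primitive_increment_le P cont int N0 that e) auto
        also have "\<dots> \<le> C' * exp (- N * y powr q)" by (intro mult_right_mono) (auto simp: C'_def)
        finally show ?thesis .
      qed
    qed
    then show ?thesis by (simp add: H_def)
  qed
  have lim: "((\<lambda>y. (P y - P (of_real x)) / (y - of_real x)) \<longlongrightarrow> G (of_real x)) (at (of_real x))"
    using P[of "of_real x"] by (simp add: has_field_derivative_iff)
  let ?X = "\<lambda>n. complex_of_real x + of_real (inverse (real (Suc n)))"
  have "(\<lambda>n. complex_of_real (inverse (real (Suc n)))) \<longlonglongrightarrow> of_real 0"
    by (intro tendsto_of_real LIMSEQ_inverse_real_of_nat)
  then have "?X \<longlonglongrightarrow> of_real x" using tendsto_add[OF tendsto_const] by fastforce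
  moreover have "?X n \<noteq> of_real x" for n
  proof -
    have "complex_of_real (inverse (real (Suc n))) \<noteq> 0" by (simp del: of_nat_Suc)
    then show ?thesis by simp
  qed
  ultimately have "(\<lambda>n. (P (?X n) - P (of_real x)) / (?X n - of_real x)) \<longlonglongrightarrow> G (of_real x)"
    using lim[unfolded tendsto_at_iff_sequentially o_def, rule_format, of ?X] by blast
  moreover have "P (?X n) - P (of_real x) = 0" for n by (rule zero) simp
  ultimately have "(\<lambda>n::nat. 0) \<longlonglongrightarrow> G (of_real x)" by simp
  then show ?thesis by (simp add: LIMSEQ_const_iff)
qed

lemma entire_integrable_decay_zero:
  fixes G :: "complex \<Rightarrow> complex"
  assumes hol: "G holomorphic_on UNIV" and q: "q > 2" and M: "M > 0"
    and gr: "\<And>z. norm (G z) \<le> C * exp (M * \<bar>Im z\<bar> powr q)"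
    and int: "integrable lborel (\<lambda>t. norm (G (of_real t)) * exp (N * \<bar>t\<bar> powr q))"
    and N: "N > M * sin (pi / (2 * (q - 1))) powr (q - 1)" and x: "x \<noteq> 0"
  shows "G (of_real x) = 0"
proof (cases "x > 0")
  case True
  with assms show ?thesis by (intro entire_integrable_decay_zero_pos)
next
  case False
  have "(\<lambda>z. G (- z)) holomorphic_on UNIV"
    by (intro holomorphic_on_compose_gen[OF _ hol, unfolded o_def] holomorphic_intros) auto
  moreover have "integrable lborel (\<lambda>t. norm (G (- of_real t)) * exp (N * \<bar>t\<bar> powr q))"
    using lborel_integrable_real_affine[OF int, of "-1" 0] by simp
  moreover have "norm (G (- z)) \<le> C * exp (M * \<bar>Im z\<bar> powr q)" for z
    using gr[of "- z"] by simp
  ultimately have "G (- of_real (- x)) = 0"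
    using False x by (intro entire_integrable_decay_zero_pos[of "\<lambda>z. G (- z)", OF _ q M _ _ N]) auto
  then show ?thesis by simp
qed

text \<open>The measure space and the real function \<open>Y\<close> are arbitrary so that functions
  of several variables need no slicing: \<open>Y\<close> will be one coordinate, and the characters
  in the other coordinates will be absorbed into \<open>h\<close>. Young's inequality for the
  product of Im z and \<open>Y\<close> shows that the transform is entire with growth exp (M' |Im
  z|^q).\<close>

theorem morgan_fourier:
  fixes h :: "'b \<Rightarrow> complex" and Y :: "'b \<Rightarrow> real"
  assumes p: "1 < p" "p < 2" "1 / p + 1 / q = 1" and ab: "a > 0" "b > 0"
    and abc: "a * b > \<bar>cos (p * pi / 2)\<bar> powr (1 / p)"
    and h: "h \<in> borel_measurable M" and Y: "Y \<in> borel_measurable M"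
    and int: "integrable M (\<lambda>t. norm (h t) * exp (2 * pi * a powr p / p * \<bar>Y t\<bar> powr p))"
    and hat: "hat = (\<lambda>s. LINT t|M. h t * cis (- 2 * pi * s * Y t))"
    and fint: "(\<integral>\<^sup>+s. ennreal (norm (hat s) * exp (2 * pi * b powr q / q * \<bar>s\<bar> powr q)) \<partial>lborel) < \<infinity>"
    and s: "s \<noteq> 0"
  shows "hat s = 0"
proof -
  have "1 / q = (p - 1) / p" using p by (simp add: field_simps)
  then have "1 / (1 / q) = p / (p - 1)" by simp
  then have q1: "q = p / (p - 1)" "q - 1 = 1 / (p - 1)" using p by (simp_all add: field_simps)
  have q2: "q > 2" using p by (simp add: q1(1) field_simps)
  define G where "G z = (LINT t|M. h t * exp (- 2 * pi * \<i> * z * of_real (Y t)))" for z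
  have hatG: "hat s = G (of_real s)" for s
    unfolding hat G_def by (simp add: cis_conv_exp mult_ac)
  define N where "N = 2 * pi * b powr q / q"
  define M' where "M' = 2 * pi * (1 / a) powr q / q"
  define W where "W t = norm (h t) * exp (2 * pi * a powr p / p * \<bar>Y t\<bar> powr p)" for t
  have nF: "norm (h t * exp (- 2 * pi * \<i> * z * of_real (Y t))) = norm (h t) * exp (2 * pi * Im z * Y t)" for z t
    by (simp add: norm_mult)
  have young: "2 * pi * y * Y t \<le> 2 * pi * a powr p / p * \<bar>Y t\<bar> powr p + M' * \<bar>y\<bar> powr q" for y t
  proof -
    have "y * Y t \<le> \<bar>y\<bar> * \<bar>Y t\<bar>" by (metis abs_ge_self abs_mult)
    also have "\<dots> = (a * \<bar>Y t\<bar>) * (1 / a * \<bar>y\<bar>)" using ab by simp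
    also have "\<dots> \<le> (a * \<bar>Y t\<bar>) powr p / p + (1 / a * \<bar>y\<bar>) powr q / q"
      using p q2 ab by (intro Youngs_inequality) auto
    also have "\<dots> = a powr p / p * \<bar>Y t\<bar> powr p + (1 / a) powr q / q * \<bar>y\<bar> powr q"
    proof -
      have "(a * \<bar>Y t\<bar>) powr p = a powr p * \<bar>Y t\<bar> powr p" "(1 / a * \<bar>y\<bar>) powr q = (1 / a) powr q * \<bar>y\<bar> powr q"
        using ab by (intro powr_mult; simp)+
      then show ?thesis by (simp only: times_divide_eq_left)
    qed
    finally have "2 * pi * (y * Y t) \<le> 2 * pi * (a powr p / p * \<bar>Y t\<bar> powr p + (1 / a) powr q / q * \<bar>y\<bar> powr q)"
      by (intro mult_left_mono) auto
    then show ?thesis by (simp add: M'_def algebra_simps)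
  qed
  have bd: "norm (h t * exp (- 2 * pi * \<i> * z * of_real (Y t))) \<le> W t * exp (M' * \<bar>Im z\<bar> powr q)" for z t
  proof -
    have "norm (h t * exp (- 2 * pi * \<i> * z * of_real (Y t))) \<le> norm (h t) * exp (2 * pi * a powr p / p * \<bar>Y t\<bar> powr p + M' * \<bar>Im z\<bar> powr q)"
      unfolding nF using young[of "Im z" t] by (intro mult_left_mono) auto
    then show ?thesis by (simp only: W_def exp_add mult.assoc)
  qed
  have Wi: "integrable M W" using int by (simp add: W_def[abs_def])
  have M'0: "M' > 0" using ab q2 by (simp add: M'_def)
  have meas: "(\<lambda>t. h t * exp (- 2 * pi * \<i> * z * of_real (Y t))) \<in> borel_measurable M" for z
    using h Y by measurable
  have hol: "G holomorphic_on UNIV"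
    unfolding G_def
  proof (rule holomorphic_on_integral_param[OF meas])
    show "(\<lambda>z. h t * exp (- 2 * pi * \<i> * z * of_real (Y t))) holomorphic_on UNIV" for t
      by (intro holomorphic_intros)
    fix z :: complex
    let ?w = "\<lambda>t. W t * exp (M' * (\<bar>Im z\<bar> + 1) powr q)"
    have "norm (h t * exp (- 2 * pi * \<i> * u * of_real (Y t))) \<le> ?w t" if "u \<in> cball z 1" for u t
    proof -
      have "\<bar>Im u - Im z\<bar> \<le> 1" using that abs_Im_le_cmod[of "u - z"] by (simp add: dist_norm norm_minus_commute)
      then have "\<bar>Im u\<bar> powr q \<le> (\<bar>Im z\<bar> + 1) powr q" using q2 by (intro powr_mono2) auto
      then have "exp (M' * \<bar>Im u\<bar> powr q) \<le> exp (M' * (\<bar>Im z\<bar> + 1) powr q)" using M'0 by simp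
      then have "W t * exp (M' * \<bar>Im u\<bar> powr q) \<le> ?w t" by (intro mult_left_mono) (auto simp: W_def)
      with bd[of t u] show ?thesis by linarith
    qed
    then show "\<exists>r>0. \<exists>w. cball z r \<subseteq> UNIV \<and> integrable M w \<and>
        (\<forall>u\<in>cball z r. \<forall>t\<in>space M. norm (h t * exp (- 2 * pi * \<i> * u * of_real (Y t))) \<le> w t)"
      using Wi by (intro exI[of _ 1] exI[of _ ?w] conjI) auto
  qed
  have gr: "norm (G z) \<le> (LINT t|M. W t) * exp (M' * \<bar>Im z\<bar> powr q)" for z
  proof -
    have W': "integrable M (\<lambda>t. W t * exp (M' * \<bar>Im z\<bar> powr q))" using Wi by simp
    have i: "integrable M (\<lambda>t. h t * exp (- 2 * pi * \<i> * z * of_real (Y t)))"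
      by (rule Bochner_Integration.integrable_bound[OF W' meas]) (intro AE_I2 order_trans[OF bd], simp)
    have "norm (G z) \<le> (LINT t|M. norm (h t * exp (- 2 * pi * \<i> * z * of_real (Y t))))"
      unfolding G_def by (rule integral_norm_bound)
    also have "\<dots> \<le> (LINT t|M. W t * exp (M' * \<bar>Im z\<bar> powr q))"
      by (intro integral_mono integrable_norm i W' bd)
    finally show ?thesis by simp
  qed
  have Gm: "(\<lambda>t. G (of_real t)) \<in> borel_measurable borel"
  proof (rule borel_measurable_continuous_onI)
    show "continuous_on UNIV (\<lambda>t. G (complex_of_real t))"
      by (rule continuous_on_compose2[OF holomorphic_on_imp_continuous_on[OF hol]]) (auto intro: continuous_intros)
  qed
  have gint: "integrable lborel (\<lambda>t. norm (G (of_real t)) * exp (N * \<bar>t\<bar> powr q))"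
    unfolding integrable_iff_bounded
  proof
    show "(\<lambda>t. norm (G (of_real t)) * exp (N * \<bar>t\<bar> powr q)) \<in> borel_measurable lborel"
      using Gm by measurable
    show "(\<integral>\<^sup>+ x. ennreal (norm (norm (G (of_real x)) * exp (N * \<bar>x\<bar> powr q))) \<partial>lborel) < \<infinity>"
      using fint unfolding hatG N_def by simp
  qed
  \<comment> \<open>Since (p - 1) (q - 1) = 1, the angle is p pi / 2 - pi / 2.\<close>
  have sin: "sin (pi / (2 * (q - 1))) = \<bar>cos (p * pi / 2)\<bar>"
  proof -
    have "pi / (2 * (q - 1)) = p * pi / 2 - pi / 2" using p by (simp add: q1(2) field_simps)
    then have "sin (pi / (2 * (q - 1))) = - cos (p * pi / 2)" by (simp add: sin_diff)
    moreover have "sin (pi / (2 * (q - 1))) > 0" using q2 by (intro sin_gt_zero) (auto simp: field_simps)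
    ultimately show ?thesis by linarith
  qed
  \<comment> \<open>The q-th power of the hypothesis on a b, because (q - 1) = q / p.\<close>
  have Nc: "N > M' * sin (pi / (2 * (q - 1))) powr (q - 1)"
  proof -
    let ?c = "\<bar>cos (p * pi / 2)\<bar>"
    have "?c powr (q - 1) = (?c powr (1 / p)) powr q"
      unfolding powr_powr using p by (simp add: q1(2)) (simp add: q1(1))
    also have "\<dots> < (a * b) powr q" using abc q2 by (intro powr_less_mono2) auto
    finally have "(1 / a) powr q * ?c powr (q - 1) < (1 / a) powr q * (a * b) powr q"
      using ab by (intro mult_strict_left_mono) auto
    also have "\<dots> = b powr q" using ab by (simp add: powr_mult[symmetric])
    finally have "2 * pi / q * ((1 / a) powr q * ?c powr (q - 1)) < 2 * pi / q * b powr q"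
      using q2 by (intro mult_strict_left_mono) auto
    then show ?thesis unfolding sin N_def M'_def by (simp add: mult_ac)
  qed
  show ?thesis unfolding hatG by (rule entire_integrable_decay_zero[OF hol q2 M'0 gr gint Nc s])
qed

section \<open>An extremal function for Morgan's theorem\<close>

lemma integrable_gaussian:
  fixes v :: real
  assumes "v > 0"
  shows "integrable lborel (\<lambda>x. exp (- v * x\<^sup>2))"
proof -
  define \<sigma> where "\<sigma> = 1 / sqrt (2 * v)"
  have \<sigma>: "\<sigma> > 0" "2 * \<sigma>\<^sup>2 = 1 / v" using assms by (auto simp: \<sigma>_def power_divide)
  have "integrable lborel (\<lambda>x. sqrt (2 * pi * \<sigma>\<^sup>2) * normal_density 0 \<sigma> x)"
    using \<sigma> integrable_normal_density by auto
  moreover have "sqrt (2 * pi * \<sigma>\<^sup>2) * normal_density 0 \<sigma> x = exp (- v * x\<^sup>2)" for x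
  proof -
    have "x\<^sup>2 / (2 * \<sigma>\<^sup>2) = v * x\<^sup>2" unfolding \<sigma>(2) by simp
    then show ?thesis using \<sigma>(1) by (simp add: normal_density_def)
  qed
  ultimately show ?thesis by simp
qed

lemma gaussian_fourier_real:
  fixes v s :: real
  assumes v: "v > 0"
  shows "(LINT x|lborel. of_real (exp (- v * x\<^sup>2)) * cis (- 2 * pi * s * x))
    = complex_of_real (sqrt (pi / v) * exp (- pi\<^sup>2 * s\<^sup>2 / v))"
proof -
  define c where "c = 1 / sqrt (2 * v)"
  have c: "c > 0" "c\<^sup>2 = 1 / (2 * v)" using v by (auto simp: c_def power_divide)
  define t where "t = - 2 * pi * s * c"
  have "(LINT x|lborel. of_real (exp (- v * x\<^sup>2)) * cis (- 2 * pi * s * x))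
     = c *\<^sub>R (LINT y|lborel. of_real (exp (- v * (c * y)\<^sup>2)) * cis (- 2 * pi * s * (c * y)))"
    using lborel_integral_real_affine[of c "\<lambda>x. of_real (exp (- v * x\<^sup>2)) * cis (- 2 * pi * s * x)" 0] c by simp
  also have "(\<lambda>y. of_real (exp (- v * (c * y)\<^sup>2)) * cis (- 2 * pi * s * (c * y)))
     = (\<lambda>y. of_real (sqrt (2 * pi)) * (std_normal_density y *\<^sub>R iexp (t * y)))"
  proof
    fix y
    have "v * (c * y)\<^sup>2 = y\<^sup>2 / 2" unfolding power_mult_distrib c(2) using v by simp
    then show "of_real (exp (- v * (c * y)\<^sup>2)) * cis (- 2 * pi * s * (c * y))
       = of_real (sqrt (2 * pi)) * (std_normal_density y *\<^sub>R iexp (t * y))"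
      by (simp add: std_normal_density_def t_def cis_conv_exp scaleR_conv_of_real mult_ac exp_of_real)
  qed
  also have "(LINT y|lborel. complex_of_real (sqrt (2 * pi)) * (std_normal_density y *\<^sub>R iexp (t * y)))
     = of_real (sqrt (2 * pi)) * (LINT y|lborel. std_normal_density y *\<^sub>R iexp (t * y))"
    by (rule integral_mult_right_zero)
  also have "(LINT y|lborel. std_normal_density y *\<^sub>R iexp (t * y)) = char std_normal_distribution t"
    unfolding char_def by (subst integral_density) auto
  also have "\<dots> = of_real (exp (- (t\<^sup>2) / 2))" by (simp add: char_std_normal_distribution)
  finally have 1: "(LINT x|lborel. of_real (exp (- v * x\<^sup>2)) * cis (- 2 * pi * s * x))
     = complex_of_real ((c * sqrt (2 * pi)) * exp (- (t\<^sup>2) / 2))"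
    by (simp add: scaleR_conv_of_real mult.assoc)
  have "c * sqrt (2 * pi) = sqrt (pi / v)"
    unfolding c_def by (simp add: real_sqrt_mult real_sqrt_divide)
  moreover have "- (t\<^sup>2) / 2 = - pi\<^sup>2 * s\<^sup>2 / v"
    unfolding t_def power_mult_distrib c(2) using v by (simp add: field_simps)
  ultimately show ?thesis unfolding 1 by simp
qed

lemma integral_gaussian:
  fixes v :: real
  assumes "v > 0"
  shows "(LINT x|lborel. exp (- v * x\<^sup>2)) = sqrt (pi / v)"
proof -
  have "complex_of_real (LINT x|lborel. exp (- v * x\<^sup>2)) = complex_of_real (sqrt (pi / v))"
    using gaussian_fourier_real[OF assms, of 0] unfolding integral_complex_of_real[symmetric] by simp
  then show ?thesis by (simp only: of_real_eq_iff)
qed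

text \<open>Both sides are holomorphic in the half-plane Re v > 0 and agree on the positive axis.
  The principal branch of \<open>v powr (- 1 / 2)\<close> is the right one because it is holomorphic
  there and positive on the axis.\<close>

lemma gaussian_fourier_complex:
  fixes v :: complex and s :: real
  assumes v: "Re v > 0"
  shows "(LINT x|lborel. exp (- v * of_real (x\<^sup>2)) * cis (- 2 * pi * s * x))
    = sqrt pi * v powr (- 1 / 2) * exp (- of_real (pi\<^sup>2 * s\<^sup>2) / v)"
proof -
  let ?S = "{v. Re v > 0}"
  define L where "L v = (LINT x|lborel. exp (- v * of_real (x\<^sup>2)) * cis (- 2 * pi * s * x))" for v
  define R where "R v = sqrt pi * v powr (- 1 / 2) * exp (- of_real (pi\<^sup>2 * s\<^sup>2) / v)" for v :: complex
  have opn: "open ?S" by (rule open_halfspace_Re_gt)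
  have m: "(\<lambda>x. exp (- v * of_real (x\<^sup>2)) * cis (- 2 * pi * s * x)) \<in> borel_measurable lborel" for v
  proof -
    have "continuous_on UNIV (\<lambda>x. exp (- v * of_real (x\<^sup>2)) * cis (- 2 * pi * s * x))"
      by (intro continuous_intros)
    then show ?thesis by (simp add: borel_measurable_continuous_onI)
  qed
  have Lh: "L holomorphic_on ?S" unfolding L_def
  proof (rule holomorphic_on_integral_param[OF m])
    show "(\<lambda>v. exp (- v * of_real (x\<^sup>2)) * cis (- 2 * pi * s * x)) holomorphic_on ?S" for x
      by (intro holomorphic_intros)
    fix v assume "v \<in> ?S"
    then have r: "Re v / 2 > 0" by simp
    have b: "Re u \<ge> Re v / 2" if "u \<in> cball v (Re v / 2)" for u
      using that abs_Re_le_cmod[of "v - u"] by (simp add: dist_norm)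
    have "norm (exp (- u * of_real (x\<^sup>2)) * cis (- 2 * pi * s * x)) \<le> exp (- (Re v / 2) * x\<^sup>2)"
      if "u \<in> cball v (Re v / 2)" for u x
      using mult_right_mono[OF b[OF that], of "x\<^sup>2"] by (simp add: norm_mult)
    then show "\<exists>r>0. \<exists>w. cball v r \<subseteq> ?S \<and> integrable lborel w \<and> (\<forall>u\<in>cball v r. \<forall>x\<in>space lborel.
        norm (exp (- u * of_real (x\<^sup>2)) * cis (- 2 * pi * s * x)) \<le> w x)"
      using r b integrable_gaussian[OF r]
      by (intro exI[of _ "Re v / 2"] conjI exI[of _ "\<lambda>x. exp (- (Re v / 2) * x\<^sup>2)"]) (auto, force)
  qed
  have Rh: "R holomorphic_on ?S" unfolding R_def
    by (intro holomorphic_intros) (auto simp: complex_nonpos_Reals_iff)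
  have "(\<lambda>v. L v - R v) v = 0"
  proof (rule analytic_continuation[where f="\<lambda>v. L v - R v" and S="?S" and U="complex_of_real ` {0<..}" and \<xi>=1])
    show "(\<lambda>v. L v - R v) holomorphic_on ?S" by (intro holomorphic_intros Lh Rh)
    show "connected ?S" by (intro convex_connected convex_halfspace_Re_gt)
    show "1 islimpt complex_of_real ` {0<..}"
      unfolding islimpt_approachable
    proof (intro allI impI)
      fix e :: real assume "e > 0"
      then show "\<exists>x'\<in>complex_of_real ` {0<..}. x' \<noteq> 1 \<and> dist x' 1 < e"
        by (intro bexI[of _ "complex_of_real (1 + e / 2)"] imageI) (auto simp: dist_norm)
    qed
    fix z assume "z \<in> complex_of_real ` {0<..}"
    then obtain x where x: "z = of_real x" "x > 0" by auto
    have "L z = of_real (sqrt (pi / x) * exp (- pi\<^sup>2 * s\<^sup>2 / x))"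
      using gaussian_fourier_real[OF x(2), of s] unfolding L_def x(1) by (simp add: exp_of_real[symmetric])
    moreover have "R z = of_real (sqrt (pi / x) * exp (- pi\<^sup>2 * s\<^sup>2 / x))"
    proof -
      have "complex_of_real x powr (- 1 / 2) = of_real (x powr (- 1 / 2))"
        using powr_of_real[of x "- 1 / 2"] x(2) by simp
      also have "x powr (- 1 / 2) = 1 / sqrt x"
        using x(2) by (simp add: powr_minus_divide powr_half_sqrt)
      finally show ?thesis unfolding R_def x(1) using x(2)
        by (simp add: real_sqrt_divide exp_of_real[symmetric])
    qed
    ultimately show "L z - R z = 0" by simp
  qed (use v opn in auto)
  then show ?thesis by (simp add: L_def R_def)
qed

text \<open>Completing the square; it serves to trade polynomial factors for an arbitrarily small
  part of a Gaussian.\<close>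

lemma one_plus_abs_le_exp_sq:
  fixes u d :: real
  assumes "d > 0"
  shows "1 + \<bar>u\<bar> \<le> exp (1 / (4 * d)) * exp (d * u\<^sup>2)"
proof -
  have "0 \<le> d * (\<bar>u\<bar> - 1 / (2 * d))\<^sup>2" using assms by simp
  also have "\<dots> = d * u\<^sup>2 - \<bar>u\<bar> + 1 / (4 * d)"
    using assms by (simp add: power2_diff field_simps) (simp add: power2_eq_square)
  finally have "\<bar>u\<bar> \<le> 1 / (4 * d) + d * u\<^sup>2" by simp
  then have "1 + \<bar>u\<bar> \<le> 1 + (1 / (4 * d) + d * u\<^sup>2)" by simp
  also have "\<dots> \<le> exp (1 / (4 * d) + d * u\<^sup>2)" by (rule exp_ge_add_one_self)
  finally show ?thesis by (simp add: exp_add)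
qed

lemma integrable_gaussian_linear:
  fixes v :: real
  assumes "v > 0"
  shows "integrable lborel (\<lambda>x. (1 + \<bar>x\<bar>) * exp (- v * x\<^sup>2))"
proof (rule Bochner_Integration.integrable_bound)
  show "integrable lborel (\<lambda>x. exp (1 / (4 * (v/2))) * exp (- (v / 2) * x\<^sup>2))"
    using integrable_gaussian[of "v/2"] assms by simp
  have "(1 + \<bar>x\<bar>) * exp (- v * x\<^sup>2) \<le> exp (1 / (4 * (v/2))) * exp (- (v / 2) * x\<^sup>2)" for x
  proof -
    have "(1 + \<bar>x\<bar>) * exp (- v * x\<^sup>2) \<le> (exp (1 / (4 * (v/2))) * exp ((v/2) * x\<^sup>2)) * exp (- v * x\<^sup>2)"
      using one_plus_abs_le_exp_sq[of "v/2" x] assms by (intro mult_right_mono) auto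
    also have "\<dots> = exp (1 / (4 * (v/2))) * exp (- (v / 2) * x\<^sup>2)"
      by (simp add: mult.assoc exp_add[symmetric] algebra_simps)
    finally show ?thesis .
  qed
  then show "AE x in lborel. norm ((1 + \<bar>x\<bar>) * exp (- v * x\<^sup>2)) \<le> norm (exp (1 / (4 * (v/2))) * exp (- (v / 2) * x\<^sup>2))"
    by (intro AE_I2) (simp add: abs_mult)
qed simp

text \<open>Weighted arithmetic-geometric mean inequality with weights l / (1 + l) and 1 / (1 + l),
  for which the powers of \<open>u\<close> cancel. The right-hand side is the exact minimum over
  \<open>u\<close>, so no decay rate is lost.\<close>

lemma sum_powr_ge:
  fixes u X l :: real
  assumes "u > 0" "X > 0" "l > 0"
  shows "u + X * u powr (- l) \<ge> (1 + l) * l powr (- (l / (1 + l))) * X powr (1 / (1 + l))"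
proof -
  define \<alpha> where "\<alpha> = l / (1 + l)"
  define \<gamma> where "\<gamma> = 1 / (1 + l)"
  have ag: "\<alpha> > 0" "\<gamma> > 0" "\<alpha> + \<gamma> = 1" "l * \<gamma> = \<alpha>"
    using assms by (auto simp: \<alpha>_def \<gamma>_def add_divide_distrib[symmetric])
  have "(u / \<alpha>) powr \<alpha> * (X * u powr (- l) / \<gamma>) powr \<gamma> \<le> \<alpha> * (u / \<alpha>) + \<gamma> * (X * u powr (- l) / \<gamma>)"
    using assms ag by (intro Youngs_inequality_0) auto
  also have "\<dots> = u + X * u powr (- l)" using ag by simp
  finally have 1: "(u / \<alpha>) powr \<alpha> * (X * u powr (- l) / \<gamma>) powr \<gamma> \<le> u + X * u powr (- l)" .
  have "(u / \<alpha>) powr \<alpha> * (X * u powr (- l) / \<gamma>) powr \<gamma> = exp (\<alpha> * (ln u - ln \<alpha>) + \<gamma> * (ln X - l * ln u - ln \<gamma>))"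
    using assms ag by (simp add: powr_def exp_add ln_div ln_mult)
  also have "\<alpha> * (ln u - ln \<alpha>) + \<gamma> * (ln X - l * ln u - ln \<gamma>) = ln (1 + l) + (- \<alpha>) * ln l + \<gamma> * ln X"
  proof -
    have la: "ln \<alpha> = ln l - ln (1 + l)" "ln \<gamma> = - ln (1 + l)"
      using assms by (auto simp: \<alpha>_def \<gamma>_def ln_div)
    have "\<alpha> * (ln u - ln \<alpha>) + \<gamma> * (ln X - l * ln u - ln \<gamma>)
       = (\<alpha> - l * \<gamma>) * ln u + (\<alpha> + \<gamma>) * ln (1 + l) - \<alpha> * ln l + \<gamma> * ln X"
      unfolding la by (simp add: algebra_simps)
    then show ?thesis unfolding ag(3,4) by simp
  qed
  also have "exp \<dots> = (1 + l) * l powr (- \<alpha>) * X powr \<gamma>"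
    using assms by (simp add: exp_add exp_diff exp_minus powr_def divide_inverse)
  finally show ?thesis using 1 by (simp add: \<alpha>_def \<gamma>_def)
qed

text \<open>The functions below are Wright functions written as integrals over the two rays
  through the saddle points, on which the real part of the exponent is
  \<open>- c (t\<^sup>2 + x\<^sup>2 t powr (- 2 l))\<close>. Taking the Fourier transform of the Gaussian
  in \<open>x\<close> turns \<open>ray_kernel\<close> into \<open>dual_kernel\<close> with \<open>k = pi\<^sup>2 s\<^sup>2\<close>.\<close>

locale wright_rays =
  fixes l \<beta> c :: real
  assumes l: "0 < l" "l < 1" and c: "0 < c" and \<beta>: "0 < \<beta>" "\<beta> < pi / 2"
    and cos_2\<beta>: "cos (2 * \<beta>) = - c" and cos_2l\<beta>: "cos (2 * l * \<beta>) = c"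
begin

definition ray_kernel :: "complex \<Rightarrow> real \<Rightarrow> real \<Rightarrow> complex" where
  "ray_kernel X \<theta> t = cis \<theta> * exp (of_real (t\<^sup>2) * cis (2 * \<theta>) - X * of_real (\<bar>t\<bar> powr (- 2 * l)) * cis (- 2 * l * \<theta>))"

text \<open>The kernel depends on \<open>t\<close> only through t^2 and |t|, so this is twice the
  integral of exp (z^2 - X z^(-2l)) dz along the ray z = t cis \<theta>, t > 0. Extending it to all
  real \<open>t\<close> makes Gaussian integrals over the line available.\<close>

definition ray_integral :: "complex \<Rightarrow> real \<Rightarrow> complex" where
  "ray_integral X \<theta> = (LINT t|lborel. ray_kernel X \<theta> t)"

text \<open>Kept as a function of X = x^2 because it is holomorphic in \<open>X\<close> on a sector
  around the positive axis, from which the zeros are controlled.\<close>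

definition wright_sq :: "complex \<Rightarrow> complex" where
  "wright_sq X = (ray_integral X \<beta> - ray_integral X (- \<beta>)) / (2 * \<i>)"

definition wright :: "real \<Rightarrow> complex" where
  "wright x = wright_sq (of_real (x\<^sup>2))"

text \<open>The integrand z^l exp (z^2 - k z^(2l)) dz on the ray z = t cis \<theta>. The factor z^l
  is v^(-1/2) for the coefficient v = z^(-2l) of the Gaussian in \<open>x\<close>, and z^(2l) is 1 /
  v.\<close>

definition dual_kernel :: "real \<Rightarrow> real \<Rightarrow> real \<Rightarrow> complex" where
  "dual_kernel k \<theta> t = cis \<theta> * (of_real (\<bar>t\<bar> powr l) * cis (l * \<theta>)) *
     exp (of_real (t\<^sup>2) * cis (2 * \<theta>) - of_real (k * \<bar>t\<bar> powr (2 * l)) * cis (2 * l * \<theta>))"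

definition dual_integral :: "real \<Rightarrow> real \<Rightarrow> complex" where
  "dual_integral k \<theta> = (LINT t|lborel. dual_kernel k \<theta> t)"

section \<open>Decay and Fourier transform of the ray integrals\<close>

lemma cos_pm: "\<bar>\<theta>\<bar> = \<beta> \<Longrightarrow> cos (2 * \<theta>) = - c" "\<bar>\<theta>\<bar> = \<beta> \<Longrightarrow> cos (2 * l * \<theta>) = c"
  using cos_2\<beta> cos_2l\<beta> by (auto simp: abs_if split: if_splits)

lemma measurable_ray_kernel [measurable]: "ray_kernel X \<theta> \<in> borel_measurable borel"
  unfolding ray_kernel_def by measurable

lemma measurable_dual_kernel [measurable]: "dual_kernel k \<theta> \<in> borel_measurable borel"
  unfolding dual_kernel_def by measurable

lemma norm_ray_kernel:
  "norm (ray_kernel X \<theta> t) = exp (t\<^sup>2 * cos (2 * \<theta>) - Re (X * cis (- 2 * l * \<theta>)) * \<bar>t\<bar> powr (- 2 * l))"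
  unfolding ray_kernel_def by (simp add: norm_mult algebra_simps)

lemma norm_ray_kernel_le:
  assumes "\<bar>\<theta>\<bar> = \<beta>" "Re (X * cis (- 2 * l * \<theta>)) \<ge> 0"
  shows "norm (ray_kernel X \<theta> t) \<le> exp (- c * t\<^sup>2)"
proof -
  have "0 \<le> Re (X * cis (- 2 * l * \<theta>)) * \<bar>t\<bar> powr (- 2 * l)" using assms(2) by (intro mult_nonneg_nonneg) auto
  then show ?thesis unfolding norm_ray_kernel cos_pm(1)[OF assms(1)] by (simp add: mult.commute)
qed

lemma norm_ray_kernel_real:
  assumes "\<bar>\<theta>\<bar> = \<beta>"
  shows "norm (ray_kernel (of_real y) \<theta> t) = exp (- c * (t\<^sup>2 + y * \<bar>t\<bar> powr (- 2 * l)))"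
proof -
  have R: "Re (of_real y * cis (- 2 * l * \<theta>)) = y * c"
    using cos_pm(2)[OF assms] by simp
  show ?thesis unfolding norm_ray_kernel cos_pm(1)[OF assms] R by (simp add: algebra_simps)
qed

lemma integrable_ray_kernel:
  assumes "\<bar>\<theta>\<bar> = \<beta>" "Re (X * cis (- 2 * l * \<theta>)) \<ge> 0"
  shows "integrable lborel (ray_kernel X \<theta>)"
  by (rule Bochner_Integration.integrable_bound[OF integrable_gaussian[OF c]])
     (use norm_ray_kernel_le[OF assms] in auto)

lemma integrable_ray_kernel_real:
  assumes "\<bar>\<theta>\<bar> = \<beta>" "y \<ge> 0"
  shows "integrable lborel (ray_kernel (of_real y) \<theta>)"
  using assms cos_pm(2)[OF assms(1)] c by (intro integrable_ray_kernel) auto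

text \<open>A share 1 - e of the exponent is estimated by its minimum over \<open>t\<close>, which
  gives the decay in \<open>x\<close>; the share e retains the Gaussian exp (- c e t^2), which makes
  the integral converge.\<close>

lemma ray_integral_le:
  assumes \<theta>: "\<bar>\<theta>\<bar> = \<beta>" and e: "0 < e" "e < 1" and x: "x \<noteq> 0"
  shows "norm (ray_integral (of_real (x\<^sup>2)) \<theta>)
    \<le> sqrt (pi / (c * e)) * exp (- ((1 - e) * c * ((1 + l) * l powr (- (l / (1 + l))))) * \<bar>x\<bar> powr (2 / (1 + l)))"
proof -
  define B where "B = (1 + l) * l powr (- (l / (1 + l))) * \<bar>x\<bar> powr (2 / (1 + l))"
  have "norm (ray_kernel (of_real (x\<^sup>2)) \<theta> t) \<le> exp (- (1 - e) * c * B) * exp (- (c * e) * t\<^sup>2)" if "t \<noteq> 0" for t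
  proof -
    have p1: "(t\<^sup>2) powr (- l) = \<bar>t\<bar> powr (- 2 * l)"
      using that powr_powr[of "\<bar>t\<bar>" 2 "- l"] by (simp add: powr_numeral)
    have p2: "(x\<^sup>2) powr (1 / (1 + l)) = \<bar>x\<bar> powr (2 / (1 + l))"
      using x powr_powr[of "\<bar>x\<bar>" 2 "1 / (1 + l)"] by (simp add: powr_numeral)
    have "B \<le> t\<^sup>2 + x\<^sup>2 * \<bar>t\<bar> powr (- 2 * l)"
      using sum_powr_ge[of "t\<^sup>2" "x\<^sup>2" l] that x l unfolding p1 p2 B_def by simp
    moreover have "0 \<le> x\<^sup>2 * \<bar>t\<bar> powr (- 2 * l)" by simp
    ultimately have "(1 - e) * B + e * t\<^sup>2 \<le> (1 - e) * (t\<^sup>2 + x\<^sup>2 * \<bar>t\<bar> powr (- 2 * l)) + e * (t\<^sup>2 + x\<^sup>2 * \<bar>t\<bar> powr (- 2 * l))"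
      using e by (intro add_mono mult_left_mono) auto
    also have "\<dots> = t\<^sup>2 + x\<^sup>2 * \<bar>t\<bar> powr (- 2 * l)" by (simp add: algebra_simps)
    finally have "c * ((1 - e) * B + e * t\<^sup>2) \<le> c * (t\<^sup>2 + x\<^sup>2 * \<bar>t\<bar> powr (- 2 * l))"
      using c by (intro mult_left_mono) auto
    then show ?thesis unfolding norm_ray_kernel_real[OF \<theta>] by (simp add: exp_add[symmetric] algebra_simps)
  qed
  note le = this
  have ae: "AE t in lborel. norm (ray_kernel (of_real (x\<^sup>2)) \<theta> t) \<le> exp (- (1 - e) * c * B) * exp (- (c * e) * t\<^sup>2)"
    using AE_lborel_singleton[of 0] by eventually_elim (rule le)
  have ce: "c * e > 0" using c e by simp
  have int: "integrable lborel (ray_kernel (of_real (x\<^sup>2)) \<theta>)" by (rule integrable_ray_kernel_real[OF \<theta>]) simp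
  have "norm (ray_integral (of_real (x\<^sup>2)) \<theta>) \<le> (LINT t|lborel. norm (ray_kernel (of_real (x\<^sup>2)) \<theta> t))"
    unfolding ray_integral_def by (rule integral_norm_bound)
  also have "\<dots> \<le> (LINT t|lborel. exp (- (1 - e) * c * B) * exp (- (c * e) * t\<^sup>2))"
    by (intro integral_mono_AE integrable_norm int integrable_mult_right integrable_gaussian ce ae)
  also have "\<dots> = exp (- (1 - e) * c * B) * sqrt (pi / (c * e))"
    by (simp only: integral_mult_right_zero integral_gaussian[OF ce])
  finally have F: "norm (ray_integral (of_real (x\<^sup>2)) \<theta>) \<le> sqrt (pi / (c * e)) * exp (- (1 - e) * c * B)"
    by (simp only: mult.commute)
  have "- (1 - e) * c * B = - ((1 - e) * c * ((1 + l) * l powr (- (l / (1 + l))))) * \<bar>x\<bar> powr (2 / (1 + l))"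
    unfolding B_def by (simp add: algebra_simps)
  then show ?thesis using F by (simp only:)
qed

lemma wright_le:
  assumes e: "0 < e" "e < 1" and x: "x \<noteq> 0"
  shows "norm (wright x)
    \<le> sqrt (pi / (c * e)) * exp (- ((1 - e) * c * ((1 + l) * l powr (- (l / (1 + l))))) * \<bar>x\<bar> powr (2 / (1 + l)))"
proof -
  have "norm (wright x) \<le> (norm (ray_integral (of_real (x\<^sup>2)) \<beta>) + norm (ray_integral (of_real (x\<^sup>2)) (- \<beta>))) / 2"
    unfolding wright_def wright_sq_def by (simp add: norm_divide norm_mult norm_triangle_ineq4)
  moreover have "\<bar>\<beta>\<bar> = \<beta>" "\<bar>- \<beta>\<bar> = \<beta>" using \<beta> by auto
  moreover have "a \<le> K" if "a \<le> (b1 + b2) / 2" "b1 \<le> K" "b2 \<le> K" for a b1 b2 K :: real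
    using that by simp
  ultimately show ?thesis using ray_integral_le[OF _ e x] by blast
qed

text \<open>Fubini: for fixed \<open>t\<close> the dependence on \<open>x\<close> is a Gaussian exp
  (- v x^2) with Re v = c |t|^(-2l) > 0. Its L1 norm is a multiple of |t|^l, which the factor exp (-
  c t^2) makes integrable in \<open>t\<close>.\<close>

lemma fourier_ray_integral:
  assumes \<theta>: "\<bar>\<theta>\<bar> = \<beta>"
  shows "integrable lborel (\<lambda>x. ray_integral (of_real (x\<^sup>2)) \<theta> * cis (- 2 * pi * s * x))" (is ?i)
    and "(LINT x|lborel. ray_integral (of_real (x\<^sup>2)) \<theta> * cis (- 2 * pi * s * x))
      = sqrt pi * dual_integral (pi\<^sup>2 * s\<^sup>2) \<theta>" (is ?e)
proof -
  define f where "f t x = ray_kernel (of_real (x\<^sup>2)) \<theta> t * cis (- 2 * pi * s * x)" for t x :: real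
  have fm: "(\<lambda>(t, x). f t x) \<in> borel_measurable (lborel \<Otimes>\<^sub>M lborel)"
    unfolding f_def ray_kernel_def cis_conv_exp by measurable
  have nf: "norm (f t x) = exp (- c * t\<^sup>2) * exp (- (c * \<bar>t\<bar> powr (- 2 * l)) * x\<^sup>2)" for t x
    unfolding f_def norm_mult norm_ray_kernel_real[OF \<theta>] by (simp add: exp_add[symmetric] algebra_simps)
  have pos: "c * \<bar>t\<bar> powr (- 2 * l) > 0" if "t \<noteq> 0" for t using that c by simp
  have tx: "t \<noteq> 0 \<Longrightarrow> integrable lborel (f t)" for t
  proof -
    assume t: "t \<noteq> 0"
    have "integrable lborel (\<lambda>x. exp (- c * t\<^sup>2) * exp (- (c * \<bar>t\<bar> powr (- 2 * l)) * x\<^sup>2))"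
      by (intro integrable_mult_right integrable_gaussian pos t)
    then have "integrable lborel (\<lambda>x. norm (f t x))" by (simp only: nf)
    moreover have "f t \<in> borel_measurable lborel"
      unfolding f_def ray_kernel_def cis_conv_exp by measurable
    ultimately show ?thesis by (rule integrable_norm_cancel)
  qed
  have int: "integrable (lborel \<Otimes>\<^sub>M lborel) (\<lambda>(t, x). f t x)"
  proof (rule lborel_pair.Fubini_integrable[OF fm])
    show "AE t in lborel. integrable lborel (\<lambda>x. case (t, x) of (t, x) \<Rightarrow> f t x)"
      using AE_lborel_singleton[of 0] by eventually_elim (use tx in simp)
    have *: "(LINT x|lborel. norm (f t x)) = exp (- c * t\<^sup>2) * sqrt (pi / (c * \<bar>t\<bar> powr (- 2 * l)))" if "t \<noteq> 0" for t
      unfolding nf integral_mult_right_zero integral_gaussian[OF pos[OF that]] ..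
    have **: "exp (- c * t\<^sup>2) * sqrt (pi / (c * \<bar>t\<bar> powr (- 2 * l))) \<le> sqrt (pi / c) * ((1 + \<bar>t\<bar>) * exp (- c * t\<^sup>2))"
      if "t \<noteq> 0" for t
    proof -
      have "1 / \<bar>t\<bar> powr (- 2 * l) = \<bar>t\<bar> powr (2 * l)" by (simp add: powr_minus_divide)
      then have "sqrt (pi / (c * \<bar>t\<bar> powr (- 2 * l))) = sqrt (pi / c * \<bar>t\<bar> powr (2 * l))"
        by (metis (no_types, lifting) divide_divide_eq_left times_divide_eq_right mult.right_neutral)
      also have "\<dots> = sqrt (pi / c) * \<bar>t\<bar> powr l"
      proof -
        have "sqrt (\<bar>t\<bar> powr (2 * l)) = \<bar>t\<bar> powr l"
          by (simp add: powr_half_sqrt[symmetric] powr_powr)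
        then show ?thesis by (simp only: real_sqrt_mult)
      qed
      also have "\<bar>t\<bar> powr l \<le> 1 + \<bar>t\<bar>"
      proof (cases "\<bar>t\<bar> \<le> 1")
        case True
        then have "\<bar>t\<bar> powr l \<le> 1" using l by (intro powr_le1) auto
        then show ?thesis by simp
      next
        case False
        then have "\<bar>t\<bar> powr l \<le> \<bar>t\<bar> powr 1" using l by (intro powr_mono) auto
        then show ?thesis by simp
      qed
      finally show ?thesis using c by (simp add: mult_left_mono mult_right_mono mult_ac)
    qed
    show "integrable lborel (\<lambda>t. LINT x|lborel. norm (case (t, x) of (t, x) \<Rightarrow> f t x))"
    proof (rule Bochner_Integration.integrable_bound)
      show "integrable lborel (\<lambda>t. sqrt (pi / c) * ((1 + \<bar>t\<bar>) * exp (- c * t\<^sup>2)))"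
        by (intro integrable_mult_right integrable_gaussian_linear c)
      show "(\<lambda>t. LINT x|lborel. norm (case (t, x) of (t, x) \<Rightarrow> f t x)) \<in> borel_measurable lborel"
        using fm by measurable
      show "AE t in lborel. norm (LINT x|lborel. norm (case (t, x) of (t, x) \<Rightarrow> f t x))
          \<le> norm (sqrt (pi / c) * ((1 + \<bar>t\<bar>) * exp (- c * t\<^sup>2)))"
        using AE_lborel_singleton[of 0] by eventually_elim (use * ** c in \<open>simp add: abs_mult\<close>)
    qed
  qed
  have sw: "(LINT t|lborel. f t x) = ray_integral (of_real (x\<^sup>2)) \<theta> * cis (- 2 * pi * s * x)" for x
    unfolding f_def ray_integral_def by (rule integral_mult_left_zero)
  show ?i using lborel_pair.integrable_snd[OF int] unfolding sw .
  have "(LINT x|lborel. ray_integral (of_real (x\<^sup>2)) \<theta> * cis (- 2 * pi * s * x)) = (LINT t|lborel. LINT x|lborel. f t x)"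
    using lborel_pair.Fubini_integral[OF int] unfolding sw .
  also have "\<dots> = (LINT t|lborel. sqrt pi * dual_kernel (pi\<^sup>2 * s\<^sup>2) \<theta> t)"
  proof (rule integral_cong_AE)
    show "(\<lambda>t. LINT x|lborel. f t x) \<in> borel_measurable lborel" using fm by measurable
    show "(\<lambda>t. complex_of_real (sqrt pi) * dual_kernel (pi\<^sup>2 * s\<^sup>2) \<theta> t) \<in> borel_measurable lborel" by measurable
    have "(LINT x|lborel. f t x) = sqrt pi * dual_kernel (pi\<^sup>2 * s\<^sup>2) \<theta> t" if t: "t \<noteq> 0" for t
    proof -
      define r where "r = \<bar>t\<bar> powr (- 2 * l)"
      have r: "r > 0" using t by (simp add: r_def)
      define \<phi> where "\<phi> = - 2 * l * \<theta>"
      define v where "v = of_real r * cis \<phi>"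
      have cphi: "cos \<phi> = c" using cos_pm(2)[OF \<theta>] by (simp add: \<phi>_def)
      have Rev: "Re v > 0" using cphi c r by (simp add: v_def)
      \<comment> \<open>Since 2 l \<beta> < pi, the principal logarithm of \<open>v\<close> has
        imaginary part \<phi>, so \<open>powr\<close> yields t^l cis (l \<theta>) and not its
        negative.\<close>
      have phi: "- pi < \<phi>" "\<phi> \<le> pi"
      proof -
        have "\<bar>\<phi>\<bar> = (2 * l) * \<beta>" using \<theta> l by (simp add: \<phi>_def abs_mult)
        also have "\<dots> < 2 * (pi / 2)" using l \<beta> by (intro mult_strict_mono) auto
        finally show "- pi < \<phi>" "\<phi> \<le> pi" by auto
      qed
      have lnv: "Ln v = of_real (ln r) + \<i> * of_real \<phi>"
      proof (rule Ln_unique)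
        show "exp (of_real (ln r) + \<i> * of_real \<phi>) = v"
          using r by (simp add: v_def exp_add cis_conv_exp exp_of_real)
      qed (use phi in auto)
      have vp: "v powr (- 1 / 2) = of_real (\<bar>t\<bar> powr l) * cis (l * \<theta>)"
      proof -
        have "v \<noteq> 0" using Rev by auto
        then have "v powr (- 1 / 2) = exp (- 1 / 2 * (of_real (ln r) + \<i> * of_real \<phi>))"
          by (simp add: powr_def lnv)
        also have "- 1 / 2 * (of_real (ln r) + \<i> * of_real \<phi>) = of_real (l * ln \<bar>t\<bar>) + \<i> * of_real (l * \<theta>)"
          using t by (simp add: r_def \<phi>_def ln_powr algebra_simps)
        finally show ?thesis using t by (simp add: exp_add cis_conv_exp powr_def exp_of_real[symmetric])
      qed
      have vi: "1 / v = of_real (\<bar>t\<bar> powr (2 * l)) * cis (2 * l * \<theta>)"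
        by (simp add: v_def r_def \<phi>_def powr_minus_divide cis_divide[symmetric] field_simps flip: cis_inverse)
      have "f t x = cis \<theta> * exp (of_real (t\<^sup>2) * cis (2 * \<theta>)) * (exp (- v * of_real (x\<^sup>2)) * cis (- 2 * pi * s * x))" for x
        unfolding f_def ray_kernel_def v_def r_def \<phi>_def by (simp add: exp_diff exp_minus field_simps)
      then have "(LINT x|lborel. f t x) = cis \<theta> * exp (of_real (t\<^sup>2) * cis (2 * \<theta>)) *
          (LINT x|lborel. exp (- v * of_real (x\<^sup>2)) * cis (- 2 * pi * s * x))"
        by (simp only: integral_mult_right_zero)
      also have "\<dots> = cis \<theta> * exp (of_real (t\<^sup>2) * cis (2 * \<theta>)) *
          (sqrt pi * (of_real (\<bar>t\<bar> powr l) * cis (l * \<theta>)) * exp (- of_real (pi\<^sup>2 * s\<^sup>2) * (1 / v)))"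
        unfolding gaussian_fourier_complex[OF Rev] vp by simp
      also have "\<dots> = sqrt pi * dual_kernel (pi\<^sup>2 * s\<^sup>2) \<theta> t"
        unfolding vi dual_kernel_def by (simp add: exp_diff exp_minus field_simps)
      finally show ?thesis .
    qed
    note eq = this
    show "AE t in lborel. (LINT x|lborel. f t x) = sqrt pi * dual_kernel (pi\<^sup>2 * s\<^sup>2) \<theta> t"
      using AE_lborel_singleton[of 0] by eventually_elim (rule eq)
  qed
  also have "\<dots> = sqrt pi * dual_integral (pi\<^sup>2 * s\<^sup>2) \<theta>"
    unfolding dual_integral_def by (rule integral_mult_right_zero)
  finally show ?e .
qed

lemma fourier_wright:
  "integrable lborel (\<lambda>x. wright x * cis (- 2 * pi * s * x))"
  "(LINT x|lborel. wright x * cis (- 2 * pi * s * x))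
     = sqrt pi * (dual_integral (pi\<^sup>2 * s\<^sup>2) \<beta> - dual_integral (pi\<^sup>2 * s\<^sup>2) (- \<beta>)) / (2 * \<i>)"
proof -
  have b: "\<bar>\<beta>\<bar> = \<beta>" "\<bar>- \<beta>\<bar> = \<beta>" using \<beta> by auto
  note i = fourier_ray_integral[OF b(1), of s] fourier_ray_integral[OF b(2), of s]
  have w: "wright x * cis (- 2 * pi * s * x) =
      (ray_integral (of_real (x\<^sup>2)) \<beta> * cis (- 2 * pi * s * x) - ray_integral (of_real (x\<^sup>2)) (- \<beta>) * cis (- 2 * pi * s * x)) / (2 * \<i>)" for x
    unfolding wright_def wright_sq_def by (simp add: field_simps)
  show "integrable lborel (\<lambda>x. wright x * cis (- 2 * pi * s * x))"
    unfolding w using i(1,3) by simp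
  show "(LINT x|lborel. wright x * cis (- 2 * pi * s * x))
     = sqrt pi * (dual_integral (pi\<^sup>2 * s\<^sup>2) \<beta> - dual_integral (pi\<^sup>2 * s\<^sup>2) (- \<beta>)) / (2 * \<i>)"
    unfolding w using i by (simp add: field_simps)
qed

text \<open>At X = 0 the two ray integrals are complex Gaussian integrals, with values i sqrt pi and
  - i sqrt pi; the value at 0 is therefore sqrt pi.\<close>

lemma wright_0_nz: "wright 0 \<noteq> 0"
proof -
  have ri: "ray_integral 0 \<theta> = cis \<theta> * (sqrt pi * (- cis (2 * \<theta>)) powr (- 1 / 2))" if "\<bar>\<theta>\<bar> = \<beta>" for \<theta>
  proof -
    have "Re (- cis (2 * \<theta>)) > 0" using cos_pm(1)[OF that] c by simp
    from gaussian_fourier_complex[OF this, of 0] show ?thesis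
      unfolding ray_integral_def ray_kernel_def by (simp add: mult.commute)
  qed
  have b: "pi / 4 \<le> \<beta>"
  proof (rule ccontr)
    assume "\<not> pi / 4 \<le> \<beta>"
    then have "cos (2 * \<beta>) > 0" using \<beta> by (intro cos_gt_zero) auto
    then show False using cos_2\<beta> c by simp
  qed
  have 1: "(- cis (2 * \<beta>)) powr (- 1 / 2) = cis (pi / 2 - \<beta>)"
  proof -
    have "- cis (2 * \<beta>) = cis (2 * \<beta> - pi)" by (simp add: cis_conv_exp[symmetric] complex_eq_iff cos_diff sin_diff)
    also have "Ln \<dots> = \<i> * of_real (2 * \<beta> - pi)"
      by (rule Ln_unique) (use \<beta> in \<open>auto simp: cis_conv_exp\<close>)
    finally have L: "Ln (- cis (2 * \<beta>)) = \<i> * of_real (2 * \<beta> - pi)" .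
    have "- cis (2 * \<beta>) \<noteq> 0" by simp
    then show ?thesis unfolding powr_def L by (simp add: cis_conv_exp algebra_simps)
  qed
  have 2: "(- cis (2 * - \<beta>)) powr (- 1 / 2) = cis (\<beta> - pi / 2)"
  proof -
    have "- cis (2 * - \<beta>) = cis (pi - 2 * \<beta>)" by (simp add: complex_eq_iff cos_diff sin_diff)
    also have "Ln \<dots> = \<i> * of_real (pi - 2 * \<beta>)"
      by (rule Ln_unique) (use \<beta> in \<open>auto simp: cis_conv_exp\<close>)
    finally have L: "Ln (- cis (2 * - \<beta>)) = \<i> * of_real (pi - 2 * \<beta>)" .
    have "- cis (2 * - \<beta>) \<noteq> 0" by simp
    then show ?thesis unfolding powr_def L by (simp add: cis_conv_exp algebra_simps)
  qed
  have "wright 0 = (cis \<beta> * (sqrt pi * cis (pi / 2 - \<beta>)) - cis (- \<beta>) * (sqrt pi * cis (\<beta> - pi / 2))) / (2 * \<i>)"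
    unfolding wright_def wright_sq_def using ri[of \<beta>] ri[of "- \<beta>"] \<beta> unfolding 1 2 by simp
  also have "cis \<beta> * (sqrt pi * cis (pi / 2 - \<beta>)) = sqrt pi * \<i>"
    by (simp add: mult.left_commute cis_mult)
  also have "cis (- \<beta>) * (sqrt pi * cis (\<beta> - pi / 2)) = - (sqrt pi * \<i>)"
  proof -
    have 3: "cis (- \<beta>) * cis (\<beta> - pi / 2) = - \<i>" by (simp add: cis_mult complex_eq_iff)
    have "cis (- \<beta>) * (sqrt pi * cis (\<beta> - pi / 2)) = sqrt pi * (cis (- \<beta>) * cis (\<beta> - pi / 2))"
      by (rule mult.left_commute)
    then show ?thesis unfolding 3 by simp
  qed
  finally show ?thesis by simp
qed

text \<open>The point X = 0 is the vertex of the sector in which holomorphy is shown, so the value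
  there has to be reached by dominated convergence.\<close>

lemma wright_tendsto_0: "(\<lambda>n. wright (inverse (real (Suc n)))) \<longlonglongrightarrow> wright 0"
proof -
  have "(\<lambda>n. ray_integral (of_real ((inverse (real (Suc n)))\<^sup>2)) \<theta>) \<longlonglongrightarrow> ray_integral (of_real (0\<^sup>2)) \<theta>"
    if \<theta>: "\<bar>\<theta>\<bar> = \<beta>" for \<theta>
    unfolding ray_integral_def
  proof (rule integral_dominated_convergence[where w="\<lambda>t. exp (- c * t\<^sup>2)"])
    show "integrable lborel (\<lambda>t. exp (- c * t\<^sup>2))" by (rule integrable_gaussian[OF c])
    have "(\<lambda>n. ray_kernel (of_real ((inverse (real (Suc n)))\<^sup>2)) \<theta> t) \<longlonglongrightarrow> ray_kernel (of_real (0\<^sup>2)) \<theta> t" for t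
      unfolding ray_kernel_def by (intro tendsto_intros LIMSEQ_inverse_real_of_nat)
    then show "AE t in lborel. (\<lambda>n. ray_kernel (of_real ((inverse (real (Suc n)))\<^sup>2)) \<theta> t) \<longlonglongrightarrow> ray_kernel (of_real (0\<^sup>2)) \<theta> t"
      by simp
    have "norm (ray_kernel (of_real ((inverse (real (Suc n)))\<^sup>2)) \<theta> t) \<le> exp (- c * t\<^sup>2)" for n t
      by (rule norm_ray_kernel_le[OF \<theta>]) (use cos_pm(2)[OF \<theta>] c in simp)
    then show "AE t in lborel. norm (ray_kernel (of_real ((inverse (real (Suc n)))\<^sup>2)) \<theta> t) \<le> exp (- c * t\<^sup>2)" for n
      by simp
  qed measurable
  from this[of \<beta>] this[of "- \<beta>"] show ?thesis
    unfolding wright_def wright_sq_def using \<beta> by (intro tendsto_intros) auto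
qed

end

text \<open>Taylor expansion at u = 0: the first derivative is imaginary, and the second has modulus
  at most 2 l |2 l - 1| because |1 + i u| \<ge> 1 and the remaining exponent 2 l - 2 is negative.
  The coefficient matters: after division by \<open>l\<close> it is |2 l - 1| < 1, less than what
  z^2 contributes on a vertical line.\<close>

lemma Re_one_plus_imaginary_powr_ge:
  fixes l u :: real
  assumes l: "0 < l" "l < 1"
  shows "Re ((1 + \<i> * of_real u) powr of_real (2 * l)) \<ge> 1 - l * \<bar>2 * l - 1\<bar> * u\<^sup>2"
proof -
  let ?z = "\<lambda>t. 1 + \<i> * of_real t :: complex"
  define d where "d m t = (if m = 0 then Re (?z t powr of_real (2 * l))
     else if m = 1 then Re (\<i> * (of_real (2 * l) * ?z t powr (of_real (2 * l) - 1)))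
     else Re (\<i> * (of_real (2 * l) * (\<i> * ((of_real (2 * l) - 1) * ?z t powr (of_real (2 * l) - 1 - 1)))))) "
    for m :: nat and t
  have nz: "?z t \<notin> \<real>\<^sub>\<le>\<^sub>0" for t by (simp add: complex_nonpos_Reals_iff)
  have D: "((\<lambda>t. ?z t powr s) has_vector_derivative \<i> * (s * ?z t powr (s - 1))) (at t)" for s t
  proof -
    have "((\<lambda>z. (1 + \<i> * z) powr s) has_field_derivative \<i> * (s * ?z t powr (s - 1))) (at (of_real t))"
      by (rule derivative_eq_intros refl nz | simp add: nz)+
    then show ?thesis by (rule has_vector_derivative_real_field)
  qed
  have 0: "(d 0 has_real_derivative d 1 t) (at t)" for t
    unfolding d_def has_real_derivative_iff_has_vector_derivative
    using bounded_linear.has_vector_derivative[OF bounded_linear_Re D[of "of_real (2 * l)" t]] by simp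
  have 1: "(d 1 has_real_derivative d 2 t) (at t)" for t
    unfolding d_def has_real_derivative_iff_has_vector_derivative
    using bounded_linear.has_vector_derivative[OF bounded_linear_Re has_vector_derivative_mult_right[OF D[of "of_real (2 * l) - 1" t], of "\<i> * of_real (2 * l)"]]
    by (simp add: mult.assoc)
  have "\<forall>m t. m < 2 \<and> \<bar>t\<bar> \<le> \<bar>u\<bar> \<longrightarrow> (d m has_real_derivative d (Suc m) t) (at t)"
  proof (intro allI impI)
    fix m :: nat and t assume "m < 2 \<and> \<bar>t\<bar> \<le> \<bar>u\<bar>"
    then have "m = 0 \<or> m = 1" by auto
    then show "(d m has_real_derivative d (Suc m) t) (at t)"
      using 0[of t] 1[of t] by (elim disjE) (simp_all add: numeral_2_eq_2)
  qed
  then obtain t where t: "d 0 u = (\<Sum>m<2. d m 0 / fact m * u ^ m) + d 2 t / fact 2 * u ^ 2"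
    using Maclaurin_bi_le[of d "d 0" 2 u] by blast
  have d2: "d 2 t \<ge> - (2 * l * \<bar>2 * l - 1\<bar>)"
  proof -
    have n1: "norm (?z t) \<ge> 1" using complex_Re_le_cmod[of "?z t"] by simp
    let ?T = "\<i> * (of_real (2 * l) * (\<i> * ((of_real (2 * l) - 1) * ?z t powr (of_real (2 * l) - 1 - 1))))"
    have "d 2 t = Re ?T" by (simp add: d_def)
    then have "\<bar>d 2 t\<bar> \<le> norm ?T" by (simp only: abs_Re_le_cmod)
    also have "norm ?T = norm (complex_of_real (2 * l)) * (norm (complex_of_real (2 * l) - 1) * norm (?z t powr (of_real (2 * l) - 1 - 1)))"
      by (simp only: norm_mult norm_ii mult_1_left)
    also have "norm (complex_of_real (2 * l) - 1) = \<bar>2 * l - 1\<bar>"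
      by (metis norm_of_real of_real_1 of_real_diff)
    also have "norm (complex_of_real (2 * l)) * (\<bar>2 * l - 1\<bar> * norm (?z t powr (of_real (2 * l) - 1 - 1)))
       = 2 * l * \<bar>2 * l - 1\<bar> * norm (?z t powr of_real (2 * l - 2))"
      using l by simp
    finally have 2: "\<bar>d 2 t\<bar> \<le> 2 * l * \<bar>2 * l - 1\<bar> * norm (?z t powr of_real (2 * l - 2))" .
    have "norm (?z t powr of_real (2 * l - 2)) = norm (?z t) powr (2 * l - 2)"
      by (subst norm_powr_real_powr') auto
    also have "\<dots> \<le> norm (?z t) powr 0" using n1 l by (intro powr_mono) auto
    also have "\<dots> \<le> 1" by simp
    finally have "2 * l * \<bar>2 * l - 1\<bar> * norm (?z t powr of_real (2 * l - 2)) \<le> 2 * l * \<bar>2 * l - 1\<bar> * 1"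
      using l by (intro mult_left_mono) auto
    with 2 have "\<bar>d 2 t\<bar> \<le> 2 * l * \<bar>2 * l - 1\<bar>" by linarith
    then show ?thesis by linarith
  qed
  have d0: "d 0 0 = 1" "d 1 0 = 0" by (simp_all add: d_def)
  have "d 0 u = 1 + d 2 t / 2 * u\<^sup>2" unfolding t using d0 by (simp add: numeral_2_eq_2)
  moreover have "- (2 * l * \<bar>2 * l - 1\<bar>) / 2 * u\<^sup>2 \<le> d 2 t / 2 * u\<^sup>2"
    using d2 by (intro mult_right_mono) auto
  ultimately show ?thesis by (simp add: d_def)
qed

section \<open>The dual integrals: moving the rays to a vertical line\<close>

context wright_rays
begin

text \<open>The holomorphic integrand behind \<open>dual_kernel\<close>, with the cut of
  \<open>powr\<close> along the negative axis; in the right half-plane its integrals do not depend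
  on the path.\<close>

definition dual_fun :: "real \<Rightarrow> complex \<Rightarrow> complex" where
  "dual_fun k z = exp (z\<^sup>2 - of_real k * z powr of_real (2 * l)) * z powr of_real l"

lemma powr_polar:
  assumes "t > 0" "- pi < \<theta>" "\<theta> \<le> pi"
  shows "(of_real t * cis \<theta>) powr of_real a = of_real (t powr a) * cis (a * \<theta>)"
proof -
  have "Ln (of_real t * cis \<theta>) = of_real (ln t) + \<i> * of_real \<theta>"
    by (rule Ln_unique) (use assms in \<open>auto simp: exp_add cis_conv_exp exp_of_real\<close>)
  then have "(of_real t * cis \<theta>) powr of_real a = exp (of_real a * (of_real (ln t) + \<i> * of_real \<theta>))"
    using assms(1) by (simp add: powr_def)
  also have "of_real a * (of_real (ln t) + \<i> * of_real \<theta>) = of_real (a * ln t) + \<i> * of_real (a * \<theta>)"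
    by (simp add: algebra_simps)
  finally show ?thesis using assms(1) by (simp add: exp_add cis_conv_exp powr_def exp_of_real[symmetric])
qed

lemma dual_kernel_eq:
  assumes "t > 0" "\<bar>\<theta>\<bar> = \<beta>"
  shows "dual_kernel k \<theta> t = dual_fun k (of_real t * cis \<theta>) * cis \<theta>"
proof -
  have th: "- pi < \<theta>" "\<theta> \<le> pi" using assms \<beta> by auto
  have "(of_real t * cis \<theta>)\<^sup>2 = of_real (t\<^sup>2) * cis (2 * \<theta>)"
    by (simp add: power_mult_distrib power2_eq_square[of "cis \<theta>"] cis_mult)
  then show ?thesis
    using assms(1) unfolding dual_kernel_def dual_fun_def powr_polar[OF assms(1) th] by (simp add: mult_ac)
qed

lemma dual_kernel_minus: "dual_kernel k \<theta> (- t) = dual_kernel k \<theta> t"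
  by (simp add: dual_kernel_def)

lemma norm_dual_kernel_le:
  assumes "\<bar>\<theta>\<bar> = \<beta>" "k \<ge> 0"
  shows "norm (dual_kernel k \<theta> t) \<le> (1 + \<bar>t\<bar>) * exp (- c * t\<^sup>2)"
proof -
  have "\<bar>t\<bar> powr l \<le> 1 + \<bar>t\<bar>"
  proof (cases "\<bar>t\<bar> \<le> 1")
    case True
    then have "\<bar>t\<bar> powr l \<le> 1" using l by (intro powr_le1) auto
    then show ?thesis by simp
  next
    case False
    then have "\<bar>t\<bar> powr l \<le> \<bar>t\<bar> powr 1" using l by (intro powr_mono) auto
    then show ?thesis by simp
  qed
  moreover have "norm (dual_kernel k \<theta> t) = \<bar>t\<bar> powr l * exp (- c * t\<^sup>2 - k * \<bar>t\<bar> powr (2 * l) * c)"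
    unfolding dual_kernel_def using cos_pm[OF assms(1)] by (simp add: norm_mult mult.commute)
  moreover have "exp (- c * t\<^sup>2 - k * \<bar>t\<bar> powr (2 * l) * c) \<le> exp (- c * t\<^sup>2)"
    using assms(2) c by simp
  ultimately show ?thesis by (simp add: mult_mono)
qed

lemma integrable_dual_kernel:
  assumes "\<bar>\<theta>\<bar> = \<beta>" "k \<ge> 0"
  shows "integrable lborel (dual_kernel k \<theta>)"
proof (rule Bochner_Integration.integrable_bound[OF integrable_gaussian_linear[OF c]])
  show "AE t in lborel. norm (dual_kernel k \<theta> t) \<le> norm ((1 + \<bar>t\<bar>) * exp (- c * t\<^sup>2))"
    using norm_dual_kernel_le[OF assms] by (auto simp: abs_mult)
qed measurable

lemma norm_dual_integral_le:
  assumes "\<bar>\<theta>\<bar> = \<beta>" "k \<ge> 0"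
  shows "norm (dual_integral k \<theta>) \<le> (LINT t|lborel. (1 + \<bar>t\<bar>) * exp (- c * t\<^sup>2))"
proof -
  have "norm (dual_integral k \<theta>) \<le> (LINT t|lborel. norm (dual_kernel k \<theta> t))"
    unfolding dual_integral_def by (rule integral_norm_bound)
  also have "\<dots> \<le> (LINT t|lborel. (1 + \<bar>t\<bar>) * exp (- c * t\<^sup>2))"
    by (intro integral_mono integrable_norm integrable_dual_kernel integrable_gaussian_linear c norm_dual_kernel_le assms)
  finally show ?thesis .
qed

text \<open>The factor 2 undoes the even extension to negative \<open>t\<close>. The truncation at 1
  / (n + 1) stays away from 0, where \<open>dual_fun\<close> need not be holomorphic.\<close>

lemma truncated_dual_integral_tendsto:
  assumes \<theta>: "\<bar>\<theta>\<bar> = \<beta>" and k: "k \<ge> 0"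
  shows "(\<lambda>n. 2 * integral {1 / real (Suc n)..real (Suc n)} (dual_kernel k \<theta>)) \<longlonglongrightarrow> dual_integral k \<theta>"
proof -
  let ?A = "\<lambda>n. {1 / real (Suc n)..real (Suc n)}"
  let ?f = "dual_kernel k \<theta>"
  have sint: "set_integrable lborel (?A n) ?f" for n
    unfolding set_integrable_def by (intro integrable_mult_indicator integrable_dual_kernel[OF \<theta> k]) auto
  have "(LINT t|lborel. (indicator (?A n) t + indicator (?A n) (- t)) *\<^sub>R ?f t) = 2 * integral (?A n) ?f" for n
  proof -
    have i1: "integrable lborel (\<lambda>t. indicat_real (?A n) t *\<^sub>R ?f t)" using sint by (simp add: set_integrable_def)
    have i2: "integrable lborel (\<lambda>t. indicat_real (?A n) (- t) *\<^sub>R ?f t)"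
      using lborel_integrable_real_affine[OF i1, of "-1" 0] by (simp add: dual_kernel_minus)
    have "(LINT t|lborel. indicat_real (?A n) t *\<^sub>R ?f t) = (LINT t|lborel. indicat_real (?A n) (- t) *\<^sub>R ?f t)"
      using lborel_integral_real_affine[of "-1" "\<lambda>t. indicat_real (?A n) t *\<^sub>R ?f t" 0] by (simp add: dual_kernel_minus)
    then have "(LINT t|lborel. (indicator (?A n) t + indicator (?A n) (- t)) *\<^sub>R ?f t)
       = 2 * (LINT t|lborel. indicat_real (?A n) t *\<^sub>R ?f t)"
      unfolding scaleR_add_left using i1 i2 by (subst Bochner_Integration.integral_add) auto
    also have "(LINT t|lborel. indicat_real (?A n) t *\<^sub>R ?f t) = integral (?A n) ?f"
      using set_borel_integral_eq_integral(2)[OF sint] by (simp add: set_lebesgue_integral_def)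
    finally show ?thesis .
  qed
  moreover have "(\<lambda>n. LINT t|lborel. (indicator (?A n) t + indicator (?A n) (- t)) *\<^sub>R ?f t) \<longlonglongrightarrow> (LINT t|lborel. ?f t)"
  proof (rule integral_dominated_convergence[where w="\<lambda>t. norm (?f t)"])
    show "integrable lborel (\<lambda>t. norm (?f t))" by (intro integrable_norm integrable_dual_kernel \<theta> k)
    have ev: "eventually (\<lambda>n. indicator (?A n) t + indicator (?A n) (- t) = (1 :: real)) sequentially" if "t \<noteq> 0" for t
    proof -
      have "eventually (\<lambda>n. inverse (real (Suc n)) < \<bar>t\<bar>) sequentially"
        using that by (intro order_tendstoD(2)[OF LIMSEQ_inverse_real_of_nat]) simp
      moreover have "eventually (\<lambda>n. \<bar>t\<bar> \<le> real (Suc n)) sequentially"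
        using eventually_ge_at_top[of "nat \<lceil>\<bar>t\<bar>\<rceil>"] by eventually_elim linarith
      ultimately show ?thesis
      proof eventually_elim
        case (elim n)
        have pos: "inverse (real (Suc n)) > 0" by simp
        show ?case
        proof (cases "t > 0")
          case True
          then have "\<not> inverse (real (Suc n)) \<le> - t" using pos by linarith
          then show ?thesis using elim True by (simp add: indicator_def inverse_eq_divide del: of_nat_Suc)
        next
          case False
          then have "\<not> inverse (real (Suc n)) \<le> t" using pos by linarith
          then show ?thesis using elim False by (simp add: indicator_def inverse_eq_divide del: of_nat_Suc)
        qed
      qed
    qed
    have lim: "(\<lambda>n. (indicator (?A n) t + indicator (?A n) (- t)) *\<^sub>R ?f t) \<longlonglongrightarrow> ?f t" if "t \<noteq> 0" for t
      by (rule tendsto_eventually, use ev[OF that] in eventually_elim) simp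
    show "AE t in lborel. (\<lambda>n. (indicator (?A n) t + indicator (?A n) (- t)) *\<^sub>R ?f t) \<longlonglongrightarrow> ?f t"
      using AE_lborel_singleton[of 0] by eventually_elim (rule lim)
    have le1: "\<bar>indicator (?A n) t + indicator (?A n) (- t) :: real\<bar> \<le> 1" for n t
    proof -
      have pos: "1 / real (Suc n) > 0" by simp
      show ?thesis
      proof (cases "t > 0")
        case True
        then have "\<not> 1 / real (Suc n) \<le> - t" using pos by linarith
        then show ?thesis by (simp add: indicator_def del: of_nat_Suc)
      next
        case False
        then have "\<not> 1 / real (Suc n) \<le> t" using pos by linarith
        then show ?thesis by (simp add: indicator_def del: of_nat_Suc)
      qed
    qed
    show "AE t in lborel. norm ((indicator (?A n) t + indicator (?A n) (- t)) *\<^sub>R ?f t) \<le> norm (?f t)" for n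
      using mult_right_mono[OF le1 norm_ge_zero] by (intro AE_I2) simp
  qed measurable
  ultimately show ?thesis by (simp add: dual_integral_def)
qed

lemma norm_dual_fun_le:
  assumes "k \<ge> 0"
  shows "norm (dual_fun k z) \<le> norm z powr l * exp (Re (z\<^sup>2) + k * norm z powr (2 * l))"
proof -
  have "- Re (z powr of_real (2 * l)) \<le> norm z powr (2 * l)"
    using abs_Re_le_cmod[of "z powr of_real (2 * l)"] norm_powr_real_powr'[of "of_real (2 * l)" z] by simp
  from mult_left_mono[OF this assms] have "exp (Re (z\<^sup>2) - k * Re (z powr of_real (2 * l))) \<le> exp (Re (z\<^sup>2) + k * norm z powr (2 * l))"
    by simp
  moreover have "norm (dual_fun k z) = exp (Re (z\<^sup>2) - k * Re (z powr of_real (2 * l))) * norm z powr l"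
    unfolding dual_fun_def norm_mult norm_exp_eq_Re by (subst norm_powr_real_powr') auto
  ultimately show ?thesis by (simp add: mult.commute mult_left_mono)
qed

text \<open>The relation between \<open>k\<close> and \<sigma> says that \<sigma> is the positive
  critical point of z^2 - k z^(2l); the value there is \<sigma>^2 - \<sigma>^2 / l. Along z =
  \<sigma> (1 + i u) the exponent falls by at least (1 - |2 l - 1|) \<sigma>^2 u^2, and \<sigma>
  \<ge> 1 permits dropping \<sigma>^2.\<close>

lemma norm_dual_fun_vertical:
  assumes \<sigma>: "\<sigma> \<ge> 1" and k: "k = \<sigma> powr (2 - 2 * l) / l"
  shows "norm (dual_fun k (of_real \<sigma> * (1 + \<i> * of_real u)))
     \<le> \<sigma> * exp (- (1 / l - 1) * \<sigma>\<^sup>2) * ((1 + \<bar>u\<bar>) * exp (- (1 - \<bar>2 * l - 1\<bar>) * u\<^sup>2))"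
proof -
  let ?w = "1 + \<i> * of_real u :: complex"
  let ?z = "of_real \<sigma> * ?w"
  define \<eta> where "\<eta> = 1 - \<bar>2 * l - 1\<bar>"
  have \<eta>: "\<eta> > 0" using l by (auto simp: \<eta>_def)
  have s0: "\<sigma> > 0" using \<sigma> by simp
  have "?z powr of_real (2 * l) = of_real (\<sigma> powr (2 * l)) * ?w powr of_real (2 * l)"
    using s0 powr_times_real_left[of "of_real \<sigma>" ?w "of_real (2 * l)"] powr_of_real[of \<sigma> "2 * l"] by simp
  then have r1: "Re (of_real k * ?z powr of_real (2 * l)) = (k * \<sigma> powr (2 * l)) * Re (?w powr of_real (2 * l))" by simp
  have ks: "k * \<sigma> powr (2 * l) = \<sigma>\<^sup>2 / l"
  proof -
    have "\<sigma> powr (2 - 2 * l) * \<sigma> powr (2 * l) = \<sigma>\<^sup>2" using s0 by (simp add: powr_add[symmetric] powr_numeral)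
    then show ?thesis unfolding k by simp
  qed
  have r2: "Re (?z\<^sup>2) = \<sigma>\<^sup>2 * (1 - u\<^sup>2)" by (simp add: power_mult_distrib power2_eq_square algebra_simps)
  have "\<sigma>\<^sup>2 / l * (1 - l * \<bar>2 * l - 1\<bar> * u\<^sup>2) \<le> \<sigma>\<^sup>2 / l * Re (?w powr of_real (2 * l))"
    using l by (intro mult_left_mono Re_one_plus_imaginary_powr_ge) auto
  then have "Re (?z\<^sup>2) - Re (of_real k * ?z powr of_real (2 * l)) \<le> \<sigma>\<^sup>2 * (1 - u\<^sup>2) - \<sigma>\<^sup>2 / l * (1 - l * \<bar>2 * l - 1\<bar> * u\<^sup>2)"
    unfolding r1 r2 ks by linarith
  also have "\<dots> = - (1 / l - 1) * \<sigma>\<^sup>2 - \<eta> * (\<sigma>\<^sup>2 * u\<^sup>2)"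
    using l by (simp add: \<eta>_def field_simps)
  also have "\<dots> \<le> - (1 / l - 1) * \<sigma>\<^sup>2 - \<eta> * u\<^sup>2"
  proof -
    have "1 * u\<^sup>2 \<le> \<sigma>\<^sup>2 * u\<^sup>2" using \<sigma> by (intro mult_right_mono) (auto simp: one_le_power)
    then show ?thesis using \<eta> by simp
  qed
  finally have 1: "exp (Re (?z\<^sup>2) - Re (of_real k * ?z powr of_real (2 * l))) \<le> exp (- (1 / l - 1) * \<sigma>\<^sup>2) * exp (- \<eta> * u\<^sup>2)"
    by (simp add: exp_add[symmetric])
  have 2: "norm (?z powr of_real l) \<le> \<sigma> * (1 + \<bar>u\<bar>)"
  proof -
    have "norm (?z powr of_real l) = norm ?z powr l" by (subst norm_powr_real_powr') auto
    also have "\<dots> \<le> (\<sigma> * (1 + \<bar>u\<bar>)) powr l"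
    proof (rule powr_mono2)
      have "norm ?w \<le> 1 + \<bar>u\<bar>" using norm_triangle_ineq[of 1 "\<i> * of_real u :: complex"] by (simp add: norm_mult)
      then show "norm ?z \<le> \<sigma> * (1 + \<bar>u\<bar>)" using s0 by (simp add: norm_mult)
    qed (use l in auto)
    also have "\<dots> \<le> (\<sigma> * (1 + \<bar>u\<bar>)) powr 1"
    proof (rule powr_mono)
      show "1 \<le> \<sigma> * (1 + \<bar>u\<bar>)" using mult_mono[of 1 \<sigma> 1 "1 + \<bar>u\<bar>"] \<sigma> by simp
    qed (use l in auto)
    also have "\<dots> = \<sigma> * (1 + \<bar>u\<bar>)" using s0 by simp
    finally show ?thesis .
  qed
  have "norm (dual_fun k ?z) \<le> exp (- (1 / l - 1) * \<sigma>\<^sup>2) * exp (- \<eta> * u\<^sup>2) * (\<sigma> * (1 + \<bar>u\<bar>))"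
    unfolding dual_fun_def norm_mult norm_exp_eq_Re minus_complex.sel using 1 2 by (intro mult_mono) auto
  then show ?thesis by (simp add: \<eta>_def mult_ac)
qed

end

context wright_rays
begin

text \<open>Since 2 l < 2, the term k N^(2l) is eventually below half of c N^2. This disposes of the
  distant horizontal sides of the contour.\<close>

lemma gaussian_times_power_tendsto_0:
  assumes "k \<ge> 0"
  shows "(\<lambda>n. real (Suc n) * (real (Suc n) powr l * exp (- c * (real (Suc n))\<^sup>2 + k * real (Suc n) powr (2 * l)))) \<longlonglongrightarrow> 0"
proof -
  let ?N = "\<lambda>n. real (Suc n)"
  have N: "filterlim ?N at_top sequentially"
    using filterlim_Suc filterlim_real_sequentially filterlim_compose by blast
  have "((\<lambda>x. x powr (2 * l - 2)) \<longlongrightarrow> 0) at_top"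
    using l by (intro tendsto_neg_powr filterlim_ident) auto
  from filterlim_compose[OF this N] have "(\<lambda>n. k * ?N n powr (2 * l - 2)) \<longlonglongrightarrow> k * 0"
    by (intro tendsto_intros)
  then have "eventually (\<lambda>n. k * ?N n powr (2 * l - 2) < c / 2) sequentially"
    using c by (intro order_tendstoD(2)) auto
  then have ev: "eventually (\<lambda>n. ?N n * (?N n powr l * exp (- c * (?N n)\<^sup>2 + k * ?N n powr (2 * l))) \<le> (?N n)\<^sup>2 * exp (- (c / 2) * (?N n)\<^sup>2)) sequentially"
  proof eventually_elim
    case (elim n)
    have p: "?N n powr (2 * l) = ?N n powr (2 * l - 2) * (?N n)\<^sup>2"
      by (simp add: powr_diff powr_numeral del: of_nat_Suc)
    have "k * ?N n powr (2 * l) \<le> c / 2 * (?N n)\<^sup>2"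
      unfolding p using elim by (simp add: mult.assoc[symmetric] mult_right_mono del: of_nat_Suc)
    then have "exp (- c * (?N n)\<^sup>2 + k * ?N n powr (2 * l)) \<le> exp (- (c / 2) * (?N n)\<^sup>2)" by (simp del: of_nat_Suc)
    moreover have "?N n powr l \<le> ?N n powr 1" using l by (intro powr_mono) auto
    ultimately have "?N n powr l * exp (- c * (?N n)\<^sup>2 + k * ?N n powr (2 * l)) \<le> ?N n * exp (- (c / 2) * (?N n)\<^sup>2)"
      by (intro mult_mono) (auto simp del: of_nat_Suc)
    from mult_left_mono[OF this, of "?N n"] show ?case by (simp add: power2_eq_square mult.assoc del: of_nat_Suc)
  qed
  have "((\<lambda>x::real. x\<^sup>2 * exp (- (c / 2) * x\<^sup>2)) \<longlongrightarrow> 0) at_top"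
    using c by real_asymp
  from filterlim_compose[OF this N] have "(\<lambda>n. (?N n)\<^sup>2 * exp (- (c / 2) * (?N n)\<^sup>2)) \<longlonglongrightarrow> 0" .
  then show ?thesis
    by (rule tendsto_sandwich[OF _ ev tendsto_const, rotated]) (auto simp del: of_nat_Suc)
qed

text \<open>The half-plane is convex, so the integrand has a primitive \<Phi> and every side of the
  contour becomes a difference of values of \<Phi>. The contour runs along the truncated rays, which
  are joined by a short chord near 0 and, at the far ends, by horizontal segments to the line Re z =
  \<sigma>. Chord and segments vanish in the limit.\<close>

lemma dual_integral_diff_le_vertical:
  assumes k: "k \<ge> 0" and \<sigma>: "\<sigma> > 0" and vint: "integrable lborel (\<lambda>y. dual_fun k (Complex \<sigma> y))"
  shows "norm (dual_integral k \<beta> - dual_integral k (- \<beta>)) \<le> 2 * (LINT y|lborel. norm (dual_fun k (Complex \<sigma> y)))"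
proof -
  let ?S = "{z. Re z > 0}"
  let ?F = "dual_fun k"
  have opn: "open ?S" by (rule open_halfspace_Re_gt)
  have hol: "?F holomorphic_on ?S" unfolding dual_fun_def
    by (intro holomorphic_intros) (auto simp: complex_nonpos_Reals_iff)
  obtain \<Phi> where \<Phi>': "\<And>z. z \<in> ?S \<Longrightarrow> (\<Phi> has_field_derivative ?F z) (at z within ?S)"
  proof (rule holomorphic_convex_primitive'[OF convex_halfspace_Re_gt[of 0] opn hol])
    fix g assume "\<And>x. x \<in> ?S \<Longrightarrow> (g has_field_derivative ?F x) (at x within ?S)"
    then show thesis by (rule that)
  qed
  have \<Phi>: "(\<Phi> has_field_derivative ?F z) (at z)" if "Re z > 0" for z
  proof -
    have z: "z \<in> ?S" using that by simp
    show ?thesis using \<Phi>'[OF z] unfolding at_within_open[OF z opn] .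
  qed
  have cb: "cos \<beta> > 0" "sin \<beta> > 0"
    using cos_gt_zero[of \<beta>] sin_gt_zero[of \<beta>] \<beta> pi_gt_zero by simp_all
  have ray: "integral {a..b} (dual_kernel k \<theta>) = \<Phi> (of_real b * cis \<theta>) - \<Phi> (of_real a * cis \<theta>)"
    if "0 < a" "a \<le> b" "\<bar>\<theta>\<bar> = \<beta>" for a b \<theta>
  proof (rule integral_unique, rule fundamental_theorem_of_calculus)
    fix t assume t: "t \<in> {a..b}"
    then have t0: "t > 0" using that by auto
    have ct: "cos \<theta> > 0" using that(3) cb by (auto simp: abs_if split: if_splits)
    then have re: "Re (of_real t * cis \<theta>) > 0" using t0 by simp
    have "((\<lambda>z. \<Phi> (z * cis \<theta>)) has_field_derivative ?F (of_real t * cis \<theta>) * cis \<theta>) (at (of_real t))"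
      by (rule DERIV_chain2[where f=\<Phi> and g="\<lambda>z. z * cis \<theta>" and x="of_real t", OF \<Phi>[OF re]])
         (auto intro!: derivative_eq_intros)
    then show "((\<lambda>t. \<Phi> (of_real t * cis \<theta>)) has_vector_derivative dual_kernel k \<theta> t) (at t within {a..b})"
      unfolding dual_kernel_eq[OF t0 that(3)] by (rule has_vector_derivative_real_field)
  qed (use that in auto)
  have vert: "norm (\<Phi> (Complex \<sigma> Y) - \<Phi> (Complex \<sigma> (- Y))) \<le> (LINT y|lborel. norm (?F (Complex \<sigma> y)))" if "Y > 0" for Y
  proof -
    have "((\<lambda>y. ?F (Complex \<sigma> y) * \<i>) has_integral \<Phi> (Complex \<sigma> Y) - \<Phi> (Complex \<sigma> (- Y))) {-Y..Y}"
    proof (rule fundamental_theorem_of_calculus)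
      fix y assume "y \<in> {-Y..Y}"
      have ce: "Complex \<sigma> y = of_real \<sigma> + \<i> * of_real y" for y by (simp add: complex_eq_iff)
      have re: "Re (of_real \<sigma> + \<i> * of_real y) > 0" using \<sigma> by simp
      have "((\<lambda>z. \<Phi> (of_real \<sigma> + \<i> * z)) has_field_derivative ?F (of_real \<sigma> + \<i> * of_real y) * \<i>) (at (of_real y))"
        by (rule DERIV_chain2[where f=\<Phi> and g="\<lambda>z. of_real \<sigma> + \<i> * z" and x="of_real y", OF \<Phi>[OF re]])
           (auto intro!: derivative_eq_intros)
      then show "((\<lambda>y. \<Phi> (Complex \<sigma> y)) has_vector_derivative ?F (Complex \<sigma> y) * \<i>) (at y within {-Y..Y})"
        unfolding ce by (rule has_vector_derivative_real_field)
    qed (use that in auto)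
    then have "\<Phi> (Complex \<sigma> Y) - \<Phi> (Complex \<sigma> (- Y)) = integral {-Y..Y} (\<lambda>y. ?F (Complex \<sigma> y) * \<i>)"
      by (rule integral_unique[symmetric])
    also have "\<dots> = (LINT y:{-Y..Y}|lborel. ?F (Complex \<sigma> y) * \<i>)"
    proof (rule set_borel_integral_eq_integral(2)[symmetric])
      show "set_integrable lborel {-Y..Y} (\<lambda>y. ?F (Complex \<sigma> y) * \<i>)"
        unfolding set_integrable_def by (intro integrable_mult_indicator integrable_mult_left vint) auto
    qed
    finally have "norm (\<Phi> (Complex \<sigma> Y) - \<Phi> (Complex \<sigma> (- Y))) \<le> (LINT y|lborel. norm (indicat_real {-Y..Y} y *\<^sub>R (?F (Complex \<sigma> y) * \<i>)))"
      unfolding set_lebesgue_integral_def by (simp only: integral_norm_bound)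
    also have "\<dots> \<le> (LINT y|lborel. norm (?F (Complex \<sigma> y)))"
    proof (rule integral_mono)
      show "integrable lborel (\<lambda>y. norm (indicat_real {-Y..Y} y *\<^sub>R (?F (Complex \<sigma> y) * \<i>)))"
        by (intro integrable_norm integrable_mult_indicator integrable_mult_left vint) auto
    qed (use vint in \<open>auto simp: indicator_def norm_mult\<close>)
    finally show ?thesis .
  qed
  let ?N = "\<lambda>n. real (Suc n)"
  define h where "h n = ?N n * (?N n powr l * exp (- c * (?N n)\<^sup>2 + k * ?N n powr (2 * l)))" for n
  \<comment> \<open>On the segment Im z is fixed and 0 < Re z \<le> N cos \<beta>, so Re (z^2) is
    largest at the end on the ray, where it is N^2 cos (2 \<beta>) = - c N^2.\<close>
  have horiz: "norm (\<Phi> (of_real (?N n) * cis \<theta>) - \<Phi> (Complex \<sigma> (?N n * sin \<theta>))) \<le> h n"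
    if \<theta>: "\<bar>\<theta>\<bar> = \<beta>" and n: "\<sigma> \<le> ?N n * cos \<beta>" for n \<theta>
  proof -
    let ?H = "{z. Im z = ?N n * sin \<theta> \<and> \<sigma> \<le> Re z \<and> Re z \<le> ?N n * cos \<beta>}"
    have ct: "cos \<theta> = cos \<beta>" using \<theta> by (auto simp: abs_if split: if_splits)
    have H: "?H = {z. Im z \<le> ?N n * sin \<theta>} \<inter> ({z. Im z \<ge> ?N n * sin \<theta>} \<inter> ({z. Re z \<ge> \<sigma>} \<inter> {z. Re z \<le> ?N n * cos \<beta>}))"
      by (rule set_eqI) (simp only: mem_Collect_eq Int_iff, linarith)
    have cv: "convex ?H"
      unfolding H by (intro convex_Int convex_halfspace_Re_ge convex_halfspace_Re_le convex_halfspace_Im_ge convex_halfspace_Im_le)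
    have "norm (\<Phi> (of_real (?N n) * cis \<theta>) - \<Phi> (Complex \<sigma> (?N n * sin \<theta>)))
      \<le> (?N n powr l * exp (- c * (?N n)\<^sup>2 + k * ?N n powr (2 * l))) * norm (of_real (?N n) * cis \<theta> - Complex \<sigma> (?N n * sin \<theta>))"
    proof (rule field_differentiable_bound[OF cv])
      fix z assume z: "z \<in> ?H"
      then have "Re z > 0" using \<sigma> by simp
      then show "(\<Phi> has_field_derivative ?F z) (at z within ?H)" using \<Phi> has_field_derivative_at_within by blast
      have "(Re z)\<^sup>2 \<le> (?N n * cos \<beta>)\<^sup>2" using z \<sigma> by (intro power_mono) auto
      moreover have "(Im z)\<^sup>2 = (?N n * sin \<theta>)\<^sup>2" using z by simp
      moreover have "(?N n * cos \<beta>)\<^sup>2 - (?N n * sin \<theta>)\<^sup>2 = - c * (?N n)\<^sup>2"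
      proof -
        have "(cos \<beta>)\<^sup>2 - (sin \<theta>)\<^sup>2 = - c"
          using cos_pm(1)[OF \<theta>] cos_double[of \<theta>] ct by simp
        moreover have "(?N n * cos \<beta>)\<^sup>2 - (?N n * sin \<theta>)\<^sup>2 = ((cos \<beta>)\<^sup>2 - (sin \<theta>)\<^sup>2) * (?N n)\<^sup>2"
          unfolding power_mult_distrib left_diff_distrib by (simp only: mult.commute)
        ultimately show ?thesis by simp
      qed
      ultimately have re: "(Re z)\<^sup>2 - (Im z)\<^sup>2 \<le> - c * (?N n)\<^sup>2" by linarith
      have nz: "norm z \<le> ?N n"
      proof -
        have "(norm z)\<^sup>2 = (Re z)\<^sup>2 + (Im z)\<^sup>2" by (simp add: cmod_power2)
        also have "\<dots> \<le> (?N n * cos \<beta>)\<^sup>2 + (?N n * sin \<theta>)\<^sup>2"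
          using \<open>(Re z)\<^sup>2 \<le> _\<close> \<open>(Im z)\<^sup>2 = _\<close> by linarith
        also have "\<dots> = (?N n)\<^sup>2 * ((cos \<theta>)\<^sup>2 + (sin \<theta>)\<^sup>2)" unfolding ct by (simp only: power_mult_distrib distrib_left)
        also have "\<dots> = (?N n)\<^sup>2" by simp
        finally show ?thesis by (rule power2_le_imp_le) simp
      qed
      have "norm (?F z) \<le> norm z powr l * exp (Re (z\<^sup>2) + k * norm z powr (2 * l))" by (rule norm_dual_fun_le[OF k])
      also have "\<dots> \<le> ?N n powr l * exp (- c * (?N n)\<^sup>2 + k * ?N n powr (2 * l))"
      proof (rule mult_mono)
        show "norm z powr l \<le> ?N n powr l" using nz l by (intro powr_mono2) auto
        have "norm z powr (2 * l) \<le> ?N n powr (2 * l)" using nz l by (intro powr_mono2) auto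
        from mult_left_mono[OF this k] show "exp (Re (z\<^sup>2) + k * norm z powr (2 * l)) \<le> exp (- c * (?N n)\<^sup>2 + k * ?N n powr (2 * l))"
          using re by (simp add: Re_power2 del: of_nat_Suc)
      qed auto
      finally show "norm (?F z) \<le> ?N n powr l * exp (- c * (?N n)\<^sup>2 + k * ?N n powr (2 * l))" .
    qed (use n ct in auto)
    also have "\<dots> \<le> (?N n powr l * exp (- c * (?N n)\<^sup>2 + k * ?N n powr (2 * l))) * ?N n"
    proof (rule mult_left_mono)
      have "of_real (?N n) * cis \<theta> - Complex \<sigma> (?N n * sin \<theta>) = of_real (?N n * cos \<beta> - \<sigma>)"
        using ct by (simp add: complex_eq_iff)
      moreover have "\<bar>?N n * cos \<beta> - \<sigma>\<bar> \<le> ?N n * 1"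
      proof -
        have "?N n * cos \<beta> \<le> ?N n * 1" by (intro mult_left_mono) auto
        then show ?thesis using n \<sigma> by linarith
      qed
      ultimately show "norm (of_real (?N n) * cis \<theta> - Complex \<sigma> (?N n * sin \<theta>)) \<le> ?N n"
        by (metis mult.right_neutral norm_of_real)
    qed simp
    finally show ?thesis by (simp only: h_def mult.commute)
  qed
  \<comment> \<open>The chord lies in the part of the unit disc inside the half-plane, where the
    integrand is at most exp (1 + k), and its length tends to 0.\<close>
  have near: "norm (\<Phi> (of_real (1 / ?N n) * cis \<beta>) - \<Phi> (of_real (1 / ?N n) * cis (- \<beta>))) \<le> exp (1 + k) * (2 * (1 / ?N n))" for n
  proof -
    let ?B = "cball 0 1 \<inter> ?S"
    have "norm (\<Phi> (of_real (1 / ?N n) * cis \<beta>) - \<Phi> (of_real (1 / ?N n) * cis (- \<beta>)))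
       \<le> exp (1 + k) * norm (of_real (1 / ?N n) * cis \<beta> - of_real (1 / ?N n) * cis (- \<beta>))"
    proof (rule field_differentiable_bound[of ?B])
      show "convex ?B" by (intro convex_Int convex_cball convex_halfspace_Re_gt)
      fix z assume z: "z \<in> ?B"
      then show "(\<Phi> has_field_derivative ?F z) (at z within ?B)" using \<Phi> has_field_derivative_at_within by blast
      have n1: "norm z \<le> 1" using z by simp
      have "norm (?F z) \<le> norm z powr l * exp (Re (z\<^sup>2) + k * norm z powr (2 * l))" by (rule norm_dual_fun_le[OF k])
      also have "\<dots> \<le> 1 * exp (1 + k * 1)"
      proof (rule mult_mono)
        show "norm z powr l \<le> 1" using n1 l by (intro powr_le1) auto
        have "norm z powr (2 * l) \<le> 1" using n1 l by (intro powr_le1) auto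
        then have "k * norm z powr (2 * l) \<le> k * 1" using k by (rule mult_left_mono)
        moreover have "Re (z\<^sup>2) \<le> 1"
          using complex_Re_le_cmod[of "z\<^sup>2"] n1 by (simp add: norm_power) (meson norm_ge_zero order_trans power_le_one)
        ultimately show "exp (Re (z\<^sup>2) + k * norm z powr (2 * l)) \<le> exp (1 + k * 1)" by simp
      qed auto
      finally show "norm (?F z) \<le> exp (1 + k)" by simp
    next
      show "of_real (1 / ?N n) * cis \<beta> \<in> ?B" "of_real (1 / ?N n) * cis (- \<beta>) \<in> ?B"
        using cb by (simp_all add: norm_mult norm_divide divide_le_eq del: of_nat_Suc)
    qed
    also have "\<dots> \<le> exp (1 + k) * (2 * (1 / ?N n))"
    proof (rule mult_left_mono)
      have "norm (of_real (1 / ?N n) * cis \<beta> - of_real (1 / ?N n) * cis (- \<beta>)) \<le> norm (of_real (1 / ?N n) * cis \<beta>) + norm (of_real (1 / ?N n) * cis (- \<beta>))"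
        by (rule norm_triangle_ineq4)
      also have "\<dots> = 2 * (1 / ?N n)" by (simp add: norm_mult norm_divide del: of_nat_Suc)
      finally show "norm (of_real (1 / ?N n) * cis \<beta> - of_real (1 / ?N n) * cis (- \<beta>)) \<le> 2 * (1 / ?N n)" .
    qed simp
    finally show ?thesis .
  qed
  define V where "V = (LINT y|lborel. norm (?F (Complex \<sigma> y)))"
  define e where "e n = exp (1 + k) * (2 * (1 / ?N n))" for n
  define D where "D n = 2 * integral {1 / ?N n..?N n} (dual_kernel k \<beta>) - 2 * integral {1 / ?N n..?N n} (dual_kernel k (- \<beta>))" for n
  have b: "\<bar>\<beta>\<bar> = \<beta>" "\<bar>- \<beta>\<bar> = \<beta>" using \<beta> by auto
  have D: "D \<longlonglongrightarrow> dual_integral k \<beta> - dual_integral k (- \<beta>)"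
    unfolding D_def by (intro tendsto_diff truncated_dual_integral_tendsto b k)
  have Db: "norm (D n) \<le> 2 * (V + 2 * h n + e n)" if n: "\<sigma> \<le> ?N n * cos \<beta>" for n
  proof -
    have "1 / ?N n \<le> 1" "1 \<le> ?N n" by auto
    then have ab: "0 < 1 / ?N n" "1 / ?N n \<le> ?N n" by (simp, linarith)
    define p1 where "p1 = \<Phi> (of_real (?N n) * cis \<beta>)"
    define p2 where "p2 = \<Phi> (of_real (?N n) * cis (- \<beta>))"
    define p3 where "p3 = \<Phi> (of_real (1 / ?N n) * cis \<beta>)"
    define p4 where "p4 = \<Phi> (of_real (1 / ?N n) * cis (- \<beta>))"
    define v1 where "v1 = \<Phi> (Complex \<sigma> (?N n * sin \<beta>))"
    define v2 where "v2 = \<Phi> (Complex \<sigma> (- (?N n * sin \<beta>)))"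
    \<comment> \<open>Telescoping along the contour: the values of \<Phi> at the corners
      \<open>v1\<close> and \<open>v2\<close> on the vertical line are inserted and removed.\<close>
    have "D n = 2 * ((p1 - v1) + (v1 - v2) - (p2 - v2) - (p3 - p4))"
      unfolding D_def ray[OF ab b(1)] ray[OF ab b(2)] p1_def p2_def p3_def p4_def by (simp add: algebra_simps)
    then have "norm (D n) = 2 * norm ((p1 - v1) + (v1 - v2) - (p2 - v2) - (p3 - p4))" by (simp only: norm_mult) simp
    also have "norm ((p1 - v1) + (v1 - v2) - (p2 - v2) - (p3 - p4)) \<le> norm (p1 - v1) + norm (v1 - v2) + norm (p2 - v2) + norm (p3 - p4)"
      by (meson add_mono norm_triangle_ineq norm_triangle_ineq4 order_refl order_trans)
    also have "\<dots> \<le> h n + V + h n + e n"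
    proof (intro add_mono)
      show "norm (p1 - v1) \<le> h n" unfolding p1_def v1_def by (rule horiz[OF b(1) n])
      show "norm (p2 - v2) \<le> h n" unfolding p2_def v2_def using horiz[OF b(2) n] by simp
      show "norm (p3 - p4) \<le> e n" unfolding p3_def p4_def e_def by (rule near)
      show "norm (v1 - v2) \<le> V" unfolding v1_def v2_def V_def by (rule vert) (use cb in simp)
    qed
    finally show ?thesis by simp
  qed
  have "h \<longlonglongrightarrow> 0" unfolding h_def by (rule gaussian_times_power_tendsto_0[OF k])
  moreover have "e \<longlonglongrightarrow> exp (1 + k) * (2 * 0)"
    unfolding e_def using LIMSEQ_inverse_real_of_nat by (intro tendsto_intros) (simp add: inverse_eq_divide)
  ultimately have "(\<lambda>n. 2 * (V + 2 * h n + e n)) \<longlonglongrightarrow> 2 * (V + 2 * 0 + exp (1 + k) * (2 * 0))"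
    by (intro tendsto_intros)
  moreover have "eventually (\<lambda>n. norm (D n) \<le> 2 * (V + 2 * h n + e n)) sequentially"
    using eventually_ge_at_top[of "nat \<lceil>\<sigma> / cos \<beta>\<rceil>"]
  proof eventually_elim
    case (elim n)
    then have "\<sigma> / cos \<beta> \<le> ?N n" by linarith
    then have "\<sigma> \<le> ?N n * cos \<beta>" using cb by (simp add: divide_le_eq del: of_nat_Suc)
    then show ?case by (rule Db)
  qed
  ultimately have "norm (dual_integral k \<beta> - dual_integral k (- \<beta>)) \<le> 2 * (V + 2 * 0 + exp (1 + k) * (2 * 0))"
    by (intro tendsto_le[OF sequentially_bot _ tendsto_norm[OF D]])
  then show ?thesis by (simp add: V_def)
qed

end

section \<open>Critical rate of the transform and zeros of the Wright function\<close>

context wright_rays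
begin

text \<open>Substituting y = \<sigma> u on the vertical line gives one factor \<sigma> from the
  Jacobian and one from the bound for z^l; what is left is a convergent integral in \<open>u\<close>
  independent of \<sigma>.\<close>

lemma dual_integral_diff_le:
  "\<exists>C. \<forall>\<sigma>\<ge>1. norm (dual_integral (\<sigma> powr (2 - 2 * l) / l) \<beta> - dual_integral (\<sigma> powr (2 - 2 * l) / l) (- \<beta>))
     \<le> C * (\<sigma>\<^sup>2 * exp (- (1 / l - 1) * \<sigma>\<^sup>2))"
proof (intro exI allI impI)
  fix \<sigma> :: real assume \<sigma>: "\<sigma> \<ge> 1"
  define k where "k = \<sigma> powr (2 - 2 * l) / l"
  define \<eta> where "\<eta> = 1 - \<bar>2 * l - 1\<bar>"
  have \<eta>: "\<eta> > 0" using l by (auto simp: \<eta>_def)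
  have k0: "k \<ge> 0" using l by (simp add: k_def)
  let ?K = "\<sigma> * exp (- (1 / l - 1) * \<sigma>\<^sup>2)"
  have ce: "Complex \<sigma> (\<sigma> * u) = of_real \<sigma> * (1 + \<i> * of_real u)" for u
    by (simp add: complex_eq_iff)
  have le: "norm (dual_fun k (Complex \<sigma> (\<sigma> * u))) \<le> ?K * ((1 + \<bar>u\<bar>) * exp (- \<eta> * u\<^sup>2))" for u
    unfolding ce \<eta>_def by (rule norm_dual_fun_vertical[OF \<sigma> k_def])
  have gi: "integrable lborel (\<lambda>u. ?K * ((1 + \<bar>u\<bar>) * exp (- \<eta> * u\<^sup>2)))"
    by (intro integrable_mult_right integrable_gaussian_linear \<eta>)
  have m: "(\<lambda>y. dual_fun k (Complex \<sigma> y)) \<in> borel_measurable borel"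
  proof (rule borel_measurable_continuous_onI)
    have "dual_fun k holomorphic_on {z. Re z > 0}" unfolding dual_fun_def
      by (intro holomorphic_intros) (auto simp: complex_nonpos_Reals_iff)
    then have c: "continuous_on {z. Re z > 0} (dual_fun k)" by (rule holomorphic_on_imp_continuous_on)
    show "continuous_on UNIV (\<lambda>y. dual_fun k (Complex \<sigma> y))"
      by (rule continuous_on_compose2[OF c]) (use \<sigma> in \<open>auto simp: Complex_eq intro!: continuous_intros\<close>)
  qed
  have i1: "integrable lborel (\<lambda>u. dual_fun k (Complex \<sigma> (0 + \<sigma> * u)))"
  proof (rule Bochner_Integration.integrable_bound[OF gi])
    show "(\<lambda>u. dual_fun k (Complex \<sigma> (0 + \<sigma> * u))) \<in> borel_measurable lborel"
      using m by measurable
    show "AE u in lborel. norm (dual_fun k (Complex \<sigma> (0 + \<sigma> * u))) \<le> norm (?K * ((1 + \<bar>u\<bar>) * exp (- \<eta> * u\<^sup>2)))"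
      using le \<sigma> by (simp add: abs_mult)
  qed
  then have vint: "integrable lborel (\<lambda>y. dual_fun k (Complex \<sigma> y))"
    using lborel_integrable_real_affine_iff[of \<sigma> "\<lambda>y. dual_fun k (Complex \<sigma> y)" 0] \<sigma> by simp
  have "norm (dual_integral k \<beta> - dual_integral k (- \<beta>)) \<le> 2 * (LINT y|lborel. norm (dual_fun k (Complex \<sigma> y)))"
    by (rule dual_integral_diff_le_vertical[OF k0 _ vint]) (use \<sigma> in simp)
  also have "(LINT y|lborel. norm (dual_fun k (Complex \<sigma> y))) = \<sigma> * (LINT u|lborel. norm (dual_fun k (Complex \<sigma> (0 + \<sigma> * u))))"
    using lborel_integral_real_affine[of \<sigma> "\<lambda>y. norm (dual_fun k (Complex \<sigma> y))" 0] \<sigma> by simp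
  also have "(LINT u|lborel. norm (dual_fun k (Complex \<sigma> (0 + \<sigma> * u)))) \<le> (LINT u|lborel. ?K * ((1 + \<bar>u\<bar>) * exp (- \<eta> * u\<^sup>2)))"
    using le by (intro integral_mono integrable_norm i1 gi) simp
  also have "\<dots> = ?K * (LINT u|lborel. (1 + \<bar>u\<bar>) * exp (- \<eta> * u\<^sup>2))" by (rule integral_mult_right_zero)
  finally have "norm (dual_integral k \<beta> - dual_integral k (- \<beta>)) \<le> 2 * (\<sigma> * (?K * (LINT u|lborel. (1 + \<bar>u\<bar>) * exp (- \<eta> * u\<^sup>2))))"
    using \<sigma> by (simp add: mult_left_mono)
  also have "\<dots> = 2 * (LINT u|lborel. (1 + \<bar>u\<bar>) * exp (- \<eta> * u\<^sup>2)) * (\<sigma>\<^sup>2 * exp (- (1 / l - 1) * \<sigma>\<^sup>2))"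
    by (simp add: power2_eq_square mult_ac)
  finally show "norm (dual_integral (\<sigma> powr (2 - 2 * l) / l) \<beta> - dual_integral (\<sigma> powr (2 - 2 * l) / l) (- \<beta>))
     \<le> 2 * (LINT u|lborel. (1 + \<bar>u\<bar>) * exp (- (1 - \<bar>2 * l - 1\<bar>) * u\<^sup>2)) * (\<sigma>\<^sup>2 * exp (- (1 / l - 1) * \<sigma>\<^sup>2))"
    unfolding k_def \<eta>_def .
qed

text \<open>For k = pi^2 s^2 the critical point satisfies \<sigma>^(2-2l) = l k, hence \<sigma>^2 =
  \<kappa> |s|^(2/(1-l)). A rate \<open>N\<close> below the critical one leaves a gap
  \<open>d\<close>, which absorbs the factor \<sigma>^2; small \<sigma> are covered by the uniform
  bound \<open>C0\<close>.\<close>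

lemma fourier_wright_le:
  assumes N: "0 \<le> N" "N < (1 / l - 1) * (l * pi\<^sup>2) powr (1 / (1 - l))"
  shows "\<exists>C. \<forall>s. norm (LINT x|lborel. wright x * cis (- 2 * pi * s * x)) \<le> C * exp (- N * \<bar>s\<bar> powr (2 / (1 - l)))"
proof -
  obtain C1 where C1: "\<And>\<sigma>. \<sigma> \<ge> 1 \<Longrightarrow> norm (dual_integral (\<sigma> powr (2 - 2 * l) / l) \<beta> - dual_integral (\<sigma> powr (2 - 2 * l) / l) (- \<beta>))
     \<le> C1 * (\<sigma>\<^sup>2 * exp (- (1 / l - 1) * \<sigma>\<^sup>2))" using dual_integral_diff_le by blast
  define \<kappa> where "\<kappa> = (l * pi\<^sup>2) powr (1 / (1 - l))"
  have \<kappa>: "\<kappa> > 0" using l by (simp add: \<kappa>_def)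
  define d where "d = (1 / l - 1) - N / \<kappa>"
  have d: "d > 0" using N \<kappa> by (simp add: d_def \<kappa>_def[symmetric] field_simps)
  define C0 where "C0 = (LINT t|lborel. (1 + \<bar>t\<bar>) * exp (- c * t\<^sup>2))"
  have C00: "C0 \<ge> 0" unfolding C0_def by (intro integral_nonneg_AE) auto
  have b: "\<bar>\<beta>\<bar> = \<beta>" "\<bar>- \<beta>\<bar> = \<beta>" using \<beta> by auto
  define C where "C = sqrt pi / 2 * (2 * C0 * exp (N / \<kappa>) + \<bar>C1\<bar> / d)"
  have "norm (LINT x|lborel. wright x * cis (- 2 * pi * s * x)) \<le> C * exp (- N * \<bar>s\<bar> powr (2 / (1 - l)))" for s
  proof -
    define k where "k = pi\<^sup>2 * s\<^sup>2"
    have k0: "k \<ge> 0" by (simp add: k_def)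
    define \<sigma> where "\<sigma> = (l * k) powr (1 / (2 - 2 * l))"
    define D where "D = norm (dual_integral k \<beta> - dual_integral k (- \<beta>))"
    have sq: "\<sigma>\<^sup>2 = \<kappa> * \<bar>s\<bar> powr (2 / (1 - l))"
    proof -
      have "\<sigma>\<^sup>2 = (l * k) powr (1 / (1 - l))"
      proof -
        have "\<sigma>\<^sup>2 = \<sigma> powr 2" by (simp add: \<sigma>_def)
        also have "\<dots> = (l * k) powr (1 / (2 - 2 * l) * 2)" unfolding \<sigma>_def powr_powr ..
        also have "1 / (2 - 2 * l) * 2 = 1 / (1 - l)" using l by (simp add: field_simps)
        finally show ?thesis .
      qed
      also have "l * k = (l * pi\<^sup>2) * \<bar>s\<bar> powr 2" by (simp add: k_def powr_numeral)
      also have "\<dots> powr (1 / (1 - l)) = \<kappa> * \<bar>s\<bar> powr (2 / (1 - l))"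
      proof -
        have "(l * pi\<^sup>2 * \<bar>s\<bar> powr 2) powr (1 / (1 - l)) = (l * pi\<^sup>2) powr (1 / (1 - l)) * (\<bar>s\<bar> powr 2) powr (1 / (1 - l))"
          by (rule powr_mult)
        then show ?thesis unfolding \<kappa>_def powr_powr by simp
      qed
      finally show ?thesis .
    qed
    then have Ns: "N * \<bar>s\<bar> powr (2 / (1 - l)) = N / \<kappa> * \<sigma>\<^sup>2" using \<kappa> by simp
    have "norm (LINT x|lborel. wright x * cis (- 2 * pi * s * x)) = sqrt pi / 2 * D"
      unfolding fourier_wright(2) k_def[symmetric] D_def by (simp add: norm_mult norm_divide)
    also have "D \<le> (2 * C0 * exp (N / \<kappa>) + \<bar>C1\<bar> / d) * exp (- (N / \<kappa>) * \<sigma>\<^sup>2)"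
    proof (cases "\<sigma> \<ge> 1")
      case False
      have "\<sigma> \<ge> 0" by (simp add: \<sigma>_def)
      then have "\<sigma>\<^sup>2 \<le> 1" using False by (simp add: power_le_one)
      then have "N / \<kappa> * \<sigma>\<^sup>2 \<le> N / \<kappa> * 1" using N \<kappa> by (intro mult_left_mono) auto
      then have e: "1 \<le> exp (N / \<kappa>) * exp (- (N / \<kappa>) * \<sigma>\<^sup>2)" by (simp add: exp_add[symmetric])
      have "D \<le> norm (dual_integral k \<beta>) + norm (dual_integral k (- \<beta>))" unfolding D_def by (rule norm_triangle_ineq4)
      also have "\<dots> \<le> 2 * C0"
        using norm_dual_integral_le[OF b(1) k0] norm_dual_integral_le[OF b(2) k0] unfolding C0_def by simp
      also have "\<dots> \<le> 2 * C0 * (exp (N / \<kappa>) * exp (- (N / \<kappa>) * \<sigma>\<^sup>2))"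
        using mult_left_mono[OF e, of "2 * C0"] C00 by simp
      also have "\<dots> \<le> (2 * C0 * exp (N / \<kappa>) + \<bar>C1\<bar> / d) * exp (- (N / \<kappa>) * \<sigma>\<^sup>2)"
        using d by (simp add: distrib_right mult.assoc)
      finally show ?thesis .
    next
      case True
      have "\<sigma> powr (2 - 2 * l) = l * k"
        unfolding \<sigma>_def powr_powr using l k0 by simp
      then have kk: "k = \<sigma> powr (2 - 2 * l) / l" using l by simp
      have "d * \<sigma>\<^sup>2 \<le> exp (d * \<sigma>\<^sup>2)" using exp_ge_add_one_self[of "d * \<sigma>\<^sup>2"] by linarith
      then have "\<sigma>\<^sup>2 \<le> exp (d * \<sigma>\<^sup>2) / d" using d by (simp add: field_simps)
      then have "\<sigma>\<^sup>2 * exp (- (1 / l - 1) * \<sigma>\<^sup>2) \<le> exp (d * \<sigma>\<^sup>2) / d * exp (- (1 / l - 1) * \<sigma>\<^sup>2)"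
        by (rule mult_right_mono) simp
      also have "\<dots> = exp (d * \<sigma>\<^sup>2 + - (1 / l - 1) * \<sigma>\<^sup>2) / d" by (simp only: exp_add times_divide_eq_left)
      also have "d * \<sigma>\<^sup>2 + - (1 / l - 1) * \<sigma>\<^sup>2 = - (N / \<kappa>) * \<sigma>\<^sup>2" by (simp add: d_def algebra_simps)
      finally have e: "\<sigma>\<^sup>2 * exp (- (1 / l - 1) * \<sigma>\<^sup>2) \<le> exp (- (N / \<kappa>) * \<sigma>\<^sup>2) / d" .
      have "D \<le> C1 * (\<sigma>\<^sup>2 * exp (- (1 / l - 1) * \<sigma>\<^sup>2))"
        unfolding D_def kk by (rule C1[OF True])
      also have "\<dots> \<le> \<bar>C1\<bar> * (\<sigma>\<^sup>2 * exp (- (1 / l - 1) * \<sigma>\<^sup>2))" by (intro mult_right_mono) auto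
      also have "\<dots> \<le> \<bar>C1\<bar> * (exp (- (N / \<kappa>) * \<sigma>\<^sup>2) / d)" by (intro mult_left_mono e) auto
      also have "\<dots> \<le> (2 * C0 * exp (N / \<kappa>) + \<bar>C1\<bar> / d) * exp (- (N / \<kappa>) * \<sigma>\<^sup>2)"
        using C00 by (simp add: distrib_right)
      finally show ?thesis .
    qed
    finally have "norm (LINT x|lborel. wright x * cis (- 2 * pi * s * x)) \<le> sqrt pi / 2 * ((2 * C0 * exp (N / \<kappa>) + \<bar>C1\<bar> / d) * exp (- (N / \<kappa>) * \<sigma>\<^sup>2))"
      by (simp add: mult_left_mono)
    also have "\<dots> = C * exp (- N * \<bar>s\<bar> powr (2 / (1 - l)))"
      using Ns by (simp add: C_def mult.assoc)
    finally show ?thesis .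
  qed
  then show ?thesis by blast
qed

lemma wright_le_exp:
  assumes R: "0 < R" "R < c * ((1 + l) * l powr (- (l / (1 + l))))"
  shows "\<exists>C. \<forall>x. norm (wright x) \<le> C * exp (- R * \<bar>x\<bar> powr (2 / (1 + l)))"
proof -
  define R0 where "R0 = c * ((1 + l) * l powr (- (l / (1 + l))))"
  \<comment> \<open>The share of the exponent that can be spent on convergence while keeping the
    rate (1 - e) R0 = R.\<close>
  define e where "e = 1 - R / R0"
  have R0: "R0 > 0" using R by (simp add: R0_def)
  have "R < R0" using R(2) by (simp only: R0_def)
  then have e: "0 < e" "e < 1" "(1 - e) * R0 = R" using R(1) R0 by (simp_all add: e_def)
  define C where "C = max (norm (wright 0)) (sqrt (pi / (c * e)))"
  have eq: "(1 - e) * c * ((1 + l) * l powr (- (l / (1 + l)))) = R" using e(3) by (simp add: R0_def mult.assoc)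
  have "norm (wright x) \<le> C * exp (- R * \<bar>x\<bar> powr (2 / (1 + l)))" for x
  proof (cases "x = 0")
    case False
    have "norm (wright x) \<le> sqrt (pi / (c * e)) * exp (- R * \<bar>x\<bar> powr (2 / (1 + l)))"
      using wright_le[OF e(1,2) False] unfolding eq .
    also have "\<dots> \<le> C * exp (- R * \<bar>x\<bar> powr (2 / (1 + l)))" by (intro mult_right_mono) (auto simp: C_def)
    finally show ?thesis .
  qed (simp add: C_def)
  then show ?thesis by blast
qed

text \<open>On the sector \<open>S\<close> both ray kernels are dominated by one Gaussian, so
  \<open>wright_sq\<close> is holomorphic. It is not constant, since along the positive axis it
  tends to \<open>wright 0\<close>, which is not 0, at the origin and to 0 at infinity. Its zeros
  are countable, and each has at most two real square roots.\<close>

lemma wright_AE_nz: "AE x in lborel. wright x \<noteq> 0"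
proof -
  define S where "S = {X. Re (X * cis (- 2 * l * \<beta>)) > 0} \<inter> {X. Re (X * cis (2 * l * \<beta>)) > 0}"
  have hs: "open {X. Re (X * z) > 0}" "convex {X. Re (X * z) > 0}" for z :: complex
  proof -
    have "{X. Re (X * z) > 0} = {X. cnj z \<bullet> X > 0}"
      by (auto simp: inner_complex_def algebra_simps)
    then show "open {X. Re (X * z) > 0}" "convex {X. Re (X * z) > 0}"
      by (simp_all add: open_halfspace_gt convex_halfspace_gt)
  qed
  have opn: "open S" unfolding S_def by (intro open_Int hs)
  have conn: "connected S" unfolding S_def by (intro convex_connected convex_Int hs)
  have rays: "(\<lambda>X. ray_integral X \<theta>) holomorphic_on S" if \<theta>: "\<theta> = \<beta> \<or> \<theta> = - \<beta>" for \<theta>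
    unfolding ray_integral_def
  proof (rule holomorphic_on_integral_param)
    have ab: "\<bar>\<theta>\<bar> = \<beta>" using \<theta> \<beta> by auto
    show "ray_kernel X \<theta> \<in> borel_measurable lborel" for X by measurable
    show "(\<lambda>X. ray_kernel X \<theta> t) holomorphic_on S" for t
      unfolding ray_kernel_def by (intro holomorphic_intros)
    fix X assume "X \<in> S"
    then obtain r where r: "r > 0" "cball X r \<subseteq> S" using opn open_contains_cball by blast
    have "norm (ray_kernel u \<theta> t) \<le> exp (- c * t\<^sup>2)" if "u \<in> cball X r" for u t
    proof (rule norm_ray_kernel_le[OF ab])
      have "u \<in> S" using that r by blast
      then have "Re (u * cis (- 2 * l * \<beta>)) > 0" "Re (u * cis (2 * l * \<beta>)) > 0" unfolding S_def by blast+
      then show "0 \<le> Re (u * cis (- 2 * l * \<theta>))" using \<theta> by (elim disjE) (simp_all only: mult_minus_left mult_minus_right minus_minus less_imp_le)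
    qed
    then show "\<exists>r>0. \<exists>w. cball X r \<subseteq> S \<and> integrable lborel w \<and> (\<forall>u\<in>cball X r. \<forall>t\<in>space lborel. norm (ray_kernel u \<theta> t) \<le> w t)"
      using r integrable_gaussian[OF c] by blast
  qed
  have hol: "wright_sq holomorphic_on S"
    unfolding wright_sq_def by (intro holomorphic_intros rays) auto
  have inS: "of_real (x\<^sup>2) \<in> S" if "x \<noteq> 0" for x :: real
    using that cos_2l\<beta> c by (simp add: S_def)
  have nconst: "\<not> wright_sq constant_on S"
  proof
    assume "wright_sq constant_on S"
    then obtain K where K: "\<And>X. X \<in> S \<Longrightarrow> wright_sq X = K" unfolding constant_on_def by blast
    then have Kx: "wright x = K" if "x \<noteq> 0" for x using inS[OF that] by (simp add: wright_def)
    have "(\<lambda>n::nat. K) \<longlonglongrightarrow> wright 0" using wright_tendsto_0 Kx by simp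
    then have K0: "K = wright 0" by (simp add: LIMSEQ_const_iff)
    define R where "R = c * ((1 + l) * l powr (- (l / (1 + l)))) / 2"
    have R: "R > 0" "R < c * ((1 + l) * l powr (- (l / (1 + l))))" using c l by (auto simp: R_def)
    obtain C where C: "\<And>x. norm (wright x) \<le> C * exp (- R * \<bar>x\<bar> powr (2 / (1 + l)))"
      using wright_le_exp[OF R] by blast
    have N: "filterlim (\<lambda>n. real (Suc n)) at_top sequentially"
      using filterlim_Suc filterlim_real_sequentially filterlim_compose by blast
    have "((\<lambda>x. exp (- R * x powr (2 / (1 + l)))) \<longlongrightarrow> 0) at_top"
    proof -
      have "2 / (1 + l) > 0" using l by simp
      then show ?thesis using R(1) by real_asymp
    qed
    from filterlim_compose[OF this N] have "(\<lambda>n. C * exp (- R * real (Suc n) powr (2 / (1 + l)))) \<longlonglongrightarrow> C * 0"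
      by (intro tendsto_intros)
    moreover have "norm K \<le> C * exp (- R * real (Suc n) powr (2 / (1 + l)))" for n
      using C[of "real (Suc n)"] Kx[of "real (Suc n)"] by (simp del: of_nat_Suc)
    ultimately have "norm K \<le> C * 0" by (intro LIMSEQ_le_const) auto
    then show False using K0 wright_0_nz by simp
  qed
  have cnt: "countable {X \<in> S. wright_sq X = 0}"
  proof (rule holomorphic_countable_zeros[OF hol opn conn _ nconst])
    \<comment> \<open>The countability of the zeros is applied on an F-sigma set; an open set is
      one, as a countable union of closed boxes.\<close>
    obtain \<D> where \<D>: "countable \<D>" "\<And>X. X \<in> \<D> \<Longrightarrow> \<exists>a b. X = cbox a b" "\<Union>\<D> = S"
      using open_countable_Union_open_cbox[OF opn] by metis
    have ne: "\<D> \<noteq> {}" using \<D>(3) inS[of 1] by auto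
    have "closed (from_nat_into \<D> n)" for n
      using \<D>(2)[OF from_nat_into[OF ne, of n]] by (elim exE) (simp only: closed_cbox)
    then have "fsigma (\<Union> (range (from_nat_into \<D>)))" by (rule fsigma.intros)
    then show "fsigma S" unfolding range_from_nat_into[OF ne \<D>(1)] \<D>(3) .
  qed
  have sub: "{x. wright x = 0} \<subseteq> insert 0 ((\<lambda>X. sqrt (Re X)) ` {X \<in> S. wright_sq X = 0} \<union> (\<lambda>X. - sqrt (Re X)) ` {X \<in> S. wright_sq X = 0})"
  proof
    fix x assume x: "x \<in> {x. wright x = 0}"
    show "x \<in> insert 0 ((\<lambda>X. sqrt (Re X)) ` {X \<in> S. wright_sq X = 0} \<union> (\<lambda>X. - sqrt (Re X)) ` {X \<in> S. wright_sq X = 0})"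
    proof (cases "x = 0")
      case False
      have z: "of_real (x\<^sup>2) \<in> {X \<in> S. wright_sq X = 0}" using x inS[OF False] by (simp add: wright_def)
      have "x = sqrt (Re (of_real (x\<^sup>2))) \<or> x = - sqrt (Re (of_real (x\<^sup>2)))" by (simp add: abs_if)
      then show ?thesis using z by blast
    qed simp
  qed
  have "countable {x. wright x = 0}"
    by (rule countable_subset[OF sub]) (intro countable_insert countable_Un countable_image cnt)
  then have "{x. wright x = 0} \<in> null_sets lborel" by (rule countable_imp_null_set_lborel)
  then have "AE x in lborel. x \<notin> {x. wright x = 0}" by (rule AE_not_in)
  then show ?thesis by simp
qed

end

text \<open>The parameter \<open>l\<close> is determined by p = 2 / (1 + l), which makes q = 2 / (1
  - l), and then \<beta> and \<open>c\<close> are forced by the two cosine conditions. The Wright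
  function has critical rates \<open>a0\<close> and \<open>b0\<close>; a dilation by
  \<open>t\<close> changes them to a0 t and b0 / t without changing their product.\<close>

theorem morgan_extremal:
  fixes p q a b :: real
  assumes p: "1 < p" "p < 2" "1 / p + 1 / q = 1" and ab: "a > 0" "b > 0"
    and abc: "a * b < \<bar>cos (p * pi / 2)\<bar> powr (1 / p)"
  obtains g :: "real \<Rightarrow> complex" and a' b' C
  where "a' > a" "b' > b" "g \<in> borel_measurable borel"
    "\<And>x. norm (g x) \<le> C * exp (- (2 * pi * a' powr p / p) * \<bar>x\<bar> powr p)"
    "\<And>s. norm (LINT x|lborel. g x * cis (- 2 * pi * s * x)) \<le> C * exp (- (2 * pi * b' powr q / q) * \<bar>s\<bar> powr q)"
    "AE x in lborel. g x \<noteq> 0"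
proof -
  define l where "l = 2 / p - 1"
  define \<beta> where "\<beta> = p * pi / 4"
  define c where "c = - cos (p * pi / 2)"
  have l: "0 < l" "l < 1" using p by (auto simp: l_def field_simps)
  have pl: "p = 2 / (1 + l)" using p by (simp add: l_def)
  have "1 / q = 1 - 1 / p" using p(3) by linarith
  also have "\<dots> = (1 - l) / 2" by (simp add: l_def field_simps)
  finally have "1 / q = (1 - l) / 2" .
  moreover have "q = 1 / (1 / q)" by simp
  ultimately have "q = 1 / ((1 - l) / 2)" by (simp only:)
  then have ql: "q = 2 / (1 - l)" by simp
  have q0: "q > 2" unfolding ql using l by (simp add: field_simps)
  have pi2: "pi / 2 < p * pi / 2" "p * pi / 2 < pi" using p pi_gt_zero by auto
  have c: "c > 0"
  proof -
    have "cos (pi - p * pi / 2) > 0" using pi2 by (intro cos_gt_zero) auto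
    then show ?thesis by (simp add: c_def)
  qed
  interpret wright_rays l \<beta> c
  proof
    show "0 < l" "l < 1" by (rule l)+
    show "0 < c" by (rule c)
    show "0 < \<beta>" using p by (simp add: \<beta>_def)
    show "\<beta> < pi / 2" using pi2(2) by (simp add: \<beta>_def)
    have "2 * \<beta> = p * pi / 2" by (simp add: \<beta>_def)
    then show "cos (2 * \<beta>) = - c" by (simp only: c_def minus_minus)
    have "2 * l * \<beta> = pi - p * pi / 2" using p by (simp add: l_def \<beta>_def field_simps)
    then show "cos (2 * l * \<beta>) = c" by (simp add: c_def)
  qed
  define R1 where "R1 = c * ((1 + l) * l powr (- (l / (1 + l))))"
  define R2 where "R2 = (1 / l - 1) * (l * pi\<^sup>2) powr (1 / (1 - l))"
  have R: "R1 > 0" "R2 > 0" using c l by (auto simp: R1_def R2_def)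
  define a0 where "a0 = (R1 * p / (2 * pi)) powr (1 / p)"
  define b0 where "b0 = (R2 * q / (2 * pi)) powr (1 / q)"
  have a0: "a0 > 0" "2 * pi * a0 powr p / p = R1" using R p by (auto simp: a0_def powr_powr)
  have b0: "b0 > 0" "2 * pi * b0 powr q / q = R2" using R q0 by (auto simp: b0_def powr_powr)
  \<comment> \<open>In logarithms the contributions of \<open>l\<close> and \<open>pi\<close> to
    \<open>a0\<close> and \<open>b0\<close> are opposite; only \<open>c\<close> survives. This is
    where the exact threshold appears.\<close>
  have prod: "a0 * b0 = c powr (1 / p)"
  proof -
    have ip: "1 / p = (1 + l) / 2" "1 / q = (1 - l) / 2" using pl ql l by auto
    have v1: "R1 * p / (2 * pi) = c * l powr (- (l / (1 + l))) / pi"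
    proof -
      have "c * (m * P) * (2 / m) / (2 * pi) = c * P / pi" if "m \<noteq> 0" for m P :: real using that by simp
      from this[of "1 + l"] show ?thesis unfolding R1_def pl using l by simp
    qed
    have v2: "R2 * q / (2 * pi) = (l * pi\<^sup>2) powr (1 / (1 - l)) / (l * pi)"
    proof -
      have "(1 / l - 1) * q = 2 / l" unfolding ql using l by (simp add: field_simps)
      then have "R2 * q = 2 / l * (l * pi\<^sup>2) powr (1 / (1 - l))" unfolding R2_def by (metis mult.commute mult.left_commute)
      then show ?thesis by simp
    qed
    have p1: "1 + l \<noteq> 0" "1 - l \<noteq> 0" using l by auto
    have "ln a0 = (1 + l) / 2 * (ln c + - (l / (1 + l)) * ln l - ln pi)"
      unfolding a0_def v1 ip using c l by (simp add: ln_powr ln_mult ln_div)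
    also have "\<dots> = (1 + l) / 2 * ln c - l / 2 * ln l - (1 + l) / 2 * ln pi"
      using p1 by (simp add: field_simps)
    finally have la: "ln a0 = (1 + l) / 2 * ln c - l / 2 * ln l - (1 + l) / 2 * ln pi" .
    have "ln b0 = (1 - l) / 2 * (1 / (1 - l) * (ln l + 2 * ln pi) - (ln l + ln pi))"
      unfolding b0_def v2 ip using l by (simp add: ln_powr ln_mult ln_div ln_realpow)
    also have "\<dots> = l / 2 * ln l + (1 + l) / 2 * ln pi"
      using p1 by (simp add: field_simps)
    finally have lb: "ln b0 = l / 2 * ln l + (1 + l) / 2 * ln pi" .
    have "ln (a0 * b0) = (1 + l) / 2 * ln c" using la lb a0 b0 by (simp add: ln_mult)
    then have "exp (ln (a0 * b0)) = exp ((1 / p) * ln c)" unfolding ip by simp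
    then show ?thesis using a0 b0 c by (simp add: powr_def)
  qed
  have "\<bar>cos (p * pi / 2)\<bar> = c" using c by (simp add: c_def)
  then have lt: "a * b < a0 * b0" using abc prod by simp
  define \<rho> where "\<rho> = a0 * b0 / (a * b)"
  have \<rho>: "\<rho> > 1" using lt ab by (simp add: \<rho>_def)
  \<comment> \<open>The surplus \<rho> is shared out in four equal factors: a0 t = a u^2 and b0 / t
    = b u^2. On each side one factor \<open>u\<close> makes a' > a or b' > b, and the other pays for
    having only rates strictly below the critical ones.\<close>
  define u where "u = \<rho> powr (1 / 4)"
  have u: "u > 1" unfolding u_def using \<rho> by (simp add: gr_one_powr)
  have u4: "u ^ 4 = \<rho>" unfolding u_def using \<rho> by (simp add: powr_powr flip: powr_realpow)
  define t where "t = a * u\<^sup>2 / a0"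
  have t: "t > 0" using ab u a0 by (simp add: t_def)
  have bt: "b0 / t = b * u\<^sup>2"
  proof -
    have "b0 / t = a0 * b0 / (a * u\<^sup>2)" using t a0 by (simp add: t_def)
    also have "a0 * b0 = u ^ 4 * (a * b)" using ab unfolding u4 \<rho>_def by simp
    also have "u ^ 4 * (a * b) / (a * u\<^sup>2) = b * u\<^sup>2" using ab u by (simp add: field_simps power4_eq_xxxx power2_eq_square)
    finally show ?thesis .
  qed
  have at: "a0 * t = a * u\<^sup>2" using a0 by (simp add: t_def)
  define a' where "a' = a * u"
  define b' where "b' = b * u"
  have ab': "a' > a" "b' > b" using ab u by (auto simp: a'_def b'_def)
  define S1 where "S1 = R1 * u powr (- p)"
  define S2 where "S2 = R2 * u powr (- q)"
  have um: "u powr (- p) < 1" "u powr (- q) < 1" using u p q0 by (auto simp: powr_less_one)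
  have S1: "0 < S1" "S1 < R1" using R um u by (auto simp: S1_def)
  have S2: "0 \<le> S2" "S2 < R2" using R um u by (auto simp: S2_def)
  obtain C1 where C1: "\<And>x. norm (wright x) \<le> C1 * exp (- S1 * \<bar>x\<bar> powr (2 / (1 + l)))"
    using wright_le_exp[of S1] S1 unfolding R1_def by blast
  obtain C2 where C2: "\<And>s. norm (LINT x|lborel. wright x * cis (- 2 * pi * s * x)) \<le> C2 * exp (- S2 * \<bar>s\<bar> powr (2 / (1 - l)))"
    using fourier_wright_le[of S2] S2 unfolding R2_def by blast
  define g where "g x = wright (t * x)" for x
  define C where "C = max C1 (C2 / t)"
  have wm: "wright \<in> borel_measurable borel"
    using borel_measurable_integrable[OF fourier_wright(1)[of 0]] by simp
  show thesis
  proof (rule that[OF ab'])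
    show "g \<in> borel_measurable borel" unfolding g_def using wm by measurable
    fix x :: real
    have "S1 * \<bar>t * x\<bar> powr p = (2 * pi * a' powr p / p) * \<bar>x\<bar> powr p"
    proof -
      have "a0 powr p * u powr (- p) * t powr p = (a0 * t) powr p * u powr (- p)" using a0 t by (simp add: powr_mult)
      also have "\<dots> = a' powr p" unfolding at a'_def using ab u
        by (simp add: powr_mult powr_minus_divide power2_eq_square)
      finally have e: "a0 powr p * u powr (- p) * t powr p = a' powr p" .
      have "S1 * \<bar>t * x\<bar> powr p = 2 * pi / p * (a0 powr p * u powr (- p) * t powr p) * \<bar>x\<bar> powr p"
        unfolding S1_def a0(2)[symmetric] using t by (simp add: abs_mult powr_mult)
      then show ?thesis unfolding e by simp
    qed
    then have "norm (g x) \<le> C1 * exp (- (2 * pi * a' powr p / p) * \<bar>x\<bar> powr p)"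
      using C1[of "t * x"] unfolding g_def pl[symmetric] by simp
    also have "\<dots> \<le> C * exp (- (2 * pi * a' powr p / p) * \<bar>x\<bar> powr p)" by (intro mult_right_mono) (auto simp: C_def)
    finally show "norm (g x) \<le> C * exp (- (2 * pi * a' powr p / p) * \<bar>x\<bar> powr p)" .
  next
    fix s :: real
    have "(LINT x|lborel. wright x * cis (- 2 * pi * (s / t) * x)) = t *\<^sub>R (LINT x|lborel. g x * cis (- 2 * pi * s * x))"
      using lborel_integral_real_affine[of t "\<lambda>x. wright x * cis (- 2 * pi * (s / t) * x)" 0] t by (simp add: g_def mult.assoc)
    then have "norm (LINT x|lborel. g x * cis (- 2 * pi * s * x)) = norm (LINT x|lborel. wright x * cis (- 2 * pi * (s / t) * x)) / t"
      using t by simp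
    also have "\<dots> \<le> C2 * exp (- S2 * \<bar>s / t\<bar> powr q) / t"
      using C2[of "s / t"] t unfolding ql[symmetric] by (intro divide_right_mono) auto
    also have "S2 * \<bar>s / t\<bar> powr q = (2 * pi * b' powr q / q) * \<bar>s\<bar> powr q"
    proof -
      have "b0 powr q * u powr (- q) / t powr q = (b0 / t) powr q * u powr (- q)" using b0 t by (simp add: powr_divide)
      also have "\<dots> = b' powr q" unfolding bt b'_def using ab u
        by (simp add: powr_mult powr_minus_divide power2_eq_square)
      finally have e: "b0 powr q * u powr (- q) / t powr q = b' powr q" .
      have "S2 * \<bar>s / t\<bar> powr q = 2 * pi / q * (b0 powr q * u powr (- q) / t powr q) * \<bar>s\<bar> powr q"
        unfolding S2_def b0(2)[symmetric] using t by (simp add: abs_divide powr_divide)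
      then show ?thesis unfolding e by simp
    qed
    then have "C2 * exp (- S2 * \<bar>s / t\<bar> powr q) / t = C2 / t * exp (- (2 * pi * b' powr q / q) * \<bar>s\<bar> powr q)" by simp
    also have "\<dots> \<le> C * exp (- (2 * pi * b' powr q / q) * \<bar>s\<bar> powr q)" by (intro mult_right_mono) (auto simp: C_def)
    finally show "norm (LINT x|lborel. g x * cis (- 2 * pi * s * x)) \<le> C * exp (- (2 * pi * b' powr q / q) * \<bar>s\<bar> powr q)" .
  next
    have "{x. wright x = 0} \<in> sets borel" using wm by measurable
    have "AE x in distr lborel borel (\<lambda>x. t * x). wright x \<noteq> 0"
    proof -
      have D: "distr lborel borel (\<lambda>x. t * x) = density lborel (\<lambda>_. inverse \<bar>t\<bar>)"
        using lborel_distr_mult[of t] t by simp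
      show ?thesis unfolding D using wright_AE_nz by (subst AE_density) auto
    qed
    then show "AE x in lborel. g x \<noteq> 0"
      unfolding g_def using wm by (subst (asm) AE_distr_iff) auto
  qed
qed

section \<open>Lebesgue measure in coordinates\<close>

abbreviation lborel_PiM :: "'i set \<Rightarrow> ('i \<Rightarrow> real) measure" where
  "lborel_PiM J \<equiv> Pi\<^sub>M J (\<lambda>_. lborel)"

lemma product_sigma_finite_lborel: "product_sigma_finite (\<lambda>_::'i. lborel :: real measure)"
  by (simp add: product_sigma_finite.intro lborel.sigma_finite_measure_axioms)

lemma sigma_finite_lborel_PiM:
  "finite J \<Longrightarrow> sigma_finite_measure (lborel_PiM J)"
  by (rule product_sigma_finite.sigma_finite[OF product_sigma_finite_lborel])

lemma borel_measurable_vec_lambda [measurable (raw)]: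
  fixes f :: "'b \<Rightarrow> 'n::finite \<Rightarrow> real"
  assumes "\<And>i. (\<lambda>x. f x i) \<in> borel_measurable M"
  shows "(\<lambda>x. \<chi> i. f x i) \<in> borel_measurable M"
proof -
  have "(\<lambda>x. (\<chi> i. f x i) \<bullet> b) \<in> borel_measurable M" if "b \<in> Basis" for b
    using that assms by (auto simp: Basis_vec_def inner_axis)
  then show ?thesis by (subst borel_measurable_euclidean_space) auto
qed

lemma borel_measurable_vec_nth [measurable]: "(\<lambda>x::real^'n. x $ i) \<in> borel_measurable borel"
  by (intro borel_measurable_continuous_onI continuous_intros)

lemma distr_lebesgue_vec_lambda:
  "distr (lborel_PiM (UNIV :: 'n::finite set)) borel (\<lambda>c. \<chi> i. c i) = (lborel :: (real^'n) measure)"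
proof (rule lborel_eqI[symmetric])
  interpret product_sigma_finite "\<lambda>_::'n. lborel :: real measure" by (rule product_sigma_finite_lborel)
  fix l u :: "real^'n" assume lu: "\<And>b. b \<in> Basis \<Longrightarrow> l \<bullet> b \<le> u \<bullet> b"
  have lui: "l $ i \<le> u $ i" for i using lu[of "axis i 1"] by (simp add: inner_axis)
  have vim: "(\<lambda>c. \<chi> i. c i) -` box l u \<inter> space (lborel_PiM UNIV) = Pi\<^sub>E UNIV (\<lambda>i. {l $ i<..<u $ i})"
    by (auto simp: space_PiM mem_box Basis_vec_def inner_axis PiE_iff)
  have "emeasure (distr (lborel_PiM UNIV) borel (\<lambda>c. \<chi> i. c i)) (box l u)
     = emeasure (lborel_PiM (UNIV::'n set)) (Pi\<^sub>E UNIV (\<lambda>i. {l $ i<..<u $ i}))"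
    unfolding vim[symmetric] by (rule emeasure_distr) auto
  also have "\<dots> = (\<Prod>i\<in>UNIV. emeasure lborel {l $ i<..<u $ i})"
    by (rule emeasure_PiM) auto
  also have "\<dots> = (\<Prod>i\<in>UNIV. ennreal (u $ i - l $ i))" using lui by simp
  also have "\<dots> = ennreal (\<Prod>i\<in>UNIV. u $ i - l $ i)" using lui by (intro prod_ennreal) simp
  also have "(\<Prod>i\<in>UNIV. u $ i - l $ i) = (\<Prod>b\<in>Basis. (u - l) \<bullet> b)"
  proof -
    have B: "Basis = (\<lambda>i::'n. axis i (1::real)) ` UNIV" by (auto simp: Basis_vec_def)
    have "inj (\<lambda>i::'n. axis i (1::real))" by (auto simp: inj_on_def axis_eq_axis)
    then show ?thesis unfolding B by (subst prod.reindex) (auto simp: inner_axis)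
  qed
  finally show "emeasure (distr (lborel_PiM UNIV) borel (\<lambda>c. \<chi> i. c i)) (box l u) = (\<Prod>b\<in>Basis. (u - l) \<bullet> b)" .
qed simp

section \<open>Uniqueness of Lebesgue measure and linear images\<close>

lemma nn_integral_lborel_isometry:
  fixes f :: "'a::euclidean_space \<Rightarrow> ennreal"
  assumes c: "\<bar>c\<bar> = 1" and f: "f \<in> borel_measurable borel"
  shows "(\<integral>\<^sup>+x. f (t + c *\<^sub>R x) \<partial>lborel) = (\<integral>\<^sup>+x. f x \<partial>lborel)"
proof -
  have "(lborel :: 'a measure) = density (distr lborel borel (\<lambda>x. t + c *\<^sub>R x)) (\<lambda>_. ennreal (\<bar>c\<bar> ^ DIM('a)))"
    using c by (intro lborel_affine) auto
  also have "\<dots> = distr lborel borel (\<lambda>x. t + c *\<^sub>R x)" unfolding c by (simp add: density_1)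
  finally have "(\<integral>\<^sup>+x. f x \<partial>lborel) = (\<integral>\<^sup>+x. f x \<partial>distr lborel borel (\<lambda>x. t + c *\<^sub>R x))" by simp
  also have "\<dots> = (\<integral>\<^sup>+x. f (t + c *\<^sub>R x) \<partial>lborel)" using f by (intro nn_integral_distr) auto
  finally show ?thesis ..
qed

text \<open>Uniqueness of Haar measure: integrate f(x) g(x + y) over both variables, shift
  \<open>x\<close> by the invariance of \<open>M\<close>, then reflect and shift \<open>y\<close> by
  the invariance of Lebesgue measure.\<close>

lemma translation_invariant_proportional:
  fixes M :: "'a::euclidean_space measure"
  assumes sf: "sigma_finite_measure M" and sets_M[measurable_cong]: "sets M = sets borel"
    and inv: "\<And>f t. f \<in> borel_measurable borel \<Longrightarrow> (\<integral>\<^sup>+x. f (x + t) \<partial>M) = (\<integral>\<^sup>+x. f x \<partial>M)"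
    and f[measurable]: "f \<in> borel_measurable borel" and g[measurable]: "g \<in> borel_measurable borel"
  shows "(\<integral>\<^sup>+x. f x \<partial>M) * (\<integral>\<^sup>+x. g x \<partial>lborel) = (\<integral>\<^sup>+x. f x \<partial>lborel) * (\<integral>\<^sup>+x. g x \<partial>M)"
proof -
  interpret M: sigma_finite_measure M by (rule sf)
  interpret P: pair_sigma_finite M lborel ..
  have "(\<integral>\<^sup>+x. f x \<partial>M) * (\<integral>\<^sup>+x. g x \<partial>lborel) = (\<integral>\<^sup>+x. f x * (\<integral>\<^sup>+y. g y \<partial>lborel) \<partial>M)"
    by (subst nn_integral_multc) auto
  also have "\<dots> = (\<integral>\<^sup>+x. f x * (\<integral>\<^sup>+y. g (x + 1 *\<^sub>R y) \<partial>lborel) \<partial>M)"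
    by (subst nn_integral_lborel_isometry) auto
  also have "\<dots> = (\<integral>\<^sup>+x. (\<integral>\<^sup>+y. f x * g (x + y) \<partial>lborel) \<partial>M)"
    by (subst nn_integral_cmult) auto
  also have "\<dots> = (\<integral>\<^sup>+y. (\<integral>\<^sup>+x. f x * g (x + y) \<partial>M) \<partial>lborel)"
    by (rule P.Fubini'[symmetric]) measurable
  also have "\<dots> = (\<integral>\<^sup>+y. (\<integral>\<^sup>+x. f (x - y) * g x \<partial>M) \<partial>lborel)"
    using inv[of "\<lambda>x. f (x - y) * g x" y for y] by simp
  also have "\<dots> = (\<integral>\<^sup>+x. (\<integral>\<^sup>+y. f (x - y) * g x \<partial>lborel) \<partial>M)"
    by (rule P.Fubini') measurable
  also have "\<dots> = (\<integral>\<^sup>+x. (\<integral>\<^sup>+y. f (x + (- 1) *\<^sub>R y) \<partial>lborel) * g x \<partial>M)"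
    by (subst nn_integral_multc) auto
  also have "\<dots> = (\<integral>\<^sup>+x. (\<integral>\<^sup>+y. f y \<partial>lborel) * g x \<partial>M)"
    by (subst nn_integral_lborel_isometry) auto
  also have "\<dots> = (\<integral>\<^sup>+x. f x \<partial>lborel) * (\<integral>\<^sup>+x. g x \<partial>M)"
    by (subst nn_integral_cmult) auto
  finally show ?thesis .
qed

text \<open>The image measure is sigma-finite and translation-invariant, hence a multiple of
  Lebesgue measure; the unit cube gives the factor \<open>k\<close>, which is not 0 because the
  total mass is infinite.\<close>

lemma distr_lborel_linear:
  fixes T :: "'a::euclidean_space \<Rightarrow> 'a"
  assumes lin: "linear T" and inj: "inj T"
  obtains k where "k > 0" "distr lborel borel T = density lborel (\<lambda>_. ennreal k)"
proof -
  obtain S where S: "linear S" "S \<circ> T = id" "T \<circ> S = id"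
    using linear_injective_isomorphism[OF lin inj] by (auto simp: fun_eq_iff)
  have SS: "S (T x) = x" "T (S x) = x" for x using S by (auto simp: fun_eq_iff)
  have Tm[measurable]: "T \<in> borel_measurable borel"
    using linear_continuous_on[of T UNIV] lin by (simp add: borel_measurable_continuous_onI linear_conv_bounded_linear)
  define M where "M = distr lborel borel T"
  have sets_M[measurable_cong]: "sets M = sets borel" by (simp add: M_def)
  have fin: "emeasure M B < \<infinity>" if "bounded B" "B \<in> sets borel" for B
  proof -
    have "T -` B = S ` B" using SS by (auto simp: image_iff) (metis SS(1))
    moreover have "bounded (S ` B)"
      using S(1) that(1) by (intro bounded_linear_image) (auto simp: linear_conv_bounded_linear)
    ultimately have "emeasure lborel (T -` B) < \<infinity>" using emeasure_bounded_finite[of "S ` B"] by (simp only:)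
    then show ?thesis using that(2) unfolding M_def by (subst emeasure_distr) auto
  qed
  have sf: "sigma_finite_measure M"
  proof
    show "\<exists>A. countable A \<and> A \<subseteq> sets M \<and> \<Union>A = space M \<and> (\<forall>a\<in>A. emeasure M a \<noteq> \<infinity>)"
    proof (intro exI[of _ "range (\<lambda>n::nat. cball 0 (real n))"] conjI)
      show "\<Union>(range (\<lambda>n::nat. cball 0 (real n))) = space M"
        by (auto simp: M_def) (meson real_arch_simple)
      show "\<forall>a\<in>range (\<lambda>n::nat. cball 0 (real n)). emeasure M a \<noteq> \<infinity>"
      proof
        fix a :: "'a set" assume "a \<in> range (\<lambda>n::nat. cball 0 (real n))"
        then have "bounded a" "a \<in> sets borel" by auto
        then show "emeasure M a \<noteq> \<infinity>" using fin[of a] by simp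
      qed
    qed (auto simp: sets_M)
  qed
  have inv: "(\<integral>\<^sup>+x. f (x + t) \<partial>M) = (\<integral>\<^sup>+x. f x \<partial>M)" if [measurable]: "f \<in> borel_measurable borel" for f t
  proof -
    have "(\<integral>\<^sup>+x. f (x + t) \<partial>M) = (\<integral>\<^sup>+x. f (T x + t) \<partial>lborel)"
      unfolding M_def by (subst nn_integral_distr) auto
    also have "\<dots> = (\<integral>\<^sup>+x. (\<lambda>x. f (T x)) (S t + 1 *\<^sub>R x) \<partial>lborel)"
      using lin SS by (simp add: linear_add add.commute)
    also have "\<dots> = (\<integral>\<^sup>+x. f (T x) \<partial>lborel)"
      by (rule nn_integral_lborel_isometry) auto
    also have "\<dots> = (\<integral>\<^sup>+x. f x \<partial>M)"
      unfolding M_def by (subst nn_integral_distr) auto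
    finally show ?thesis .
  qed
  define Q where "Q = cbox 0 (One :: 'a)"
  have Q: "Q \<in> sets borel" "emeasure lborel Q = 1"
    by (simp_all add: Q_def emeasure_lborel_cbox_eq)
  define k where "k = measure M Q"
  have kQ: "emeasure M Q = ennreal k"
    using fin[of Q] Q by (simp add: k_def Q_def emeasure_eq_ennreal_measure)
  have M_eq: "emeasure M B = emeasure lborel B * ennreal k" if "B \<in> sets borel" for B
    using translation_invariant_proportional[OF sf sets_M inv, of "indicator B" "indicator Q"] that Q kQ sets_M by simp
  have "M = density lborel (\<lambda>_. ennreal k)"
  proof (rule measure_eqI)
    fix B assume "B \<in> sets M"
    then have B: "B \<in> sets borel" by (simp add: sets_M)
    have "emeasure (density lborel (\<lambda>_. ennreal k)) B = ennreal k * emeasure lborel B"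
      using B by (subst emeasure_density) (auto simp: nn_integral_cmult_indicator)
    then show "emeasure M B = emeasure (density lborel (\<lambda>_. ennreal k)) B"
      using M_eq[OF B] by (simp add: mult.commute)
  qed (simp add: sets_M)
  then have eq: "distr lborel borel T = density lborel (\<lambda>_. ennreal k)" by (simp only: M_def)
  have "k \<noteq> 0"
  proof
    assume "k = 0"
    then have "emeasure M UNIV = 0" using M_eq[of UNIV] by simp
    moreover have "emeasure M UNIV = \<infinity>" unfolding M_def by (subst emeasure_distr) auto
    ultimately show False by simp
  qed
  then have "k > 0" using measure_nonneg[of M Q] unfolding k_def by linarith
  then show thesis using that eq by blast
qed

lemma distr_lebesgue_basis:
  fixes b :: "'n::finite \<Rightarrow> real^'n"
  assumes inj: "\<And>c. (\<Sum>i\<in>UNIV. c i *\<^sub>R b i) = 0 \<Longrightarrow> \<forall>i. c i = 0"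
  obtains k where "k > 0"
    "distr (lborel_PiM UNIV) borel (\<lambda>c. \<Sum>i\<in>UNIV. c i *\<^sub>R b i) = density lborel (\<lambda>_. ennreal k)"
proof -
  define T where "T x = (\<Sum>i\<in>UNIV. (x $ i) *\<^sub>R b i)" for x :: "real^'n"
  have lin: "linear T" unfolding T_def
    by (intro linearI) (auto simp: scaleR_add_left sum.distrib scaleR_sum_right)
  have "inj T"
    using lin inj by (auto simp: linear_injective_0 T_def vec_eq_iff)
  then obtain k where k: "k > 0" "distr lborel borel T = density lborel (\<lambda>_. ennreal k)"
    using distr_lborel_linear[OF lin] by blast
  have Tm: "T \<in> borel_measurable borel"
    using linear_continuous_on[of T UNIV] lin by (simp add: borel_measurable_continuous_onI linear_conv_bounded_linear)
  have "distr (distr (lborel_PiM (UNIV :: 'n set)) borel (\<lambda>c. \<chi> i. c i)) borel T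
     = distr (lborel_PiM UNIV) borel (T \<circ> (\<lambda>c. \<chi> i. c i))"
    by (rule distr_distr[OF Tm]) measurable
  also have "T \<circ> (\<lambda>c. \<chi> i. c i) = (\<lambda>c. \<Sum>i\<in>UNIV. c i *\<^sub>R b i)"
    by (auto simp: T_def)
  finally show thesis using that k unfolding distr_lebesgue_vec_lambda by simp
qed

lemma distr_lebesgue_reindex:
  assumes fin: "finite J" and bij: "bij_betw \<epsilon> J E"
  shows "distr (lborel_PiM J) (lborel_PiM E) (\<lambda>y. \<lambda>e\<in>E. y (inv_into J \<epsilon> e)) = lborel_PiM E"
proof (rule product_sigma_finite.PiM_eqI[OF product_sigma_finite_lborel])
  show "finite E" using fin bij bij_betw_finite by blast
  fix A :: "'b \<Rightarrow> real set" assume A: "\<And>i. i \<in> E \<Longrightarrow> A i \<in> sets lborel"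
  interpret product_sigma_finite "\<lambda>_::'a. lborel :: real measure" by (rule product_sigma_finite_lborel)
  have inv: "inv_into J \<epsilon> e \<in> J" if "e \<in> E" for e
    using bij that by (metis bij_betw_imp_surj_on inv_into_into)
  have m: "(\<lambda>y. \<lambda>e\<in>E. y (inv_into J \<epsilon> e)) \<in> measurable (lborel_PiM J) (lborel_PiM E)"
    by (intro measurable_restrict measurable_component_singleton inv)
  have fE: "finite E" using fin bij bij_betw_finite by blast
  have AE: "Pi\<^sub>E E A \<in> sets (lborel_PiM E)" using A fE by (intro sets_PiM_I_finite) auto
  have e: "\<epsilon> j \<in> E" "inv_into J \<epsilon> (\<epsilon> j) = j" if "j \<in> J" for j
    using bij that by (auto simp: bij_betw_def)
  have vim: "(\<lambda>y. \<lambda>e\<in>E. y (inv_into J \<epsilon> e)) -` (Pi\<^sub>E E A) \<inter> space (lborel_PiM J) = Pi\<^sub>E J (\<lambda>j. A (\<epsilon> j))"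
  proof (intro set_eqI iffI)
    fix y assume y: "y \<in> (\<lambda>y. \<lambda>e\<in>E. y (inv_into J \<epsilon> e)) -` (Pi\<^sub>E E A) \<inter> space (lborel_PiM J)"
    have "y j \<in> A (\<epsilon> j)" if "j \<in> J" for j
      using y e[OF that] by (auto simp: PiE_iff)
    then show "y \<in> Pi\<^sub>E J (\<lambda>j. A (\<epsilon> j))" using y by (auto simp: space_PiM PiE_iff)
  next
    fix y assume y: "y \<in> Pi\<^sub>E J (\<lambda>j. A (\<epsilon> j))"
    have "y (inv_into J \<epsilon> x) \<in> A x" if "x \<in> E" for x
    proof -
      have "\<epsilon> (inv_into J \<epsilon> x) = x" using bij that by (metis bij_betw_inv_into_right)
      then show ?thesis using y inv[OF that] by (auto simp: PiE_iff dest: bspec[of J _ "inv_into J \<epsilon> x"])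
    qed
    then show "y \<in> (\<lambda>y. \<lambda>e\<in>E. y (inv_into J \<epsilon> e)) -` (Pi\<^sub>E E A) \<inter> space (lborel_PiM J)"
      using y by (auto simp: space_PiM PiE_iff)
  qed
  have "emeasure (distr (lborel_PiM J) (lborel_PiM E) (\<lambda>y. \<lambda>e\<in>E. y (inv_into J \<epsilon> e))) (Pi\<^sub>E E A)
     = emeasure (lborel_PiM J) (Pi\<^sub>E J (\<lambda>j. A (\<epsilon> j)))"
    unfolding vim[symmetric] by (rule emeasure_distr[OF m AE])
  also have "\<dots> = (\<Prod>j\<in>J. emeasure lborel (A (\<epsilon> j)))"
    using A e(1) fin by (intro emeasure_PiM) auto
  also have "\<dots> = (\<Prod>i\<in>E. emeasure lborel (A i))"
    using bij by (rule prod.reindex_bij_betw)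
  finally show "emeasure (distr (lborel_PiM J) (lborel_PiM E) (\<lambda>y. \<lambda>e\<in>E. y (inv_into J \<epsilon> e))) (Pi\<^sub>E E A)
     = (\<Prod>i\<in>E. emeasure lborel (A i))" .
qed simp

text \<open>\<open>z\<close> labels a fibre and \<open>y\<close> runs along it. Since only the
  entries of \<open>z\<close> outside \<open>I\<close> are read, \<open>join I (vec_nth c) y\<close>
  runs through the fibre containing \<open>c\<close>.\<close>

definition join :: "'n set \<Rightarrow> ('n \<Rightarrow> real) \<Rightarrow> ('n \<Rightarrow> real) \<Rightarrow> real^'n::finite" where
  "join I z y = (\<chi> i. if i \<in> I then y i else z i)"

lemma join_nth [simp]: "join I z y $ i = (if i \<in> I then y i else z i)"
  by (simp add: join_def)

lemma measurable_join [measurable]: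
  "(\<lambda>(z, y). join I z y) \<in> borel_measurable (lborel_PiM (- I) \<Otimes>\<^sub>M lborel_PiM I)"
  unfolding join_def split_beta
proof (rule borel_measurable_vec_lambda)
  fix i
  show "(\<lambda>x. if i \<in> I then snd x i else fst x i) \<in> borel_measurable (lborel_PiM (- I) \<Otimes>\<^sub>M lborel_PiM I)"
  proof (cases "i \<in> I")
    case True
    then have "(\<lambda>x. snd x i) \<in> borel_measurable (lborel_PiM (- I) \<Otimes>\<^sub>M lborel_PiM I)"
      using measurable_compose[OF measurable_snd measurable_component_singleton[OF True]] by simp
    then show ?thesis using True by simp
  next
    case False
    then have "i \<in> - I" by simp
    then have "(\<lambda>x. fst x i) \<in> borel_measurable (lborel_PiM (- I) \<Otimes>\<^sub>M lborel_PiM I)"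
      using measurable_compose[OF measurable_fst measurable_component_singleton] by fastforce
    then show ?thesis using False by simp
  qed
qed

lemma merge_eq_join: "(\<chi> i. merge (- I) I (z, y) i) = join I z y"
  by (auto simp: join_def merge_def vec_eq_iff)

lemma distr_join:
  "distr (lborel_PiM (- I) \<Otimes>\<^sub>M lborel_PiM I) borel (\<lambda>(z, y). join I z y) = (lborel :: (real^'n::finite) measure)"
proof -
  have U: "- I \<union> I = (UNIV :: 'n set)" by auto
  have "distr (distr (lborel_PiM (- I) \<Otimes>\<^sub>M lborel_PiM I) (lborel_PiM (- I \<union> I)) (merge (- I) I)) borel (\<lambda>c. \<chi> i. c i)
     = (lborel :: (real^'n) measure)"
    unfolding product_sigma_finite.distr_merge[OF product_sigma_finite_lborel, of "- I" I, simplified U, simplified]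
    using product_sigma_finite.distr_merge[OF product_sigma_finite_lborel, of "- I" I] distr_lebesgue_vec_lambda[where 'n='n]
    unfolding U by simp
  moreover have "distr (distr (lborel_PiM (- I) \<Otimes>\<^sub>M lborel_PiM I) (lborel_PiM (- I \<union> I)) (merge (- I) I)) borel (\<lambda>c. \<chi> i. c i)
     = distr (lborel_PiM (- I) \<Otimes>\<^sub>M lborel_PiM I) borel ((\<lambda>c. \<chi> i. c i) \<circ> merge (- I) I)"
  proof (rule distr_distr)
    show "(\<lambda>c. \<chi> i. c i) \<in> borel_measurable (lborel_PiM (- I \<union> I))" unfolding U by measurable
  qed measurable
  moreover have "(\<lambda>c. \<chi> i. c i) \<circ> merge (- I) I = (\<lambda>(z, y). join I z y)"
    by (auto simp: fun_eq_iff merge_eq_join)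
  ultimately show ?thesis by simp
qed

lemma nn_integral_join:
  assumes "f \<in> borel_measurable borel"
  shows "(\<integral>\<^sup>+c. f c \<partial>(lborel :: (real^'n::finite) measure))
    = (\<integral>\<^sup>+z. (\<integral>\<^sup>+y. f (join I z y) \<partial>lborel_PiM I) \<partial>lborel_PiM (- I))"
proof -
  interpret I: sigma_finite_measure "lborel_PiM I" by (rule sigma_finite_lborel_PiM) simp
  have "(\<integral>\<^sup>+c. f c \<partial>(lborel :: (real^'n) measure)) = (\<integral>\<^sup>+x. f (case x of (z, y) \<Rightarrow> join I z y) \<partial>(lborel_PiM (- I) \<Otimes>\<^sub>M lborel_PiM I))"
    unfolding distr_join[of I, symmetric] using assms by (intro nn_integral_distr) auto
  also have "\<dots> = (\<integral>\<^sup>+z. (\<integral>\<^sup>+y. f (join I z y) \<partial>lborel_PiM I) \<partial>lborel_PiM (- I))"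
  proof -
    have "(\<lambda>x. f (case x of (z, y) \<Rightarrow> join I z y)) \<in> borel_measurable (lborel_PiM (- I) \<Otimes>\<^sub>M lborel_PiM I)"
      using measurable_compose[OF measurable_join assms] by simp
    from I.nn_integral_fst[OF this] show ?thesis by simp
  qed
  finally show ?thesis .
qed

lemma AE_join:
  assumes "AE c in (lborel :: (real^'n::finite) measure). P c"
  shows "AE z in lborel_PiM (- I). AE y in lborel_PiM I. P (join I z y)"
proof -
  interpret I: sigma_finite_measure "lborel_PiM I" by (rule sigma_finite_lborel_PiM) simp
  interpret J: sigma_finite_measure "lborel_PiM (- I)" by (rule sigma_finite_lborel_PiM) simp
  interpret pair_sigma_finite "lborel_PiM (- I)" "lborel_PiM I" ..
  have "AE x in lborel_PiM (- I) \<Otimes>\<^sub>M lborel_PiM I. P (case x of (z, y) \<Rightarrow> join I z y)"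
    using assms unfolding distr_join[of I, symmetric] by (rule AE_distrD[rotated]) measurable
  from AE_pair[OF this] show ?thesis by simp
qed

lemma AE_join_iff:
  assumes P: "Measurable.pred borel P"
  shows "(AE c in (lborel :: (real^'n::finite) measure). P c) \<longleftrightarrow>
    (AE z in lborel_PiM (- I). AE y in lborel_PiM I. P (join I z y))"
proof
  assume r: "AE z in lborel_PiM (- I). AE y in lborel_PiM I. P (join I z y)"
  let ?f = "\<lambda>c. indicator {c. \<not> P c} c :: ennreal"
  have m: "?f \<in> borel_measurable borel" using P by measurable
  have inner: "(\<integral>\<^sup>+y. ?f (join I z y) \<partial>lborel_PiM I) = 0" if "AE y in lborel_PiM I. P (join I z y)" for z
  proof -
    have "(\<integral>\<^sup>+y. ?f (join I z y) \<partial>lborel_PiM I) = (\<integral>\<^sup>+y. 0 \<partial>lborel_PiM I)"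
      by (rule nn_integral_cong_AE, use that in eventually_elim) simp
    then show ?thesis by simp
  qed
  have "(\<integral>\<^sup>+c. ?f c \<partial>(lborel :: (real^'n) measure)) = (\<integral>\<^sup>+z. 0 \<partial>lborel_PiM (- I))"
    unfolding nn_integral_join[OF m, of I]
    by (rule nn_integral_cong_AE, use r in eventually_elim) (rule inner)
  then have "(\<integral>\<^sup>+c. ?f c \<partial>(lborel :: (real^'n) measure)) = 0" by simp
  moreover have m': "?f \<in> borel_measurable lborel" using m by simp
  ultimately have "AE c in (lborel :: (real^'n) measure). ?f c = 0"
    by (simp only: nn_integral_0_iff_AE[OF m'])
  then show "AE c in (lborel :: (real^'n) measure). P c"
    by eventually_elim (auto simp: indicator_def split: if_splits)
qed (rule AE_join)

lemma integral_join:
  fixes f :: "real^'n::finite \<Rightarrow> 'b::{banach, second_countable_topology}"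
  assumes "integrable lborel f"
  shows "(LINT c|lborel. f c) = (LINT z|lborel_PiM (- I). LINT y|lborel_PiM I. f (join I z y))"
    and "AE z in lborel_PiM (- I). integrable (lborel_PiM I) (\<lambda>y. f (join I z y))"
proof -
  interpret I: sigma_finite_measure "lborel_PiM I" by (rule sigma_finite_lborel_PiM) simp
  interpret J: sigma_finite_measure "lborel_PiM (- I)" by (rule sigma_finite_lborel_PiM) simp
  interpret pair_sigma_finite "lborel_PiM (- I)" "lborel_PiM I" ..
  let ?P = "lborel_PiM (- I) \<Otimes>\<^sub>M lborel_PiM I"
  let ?j = "\<lambda>x. case x of (z, y) \<Rightarrow> join I z y"
  have fm: "f \<in> borel_measurable borel" using assms by simp
  have int: "integrable ?P (\<lambda>x. f (?j x))"
    using assms unfolding distr_join[of I, symmetric] by (subst (asm) integrable_distr_eq) (use fm in auto)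
  have "(LINT c|lborel. f c) = (LINT x|?P. f (?j x))"
    unfolding distr_join[of I, symmetric] using fm by (intro integral_distr) auto
  also have "\<dots> = (LINT z|lborel_PiM (- I). LINT y|lborel_PiM I. f (join I z y))"
    using integral_fst'[OF int] by simp
  finally show "(LINT c|lborel. f c) = (LINT z|lborel_PiM (- I). LINT y|lborel_PiM I. f (join I z y))" .
  show "AE z in lborel_PiM (- I). integrable (lborel_PiM I) (\<lambda>y. f (join I z y))"
    using AE_integrable_fst'[OF int] by simp
qed

lemma measurable_join_snd [measurable]: "(\<lambda>y. join I z y) \<in> borel_measurable (lborel_PiM I)"
  unfolding join_def
proof (rule borel_measurable_vec_lambda)
  fix i show "(\<lambda>y. if i \<in> I then y i else z i) \<in> borel_measurable (lborel_PiM I)"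
    by (cases "i \<in> I") (auto intro: measurable_component_singleton)
qed

section \<open>Lebesgue measure on a subspace in an arbitrary basis\<close>

lemma is_onb_properties:
  assumes "is_onb L E"
  shows "finite E" "independent E" "span E = L" "card E = dim L" "subspace L"
    "\<And>e e'. e \<in> E \<Longrightarrow> e' \<in> E \<Longrightarrow> e \<bullet> e' = (if e = e' then 1 else 0)"
proof -
  have o: "pairwise orthogonal E" "\<And>e. e \<in> E \<Longrightarrow> norm e = 1" "span E = L" using assms by (auto simp: is_onb_def)
  have "0 \<notin> E" using o(2)[of 0] by auto
  then show ind: "independent E" using o by (intro pairwise_orthogonal_independent) auto
  then show "finite E" by (rule independent_imp_finite)
  show "span E = L" by (rule o)
  show "card E = dim L" using dim_span_eq_card_independent[OF ind] o(3) by simp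
  show "subspace L" using o(3) subspace_span by blast
  show "e \<bullet> e' = (if e = e' then 1 else 0)" if "e \<in> E" "e' \<in> E" for e e'
  proof (cases "e = e'")
    case True
    then show ?thesis using o(2)[OF that(1)] by (simp add: norm_eq_1)
  next
    case False
    then show ?thesis using o(1) that by (auto simp: pairwise_def orthogonal_def)
  qed
qed

text \<open>The set on the right is the cylinder over \<open>B\<close> with a unit cube in the
  directions \<open>e\<close>; it does not mention \<open>b\<close>. Two bases \<open>b\<close> with
  the same span therefore give proportional measures.\<close>

lemma distr_lebesgue_basis_cube:
  fixes b e :: "'n::finite \<Rightarrow> real^'n"
  assumes b: "\<And>y. (\<Sum>j\<in>J. y j *\<^sub>R b j) = 0 \<Longrightarrow> \<forall>j\<in>J. y j = 0"
    and orth: "\<And>i j. i \<notin> J \<Longrightarrow> j \<in> J \<Longrightarrow> e i \<bullet> b j = 0"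
    and on: "\<And>i i'. i \<notin> J \<Longrightarrow> i' \<notin> J \<Longrightarrow> e i \<bullet> e i' = (if i = i' then 1 else 0)"
  obtains k where "k > 0" "\<And>B. B \<in> sets borel \<Longrightarrow>
    emeasure (distr (lborel_PiM J) borel (\<lambda>y. \<Sum>j\<in>J. y j *\<^sub>R b j)) B
      = ennreal k * emeasure lborel {x. x - (\<Sum>i\<in>-J. (x \<bullet> e i) *\<^sub>R e i) \<in> B \<and> (\<forall>i\<in>-J. x \<bullet> e i \<in> {0..1})}"
proof -
  define b1 where "b1 i = (if i \<in> J then b i else e i)" for i
  let ?s = "\<lambda>c::'n \<Rightarrow> real. \<Sum>i\<in>UNIV. c i *\<^sub>R b1 i"
  have split: "?s c = (\<Sum>j\<in>J. c j *\<^sub>R b j) + (\<Sum>i\<in>-J. c i *\<^sub>R e i)" for c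
  proof -
    have "?s c = (\<Sum>i\<in>J. c i *\<^sub>R b1 i) + (\<Sum>i\<in>-J. c i *\<^sub>R b1 i)"
      using sum.union_disjoint[of J "-J" "\<lambda>i. c i *\<^sub>R b1 i"] by (simp add: Compl_partition)
    then show ?thesis by (simp add: b1_def)
  qed
  have co: "?s c \<bullet> e i = c i" if "i \<notin> J" for c i
  proof -
    have "(\<Sum>j\<in>J. c j *\<^sub>R b j) \<bullet> e i = 0"
      unfolding inner_sum_left using orth[OF that] by (intro sum.neutral) (simp add: inner_commute)
    moreover have "(\<Sum>i'\<in>-J. c i' *\<^sub>R e i') \<bullet> e i = (\<Sum>i'\<in>-J. if i' = i then c i' else 0)"
      unfolding inner_sum_left using on that by (intro sum.cong) auto
    ultimately show ?thesis unfolding split using that by (simp add: inner_add_left)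
  qed
  have "\<forall>i. c i = 0" if "?s c = 0" for c
  proof -
    have 1: "c i = 0" if "i \<notin> J" for i using co[OF that, of c] \<open>?s c = 0\<close> by simp
    then have "(\<Sum>i\<in>-J. c i *\<^sub>R e i) = 0" by (intro sum.neutral) auto
    then have "(\<Sum>j\<in>J. c j *\<^sub>R b j) = 0" using that split by simp
    with b 1 show ?thesis by blast
  qed
  then obtain k where k: "k > 0" "distr (lborel_PiM UNIV) borel ?s = density lborel (\<lambda>_. ennreal k)"
    using distr_lebesgue_basis[of b1] by blast
  show thesis
  proof (rule that[OF k(1)])
    fix B :: "(real^'n) set" assume B[measurable]: "B \<in> sets borel"
    let ?S = "{x. x - (\<Sum>i\<in>-J. (x \<bullet> e i) *\<^sub>R e i) \<in> B \<and> (\<forall>i\<in>-J. x \<bullet> e i \<in> {0..1})}"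
    let ?m = "lborel_PiM (- J) \<Otimes>\<^sub>M lborel_PiM J"
    interpret J: sigma_finite_measure "lborel_PiM J" by (rule sigma_finite_lborel_PiM) simp
    have S: "?S \<in> sets borel" by measurable
    have sm: "?s \<in> borel_measurable (lborel_PiM UNIV)" by measurable
    have jm: "(\<lambda>y. \<Sum>j\<in>J. y j *\<^sub>R b j) \<in> borel_measurable (lborel_PiM J)"
      by (intro borel_measurable_sum borel_measurable_scaleR measurable_component_singleton) auto
    define A where "A = (\<lambda>y. \<Sum>j\<in>J. y j *\<^sub>R b j) -` B \<inter> space (lborel_PiM J)"
    have A: "A \<in> sets (lborel_PiM J)" unfolding A_def using jm B by (rule measurable_sets)
    have U: "- J \<union> J = (UNIV :: 'n set)" by auto
    have "ennreal k * emeasure lborel ?S = emeasure (distr (lborel_PiM UNIV) borel ?s) ?S"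
      unfolding k(2) using S by (simp add: emeasure_density nn_integral_cmult_indicator)
    also have "\<dots> = emeasure (lborel_PiM UNIV) (?s -` ?S \<inter> space (lborel_PiM UNIV))"
      by (rule emeasure_distr[OF sm]) (use S in simp)
    also have "?s -` ?S \<inter> space (lborel_PiM UNIV) = {c. (\<Sum>j\<in>J. c j *\<^sub>R b j) \<in> B \<and> (\<forall>i\<in>-J. c i \<in> {0..1})}"
    proof -
      have "?s c - (\<Sum>i\<in>-J. (?s c \<bullet> e i) *\<^sub>R e i) = (\<Sum>j\<in>J. c j *\<^sub>R b j)" for c
        using co by (simp add: split)
      then show ?thesis using co by (auto simp: space_PiM)
    qed
    also have "emeasure (lborel_PiM UNIV) \<dots> = emeasure (distr ?m (lborel_PiM UNIV) (merge (- J) J)) \<dots>"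
      using product_sigma_finite.distr_merge[OF product_sigma_finite_lborel, of "- J" J] unfolding U by simp
    also have "\<dots> = emeasure ?m (merge (- J) J -` {c. (\<Sum>j\<in>J. c j *\<^sub>R b j) \<in> B \<and> (\<forall>i\<in>-J. c i \<in> {0..1})} \<inter> space ?m)"
    proof (rule emeasure_distr)
      show "merge (- J) J \<in> measurable ?m (lborel_PiM UNIV)"
        using measurable_merge[of "- J" J "\<lambda>_. lborel :: real measure"] unfolding U .
      have "Measurable.pred (lborel_PiM UNIV) (\<lambda>c. (\<Sum>j\<in>J. c j *\<^sub>R b j) \<in> B \<and> (\<forall>i\<in>-J. c i \<in> {0..1}))" by measurable
      then show "{c. (\<Sum>j\<in>J. c j *\<^sub>R b j) \<in> B \<and> (\<forall>i\<in>-J. c i \<in> {0..1})} \<in> sets (lborel_PiM UNIV)"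
        by (simp add: pred_def space_PiM)
    qed
    also have "merge (- J) J -` {c. (\<Sum>j\<in>J. c j *\<^sub>R b j) \<in> B \<and> (\<forall>i\<in>-J. c i \<in> {0..1})} \<inter> space ?m = Pi\<^sub>E (-J) (\<lambda>_. {0..1}) \<times> A"
      by (auto simp: A_def merge_def space_pair_measure space_PiM PiE_iff)
    also have "emeasure ?m (Pi\<^sub>E (-J) (\<lambda>_. {0..1}) \<times> A) = emeasure (lborel_PiM (- J)) (Pi\<^sub>E (-J) (\<lambda>_. {0..1})) * emeasure (lborel_PiM J) A"
      using A by (intro J.emeasure_pair_measure_Times sets_PiM_I_finite) auto
    also have "emeasure (lborel_PiM (- J)) (Pi\<^sub>E (-J) (\<lambda>_. {0..1})) = (\<Prod>i\<in>-J. emeasure lborel {0..1::real})"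
      by (rule product_sigma_finite.emeasure_PiM[OF product_sigma_finite_lborel]) auto
    also have "\<dots> = 1" by simp
    also have "1 * emeasure (lborel_PiM J) A = emeasure (distr (lborel_PiM J) borel (\<lambda>y. \<Sum>j\<in>J. y j *\<^sub>R b j)) B"
      unfolding A_def using jm B by (simp add: emeasure_distr)
    finally show "emeasure (distr (lborel_PiM J) borel (\<lambda>y. \<Sum>j\<in>J. y j *\<^sub>R b j)) B = ennreal k * emeasure lborel ?S" ..
  qed
qed

text \<open>Two bases of \<open>L\<close> are compared after adding a common unit cube in the orthogonal
  complement, which reduces the claim to the uniqueness of Lebesgue measure on the whole space.\<close>

lemma subspace_lebesgue_basis:
  fixes b :: "'n::finite \<Rightarrow> real^'n"
  assumes b: "\<And>y. (\<Sum>j\<in>J. y j *\<^sub>R b j) = 0 \<Longrightarrow> \<forall>j\<in>J. y j = 0"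
    and sp: "span (b ` J) = L"
  obtains k where "k > 0" "subspace_lebesgue L =
    density (distr (lborel_PiM J) borel (\<lambda>y. \<Sum>j\<in>J. y j *\<^sub>R b j)) (\<lambda>_. ennreal k)"
proof -
  have subL: "subspace L" using sp subspace_span by blast
  have injb: "inj_on b J"
  proof (rule inj_onI)
    fix i j assume ij: "i \<in> J" "j \<in> J" "b i = b j"
    show "i = j"
    proof (rule ccontr)
      assume ne: "i \<noteq> j"
      have "(\<Sum>k\<in>J. (if k = i then 1 else if k = j then -1 else 0) *\<^sub>R b k) = (\<Sum>k\<in>J. (if k = i then b k else 0) - (if k = j then b k else 0))"
        using ne by (intro sum.cong) auto
      also have "\<dots> = 0" using ij by (simp add: sum_subtractf)
      finally show False using b[of "\<lambda>k. if k = i then 1 else if k = j then -1 else 0"] ij(1) by auto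
    qed
  qed
  have indb: "independent (b ` J)"
  proof (rule independent_if_scalars_zero)
    show "finite (b ` J)" by simp
    fix f x assume f: "(\<Sum>x\<in>b ` J. f x *\<^sub>R x) = 0" "x \<in> b ` J"
    have "(\<Sum>j\<in>J. f (b j) *\<^sub>R b j) = 0" using f(1) by (simp add: sum.reindex[OF injb])
    with b[of "\<lambda>j. f (b j)"] f(2) show "f x = 0" by auto
  qed
  have dimL: "dim L = card J"
    using dim_span_eq_card_independent[OF indb] sp card_image[OF injb] by simp
  define E where "E = some_onb L"
  have E: "is_onb L E" unfolding E_def by (rule is_onb_some_onb[OF subL])
  note Ep = is_onb_properties[OF E]
  have "card J = card E" using Ep dimL by simp
  then obtain \<epsilon> where eps: "bij_betw \<epsilon> J E"
    using finite_same_card_bij[of J E] Ep(1) by auto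
  define L' where "L' = L\<^sup>\<bottom>"
  have subL': "subspace L'" unfolding L'_def by (rule subspace_orthogonal_comp)
  define E' where "E' = some_onb L'"
  have E': "is_onb L' E'" unfolding E'_def by (rule is_onb_some_onb[OF subL'])
  note Ep' = is_onb_properties[OF E']
  have "dim L + dim L' = CARD('n)"
  proof -
    have "L' = {y \<in> UNIV. \<forall>x\<in>L. orthogonal x y}" by (auto simp: L'_def orthogonal_comp_def)
    then show ?thesis using dim_subspace_orthogonal_to_vectors[OF subL subspace_UNIV subset_UNIV] by simp
  qed
  then have "card (- J) = card E'" using dimL Ep' by (simp add: Compl_eq_Diff_UNIV card_Diff_subset)
  then obtain e where e: "bij_betw e (- J) E'"
    using finite_same_card_bij[of "- J" E'] Ep'(1) by auto
  have eE: "e i \<in> E'" if "i \<notin> J" for i using e that by (auto simp: bij_betw_def)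
  have eL: "e i \<bullet> x = 0" if "i \<notin> J" "x \<in> L" for i x
  proof -
    have "e i \<in> L'" using span_base[OF eE[OF that(1)]] unfolding Ep'(3) .
    then show ?thesis using that(2) by (auto simp: L'_def orthogonal_comp_def orthogonal_def inner_commute)
  qed
  have on: "e i \<bullet> e i' = (if i = i' then 1 else 0)" if "i \<notin> J" "i' \<notin> J" for i i'
  proof -
    have "e i = e i' \<longleftrightarrow> i = i'" using that e by (intro inj_on_eq_iff[of e "- J"]) (auto simp: bij_betw_def)
    then show ?thesis using Ep'(6)[OF eE[OF that(1)] eE[OF that(2)]] by simp
  qed
  have bL: "b j \<in> L" if "j \<in> J" for j using span_base[of "b j" "b ` J"] that unfolding sp by simp
  have epsE: "\<epsilon> j \<in> E" if "j \<in> J" for j using eps that by (auto simp: bij_betw_def)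
  have epsL: "\<epsilon> j \<in> L" if "j \<in> J" for j using span_base[OF epsE[OF that]] unfolding Ep(3) .
  have epsi: "\<forall>j\<in>J. y j = 0" if z: "(\<Sum>j\<in>J. y j *\<^sub>R \<epsilon> j) = 0" for y
  proof
    fix j assume j: "j \<in> J"
    have "\<epsilon> i \<bullet> \<epsilon> j = (if i = j then 1 else 0)" if "i \<in> J" for i
    proof -
      have "\<epsilon> i = \<epsilon> j \<longleftrightarrow> i = j" using that j eps by (intro inj_on_eq_iff[of \<epsilon> J]) (auto simp: bij_betw_def)
      then show ?thesis using Ep(6)[OF epsE[OF that] epsE[OF j]] by simp
    qed
    then have "(\<Sum>i\<in>J. y i *\<^sub>R \<epsilon> i) \<bullet> \<epsilon> j = (\<Sum>i\<in>J. if i = j then y i else 0)"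
      unfolding inner_sum_left by (intro sum.cong) auto
    then show "y j = 0" using z j by simp
  qed
  have ob: "e i \<bullet> b j = 0" and oe: "e i \<bullet> \<epsilon> j = 0" if "i \<notin> J" "j \<in> J" for i j
    using eL[OF that(1)] bL[OF that(2)] epsL[OF that(2)] by blast+
  let ?S = "\<lambda>B. {x. x - (\<Sum>i\<in>-J. (x \<bullet> e i) *\<^sub>R e i) \<in> B \<and> (\<forall>i\<in>-J. x \<bullet> e i \<in> {0..1})}"
  obtain k1 where k1: "k1 > 0" "\<And>B. B \<in> sets borel \<Longrightarrow>
     emeasure (distr (lborel_PiM J) borel (\<lambda>y. \<Sum>j\<in>J. y j *\<^sub>R b j)) B = ennreal k1 * emeasure lborel (?S B)"
    by (rule distr_lebesgue_basis_cube[where J=J and b=b and e=e, OF b ob on]) simp_all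
  obtain k2 where k2: "k2 > 0" "\<And>B. B \<in> sets borel \<Longrightarrow>
     emeasure (distr (lborel_PiM J) borel (\<lambda>y. \<Sum>j\<in>J. y j *\<^sub>R \<epsilon> j)) B = ennreal k2 * emeasure lborel (?S B)"
    by (rule distr_lebesgue_basis_cube[where J=J and b=\<epsilon> and e=e, OF epsi oe on]) simp_all
  have L: "subspace_lebesgue L = distr (lborel_PiM J) borel (\<lambda>y. \<Sum>j\<in>J. y j *\<^sub>R \<epsilon> j)"
  proof -
    have inv: "inv_into J \<epsilon> x \<in> J" if "x \<in> E" for x
      using eps that by (metis bij_betw_imp_surj_on inv_into_into)
    have m1: "(\<lambda>y. \<lambda>x\<in>E. y (inv_into J \<epsilon> x)) \<in> measurable (lborel_PiM J) (lborel_PiM E)"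
      by (intro measurable_restrict measurable_component_singleton inv)
    have m2: "(\<lambda>c. \<Sum>x\<in>E. c x *\<^sub>R x) \<in> borel_measurable (lborel_PiM E)"
      by (intro borel_measurable_sum borel_measurable_scaleR measurable_component_singleton) auto
    have "subspace_lebesgue L = distr (lborel_PiM E) borel (\<lambda>c. \<Sum>x\<in>E. c x *\<^sub>R x)"
      by (simp add: subspace_lebesgue_def E_def)
    also have "\<dots> = distr (distr (lborel_PiM J) (lborel_PiM E) (\<lambda>y. \<lambda>x\<in>E. y (inv_into J \<epsilon> x))) borel (\<lambda>c. \<Sum>x\<in>E. c x *\<^sub>R x)"
      by (subst distr_lebesgue_reindex[OF _ eps]) auto
    also have "\<dots> = distr (lborel_PiM J) borel ((\<lambda>c. \<Sum>x\<in>E. c x *\<^sub>R x) \<circ> (\<lambda>y. \<lambda>x\<in>E. y (inv_into J \<epsilon> x)))"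
      by (rule distr_distr[OF m2 m1])
    also have "(\<lambda>c. \<Sum>x\<in>E. c x *\<^sub>R x) \<circ> (\<lambda>y. \<lambda>x\<in>E. y (inv_into J \<epsilon> x)) = (\<lambda>y. \<Sum>j\<in>J. y j *\<^sub>R \<epsilon> j)"
    proof
      fix y
      have "(\<Sum>x\<in>E. y (inv_into J \<epsilon> x) *\<^sub>R x) = (\<Sum>j\<in>J. y (inv_into J \<epsilon> (\<epsilon> j)) *\<^sub>R \<epsilon> j)"
        by (rule sum.reindex_bij_betw[OF eps, symmetric])
      also have "\<dots> = (\<Sum>j\<in>J. y j *\<^sub>R \<epsilon> j)"
        using eps by (intro sum.cong) (auto simp: bij_betw_def)
      finally show "((\<lambda>c. \<Sum>x\<in>E. c x *\<^sub>R x) \<circ> (\<lambda>y. \<lambda>x\<in>E. y (inv_into J \<epsilon> x))) y = (\<Sum>j\<in>J. y j *\<^sub>R \<epsilon> j)" by simp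
    qed
    finally show ?thesis .
  qed
  have "subspace_lebesgue L = density (distr (lborel_PiM J) borel (\<lambda>y. \<Sum>j\<in>J. y j *\<^sub>R b j)) (\<lambda>_. ennreal (k2 / k1))"
  proof (rule measure_eqI)
    fix B assume "B \<in> sets (subspace_lebesgue L)"
    then have B: "B \<in> sets borel" by (simp add: L)
    have "emeasure (density (distr (lborel_PiM J) borel (\<lambda>y. \<Sum>j\<in>J. y j *\<^sub>R b j)) (\<lambda>_. ennreal (k2 / k1))) B
       = ennreal (k2 / k1) * emeasure (distr (lborel_PiM J) borel (\<lambda>y. \<Sum>j\<in>J. y j *\<^sub>R b j)) B"
      using B by (subst emeasure_density) (auto simp: nn_integral_cmult_indicator)
    also have "\<dots> = emeasure (subspace_lebesgue L) B"
    proof -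
      have "ennreal (k2 / k1) * (ennreal k1 * X) = ennreal k2 * X" for X
        using k1(1) k2(1) by (simp add: mult.assoc[symmetric] ennreal_mult'[symmetric])
      then show ?thesis unfolding L k2(2)[OF B] k1(2)[OF B] .
    qed
    finally show "emeasure (subspace_lebesgue L) B = emeasure (density (distr (lborel_PiM J) borel (\<lambda>y. \<Sum>j\<in>J. y j *\<^sub>R b j)) (\<lambda>_. ennreal (k2 / k1))) B" ..
  qed (simp add: L)
  moreover have "k2 / k1 > 0" using k1 k2 by simp
  ultimately show thesis using that by blast
qed

section \<open>Operators given by a partial Fourier transform\<close>

lemma L2_add:
  assumes "f \<in> L2" "g \<in> L2"
  shows "(\<lambda>x. f x + g x) \<in> L2"
  unfolding L2_def mem_Collect_eq
proof
  have [measurable]: "f \<in> borel_measurable borel" "g \<in> borel_measurable borel" using assms by (auto simp: L2_def)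
  show "(\<lambda>x. f x + g x) \<in> borel_measurable borel" by measurable
  show "integrable lborel (\<lambda>x. (norm (f x + g x))\<^sup>2)"
  proof (rule Bochner_Integration.integrable_bound)
    show "integrable lborel (\<lambda>x. 2 * (norm (f x))\<^sup>2 + 2 * (norm (g x))\<^sup>2)"
      using assms by (auto simp: L2_def)
  qed (use norm_add_sq_le in \<open>auto intro!: AE_I2\<close>)
qed

lemma L2_cmult: "f \<in> L2 \<Longrightarrow> (\<lambda>x. c * f x) \<in> L2"
  by (auto simp: L2_def norm_mult power_mult_distrib)

lemma L2_diff: "f \<in> L2 \<Longrightarrow> g \<in> L2 \<Longrightarrow> (\<lambda>x. f x - g x) \<in> L2"
  using L2_add[of f "\<lambda>x. - 1 * g x"] L2_cmult[of g "- 1"] by simp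

lemma L2_measurable: "f \<in> L2 \<Longrightarrow> f \<in> borel_measurable borel"
  by (simp add: L2_def)

lemma L2_bound:
  assumes "g \<in> L2" "f \<in> borel_measurable borel" "\<And>x. norm (f x) \<le> norm (g x)"
  shows "f \<in> L2"
  unfolding L2_def mem_Collect_eq
proof (intro conjI assms(2))
  show "integrable lborel (\<lambda>x. (norm (f x))\<^sup>2)"
  proof (rule Bochner_Integration.integrable_bound)
    show "integrable lborel (\<lambda>x. (norm (g x))\<^sup>2)" using assms(1) by (simp add: L2_def)
    show "(\<lambda>x. (norm (f x))\<^sup>2) \<in> borel_measurable lborel" using assms(2) by measurable
  qed (use assms(3) in \<open>auto intro!: AE_I2 power_mono\<close>)
qed

text \<open>The inequality x y \<le> x^2 / d + d y^2 with a free parameter \<open>d\<close> replaces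
  Cauchy-Schwarz: if the first norm is of order \<open>d\<close>, the whole bound is.\<close>

lemma L2_mult_integrable:
  assumes f: "f \<in> L2" and g: "g \<in> L2"
  shows "integrable lborel (\<lambda>x. f x * g x)"
    and "d > 0 \<Longrightarrow> norm (LINT x|lborel. f x * g x) \<le> (LINT x|lborel. (norm (f x))\<^sup>2) / d + d * (LINT x|lborel. (norm (g x))\<^sup>2)"
proof -
  have fi: "integrable lborel (\<lambda>x. (norm (f x))\<^sup>2)" and gi: "integrable lborel (\<lambda>x. (norm (g x))\<^sup>2)"
    using assms by (auto simp: L2_def)
  have m: "(\<lambda>x. f x * g x) \<in> borel_measurable lborel"
    using L2_measurable[OF f] L2_measurable[OF g] by (intro borel_measurable_times) auto
  have bd: "norm (f x * g x) \<le> (norm (f x))\<^sup>2 / d + d * (norm (g x))\<^sup>2" if "d > 0" for x d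
  proof -
    have "0 \<le> (norm (f x) - d * norm (g x))\<^sup>2" by simp
    then have 1: "2 * d * (norm (f x) * norm (g x)) \<le> (norm (f x))\<^sup>2 + d\<^sup>2 * (norm (g x))\<^sup>2"
      by (simp add: power2_diff power_mult_distrib algebra_simps)
    have "0 \<le> d * (norm (f x) * norm (g x))" using that by simp
    with 1 have "d * (norm (f x) * norm (g x)) \<le> (norm (f x))\<^sup>2 + d\<^sup>2 * (norm (g x))\<^sup>2" by simp
    then have "norm (f x) * norm (g x) \<le> ((norm (f x))\<^sup>2 + d\<^sup>2 * (norm (g x))\<^sup>2) / d"
      using that by (simp add: pos_le_divide_eq mult.commute)
    then show ?thesis using that by (simp add: norm_mult add_divide_distrib power2_eq_square)
  qed
  show int: "integrable lborel (\<lambda>x. f x * g x)"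
  proof (rule Bochner_Integration.integrable_bound[OF _ m])
    show "integrable lborel (\<lambda>x. (norm (f x))\<^sup>2 / 1 + 1 * (norm (g x))\<^sup>2)" using fi gi by simp
    show "AE x in lborel. norm (f x * g x) \<le> norm ((norm (f x))\<^sup>2 / 1 + 1 * (norm (g x))\<^sup>2)"
      using bd[of 1] by (intro AE_I2) (metis abs_ge_self order_trans real_norm_def zero_less_one)
  qed
  assume d: "d > 0"
  have "norm (LINT x|lborel. f x * g x) \<le> (LINT x|lborel. norm (f x * g x))" by (rule integral_norm_bound)
  also have "\<dots> \<le> (LINT x|lborel. (norm (f x))\<^sup>2 / d + d * (norm (g x))\<^sup>2)"
    by (intro integral_mono integrable_norm int Bochner_Integration.integrable_add integrable_divide integrable_mult_right fi gi bd d)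
  also have "\<dots> = (LINT x|lborel. (norm (f x))\<^sup>2) / d + d * (LINT x|lborel. (norm (g x))\<^sup>2)"
    using fi gi by simp
  finally show "norm (LINT x|lborel. f x * g x) \<le> (LINT x|lborel. (norm (f x))\<^sup>2) / d + d * (LINT x|lborel. (norm (g x))\<^sup>2)" .
qed

lemma integrable_prod_coordinates:
  fixes f :: "'n::finite \<Rightarrow> real \<Rightarrow> 'b::{real_normed_field, banach, second_countable_topology}"
  assumes "\<And>i. integrable lborel (f i)"
  shows "integrable lborel (\<lambda>c::real^'n. \<Prod>i\<in>UNIV. f i (c $ i))"
proof -
  interpret product_sigma_finite "\<lambda>_::'n. lborel :: real measure" by (rule product_sigma_finite_lborel)
  have "integrable (lborel_PiM UNIV) (\<lambda>x. \<Prod>i\<in>(UNIV::'n set). f i (x i))"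
    by (rule product_integrable_prod) (use assms in auto)
  then have "integrable (lborel_PiM UNIV) (\<lambda>x. (\<lambda>c::real^'n. \<Prod>i\<in>UNIV. f i (c $ i)) (\<chi> i. x i))" by simp
  moreover have "(\<lambda>c::real^'n. \<Prod>i\<in>UNIV. f i (c $ i)) \<in> borel_measurable borel"
  proof (rule borel_measurable_prod)
    fix i :: 'n
    have "f i \<in> borel_measurable borel" using borel_measurable_integrable[OF assms[of i]] by simp
    then show "(\<lambda>c::real^'n. f i (c $ i)) \<in> borel_measurable borel"
      using measurable_compose[OF borel_measurable_vec_nth] by blast
  qed
  ultimately show ?thesis
    unfolding distr_lebesgue_vec_lambda[symmetric] by (subst integrable_distr_eq) auto
qed

text \<open>The entries of \<open>c\<close> outside \<open>I\<close> choose the fibre, those in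
  \<open>I\<close> are the frequency. On a fibre where the integrand is not integrable the value is
  0 by convention.\<close>

definition partial_fourier :: "'n::finite set \<Rightarrow> (real^'n \<Rightarrow> complex) \<Rightarrow> real^'n \<Rightarrow> complex" where
  "partial_fourier I F c =
     (LINT y|lborel_PiM I. F (join I (vec_nth c) y) * cis (- 2 * pi * (\<Sum>i\<in>I. c $ i * y i)))"

lemma join_join: "join I (vec_nth (join I z x)) y = join I z y"
  by (simp add: vec_eq_iff)

lemma partial_fourier_join:
  "partial_fourier I F (join I z x) = (LINT y|lborel_PiM I. F (join I z y) * cis (- 2 * pi * (\<Sum>i\<in>I. x i * y i)))"
  unfolding partial_fourier_def join_join by simp

lemma cis_measurable [measurable (raw)]:
  "f \<in> borel_measurable M \<Longrightarrow> (\<lambda>x. cis (f x)) \<in> borel_measurable M"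
  unfolding cis_conv_exp by measurable

lemma component_measurable: "i \<in> J \<Longrightarrow> (\<lambda>x. x i) \<in> borel_measurable (lborel_PiM J)"
  using measurable_component_singleton[of i J "\<lambda>_. lborel :: real measure"] by simp

lemma measurable_join_pair [measurable]:
  "(\<lambda>x. join I (vec_nth (fst x)) (snd x)) \<in> borel_measurable (borel \<Otimes>\<^sub>M lborel_PiM I)"
  unfolding join_def
proof (rule borel_measurable_vec_lambda)
  fix i
  show "(\<lambda>x. if i \<in> I then snd x i else vec_nth (fst x) i) \<in> borel_measurable (borel \<Otimes>\<^sub>M lborel_PiM I)"
  proof (cases "i \<in> I")
    case True
    have "(\<lambda>x. snd x i) \<in> borel_measurable (borel \<Otimes>\<^sub>M lborel_PiM I)"
      by (rule measurable_compose[OF measurable_snd component_measurable[OF True]])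
    then show ?thesis using True by simp
  next
    case False
    have "(\<lambda>x. vec_nth (fst x) i :: real) \<in> borel_measurable (borel \<Otimes>\<^sub>M lborel_PiM I)"
      by (rule measurable_compose[OF measurable_fst borel_measurable_vec_nth])
    then show ?thesis using False by simp
  qed
qed

lemma measurable_coord_sum [measurable]:
  "(\<lambda>x. \<Sum>i\<in>I. vec_nth (fst x) i * snd x i) \<in> borel_measurable (borel \<Otimes>\<^sub>M lborel_PiM I)"
proof (intro borel_measurable_sum borel_measurable_times)
  fix i assume "i \<in> I"
  then show "(\<lambda>x. snd x i) \<in> borel_measurable (borel \<Otimes>\<^sub>M lborel_PiM I)"
    by (intro measurable_compose[OF measurable_snd component_measurable])
  show "(\<lambda>x. vec_nth (fst x) i :: real) \<in> borel_measurable (borel \<Otimes>\<^sub>M lborel_PiM I)"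
    by (rule measurable_compose[OF measurable_fst borel_measurable_vec_nth])
qed

lemma partial_fourier_measurable:
  assumes [measurable]: "F \<in> borel_measurable borel"
  shows "partial_fourier I F \<in> borel_measurable borel"
proof -
  interpret I: sigma_finite_measure "lborel_PiM I" by (rule sigma_finite_lborel_PiM) simp
  have "(\<lambda>x. F (join I (vec_nth (fst x)) (snd x)) * cis (- 2 * pi * (\<Sum>i\<in>I. vec_nth (fst x) i * snd x i)))
     \<in> borel_measurable (borel \<Otimes>\<^sub>M lborel_PiM I)" by measurable
  then have "(\<lambda>c. LINT y|lborel_PiM I. F (join I (vec_nth c) y) * cis (- 2 * pi * (\<Sum>i\<in>I. c $ i * y i))) \<in> borel_measurable borel"
    by (intro I.borel_measurable_lebesgue_integral) (simp add: split_beta)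
  then show ?thesis unfolding partial_fourier_def[abs_def] .
qed

lemma fibre_norm_measurable:
  assumes [measurable]: "F \<in> borel_measurable borel"
  shows "(\<lambda>c. \<integral>\<^sup>+y. ennreal (norm (F (join I (vec_nth c) y))) \<partial>lborel_PiM I) \<in> borel_measurable borel"
proof -
  interpret I: sigma_finite_measure "lborel_PiM I" by (rule sigma_finite_lborel_PiM) simp
  have "(\<lambda>x. ennreal (norm (F (join I (vec_nth (fst x)) (snd x))))) \<in> borel_measurable (borel \<Otimes>\<^sub>M lborel_PiM I)" by measurable
  then show ?thesis by (intro I.borel_measurable_nn_integral) (simp add: split_beta)
qed

text \<open>The multiplication formula for the Fourier transform, by Fubini on each fibre: the phase
  is symmetric in frequency and position. Integrability along fibres does not make the two products
  integrable on the whole space, which is why that is assumed separately.\<close>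

lemma partial_fourier_swap:
  fixes F M :: "real^'n::finite \<Rightarrow> complex"
  assumes F: "F \<in> borel_measurable borel" and M: "M \<in> borel_measurable borel"
    and Ff: "AE z in lborel_PiM (- I). integrable (lborel_PiM I) (\<lambda>y. F (join I z y))"
    and Mf: "AE z in lborel_PiM (- I). integrable (lborel_PiM I) (\<lambda>y. M (join I z y))"
    and i1: "integrable lborel (\<lambda>c. partial_fourier I F c * M c)"
    and i2: "integrable lborel (\<lambda>c. F c * partial_fourier I M c)"
  shows "(LINT c|lborel. partial_fourier I F c * M c) = (LINT c|lborel. F c * partial_fourier I M c)"
proof -
  interpret I: sigma_finite_measure "lborel_PiM I" by (rule sigma_finite_lborel_PiM) simp
  interpret II: pair_sigma_finite "lborel_PiM I" "lborel_PiM I" ..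
  let ?P = "lborel_PiM I"
  have key: "(LINT x|?P. partial_fourier I F (join I z x) * M (join I z x)) = (LINT y|?P. F (join I z y) * partial_fourier I M (join I z y))"
    if f: "integrable ?P (\<lambda>y. F (join I z y))" and m: "integrable ?P (\<lambda>y. M (join I z y))" for z
  proof -
    define H where "H x y = F (join I z y) * cis (- 2 * pi * (\<Sum>i\<in>I. x i * y i)) * M (join I z x)" for x y
    have fm: "(\<lambda>y. F (join I z y)) \<in> borel_measurable ?P" using f by simp
    have mm: "(\<lambda>y. M (join I z y)) \<in> borel_measurable ?P" using m by simp
    have s: "(\<lambda>p. \<Sum>i\<in>I. fst p i * snd p i) \<in> borel_measurable (?P \<Otimes>\<^sub>M ?P)"
    proof (intro borel_measurable_sum borel_measurable_times)
      fix i assume "i \<in> I"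
      then have c: "(\<lambda>x. x i) \<in> borel_measurable ?P" by (rule component_measurable)
      show "(\<lambda>p. fst p i) \<in> borel_measurable (?P \<Otimes>\<^sub>M ?P)" "(\<lambda>p. snd p i) \<in> borel_measurable (?P \<Otimes>\<^sub>M ?P)"
        using measurable_compose[OF measurable_fst c] measurable_compose[OF measurable_snd c] by auto
    qed
    have Hm: "(\<lambda>(x, y). H x y) \<in> borel_measurable (?P \<Otimes>\<^sub>M ?P)"
      unfolding H_def split_beta
      by (intro borel_measurable_times cis_measurable measurable_compose[OF measurable_fst mm] measurable_compose[OF measurable_snd fm] s) auto
    have nH: "norm (H x y) = norm (M (join I z x)) * norm (F (join I z y))" for x y
      by (simp add: H_def norm_mult)
    have Hx: "integrable ?P (\<lambda>y. H x y)" if "x \<in> space ?P" for x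
    proof (rule Bochner_Integration.integrable_bound)
      show "integrable ?P (\<lambda>y. norm (M (join I z x)) * norm (F (join I z y)))" using f by simp
      show "(\<lambda>y. H x y) \<in> borel_measurable ?P"
        using measurable_compose[OF measurable_Pair1'[OF that] Hm] by simp
    qed (simp add: nH)
    have int: "integrable (?P \<Otimes>\<^sub>M ?P) (\<lambda>(x, y). H x y)"
    proof (rule II.Fubini_integrable[OF Hm])
      show "integrable ?P (\<lambda>x. LINT y|?P. norm (case (x, y) of (x, y) \<Rightarrow> H x y))"
        using m by (simp add: nH)
      show "AE x in ?P. integrable ?P (\<lambda>y. case (x, y) of (x, y) \<Rightarrow> H x y)"
        using Hx by (intro AE_I2) simp
    qed
    have "(LINT x|?P. partial_fourier I F (join I z x) * M (join I z x)) = (LINT x|?P. LINT y|?P. H x y)"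
      unfolding partial_fourier_join H_def by simp
    also have "\<dots> = (LINT y|?P. LINT x|?P. H x y)"
      using II.Fubini_integral[OF int] by simp
    also have "\<dots> = (LINT y|?P. F (join I z y) * partial_fourier I M (join I z y))"
    proof -
      have "H x y = F (join I z y) * (M (join I z x) * cis (- 2 * pi * (\<Sum>i\<in>I. y i * x i)))" for x y
        by (simp add: H_def mult_ac)
      then show ?thesis unfolding partial_fourier_join by simp
    qed
    finally show ?thesis .
  qed
  show ?thesis
    unfolding integral_join(1)[OF i1, of I] integral_join(1)[OF i2, of I]
  proof (rule integral_cong_AE)
    have m1: "(\<lambda>p. case p of (z, x) \<Rightarrow> (\<lambda>c. partial_fourier I F c * M c) (join I z x)) \<in> borel_measurable (lborel_PiM (- I) \<Otimes>\<^sub>M ?P)"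
      using measurable_compose[OF measurable_join borel_measurable_times[OF partial_fourier_measurable[OF F] M]] by (simp add: split_beta)
    have m2: "(\<lambda>p. case p of (z, x) \<Rightarrow> (\<lambda>c. F c * partial_fourier I M c) (join I z x)) \<in> borel_measurable (lborel_PiM (- I) \<Otimes>\<^sub>M ?P)"
      using measurable_compose[OF measurable_join borel_measurable_times[OF F partial_fourier_measurable[OF M]]] by (simp add: split_beta)
    show "(\<lambda>z. LINT y|?P. partial_fourier I F (join I z y) * M (join I z y)) \<in> borel_measurable (lborel_PiM (- I))"
      using I.borel_measurable_lebesgue_integral[OF m1] by simp
    show "(\<lambda>z. LINT y|?P. F (join I z y) * partial_fourier I M (join I z y)) \<in> borel_measurable (lborel_PiM (- I))"
      using I.borel_measurable_lebesgue_integral[OF m2] by simp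
    show "AE z in lborel_PiM (- I). (LINT y|?P. partial_fourier I F (join I z y) * M (join I z y)) = (LINT y|?P. F (join I z y) * partial_fourier I M (join I z y))"
      using Ff Mf by eventually_elim (rule key)
  qed
qed

text \<open>A product over the coordinates, so that fibre integrals factor; varying \<open>t\<close>
  modulates it by all characters, which later produces Fourier integrals.\<close>

definition test_fun :: "real^'n::finite \<Rightarrow> (real^'n) set \<Rightarrow> real^'n \<Rightarrow> complex" where
  "test_fun t A c = (\<Prod>i\<in>UNIV. of_real (exp (- 1 * (c $ i)\<^sup>2)) * cis (t $ i * c $ i)) * indicator A c"

definition fibre_set :: "'n::finite set \<Rightarrow> (real^'n) set \<Rightarrow> bool" where
  "fibre_set I A \<longleftrightarrow> A \<in> sets borel \<and> (\<forall>c y. join I (vec_nth c) y \<in> A \<longleftrightarrow> c \<in> A)"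

lemma test_fun_measurable [measurable (raw)]:
  assumes [measurable]: "A \<in> sets borel"
  shows "test_fun t A \<in> borel_measurable borel"
  unfolding test_fun_def[abs_def] by measurable

lemma norm_test_fun_le: "norm (test_fun t A c) \<le> (\<Prod>i\<in>UNIV. exp (- 1 * (c $ i)\<^sup>2))"
proof -
  have "norm (\<Prod>i\<in>UNIV. of_real (exp (- 1 * (c $ i)\<^sup>2)) * cis (t $ i * c $ i)) = (\<Prod>i\<in>UNIV. exp (- 1 * (c $ i)\<^sup>2))"
    by (simp add: norm_mult flip: prod_norm)
  then show ?thesis by (auto simp: test_fun_def norm_mult indicator_def intro: prod_nonneg)
qed

lemma prod_gaussian_L2:
  assumes "\<And>i. v i > 0"
  shows "(\<lambda>c::real^'n. complex_of_real (\<Prod>i\<in>UNIV. K i * exp (- v i * (c $ i - s i)\<^sup>2))) \<in> L2"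
    and "integrable lborel (\<lambda>c::real^'n. (\<Prod>i\<in>UNIV. K i * exp (- v i * (c $ i - s i)\<^sup>2)))"
proof -
  have g: "integrable lborel (\<lambda>x. K * exp (- a * (x - s)\<^sup>2))" if "a > 0" for a s K :: real
    using lborel_integrable_real_affine[OF integrable_gaussian[OF that], of 1 "- s"] by simp
  show "integrable lborel (\<lambda>c::real^'n. (\<Prod>i\<in>UNIV. K i * exp (- v i * (c $ i - s i)\<^sup>2)))"
    by (intro integrable_prod_coordinates g assms)
  have "integrable lborel (\<lambda>c::real^'n. (\<Prod>i\<in>UNIV. (K i)\<^sup>2 * exp (- (2 * v i) * (c $ i - s i)\<^sup>2)))"
    using assms by (intro integrable_prod_coordinates g) simp
  moreover have "(norm (complex_of_real (\<Prod>i\<in>UNIV. K i * exp (- v i * (c $ i - s i)\<^sup>2))))\<^sup>2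
      = (\<Prod>i\<in>UNIV. (K i)\<^sup>2 * exp (- (2 * v i) * (c $ i - s i)\<^sup>2))" for c :: "real^'n"
  proof -
    have "(exp a)\<^sup>2 = exp (2 * a)" for a :: real by (rule exp_double[symmetric])
    then show ?thesis
      unfolding norm_of_real power2_abs prod_power_distrib power_mult_distrib by (simp add: mult.assoc)
  qed
  moreover have "(\<lambda>c::real^'n. complex_of_real (\<Prod>i\<in>UNIV. K i * exp (- v i * (c $ i - s i)\<^sup>2))) \<in> borel_measurable borel"
    by measurable
  ultimately show "(\<lambda>c::real^'n. complex_of_real (\<Prod>i\<in>UNIV. K i * exp (- v i * (c $ i - s i)\<^sup>2))) \<in> L2"
    by (simp add: L2_def)
qed

lemma test_fun_L2:
  assumes "A \<in> sets borel"
  shows "test_fun t A \<in> L2" "integrable lborel (test_fun t A)"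
proof -
  have eq1: "(\<Prod>i\<in>UNIV. 1 * exp (- 1 * (c $ i - 0)\<^sup>2)) = (\<Prod>i\<in>UNIV. exp (- 1 * (c $ i)\<^sup>2))" for c :: "real^'n" by simp
  have m: "test_fun t A \<in> borel_measurable borel" using assms by measurable
  show "test_fun t A \<in> L2"
  proof (rule L2_bound[OF _ m])
    show "(\<lambda>c. complex_of_real (\<Prod>i\<in>UNIV. 1 * exp (- 1 * (c $ i - 0)\<^sup>2))) \<in> L2"
      by (rule prod_gaussian_L2(1)) simp
    show "norm (test_fun t A c) \<le> norm (complex_of_real (\<Prod>i\<in>UNIV. 1 * exp (- 1 * (c $ i - 0)\<^sup>2)))" for c
      unfolding norm_of_real eq1 by (rule order_trans[OF norm_test_fun_le abs_ge_self])
  qed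
  show "integrable lborel (test_fun t A)"
  proof (rule Bochner_Integration.integrable_bound)
    show "integrable lborel (\<lambda>c::real^'n. (\<Prod>i\<in>UNIV. 1 * exp (- 1 * (c $ i - 0)\<^sup>2)))"
      by (rule prod_gaussian_L2(2)) simp
    show "AE c in lborel. norm (test_fun t A c) \<le> norm (\<Prod>i\<in>UNIV. 1 * exp (- 1 * (c $ i - 0)\<^sup>2))"
      unfolding real_norm_def eq1 by (intro AE_I2 order_trans[OF norm_test_fun_le abs_ge_self])
  qed (use m in simp)
qed

text \<open>The indicator of a union of fibres is constant along each fibre and leaves the integral.
  The rest factors into Gaussian transforms in one variable, centred at
  \<open>t $ i / (2 * pi)\<close>.\<close>

lemma partial_fourier_test_fun:
  fixes I :: "'n::finite set"
  assumes A: "fibre_set I A"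
  shows "partial_fourier I (test_fun t A) \<in> L2"
proof -
  have Ab: "A \<in> sets borel" using A by (simp add: fibre_set_def)
  interpret product_sigma_finite "\<lambda>_::'n. lborel :: real measure" by (rule product_sigma_finite_lborel)
  define \<phi> where "\<phi> s x = (LINT y|lborel. complex_of_real (exp (- 1 * y\<^sup>2)) * cis (- 2 * pi * (x - s / (2 * pi)) * y))" for s x :: real
  have phi: "norm (\<phi> s x) = sqrt pi * exp (- (pi\<^sup>2) * (x - s / (2 * pi))\<^sup>2)" for s x
    unfolding \<phi>_def by (subst gaussian_fourier_real) (auto simp: norm_mult)
  have int1: "integrable lborel (\<lambda>y. complex_of_real (exp (- 1 * y\<^sup>2)) * cis (- 2 * pi * (x - s / (2 * pi)) * y))" for s x
  proof (rule Bochner_Integration.integrable_bound)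
    show "integrable lborel (\<lambda>y::real. exp (- 1 * y\<^sup>2))" by (rule integrable_gaussian) simp
  qed (auto simp: norm_mult)
  let ?g = "\<lambda>c i. complex_of_real (exp (- 1 * (c $ i)\<^sup>2)) * cis (t $ i * c $ i)"
  have eq: "partial_fourier I (test_fun t A) c = indicator A c * ((\<Prod>i\<in>-I. ?g c i) * (\<Prod>i\<in>I. \<phi> (t $ i) (c $ i)))" for c
  proof -
    have tf: "test_fun t A (join I (vec_nth c) y) * cis (- 2 * pi * (\<Sum>i\<in>I. c $ i * y i))
       = (indicator A c * (\<Prod>i\<in>-I. ?g c i)) * (\<Prod>i\<in>I. complex_of_real (exp (- 1 * (y i)\<^sup>2)) * cis (- 2 * pi * (c $ i - t $ i / (2 * pi)) * y i))" for y
    proof -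
      let ?j = "join I (vec_nth c) y"
      have i: "indicator A ?j = (indicator A c :: complex)" using A by (simp add: fibre_set_def indicator_def)
      have "(\<Prod>i\<in>UNIV. ?g ?j i) = (\<Prod>i\<in>-I. ?g ?j i) * (\<Prod>i\<in>I. ?g ?j i)"
        using prod.union_disjoint[of "-I" I "?g ?j"] by (simp add: Compl_partition2)
      also have "(\<Prod>i\<in>-I. ?g ?j i) = (\<Prod>i\<in>-I. ?g c i)" by (intro prod.cong) auto
      also have "(\<Prod>i\<in>I. ?g ?j i) = (\<Prod>i\<in>I. complex_of_real (exp (- 1 * (y i)\<^sup>2)) * cis (t $ i * y i))" by (intro prod.cong) auto
      finally have 1: "(\<Prod>i\<in>UNIV. ?g ?j i) = (\<Prod>i\<in>-I. ?g c i) * (\<Prod>i\<in>I. complex_of_real (exp (- 1 * (y i)\<^sup>2)) * cis (t $ i * y i))" .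
      have "cis (- 2 * pi * (\<Sum>i\<in>I. c $ i * y i)) = (\<Prod>i\<in>I. cis (- 2 * pi * (c $ i * y i)))"
      proof -
        have "(\<Prod>i\<in>J. cis (- 2 * pi * (c $ i * y i))) = cis (- 2 * pi * (\<Sum>i\<in>J. c $ i * y i))" if "finite J" for J
          using that by (induction J) (auto simp: cis_mult algebra_simps)
        then show ?thesis by simp
      qed
      then have "(\<Prod>i\<in>I. complex_of_real (exp (- 1 * (y i)\<^sup>2)) * cis (t $ i * y i)) * cis (- 2 * pi * (\<Sum>i\<in>I. c $ i * y i))
          = (\<Prod>i\<in>I. complex_of_real (exp (- 1 * (y i)\<^sup>2)) * cis (t $ i * y i) * cis (- 2 * pi * (c $ i * y i)))"
        by (simp only: prod.distrib)
      also have "\<dots> = (\<Prod>i\<in>I. complex_of_real (exp (- 1 * (y i)\<^sup>2)) * cis (- 2 * pi * (c $ i - t $ i / (2 * pi)) * y i))"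
      proof (rule prod.cong[OF refl])
        fix i
        have "t $ i * y i + - 2 * pi * (c $ i * y i) = - 2 * pi * (c $ i - t $ i / (2 * pi)) * y i"
          by (simp add: field_simps)
        then show "complex_of_real (exp (- 1 * (y i)\<^sup>2)) * cis (t $ i * y i) * cis (- 2 * pi * (c $ i * y i))
          = complex_of_real (exp (- 1 * (y i)\<^sup>2)) * cis (- 2 * pi * (c $ i - t $ i / (2 * pi)) * y i)"
          by (simp only: mult.assoc cis_mult)
      qed
      finally have E: "(\<Prod>i\<in>I. complex_of_real (exp (- 1 * (y i)\<^sup>2)) * cis (t $ i * y i)) * cis (- 2 * pi * (\<Sum>i\<in>I. c $ i * y i))
          = (\<Prod>i\<in>I. complex_of_real (exp (- 1 * (y i)\<^sup>2)) * cis (- 2 * pi * (c $ i - t $ i / (2 * pi)) * y i))" .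
      have "(p1 * p2) * ia * cc = (ia * p1) * (p2 * cc)" for p1 p2 ia cc :: complex by (simp add: mult_ac)
      then show ?thesis unfolding test_fun_def i 1 by (simp only: E)
    qed
    have "partial_fourier I (test_fun t A) c = (indicator A c * (\<Prod>i\<in>-I. ?g c i)) *
       (LINT y|lborel_PiM I. (\<Prod>i\<in>I. complex_of_real (exp (- 1 * (y i)\<^sup>2)) * cis (- 2 * pi * (c $ i - t $ i / (2 * pi)) * y i)))"
      unfolding partial_fourier_def tf by (rule integral_mult_right_zero)
    also have "(LINT y|lborel_PiM I. (\<Prod>i\<in>I. complex_of_real (exp (- 1 * (y i)\<^sup>2)) * cis (- 2 * pi * (c $ i - t $ i / (2 * pi)) * y i)))
       = (\<Prod>i\<in>I. \<phi> (t $ i) (c $ i))"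
      unfolding \<phi>_def by (rule product_integral_prod) (use int1 in auto)
    finally show ?thesis by (simp only: mult.assoc)
  qed
  let ?K = "\<lambda>i. if i \<in> I then sqrt pi else 1"
  let ?v = "\<lambda>i. if i \<in> I then pi\<^sup>2 else 1"
  let ?s = "\<lambda>i. if i \<in> I then t $ i / (2 * pi) else 0"
  show ?thesis
  proof (rule L2_bound)
    show "(\<lambda>c. complex_of_real (\<Prod>i\<in>UNIV. ?K i * exp (- ?v i * (c $ i - ?s i)\<^sup>2))) \<in> L2"
      by (rule prod_gaussian_L2(1)) auto
    show "partial_fourier I (test_fun t A) \<in> borel_measurable borel"
      using Ab by (intro partial_fourier_measurable test_fun_measurable)
    fix c :: "real^'n"
    have "norm (partial_fourier I (test_fun t A) c) \<le> 1 * (norm (\<Prod>i\<in>-I. ?g c i) * norm (\<Prod>i\<in>I. \<phi> (t $ i) (c $ i)))"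
      unfolding eq norm_mult by (intro mult_right_mono) (auto simp: indicator_def)
    also have "norm (\<Prod>i\<in>-I. ?g c i) = (\<Prod>i\<in>-I. ?K i * exp (- ?v i * (c $ i - ?s i)\<^sup>2))"
      unfolding prod_norm[symmetric] by (intro prod.cong) (auto simp: norm_mult)
    also have "norm (\<Prod>i\<in>I. \<phi> (t $ i) (c $ i)) = (\<Prod>i\<in>I. ?K i * exp (- ?v i * (c $ i - ?s i)\<^sup>2))"
      unfolding prod_norm[symmetric] phi by (intro prod.cong) auto
    also have "(\<Prod>i\<in>-I. ?K i * exp (- ?v i * (c $ i - ?s i)\<^sup>2)) * (\<Prod>i\<in>I. ?K i * exp (- ?v i * (c $ i - ?s i)\<^sup>2))
      = (\<Prod>i\<in>UNIV. ?K i * exp (- ?v i * (c $ i - ?s i)\<^sup>2))"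
      using prod.union_disjoint[of "-I" I "\<lambda>i. ?K i * exp (- ?v i * (c $ i - ?s i)\<^sup>2)"] by (simp add: Compl_partition2)
    finally show "norm (partial_fourier I (test_fun t A) c) \<le> norm (complex_of_real (\<Prod>i\<in>UNIV. ?K i * exp (- ?v i * (c $ i - ?s i)\<^sup>2)))"
      unfolding norm_of_real by (simp only: mult_1_left)
  qed
qed

text \<open>Division by \<open>w\<close> is an isometry onto L2 of the finite measure |w|^2 dx
  because \<open>w\<close> vanishes almost nowhere; there trigonometric polynomials are
  dense.\<close>

lemma weighted_trig_poly_dense:
  fixes w F :: "real^'n::finite \<Rightarrow> complex"
  assumes w: "w \<in> L2" "AE c in lborel. w c \<noteq> 0" and F: "F \<in> L2" and e: "e > 0"
  obtains t where "t \<in> trig_poly" "(\<lambda>c. w c * t c) \<in> L2" "(LINT c|lborel. (norm (F c - w c * t c))\<^sup>2) < e"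
proof -
  have wm[measurable]: "w \<in> borel_measurable borel" and Fm[measurable]: "F \<in> borel_measurable borel"
    using w F by (auto simp: L2_def)
  define \<nu> where "\<nu> = density lborel (\<lambda>c. ennreal ((norm (w c))\<^sup>2))"
  have "emeasure \<nu> (space \<nu>) = (\<integral>\<^sup>+c. ennreal ((norm (w c))\<^sup>2) \<partial>lborel)"
    unfolding \<nu>_def by (subst emeasure_density) (auto intro!: nn_integral_cong)
  also have "\<dots> < \<infinity>" using w(1) unfolding L2_def integrable_iff_bounded by simp
  finally have fin: "emeasure \<nu> (space \<nu>) \<noteq> \<infinity>" by simp
  interpret finite_borel_measure \<nu>
    by (intro finite_borel_measure.intro finite_measureI fin finite_borel_measure_axioms.intro) (simp add: \<nu>_def)
  have tr: "integrable \<nu> g \<longleftrightarrow> integrable lborel (\<lambda>c. (norm (w c))\<^sup>2 *\<^sub>R g c)"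
    "integral\<^sup>L \<nu> g = (LINT c|lborel. (norm (w c))\<^sup>2 *\<^sub>R g c)" if "g \<in> borel_measurable borel" for g :: "real^'n \<Rightarrow> real"
  proof -
    have [measurable]: "g \<in> borel_measurable borel" by fact
    show "integrable \<nu> g \<longleftrightarrow> integrable lborel (\<lambda>c. (norm (w c))\<^sup>2 *\<^sub>R g c)"
      unfolding \<nu>_def by (rule integrable_density) auto
    show "integral\<^sup>L \<nu> g = (LINT c|lborel. (norm (w c))\<^sup>2 *\<^sub>R g c)"
      unfolding \<nu>_def by (rule integral_density) auto
  qed
  have fe: "(norm (w c))\<^sup>2 *\<^sub>R (norm (F c / w c - t))\<^sup>2 = (norm (F c - w c * t))\<^sup>2" if "w c \<noteq> 0" for c t
  proof -
    have "w c * (F c / w c - t) = F c - w c * t" using that by (simp add: right_diff_distrib)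
    then have "norm (w c) * norm (F c / w c - t) = norm (F c - w c * t)" by (metis norm_mult)
    then show ?thesis by (simp flip: power_mult_distrib)
  qed
  have "integrable \<nu> (\<lambda>c. (norm (F c / w c))\<^sup>2)"
  proof (subst tr)
    show "(\<lambda>c. (norm (F c / w c))\<^sup>2) \<in> borel_measurable borel" by measurable
    have "integrable lborel (\<lambda>c. (norm (F c))\<^sup>2)" using F by (simp add: L2_def)
    moreover have "AE c in lborel. (norm (F c))\<^sup>2 = (norm (w c))\<^sup>2 *\<^sub>R (norm (F c / w c))\<^sup>2"
      using w(2) by eventually_elim (use fe[of _ 0] in simp)
    ultimately show "integrable lborel (\<lambda>c. (norm (w c))\<^sup>2 *\<^sub>R (norm (F c / w c))\<^sup>2)"
      by (subst (asm) integrable_cong_AE) auto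
  qed
  moreover have "(\<lambda>c. F c / w c) \<in> borel_measurable borel" by measurable
  ultimately obtain t where t: "t \<in> trig_poly" "(LINT c|\<nu>. (norm (F c / w c - t c))\<^sup>2) < e"
    using trig_poly_dense[of "\<lambda>c. F c / w c" e] e by blast
  have tm[measurable]: "t \<in> borel_measurable borel" by (rule trig_poly_measurable[OF t(1)])
  obtain B where B: "\<And>x. norm (t x) \<le> B" using trig_poly_bounded[OF t(1)] by blast
  have wt: "(\<lambda>c. w c * t c) \<in> L2"
  proof (rule L2_bound[OF L2_cmult[OF w(1), of "of_real B"]])
    show "norm (w c * t c) \<le> norm (of_real B * w c)" for c
      using B[of c] mult_left_mono[OF order_trans[OF B abs_ge_self], of "norm (w c)" c] by (simp add: norm_mult mult.commute)
  qed measurable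
  have "(LINT c|\<nu>. (norm (F c / w c - t c))\<^sup>2) = (LINT c|lborel. (norm (w c))\<^sup>2 *\<^sub>R (norm (F c / w c - t c))\<^sup>2)"
    by (rule tr(2)) measurable
  also have "\<dots> = (LINT c|lborel. (norm (F c - w c * t c))\<^sup>2)"
  proof (rule integral_cong_AE)
    show "AE c in lborel. (norm (w c))\<^sup>2 *\<^sub>R (norm (F c / w c - t c))\<^sup>2 = (norm (F c - w c * t c))\<^sup>2"
      using w(2) by eventually_elim (rule fe)
  qed measurable
  finally show thesis using that[OF t(1) wt] t(2) by simp
qed

text \<open>\<open>U\<close> is only known on the functions \<open>w\<close> times a character. Since these span a dense subspace of
  \<open>L\<^sup>2\<close>, the identity extends weakly, against the functions \<open>test_fun\<close>. A \<open>fibre_set\<close> is a union of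
  whole fibres; it is used to cut down to fibres on which \<open>F\<close> has a bounded \<open>L\<^sup>1\<close> norm.\<close>

locale partial_fourier_op =
  fixes I :: "'n::finite set" and U :: "(real^'n \<Rightarrow> complex) \<Rightarrow> (real^'n \<Rightarrow> complex)"
    and \<kappa> :: complex and w :: "real^'n \<Rightarrow> complex" and K :: real
  assumes U_L2: "F \<in> L2 \<Longrightarrow> U F \<in> L2"
    and U_add: "F \<in> L2 \<Longrightarrow> G \<in> L2 \<Longrightarrow> AE c in lborel. U (\<lambda>x. F x + G x) c = U F c + U G c"
    and U_scale: "F \<in> L2 \<Longrightarrow> AE c in lborel. U (\<lambda>x. a * F x) c = a * U F c"
    and U_bounded: "F \<in> L2 \<Longrightarrow> (LINT c|lborel. (norm (U F c))\<^sup>2) \<le> K * (LINT c|lborel. (norm (F c))\<^sup>2)"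
    and w: "w \<in> L2" "integrable lborel w" "AE c in lborel. w c \<noteq> 0"
    and U_char: "AE c in lborel. U (\<lambda>x. w x * cis (s \<bullet> x)) c = \<kappa> * partial_fourier I (\<lambda>x. w x * cis (s \<bullet> x)) c"
    and \<kappa>: "\<kappa> \<noteq> 0"
begin

lemma w_trig_L2: "t \<in> trig_poly \<Longrightarrow> (\<lambda>c. w c * t c) \<in> L2"
proof -
  assume t: "t \<in> trig_poly"
  obtain B where B: "\<And>x. norm (t x) \<le> B" using trig_poly_bounded[OF t] by blast
  show ?thesis
  proof (rule L2_bound[OF L2_cmult[OF w(1), of "of_real B"]])
    show "(\<lambda>c. w c * t c) \<in> borel_measurable borel"
      using L2_measurable[OF w(1)] trig_poly_measurable[OF t] by (rule borel_measurable_times)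
    show "norm (w c * t c) \<le> norm (of_real B * w c)" for c
      using B[of c] mult_left_mono[OF order_trans[OF B abs_ge_self], of "norm (w c)" c] by (simp add: norm_mult mult.commute)
  qed
qed

text \<open>For a character this is the multiplication formula applied to \<open>U_char\<close>;
  both sides are linear in \<open>t\<close>.\<close>

lemma weak_identity_trig:
  assumes A: "fibre_set I A" and t: "t \<in> trig_poly"
  shows "(LINT c|lborel. U (\<lambda>x. w x * t x) c * test_fun s A c)
    = \<kappa> * (LINT c|lborel. w c * t c * partial_fourier I (test_fun s A) c)"
proof -
  have Ab: "A \<in> sets borel" using A by (simp add: fibre_set_def)
  note M = test_fun_L2[OF Ab, of s]
  note pM = partial_fourier_test_fun[OF A, of s]
  show ?thesis using t
  proof (induction rule: trig_poly.induct)
    case (char r)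
    let ?F = "\<lambda>x. w x * cis (r \<bullet> x)"
    have F: "?F \<in> L2" by (rule w_trig_L2[OF trig_poly.char])
    have Fi: "integrable lborel ?F"
    proof (rule Bochner_Integration.integrable_bound[OF w(2)])
      show "?F \<in> borel_measurable lborel" using L2_measurable[OF F] by simp
    qed (simp add: norm_mult)
    have um: "U ?F \<in> borel_measurable borel" by (rule L2_measurable[OF U_L2[OF F]])
    have pm: "partial_fourier I ?F \<in> borel_measurable borel" by (rule partial_fourier_measurable[OF L2_measurable[OF F]])
    have mm: "test_fun s A \<in> borel_measurable borel" using Ab by measurable
    have ae: "AE c in lborel. U ?F c * test_fun s A c = \<kappa> * (partial_fourier I ?F c * test_fun s A c)"
      using U_char[of r] by eventually_elim simp
    \<comment> \<open>The partial transform of \<open>?F\<close> inherits integrability against the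
      test function from the square-integrable \<open>U ?F\<close>; dividing by \<kappa> then
      removes the constant.\<close>
    have "integrable lborel (\<lambda>c. \<kappa> * (partial_fourier I ?F c * test_fun s A c))"
      using L2_mult_integrable(1)[OF U_L2[OF F] M(1)] ae um pm mm
      by (subst (asm) integrable_cong_AE[where g="\<lambda>c. \<kappa> * (partial_fourier I ?F c * test_fun s A c)"]) auto
    then have "integrable lborel (\<lambda>c. inverse \<kappa> * (\<kappa> * (partial_fourier I ?F c * test_fun s A c)))"
      by (rule integrable_mult_right)
    moreover have "inverse \<kappa> * (\<kappa> * x) = x" for x using \<kappa> by simp
    ultimately have i1: "integrable lborel (\<lambda>c. partial_fourier I ?F c * test_fun s A c)" by (simp only:)
    have "(LINT c|lborel. U ?F c * test_fun s A c) = (LINT c|lborel. \<kappa> * (partial_fourier I ?F c * test_fun s A c))"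
      using ae um pm mm by (intro integral_cong_AE) auto
    also have "\<dots> = \<kappa> * (LINT c|lborel. partial_fourier I ?F c * test_fun s A c)" by (rule integral_mult_right_zero)
    also have "(LINT c|lborel. partial_fourier I ?F c * test_fun s A c) = (LINT c|lborel. ?F c * partial_fourier I (test_fun s A) c)"
      by (rule partial_fourier_swap[OF L2_measurable[OF F] mm integral_join(2)[OF Fi] integral_join(2)[OF M(2)] i1 L2_mult_integrable(1)[OF F pM]])
    finally show ?case .
  next
    case (add f g)
    note F = w_trig_L2[OF add.hyps(1)] and G = w_trig_L2[OF add.hyps(2)]
    note i = L2_mult_integrable(1)[OF U_L2[OF F] M(1)] L2_mult_integrable(1)[OF U_L2[OF G] M(1)]
      L2_mult_integrable(1)[OF F pM] L2_mult_integrable(1)[OF G pM]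
    note FG = w_trig_L2[OF trig_poly.add[OF add.hyps(1,2)]]
    have "(LINT c|lborel. U (\<lambda>x. w x * (f x + g x)) c * test_fun s A c) =
        (LINT c|lborel. U (\<lambda>x. w x * f x) c * test_fun s A c + U (\<lambda>x. w x * g x) c * test_fun s A c)"
    proof (rule integral_cong_AE)
      show "(\<lambda>c. U (\<lambda>x. w x * (f x + g x)) c * test_fun s A c) \<in> borel_measurable lborel"
        using L2_mult_integrable(1)[OF U_L2[OF FG] M(1)] by simp
      show "(\<lambda>c. U (\<lambda>x. w x * f x) c * test_fun s A c + U (\<lambda>x. w x * g x) c * test_fun s A c) \<in> borel_measurable lborel"
        using i by simp
      show "AE c in lborel. U (\<lambda>x. w x * (f x + g x)) c * test_fun s A c = U (\<lambda>x. w x * f x) c * test_fun s A c + U (\<lambda>x. w x * g x) c * test_fun s A c"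
        using U_add[OF F G] by eventually_elim (simp add: distrib_left distrib_right)
    qed
    also have "\<dots> = \<kappa> * (LINT c|lborel. w c * f c * partial_fourier I (test_fun s A) c) + \<kappa> * (LINT c|lborel. w c * g c * partial_fourier I (test_fun s A) c)"
      using i add.IH by simp
    also have "\<dots> = \<kappa> * (LINT c|lborel. w c * (f c + g c) * partial_fourier I (test_fun s A) c)"
      using i by (simp add: distrib_left distrib_right)
    finally show ?case .
  next
    case (scale f a)
    note F = w_trig_L2[OF scale.hyps(1)]
    note FG = w_trig_L2[OF trig_poly.scale[OF scale.hyps(1), of a]]
    have "(LINT c|lborel. U (\<lambda>x. w x * (a * f x)) c * test_fun s A c) = (LINT c|lborel. a * (U (\<lambda>x. w x * f x) c * test_fun s A c))"
    proof (rule integral_cong_AE)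
      show "(\<lambda>c. U (\<lambda>x. w x * (a * f x)) c * test_fun s A c) \<in> borel_measurable lborel"
        using L2_mult_integrable(1)[OF U_L2[OF FG] M(1)] by simp
      show "(\<lambda>c. a * (U (\<lambda>x. w x * f x) c * test_fun s A c)) \<in> borel_measurable lborel"
        using L2_mult_integrable(1)[OF U_L2[OF F] M(1)] by simp
      show "AE c in lborel. U (\<lambda>x. w x * (a * f x)) c * test_fun s A c = a * (U (\<lambda>x. w x * f x) c * test_fun s A c)"
        using U_scale[OF F, of a] by eventually_elim (simp add: mult.left_commute mult.assoc)
    qed
    also have "\<dots> = a * (\<kappa> * (LINT c|lborel. w c * f c * partial_fourier I (test_fun s A) c))"
      using scale.IH by (simp only: integral_mult_right_zero)
    also have "\<dots> = \<kappa> * (LINT c|lborel. w c * (a * f c) * partial_fourier I (test_fun s A) c)"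
    proof -
      have "w c * (a * f c) * p = a * (w c * f c * p)" for c p by (simp add: mult_ac)
      then show ?thesis by (simp only: integral_mult_right_zero mult.left_commute)
    qed
    finally show ?case .
  qed
qed

text \<open>Both sides are L2-continuous in \<open>F\<close>: the left by \<open>U_bounded\<close>,
  the right because the transformed test function is square-integrable. An approximation with
  squared error below d^2 makes their difference at most d C.\<close>

lemma weak_identity:
  assumes A: "fibre_set I A" and F: "F \<in> L2"
  shows "(LINT c|lborel. U F c * test_fun s A c) = \<kappa> * (LINT c|lborel. F c * partial_fourier I (test_fun s A) c)"
proof -
  have Ab: "A \<in> sets borel" using A by (simp add: fibre_set_def)
  note M = test_fun_L2[OF Ab, of s]
  note pM = partial_fourier_test_fun[OF A, of s]
  define D where "D = (LINT c|lborel. U F c * test_fun s A c) - \<kappa> * (LINT c|lborel. F c * partial_fourier I (test_fun s A) c)"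
  define C where "C = \<bar>K\<bar> + (LINT c|lborel. (norm (test_fun s A c))\<^sup>2) + norm \<kappa> * (1 + (LINT c|lborel. (norm (partial_fourier I (test_fun s A) c))\<^sup>2))"
  have C: "C \<ge> 0" unfolding C_def by (intro add_nonneg_nonneg mult_nonneg_nonneg integral_nonneg_AE) auto
  have bd: "norm D \<le> d * C" if d: "d > 0" for d
  proof -
    obtain t where t: "t \<in> trig_poly" "(\<lambda>c. w c * t c) \<in> L2" "(LINT c|lborel. (norm (F c - w c * t c))\<^sup>2) < d\<^sup>2"
      using weighted_trig_poly_dense[OF w(1,3) F, of "d\<^sup>2"] d by auto
    define G where "G c = F c - w c * t c" for c
    have G: "G \<in> L2" unfolding G_def by (rule L2_diff[OF F t(2)])
    have FG: "F = (\<lambda>c. G c + w c * t c)" by (simp add: G_def)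
    have Gd: "(LINT c|lborel. (norm (G c))\<^sup>2) \<le> d\<^sup>2" "0 \<le> (LINT c|lborel. (norm (G c))\<^sup>2)" using t(3) by (auto simp: G_def)
    note i = L2_mult_integrable(1)[OF U_L2[OF G] M(1)] L2_mult_integrable(1)[OF U_L2[OF t(2)] M(1)]
      L2_mult_integrable(1)[OF G pM] L2_mult_integrable(1)[OF t(2) pM]
    have "(LINT c|lborel. U F c * test_fun s A c) = (LINT c|lborel. U G c * test_fun s A c + U (\<lambda>c. w c * t c) c * test_fun s A c)"
    proof (rule integral_cong_AE)
      show "(\<lambda>c. U F c * test_fun s A c) \<in> borel_measurable lborel"
        using L2_mult_integrable(1)[OF U_L2[OF F] M(1)] by simp
      show "(\<lambda>c. U G c * test_fun s A c + U (\<lambda>c. w c * t c) c * test_fun s A c) \<in> borel_measurable lborel" using i by simp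
      show "AE c in lborel. U F c * test_fun s A c = U G c * test_fun s A c + U (\<lambda>c. w c * t c) c * test_fun s A c"
        using U_add[OF G t(2), folded FG] by eventually_elim (simp add: distrib_right)
    qed
    also have "\<dots> = (LINT c|lborel. U G c * test_fun s A c) + \<kappa> * (LINT c|lborel. w c * t c * partial_fourier I (test_fun s A) c)"
      using i(1,2) weak_identity_trig[OF A t(1), of s] by simp
    finally have 1: "(LINT c|lborel. U F c * test_fun s A c) = (LINT c|lborel. U G c * test_fun s A c) + \<kappa> * (LINT c|lborel. w c * t c * partial_fourier I (test_fun s A) c)" .
    have 2: "(LINT c|lborel. F c * partial_fourier I (test_fun s A) c) = (LINT c|lborel. G c * partial_fourier I (test_fun s A) c) + (LINT c|lborel. w c * t c * partial_fourier I (test_fun s A) c)"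
      using i(3,4) by (subst FG) (simp add: distrib_right)
    have "D = (LINT c|lborel. U G c * test_fun s A c) - \<kappa> * (LINT c|lborel. G c * partial_fourier I (test_fun s A) c)"
      unfolding D_def 1 2 by (simp add: distrib_left)
    then have "norm D \<le> norm (LINT c|lborel. U G c * test_fun s A c) + norm (\<kappa> * (LINT c|lborel. G c * partial_fourier I (test_fun s A) c))"
      by (simp only: norm_triangle_ineq4)
    also have "\<dots> = norm (LINT c|lborel. U G c * test_fun s A c) + norm \<kappa> * norm (LINT c|lborel. G c * partial_fourier I (test_fun s A) c)"
      by (simp only: norm_mult)
    finally have D1: "norm D \<le> norm (LINT c|lborel. U G c * test_fun s A c) + norm \<kappa> * norm (LINT c|lborel. G c * partial_fourier I (test_fun s A) c)" .
    have D2: "norm (LINT c|lborel. U G c * test_fun s A c) \<le> d * \<bar>K\<bar> + d * (LINT c|lborel. (norm (test_fun s A c))\<^sup>2)"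
    proof -
      have "(LINT c|lborel. (norm (U G c))\<^sup>2) \<le> \<bar>K\<bar> * d\<^sup>2"
        using U_bounded[OF G] mult_mono[OF abs_ge_self[of K] Gd(1) _ Gd(2)] by linarith
      then have "(LINT c|lborel. (norm (U G c))\<^sup>2) / d \<le> \<bar>K\<bar> * d\<^sup>2 / d" using d by (intro divide_right_mono) auto
      also have "\<dots> = d * \<bar>K\<bar>" using d by (simp add: power2_eq_square)
      finally show ?thesis using L2_mult_integrable(2)[OF U_L2[OF G] M(1) d] by linarith
    qed
    have D3: "norm (LINT c|lborel. G c * partial_fourier I (test_fun s A) c) \<le> d * (1 + (LINT c|lborel. (norm (partial_fourier I (test_fun s A) c))\<^sup>2))"
    proof -
      have "(LINT c|lborel. (norm (G c))\<^sup>2) / d \<le> d\<^sup>2 / d" using d Gd by (intro divide_right_mono) auto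
      also have "\<dots> = d" using d by (simp add: power2_eq_square)
      finally show ?thesis using L2_mult_integrable(2)[OF G pM d] by (simp add: distrib_left)
    qed
    have "norm D \<le> (d * \<bar>K\<bar> + d * (LINT c|lborel. (norm (test_fun s A c))\<^sup>2))
        + norm \<kappa> * (d * (1 + (LINT c|lborel. (norm (partial_fourier I (test_fun s A) c))\<^sup>2)))"
      using D1 D2 mult_left_mono[OF D3 norm_ge_zero[of \<kappa>]] by linarith
    also have "\<dots> = d * C" by (simp add: C_def algebra_simps)
    finally show ?thesis .
  qed
  have "norm D \<le> 0 + e" if "e > 0" for e
  proof -
    have "e / (C + 1) * C \<le> e" using that C by (simp add: divide_le_eq mult.commute[of _ C] algebra_simps)
    then show ?thesis using bd[of "e / (C + 1)"] that C by simp
  qed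
  then have "norm D \<le> 0" by (rule field_le_epsilon)
  then show ?thesis by (simp add: D_def)
qed

text \<open>On the set \<open>A k\<close>, where the fibre norm \<open>N\<close> is at most
  \<open>k\<close>, the partial transform is bounded, so the difference of both sides times a
  Gaussian is integrable. By the weak identity all its Fourier integrals vanish, hence it is 0
  almost everywhere on \<open>A k\<close>; by \<open>fib\<close> the sets \<open>A k\<close> exhaust
  almost all of the space.\<close>

theorem eq_partial_fourier:
  assumes F: "F \<in> L2"
    and fib: "AE z in lborel_PiM (- I). integrable (lborel_PiM I) (\<lambda>y. F (join I z y))"
  shows "AE c in lborel. U F c = \<kappa> * partial_fourier I F c"
proof -
  define N where "N c = (\<integral>\<^sup>+y. ennreal (norm (F (join I (vec_nth c) y))) \<partial>lborel_PiM I)" for c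
  have Fm: "F \<in> borel_measurable borel" by (rule L2_measurable[OF F])
  have Nm[measurable]: "N \<in> borel_measurable borel" unfolding N_def[abs_def] by (rule fibre_norm_measurable[OF Fm])
  define A where "A k = {c. N c \<le> of_nat k}" for k :: nat
  have Ak: "fibre_set I (A k)" for k
  proof -
    have "A k \<in> sets borel" unfolding A_def by measurable
    moreover have "N (join I (vec_nth c) y) = N c" for c y unfolding N_def join_join ..
    ultimately show ?thesis by (simp add: fibre_set_def A_def)
  qed
  have Ab: "A k \<in> sets borel" for k using Ak by (simp add: fibre_set_def)
  have um: "U F \<in> borel_measurable borel" by (rule L2_measurable[OF U_L2[OF F]])
  have pm: "partial_fourier I F \<in> borel_measurable borel" by (rule partial_fourier_measurable[OF Fm])
  have pb: "norm (partial_fourier I F c) \<le> real k" if "c \<in> A k" for c k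
  proof -
    \<comment> \<open>Without integrability the left-hand side is 0, so the bound holds in both
      cases.\<close>
    have "ennreal (norm (partial_fourier I F c)) \<le> (\<integral>\<^sup>+y. ennreal (norm (F (join I (vec_nth c) y) * cis (- 2 * pi * (\<Sum>i\<in>I. c $ i * y i)))) \<partial>lborel_PiM I)"
      unfolding partial_fourier_def
      by (cases "integrable (lborel_PiM I) (\<lambda>y. F (join I (vec_nth c) y) * cis (- 2 * pi * (\<Sum>i\<in>I. c $ i * y i)))")
         (auto intro: integral_norm_bound_ennreal simp: not_integrable_integral_eq)
    also have "\<dots> = N c" by (simp add: N_def norm_mult)
    also have "\<dots> \<le> ennreal (real k)" using that by (simp add: A_def ennreal_of_nat_eq_real_of_nat)
    finally show ?thesis by simp
  qed
  have main: "AE c in lborel. (U F c - \<kappa> * partial_fourier I F c) * test_fun 0 (A k) c = 0" for k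
  proof (rule fourier_integrals_zero_imp_AE_zero)
    have tm: "test_fun s (A k) \<in> borel_measurable borel" for s using Ab by measurable
    have i1: "integrable lborel (\<lambda>c. U F c * test_fun s (A k) c)" for s
      by (rule L2_mult_integrable(1)[OF U_L2[OF F] test_fun_L2(1)[OF Ab]])
    have i2: "integrable lborel (\<lambda>c. partial_fourier I F c * test_fun s (A k) c)" for s
    proof (rule Bochner_Integration.integrable_bound)
      show "integrable lborel (\<lambda>c. real k * norm (test_fun s (A k) c))"
        by (intro integrable_mult_right integrable_norm test_fun_L2(2)[OF Ab])
      show "(\<lambda>c. partial_fourier I F c * test_fun s (A k) c) \<in> borel_measurable lborel"
        using pm tm by simp
      have "norm (partial_fourier I F c * test_fun s (A k) c) \<le> real k * norm (test_fun s (A k) c)" for c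
      proof (cases "c \<in> A k")
        case True
        then show ?thesis using pb[OF True] by (simp add: norm_mult mult_right_mono)
      qed (simp add: test_fun_def)
      then show "AE c in lborel. norm (partial_fourier I F c * test_fun s (A k) c) \<le> norm (real k * norm (test_fun s (A k) c))"
        by simp
    qed
    have i3: "integrable lborel (\<lambda>c. (U F c - \<kappa> * partial_fourier I F c) * test_fun s (A k) c)" for s
    proof -
      have "integrable lborel (\<lambda>c. U F c * test_fun s (A k) c - \<kappa> * (partial_fourier I F c * test_fun s (A k) c))"
        using i1 i2 by (intro Bochner_Integration.integrable_diff integrable_mult_right)
      then show ?thesis by (simp add: left_diff_distrib mult.assoc)
    qed
    then show "integrable lborel (\<lambda>c. (U F c - \<kappa> * partial_fourier I F c) * test_fun 0 (A k) c)" .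
    fix s
    \<comment> \<open>The character of the Fourier integral is absorbed into the test function, so
      the weak identity applies for every frequency.\<close>
    have ts: "test_fun 0 (A k) c * cis (s \<bullet> c) = test_fun s (A k) c" for c
    proof -
      have "(\<Prod>i\<in>J. cis (s $ i * c $ i)) = cis (\<Sum>i\<in>J. s $ i * c $ i)" if "finite J" for J
        using that by (induction J) (auto simp: cis_mult)
      then have "cis (s \<bullet> c) = (\<Prod>i\<in>UNIV. cis (s $ i * c $ i))" by (simp add: inner_vec_def)
      then show ?thesis by (simp add: test_fun_def prod.distrib mult_ac)
    qed
    have "(LINT c|lborel. (U F c - \<kappa> * partial_fourier I F c) * test_fun 0 (A k) c * cis (s \<bullet> c))
      = (LINT c|lborel. U F c * test_fun s (A k) c - \<kappa> * (partial_fourier I F c * test_fun s (A k) c))"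
      unfolding mult.assoc ts by (simp add: left_diff_distrib mult.assoc)
    also have "\<dots> = (LINT c|lborel. U F c * test_fun s (A k) c) - \<kappa> * (LINT c|lborel. partial_fourier I F c * test_fun s (A k) c)"
      using i1 i2 by simp
    also have "(LINT c|lborel. partial_fourier I F c * test_fun s (A k) c) = (LINT c|lborel. F c * partial_fourier I (test_fun s (A k)) c)"
      by (rule partial_fourier_swap[OF Fm tm fib integral_join(2)[OF test_fun_L2(2)[OF Ab]] i2 L2_mult_integrable(1)[OF F partial_fourier_test_fun[OF Ak]]])
    finally show "(LINT c|lborel. (U F c - \<kappa> * partial_fourier I F c) * test_fun 0 (A k) c * cis (s \<bullet> c)) = 0"
      using weak_identity[OF Ak F, of s k] by simp
  qed
  then have "AE c in lborel. \<forall>k. (U F c - \<kappa> * partial_fourier I F c) * test_fun 0 (A k) c = 0"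
    unfolding AE_all_countable by blast
  moreover have "AE c in lborel. \<exists>k. c \<in> A k"
  proof (subst AE_join_iff[of _ I])
    show "Measurable.pred borel (\<lambda>c. \<exists>k. c \<in> A k)" using Ab by measurable
    show "AE z in lborel_PiM (- I). AE y in lborel_PiM I. \<exists>k. join I z y \<in> A k"
      using fib
    proof eventually_elim
      case (elim z)
      then have "(\<integral>\<^sup>+y. ennreal (norm (F (join I z y))) \<partial>lborel_PiM I) < \<infinity>"
        by (simp add: integrable_iff_bounded)
      then obtain k :: nat where "(\<integral>\<^sup>+y. ennreal (norm (F (join I z y))) \<partial>lborel_PiM I) \<le> of_nat k"
        using ennreal_Ex_less_of_nat by (metis less_imp_le infinity_ennreal_def)
      then have "join I z y \<in> A k" for y by (simp add: A_def N_def join_join)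
      then show ?case by blast
    qed
  qed
  ultimately show ?thesis
  proof eventually_elim
    case (elim c)
    then obtain k where k: "c \<in> A k" by blast
    have "test_fun 0 (A k) c \<noteq> 0" using k by (simp add: test_fun_def prod_zero_iff)
    then show ?case using elim(1) by (metis eq_iff_diff_eq_0 mult_eq_0_iff)
  qed
qed

end

section \<open>Gaussians times characters\<close>

text \<open>A class closed under directional derivatives and under multiplication by the logarithmic
  derivative of \<open>gauss_char\<close>, and of polynomial growth. It describes all iterated
  derivatives of a Gaussian times a character.\<close>

inductive_set coord_poly :: "(real^'n \<Rightarrow> complex) set" where
  const: "(\<lambda>x. c) \<in> coord_poly"
| coord: "(\<lambda>x. complex_of_real (x $ i)) \<in> coord_poly"
| add: "f \<in> coord_poly \<Longrightarrow> g \<in> coord_poly \<Longrightarrow> (\<lambda>x. f x + g x) \<in> coord_poly"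
| mult: "f \<in> coord_poly \<Longrightarrow> g \<in> coord_poly \<Longrightarrow> (\<lambda>x. f x * g x) \<in> coord_poly"

lemma coord_poly_derivative:
  fixes P :: "real^'n::finite \<Rightarrow> complex"
  assumes "P \<in> coord_poly"
  shows "\<exists>P'. (\<forall>x. (P has_derivative P' x) (at x)) \<and> (\<forall>h. (\<lambda>x. P' x h) \<in> coord_poly)"
  using assms
proof (induction rule: coord_poly.induct)
  case (const c)
  show ?case by (intro exI[of _ "\<lambda>x h. 0"]) (auto intro: coord_poly.const)
next
  case (coord i)
  have "((\<lambda>x. complex_of_real (x $ i)) has_derivative (\<lambda>h. complex_of_real (h $ i))) (at x)" for x :: "real^'n"
    by (intro bounded_linear.has_derivative[OF bounded_linear_of_real] bounded_linear_imp_has_derivative bounded_linear_vec_nth)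
  then show ?case by (intro exI[of _ "\<lambda>x h. complex_of_real (h $ i)"]) (auto intro: coord_poly.const)
next
  case (add f g)
  then obtain f' g' where d: "\<And>x. (f has_derivative f' x) (at x)" "\<And>x. (g has_derivative g' x) (at x)"
    and p: "\<And>h. (\<lambda>x. f' x h) \<in> coord_poly" "\<And>h. (\<lambda>x. g' x h) \<in> coord_poly" by blast
  show ?case
    by (intro exI[of _ "\<lambda>x h. f' x h + g' x h"] conjI allI has_derivative_add d coord_poly.add p)
next
  case (mult f g)
  then obtain f' g' where d: "\<And>x. (f has_derivative f' x) (at x)" "\<And>x. (g has_derivative g' x) (at x)"
    and p: "\<And>h. (\<lambda>x. f' x h) \<in> coord_poly" "\<And>h. (\<lambda>x. g' x h) \<in> coord_poly" by blast
  show ?case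
    by (intro exI[of _ "\<lambda>x h. f x * g' x h + f' x h * g x"] conjI allI has_derivative_mult d coord_poly.add coord_poly.mult p mult.hyps)
qed

lemma coord_poly_growth:
  fixes P :: "real^'n::finite \<Rightarrow> complex"
  assumes "P \<in> coord_poly"
  shows "\<exists>C m. C \<ge> 0 \<and> (\<forall>x. norm (P x) \<le> C * (1 + norm x) ^ m)"
  using assms
proof (induction rule: coord_poly.induct)
  case (const c)
  show ?case by (intro exI[of _ "norm c"] exI[of _ 0]) auto
next
  case (coord i)
  have "norm (complex_of_real (x $ i)) \<le> 1 * (1 + norm x) ^ 1" for x :: "real^'n"
    using component_le_norm_cart[of x i] by simp
  then show ?case by (intro exI[of _ 1] exI[of _ 1]) auto
next
  case (add f g)
  then obtain C m C' m' where *: "C \<ge> 0" "\<And>x. norm (f x) \<le> C * (1 + norm x) ^ m" "C' \<ge> 0" "\<And>x. norm (g x) \<le> C' * (1 + norm x) ^ m'" by blast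
  have "norm (f x + g x) \<le> (C + C') * (1 + norm x) ^ (m + m')" for x
  proof -
    have "norm (f x + g x) \<le> C * (1 + norm x) ^ m + C' * (1 + norm x) ^ m'"
      using norm_triangle_ineq[of "f x" "g x"] *(2)[of x] *(4)[of x] by linarith
    also have "\<dots> \<le> C * (1 + norm x) ^ (m + m') + C' * (1 + norm x) ^ (m + m')"
      using * by (intro add_mono mult_left_mono power_increasing) auto
    finally show ?thesis by (simp add: distrib_right)
  qed
  then show ?case using * by (intro exI[of _ "C + C'"] exI[of _ "m + m'"]) auto
next
  case (mult f g)
  then obtain C m C' m' where *: "C \<ge> 0" "\<And>x. norm (f x) \<le> C * (1 + norm x) ^ m" "C' \<ge> 0" "\<And>x. norm (g x) \<le> C' * (1 + norm x) ^ m'" by blast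
  have "norm (f x * g x) \<le> (C * C') * (1 + norm x) ^ (m + m')" for x
  proof -
    have "norm (f x * g x) \<le> (C * (1 + norm x) ^ m) * (C' * (1 + norm x) ^ m')"
      unfolding norm_mult using * by (intro mult_mono) auto
    then show ?thesis by (simp add: power_add mult_ac)
  qed
  then show ?case using * by (intro exI[of _ "C * C'"] exI[of _ "m + m'"]) auto
qed

definition gauss_char :: "real^'n \<Rightarrow> real^'n \<Rightarrow> complex" where
  "gauss_char s x = exp (complex_of_real (- (x \<bullet> x)) + \<i> * of_real (s \<bullet> x))"

lemma gauss_char_eq: "gauss_char s x = of_real (exp (- (x \<bullet> x))) * cis (s \<bullet> x)"
  unfolding gauss_char_def by (simp only: exp_add cis_conv_exp exp_of_real)

lemma norm_gauss_char: "norm (gauss_char s x) = exp (- (norm x)\<^sup>2)"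
  by (simp add: gauss_char_eq norm_mult power2_norm_eq_inner)

lemma gauss_char_derivative:
  "(gauss_char s has_derivative (\<lambda>h. (of_real (- 2 * (x \<bullet> h)) + \<i> * of_real (s \<bullet> h)) * gauss_char s x)) (at x)"
proof -
  have "((\<lambda>x. complex_of_real (- (x \<bullet> x)) + \<i> * of_real (s \<bullet> x)) has_derivative
     (\<lambda>h. of_real (- 2 * (x \<bullet> h)) + \<i> * of_real (s \<bullet> h))) (at x)"
    by (auto intro!: derivative_eq_intros simp: inner_commute)
  from has_derivative_compose[OF this, of exp "(*) (exp (complex_of_real (- (x \<bullet> x)) + \<i> * of_real (s \<bullet> x)))"]
  have "((\<lambda>x. exp (complex_of_real (- (x \<bullet> x)) + \<i> * of_real (s \<bullet> x))) has_derivative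
     (\<lambda>h. exp (complex_of_real (- (x \<bullet> x)) + \<i> * of_real (s \<bullet> x)) * (of_real (- 2 * (x \<bullet> h)) + \<i> * of_real (s \<bullet> h)))) (at x)"
    using DERIV_exp[of "complex_of_real (- (x \<bullet> x)) + \<i> * of_real (s \<bullet> x)"] unfolding has_field_derivative_def by simp
  then show ?thesis unfolding gauss_char_def[abs_def] by (simp add: mult.commute)
qed

lemma gauss_char_factor_poly:
  "(\<lambda>x. of_real (- 2 * (x \<bullet> axis i 1)) + \<i> * of_real (s \<bullet> axis i 1)) \<in> coord_poly"
proof -
  have "(\<lambda>x. of_real (- 2) * complex_of_real (x $ i) + \<i> * of_real (s \<bullet> axis i 1)) \<in> coord_poly"
    by (intro coord_poly.add coord_poly.mult coord_poly.const coord_poly.coord)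
  then show ?thesis by (simp add: inner_axis)
qed

lemma poly_gauss_derivative:
  assumes P: "P \<in> coord_poly"
  shows "(\<lambda>x. P x * gauss_char s x) differentiable (at x)"
    and "\<exists>Q\<in>coord_poly. (\<lambda>x. frechet_derivative (\<lambda>x. P x * gauss_char s x) (at x) (axis i 1)) = (\<lambda>x. Q x * gauss_char s x)"
proof -
  obtain P' where P': "\<And>x. (P has_derivative P' x) (at x)" "\<And>h. (\<lambda>x. P' x h) \<in> coord_poly"
    using coord_poly_derivative[OF P] by blast
  let ?d = "\<lambda>x h. P x * ((of_real (- 2 * (x \<bullet> h)) + \<i> * of_real (s \<bullet> h)) * gauss_char s x) + P' x h * gauss_char s x"
  have d: "((\<lambda>x. P x * gauss_char s x) has_derivative ?d x) (at x)" for x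
    by (intro has_derivative_mult P' gauss_char_derivative)
  then show "(\<lambda>x. P x * gauss_char s x) differentiable (at x)" unfolding differentiable_def by blast
  let ?Q = "\<lambda>x. P x * (of_real (- 2 * (x \<bullet> axis i 1)) + \<i> * of_real (s \<bullet> axis i 1)) + P' x (axis i 1)"
  have "?Q \<in> coord_poly" by (intro coord_poly.add coord_poly.mult P P' gauss_char_factor_poly)
  moreover have "frechet_derivative (\<lambda>x. P x * gauss_char s x) (at x) (axis i 1) = ?Q x * gauss_char s x" for x
    unfolding frechet_derivative_at[OF d, symmetric] by (simp only: distrib_right mult.assoc)
  ultimately show "\<exists>Q\<in>coord_poly. (\<lambda>x. frechet_derivative (\<lambda>x. P x * gauss_char s x) (at x) (axis i 1)) = (\<lambda>x. Q x * gauss_char s x)"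
    by (intro bexI[of _ ?Q]) auto
qed

lemma iter_partial_poly_gauss:
  fixes P :: "real^'n::finite \<Rightarrow> complex"
  shows   "P \<in> coord_poly \<Longrightarrow> \<exists>Q\<in>coord_poly. iter_partial is (\<lambda>x. P x * gauss_char s x) = (\<lambda>x. Q x * gauss_char s x)"
proof (induction "is" arbitrary: P)
  case (Cons i "is")
  obtain Q where Q: "Q \<in> coord_poly" "(\<lambda>x. frechet_derivative (\<lambda>x. P x * gauss_char s x) (at x) (axis i 1)) = (\<lambda>x. Q x * gauss_char s x)"
    using poly_gauss_derivative(2)[OF Cons.prems] by blast
  show ?case using Cons.IH[OF Q(1)] by (simp only: iter_partial.simps Q(2))
qed auto

lemma gauss_char_schwartz:
  fixes s :: "real^'n::finite"
  shows "gauss_char s \<in> schwartz"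
  unfolding schwartz_def mem_Collect_eq
proof
  fix "is" :: "'n list"
  have "(\<lambda>x. 1 * gauss_char s x) = gauss_char s" by simp
  then obtain Q where Q: "Q \<in> coord_poly" "iter_partial is (gauss_char s) = (\<lambda>x. Q x * gauss_char s x)"
    using iter_partial_poly_gauss[OF coord_poly.const[of 1], of "is" s] by auto
  obtain C m where C: "C \<ge> 0" "\<And>x. norm (Q x) \<le> C * (1 + norm x) ^ m" using coord_poly_growth[OF Q(1)] by blast
  show "(\<forall>x. iter_partial is (gauss_char s) differentiable (at x)) \<and>
    (\<forall>k::nat. bounded (range (\<lambda>x. norm x ^ k *\<^sub>R iter_partial is (gauss_char s) x)))"
  proof (intro conjI allI)
    show "iter_partial is (gauss_char s) differentiable (at x)" for x
      unfolding Q(2) by (rule poly_gauss_derivative(1)[OF Q(1)])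
    fix k :: nat
    define N where "N = m + k"
    \<comment> \<open>Each of the \<open>N\<close> polynomial factors costs exp (d |x|^2), and N d
      \<le> 1, so the Gaussian exp (- |x|^2) pays for all of them.\<close>
    define d where "d = 1 / (real N + 1)"
    have d: "d > 0" "real N * d \<le> 1" by (auto simp: d_def divide_le_eq)
    have "norm (norm x ^ k *\<^sub>R (Q x * gauss_char s x)) \<le> C * exp (1 / (4 * d)) ^ N" for x
    proof -
      have "norm (norm x ^ k *\<^sub>R (Q x * gauss_char s x)) = norm x ^ k * (norm (Q x) * exp (- (norm x)\<^sup>2))"
        by (simp add: norm_mult norm_gauss_char)
      also have "\<dots> \<le> (1 + norm x) ^ k * (C * (1 + norm x) ^ m * exp (- (norm x)\<^sup>2))"
        using C by (intro mult_mono power_mono) auto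
      also have "\<dots> = C * ((1 + norm x) ^ N * exp (- (norm x)\<^sup>2))" by (simp add: N_def power_add mult_ac)
      also have "\<dots> \<le> C * (exp (1 / (4 * d)) ^ N)"
      proof (rule mult_left_mono[OF _ C(1)])
        have "(1 + norm x) ^ N \<le> (exp (1 / (4 * d)) * exp (d * (norm x)\<^sup>2)) ^ N"
          using one_plus_abs_le_exp_sq[OF d(1), of "norm x"] by (intro power_mono) auto
        also have "\<dots> = exp (1 / (4 * d)) ^ N * exp (real N * d * (norm x)\<^sup>2)"
          by (simp add: power_mult_distrib exp_of_nat_mult[symmetric] mult.assoc)
        also have "\<dots> \<le> exp (1 / (4 * d)) ^ N * exp ((norm x)\<^sup>2)"
          using mult_right_mono[OF d(2), of "(norm x)\<^sup>2"] by (intro mult_left_mono) auto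
        finally have "(1 + norm x) ^ N * exp (- (norm x)\<^sup>2) \<le> exp (1 / (4 * d)) ^ N * exp ((norm x)\<^sup>2) * exp (- (norm x)\<^sup>2)"
          by (rule mult_right_mono) simp
        then show "(1 + norm x) ^ N * exp (- (norm x)\<^sup>2) \<le> exp (1 / (4 * d)) ^ N"
          by (simp add: mult.assoc exp_add[symmetric])
      qed
      finally show ?thesis .
    qed
    then show "bounded (range (\<lambda>x. norm x ^ k *\<^sub>R iter_partial is (gauss_char s) x))"
      unfolding Q(2) by (auto simp: bounded_iff)
  qed
qed

lemma gauss_char_L2: "gauss_char s \<in> L2" "integrable lborel (gauss_char s)"
proof -
  have m: "gauss_char s \<in> borel_measurable borel" unfolding gauss_char_eq[abs_def] by measurable
  have e: "exp (- (norm x)\<^sup>2) = (\<Prod>i\<in>UNIV. 1 * exp (- 1 * (x $ i - 0)\<^sup>2))" for x :: "real^'n"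
    by (simp add: exp_sum[symmetric] sum_negf norm_vec_def L2_set_def sum_nonneg)
  show "gauss_char s \<in> L2"
  proof (rule L2_bound[OF prod_gaussian_L2(1)[of "\<lambda>_. 1" "\<lambda>_. 1" "\<lambda>_. 0"] m])
    show "norm (gauss_char s x) \<le> norm (complex_of_real (\<Prod>i\<in>UNIV. 1 * exp (- 1 * (x $ i - 0)\<^sup>2)))" for x
      unfolding norm_gauss_char e norm_of_real by (rule abs_ge_self)
  qed simp
  show "integrable lborel (gauss_char s)"
  proof (rule Bochner_Integration.integrable_bound[OF prod_gaussian_L2(2)[of "\<lambda>_. 1" "\<lambda>_. 1" "\<lambda>_. 0"]])
    show "AE x in lborel. norm (gauss_char s x) \<le> norm (\<Prod>i\<in>UNIV. 1 * exp (- 1 * (x $ i - 0)\<^sup>2))"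
      unfolding norm_gauss_char e real_norm_def by (intro AE_I2 abs_ge_self)
  qed (use m in auto)
qed

section \<open>Symplectic coordinates\<close>

declare transpose_matrix_vector [simp del]

section \<open>Symplectic relations and the Moore-Penrose inverse\<close>

lemma inner_matrix_transpose:
  fixes M :: "real^'n::finite^'n"
  shows "(M *v x) \<bullet> y = x \<bullet> (transpose M *v y)" "x \<bullet> (M *v y) = (transpose M *v x) \<bullet> y"
proof -
  show "x \<bullet> (M *v y) = (transpose M *v x) \<bullet> y" for M :: "real^'n^'n" and x y
    by (simp add: transpose_matrix_vector dot_lmul_matrix)
  from this[of y M x] show "(M *v x) \<bullet> y = x \<bullet> (transpose M *v y)" by (simp add: inner_commute)
qed

text \<open>The last identity belongs to the transposed symplectic matrix. The map \<open>G\<close>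
  is built as the left inverse of \<open>F\<close>; in finite dimension it is also a right inverse,
  and the first component of F (G (0, x)) = (0, x) is the claim.\<close>

lemma symplectic_vector_identities:
  fixes A B C D :: "real^'n::finite^'n"
  assumes "symplectic_blocks A B C D"
  shows "transpose B *v (D *v x) = transpose D *v (B *v x)"
    and "transpose A *v (D *v x) = x + transpose C *v (B *v x)"
    and "transpose D *v (A *v x) = x + transpose B *v (C *v x)"
    and "A *v (transpose B *v x) = B *v (transpose A *v x)"
proof -
  have S: "transpose A ** C = transpose C ** A" "transpose B ** D = transpose D ** B"
    "transpose A ** D - transpose C ** B = mat 1" using assms by (auto simp: symplectic_blocks_def)
  have S3: "transpose A ** D = mat 1 + transpose C ** B" using S(3) by (simp add: algebra_simps)
  then have "transpose (transpose A ** D) = transpose (mat 1 + transpose C ** B)" by simp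
  moreover have "transpose (M + N) = transpose M + transpose N" for M N :: "real^'n^'n"
    by (simp add: transpose_def vec_eq_iff)
  ultimately have S4: "transpose D ** A = mat 1 + transpose B ** C"
    by (simp add: matrix_transpose_mul)
  have AC: "transpose A *v (C *v x) = transpose C *v (A *v x)" for x
    using S(1) by (simp add: matrix_vector_mul_assoc)
  show BD: "transpose B *v (D *v x) = transpose D *v (B *v x)" for x
    using S(2) by (simp add: matrix_vector_mul_assoc)
  show AD: "transpose A *v (D *v x) = x + transpose C *v (B *v x)" for x
    using S3 by (simp add: matrix_vector_mul_assoc matrix_vector_mult_add_rdistrib)
  show DA: "transpose D *v (A *v x) = x + transpose B *v (C *v x)" for x
    using S4 by (simp add: matrix_vector_mul_assoc matrix_vector_mult_add_rdistrib)
  define F where "F z = (A *v fst z + B *v snd z, C *v fst z + D *v snd z)" for z :: "(real^'n) \<times> (real^'n)"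
  define G where "G w = (transpose D *v fst w - transpose B *v snd w, transpose A *v snd w - transpose C *v fst w)" for w :: "(real^'n) \<times> (real^'n)"
  note mv = matrix_vector_right_distrib matrix_vector_mult_diff_distrib
  have GF: "G (F z) = z" for z
    unfolding F_def G_def by (cases z) (simp add: mv AC AD BD DA)
  have lF: "linear F"
    unfolding F_def by (intro linearI) (auto simp: mv algebra_simps matrix_vector_mult_scaleR)
  have "inj F" by (rule inj_on_inverseI[of _ G]) (rule GF)
  then have "surj F" using linear_injective_imp_surjective[OF lF] by blast
  have FG: "F (G w) = w" for w
  proof -
    obtain z where "w = F z" using \<open>surj F\<close> by (rule surjE)
    then show ?thesis by (simp add: GF)
  qed
  show "A *v (transpose B *v x) = B *v (transpose A *v x)"
    using FG[of "(0, x)"] by (simp add: F_def G_def mv linear_neg[OF matrix_vector_mul_linear])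
qed

lemma subspace_mat_ker: "subspace (mat_ker (B :: real^'n::finite^'n))"
  by (auto simp: mat_ker_def subspace_def matrix_vector_right_distrib matrix_vector_mult_scaleR)

text \<open>If \<open>Q\<close> is the orthogonal projection onto the kernel, then $B^T B + Q$ is invertible and its
  inverse times $B^T$ satisfies the Penrose equations.\<close>

lemma moore_penrose_equations:
  fixes B :: "real^'n::finite^'n"
  shows "B ** moore_penrose B ** B = B" "transpose (moore_penrose B ** B) = moore_penrose B ** B"
proof -
  let ?P = "\<lambda>X. B ** X ** B = B \<and> X ** B ** X = X \<and> transpose (B ** X) = B ** X \<and> transpose (X ** B) = X ** B"
  define E where "E = some_onb (mat_ker B)"
  note E = is_onb_properties[OF is_onb_some_onb[OF subspace_mat_ker[of B]], folded E_def]
  define Q :: "real^'n^'n" where "Q = (\<chi> i j. \<Sum>e\<in>E. e $ i * e $ j)"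
  have Qt: "transpose Q = Q" by (simp add: Q_def transpose_def vec_eq_iff mult.commute)
  have Qv: "Q *v x = (\<Sum>e\<in>E. (e \<bullet> x) *\<^sub>R e)" for x
  proof (rule vec_eq_iff[THEN iffD2], rule allI)
    fix i
    have "(Q *v x) $ i = (\<Sum>j\<in>UNIV. \<Sum>e\<in>E. e $ i * e $ j * x $ j)"
      by (simp add: Q_def matrix_vector_mult_def sum_distrib_right)
    also have "\<dots> = (\<Sum>e\<in>E. \<Sum>j\<in>UNIV. e $ i * e $ j * x $ j)" by (rule sum.swap)
    also have "\<dots> = (\<Sum>e\<in>E. (e \<bullet> x) *\<^sub>R e) $ i"
      by (simp add: inner_vec_def sum_distrib_right sum_distrib_left mult_ac)
    finally show "(Q *v x) $ i = (\<Sum>e\<in>E. (e \<bullet> x) *\<^sub>R e) $ i" .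
  qed
  have ker: "B *v e = 0" if "e \<in> E" for e
  proof -
    have "e \<in> span E" using that by (rule span_base)
    then show ?thesis by (simp add: E(3) mat_ker_def)
  qed
  have BQv: "B *v (Q *v x) = 0" for x
  proof -
    have "B *v (Q *v x) = (\<Sum>e\<in>E. B *v ((e \<bullet> x) *\<^sub>R e))" unfolding Qv by (rule linear_sum[OF matrix_vector_mul_linear])
    also have "\<dots> = 0" by (simp add: matrix_vector_mult_scaleR ker)
    finally show ?thesis .
  qed
  have BQ: "B ** Q = 0"
    unfolding matrix_eq by (simp add: matrix_vector_mul_assoc[symmetric] BQv)
  have fixQ: "Q *v x = x" if x: "B *v x = 0" for x
  proof -
    let ?d = "x - Q *v x"
    have "B *v ?d = 0" using x BQv by (simp add: matrix_vector_mult_diff_distrib)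
    then have "?d \<in> span E" by (simp add: E(3) mat_ker_def)
    moreover have "orthogonal ?d e" if e: "e \<in> E" for e
    proof -
      have "(Q *v x) \<bullet> e = (\<Sum>e'\<in>E. if e' = e then e \<bullet> x else 0)"
        unfolding Qv inner_sum_left inner_scaleR_left using E(6) e by (intro sum.cong) auto
      also have "\<dots> = e \<bullet> x" using e E(1) by simp
      finally show ?thesis by (simp add: orthogonal_def inner_diff_left inner_commute[of x])
    qed
    ultimately have "orthogonal ?d ?d" by (rule orthogonal_to_span)
    then show ?thesis by (simp add: orthogonal_self)
  qed
  have QQ: "Q ** Q = Q"
    unfolding matrix_eq by (simp add: matrix_vector_mul_assoc[symmetric] fixQ[OF BQv])
  define T where "T = transpose B ** B + Q"
  have Tt: "transpose T = T"
  proof -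
    have "transpose (M + N) = transpose M + transpose N" for M N :: "real^'n^'n"
      by (simp add: transpose_def vec_eq_iff)
    then show ?thesis by (simp add: T_def matrix_transpose_mul Qt)
  qed
  have inj: "x = 0" if x: "T *v x = 0" for x
  proof -
    have "0 = x \<bullet> (T *v x)" using x by simp
    also have "\<dots> = (B *v x) \<bullet> (B *v x) + (Q *v x) \<bullet> (Q *v x)"
    proof -
      have "x \<bullet> (Q *v x) = (Q *v x) \<bullet> (Q *v x)"
        by (metis QQ Qt inner_matrix_transpose(2) matrix_vector_mul_assoc)
      moreover have "x \<bullet> (transpose B *v (B *v x)) = (B *v x) \<bullet> (B *v x)"
        by (simp add: inner_matrix_transpose(1)[of B])
      ultimately show ?thesis
        by (simp add: T_def matrix_vector_mult_add_rdistrib inner_right_distrib matrix_vector_mul_assoc[symmetric])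
    qed
    finally have s: "(B *v x) \<bullet> (B *v x) + (Q *v x) \<bullet> (Q *v x) = 0" by (rule sym)
    have "(B *v x) \<bullet> (B *v x) = 0" "(Q *v x) \<bullet> (Q *v x) = 0"
      using s inner_ge_zero[of "B *v x"] inner_ge_zero[of "Q *v x"] by linarith+
    then have "B *v x = 0" "Q *v x = 0" by auto
    then show ?thesis using fixQ by simp
  qed
  then have "inj ((*v) T)"
    by (intro linear_injective_0[OF matrix_vector_mul_linear, THEN iffD2]) auto
  then obtain S where ST: "S ** T = mat 1" using matrix_left_invertible_injective[of T] by blast
  then have TS: "T ** S = mat 1" by (rule matrix_left_right_inverse[THEN iffD1])
  have St: "transpose S = S"
  proof -
    have "transpose S ** T = mat 1" using arg_cong[OF TS, of transpose] by (simp add: matrix_transpose_mul Tt)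
    then have "transpose S ** (T ** S) = S" by (simp add: matrix_mul_assoc)
    then show ?thesis by (simp add: TS)
  qed
  have add_r: "(M + N) ** L = M ** L + N ** L" for M N L :: "real^'n^'n"
    by (simp add: matrix_matrix_mult_def vec_eq_iff sum.distrib distrib_right)
  have QB: "Q ** transpose B = 0"
  proof -
    have "Q ** transpose B = transpose (B ** Q)" by (simp add: matrix_transpose_mul Qt)
    also have "\<dots> = 0" unfolding BQ by (simp add: transpose_def vec_eq_iff)
    finally show ?thesis .
  qed
  have QT: "Q ** T = Q"
    by (simp add: T_def matrix_add_ldistrib matrix_mul_assoc QB QQ)
  have TQ: "T ** Q = Q"
    by (simp add: T_def add_r matrix_mul_assoc[symmetric] BQ QQ)
  have SQ: "S ** Q = Q"
  proof -
    have "S ** Q = S ** (T ** Q)" by (simp add: TQ)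
    then show ?thesis by (simp add: matrix_mul_assoc ST)
  qed
  have QS: "Q ** S = Q"
  proof -
    have "Q ** S = (Q ** T) ** S" by (simp add: QT)
    then show ?thesis by (simp add: matrix_mul_assoc[symmetric] TS)
  qed
  define X where "X = S ** transpose B"
  have XB: "X ** B + Q = mat 1"
  proof -
    have "X ** B + Q = S ** (transpose B ** B) + S ** Q" by (simp add: X_def SQ matrix_mul_assoc)
    also have "\<dots> = S ** T" by (simp add: T_def matrix_add_ldistrib)
    finally show ?thesis by (simp add: ST)
  qed
  have X1: "B ** X ** B = B"
  proof -
    have "B ** (X ** B + Q) = B" by (simp add: XB)
    then show ?thesis by (simp add: matrix_add_ldistrib BQ matrix_mul_assoc)
  qed
  have X2: "X ** B ** X = X"
  proof -
    have "(X ** B + Q) ** X = X" by (simp add: XB)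
    moreover have "Q ** X = 0" by (simp add: X_def matrix_mul_assoc QS QB)
    ultimately show ?thesis by (simp add: add_r)
  qed
  have X3: "transpose (B ** X) = B ** X"
    by (simp add: X_def matrix_transpose_mul St matrix_mul_assoc)
  have X4: "transpose (X ** B) = X ** B"
  proof -
    have XBe: "X ** B = mat 1 - Q" using XB by (simp add: algebra_simps)
    have "transpose (M - N) = transpose M - transpose N" for M N :: "real^'n^'n"
      by (simp add: transpose_def vec_eq_iff)
    then show ?thesis by (simp add: XBe Qt)
  qed
  \<comment> \<open>The definition is a definite description, so uniqueness is needed too. By
    symmetry of the four products, B Y = B X and Y B = X B, and then Y = Y B Y = X B X.\<close>
  have "Y = X" if Y: "?P Y" for Y
  proof -
    have "B ** Y = (B ** X ** B) ** Y" by (simp add: X1)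
    also have "\<dots> = transpose (B ** X) ** transpose (B ** Y)" using Y X3 by (simp add: matrix_mul_assoc)
    also have "\<dots> = transpose ((B ** Y ** B) ** X)" by (simp add: matrix_transpose_mul matrix_mul_assoc)
    also have "\<dots> = B ** X" using Y X3 by simp
    finally have 1: "B ** Y = B ** X" .
    have "Y ** B = Y ** (B ** X ** B)" by (simp add: X1)
    also have "\<dots> = transpose (Y ** B) ** transpose (X ** B)" using Y X4 by (simp add: matrix_mul_assoc)
    also have "\<dots> = transpose (X ** (B ** Y ** B))" by (simp add: matrix_transpose_mul matrix_mul_assoc)
    also have "\<dots> = X ** B" using Y X4 by simp
    finally have 2: "Y ** B = X ** B" .
    have "Y = Y ** B ** Y" using Y by simp
    also have "\<dots> = X ** (B ** Y)" by (simp add: 2 matrix_mul_assoc)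
    also have "\<dots> = X" by (simp add: 1 matrix_mul_assoc X2)
    finally show ?thesis .
  qed
  moreover have "?P X" using X1 X2 X3 X4 by simp
  ultimately have "\<exists>!X. ?P X" by (intro ex1I[of _ X])
  then have "?P (moore_penrose B)" unfolding moore_penrose_def by (rule theI')
  then show "B ** moore_penrose B ** B = B" "transpose (moore_penrose B ** B) = moore_penrose B ** B" by auto
qed

text \<open>\<open>moore_penrose B ** B\<close> is the orthogonal projection onto the range of
  \<open>transpose B\<close>: it is symmetric, so the first Penrose equation can be
  transposed.\<close>

lemma moore_penrose_range_transpose:
  fixes B :: "real^'n::finite^'n"
  shows "moore_penrose B *v (B *v (transpose B *v z)) = transpose B *v z"
proof -
  let ?X = "moore_penrose B"
  have "(?X ** B) ** transpose B = transpose (?X ** B) ** transpose B"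
    by (simp only: moore_penrose_equations(2))
  also have "\<dots> = transpose (B ** ?X ** B)" by (simp add: matrix_transpose_mul matrix_mul_assoc)
  also have "\<dots> = transpose B" by (simp only: moore_penrose_equations(1))
  finally have "((?X ** B) ** transpose B) *v z = transpose B *v z" by simp
  then show ?thesis by (simp add: matrix_vector_mul_assoc matrix_mul_assoc)
qed

text \<open>For y orthogonal to the kernel, the vector y - B^+ B y lies in the kernel and is
  orthogonal to both y and B^+ B y, hence to itself. Symmetry of B^+ B then displays B^+ B y as a
  value of \<open>transpose B\<close>.\<close>

lemma orthogonal_comp_mat_ker:
  fixes B :: "real^'n::finite^'n"
  shows "y \<in> (mat_ker B)\<^sup>\<bottom> \<longleftrightarrow> (\<exists>z. y = transpose B *v z)"
proof
  assume "\<exists>z. y = transpose B *v z"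
  then show "y \<in> (mat_ker B)\<^sup>\<bottom>"
    by (auto simp: orthogonal_comp_def orthogonal_def mat_ker_def inner_matrix_transpose(2)[of _ "transpose B"])
next
  assume y: "y \<in> (mat_ker B)\<^sup>\<bottom>"
  let ?X = "moore_penrose B"
  let ?d = "y - ?X *v (B *v y)"
  have e: "B *v (?X *v (B *v u)) = B *v u" for u
    using moore_penrose_equations(1)[of B] by (simp add: matrix_vector_mul_assoc matrix_mul_assoc)
  have k: "?d \<in> mat_ker B" by (simp add: mat_ker_def matrix_vector_mult_diff_distrib e)
  have t: "transpose B *v (transpose ?X *v u) = ?X *v (B *v u)" for u
    using moore_penrose_equations(2)[of B] by (simp add: matrix_transpose_mul matrix_vector_mul_assoc)
  have "(?X *v (B *v y)) \<bullet> ?d = (transpose ?X *v y) \<bullet> (B *v ?d)"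
    unfolding t[symmetric] by (simp add: inner_matrix_transpose(1)[of "transpose B"])
  also have "\<dots> = 0" using k by (simp add: mat_ker_def)
  finally have "(?X *v (B *v y)) \<bullet> ?d = 0" .
  moreover have "y \<bullet> ?d = 0" using y k by (auto simp: orthogonal_comp_def orthogonal_def inner_commute)
  ultimately have "?d \<bullet> ?d = 0" by (simp add: inner_diff_left)
  then have "y = ?X *v (B *v y)" by simp
  then show "\<exists>z. y = transpose B *v z" using t[of y] by metis
qed

text \<open>Coordinates are indexed by the type \<open>'n\<close>, while the given vectors are
  numbered from 1 to \<open>r\<close>. Any r-element set \<open>I\<close> of indices carries the
  given vectors, and its complement carries an orthonormal basis of \<open>K\<close>.\<close>

lemma adapted_basis:
  fixes v :: "nat \<Rightarrow> real^'n::finite" and K :: "(real^'n) set"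
  assumes o: "\<And>i j. i \<in> {1..r} \<Longrightarrow> j \<in> {1..r} \<Longrightarrow> v i \<bullet> v j = (if i = j then 1 else 0)"
    and sp: "span (v ` {1..r}) = K\<^sup>\<bottom>" and r: "r \<le> CARD('n)" and K: "subspace K"
  obtains I \<iota> and e :: "'n \<Rightarrow> real^'n" where "bij_betw \<iota> I {1..r}" "\<And>i. i \<in> I \<Longrightarrow> e i = v (\<iota> i)"
    "\<And>i j. e i \<bullet> e j = (if i = j then 1 else 0)" "span (e ` I) = K\<^sup>\<bottom>" "span (e ` (- I)) = K"
proof -
  obtain I :: "'n set" where I: "card I = r" using obtain_subset_with_card_n[OF r] by metis
  obtain \<iota> where \<iota>: "bij_betw \<iota> I {1..r}" using finite_same_card_bij[of I "{1..r}"] I by auto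
  define E where "E = some_onb K"
  note E = is_onb_properties[OF is_onb_some_onb[OF K], folded E_def]
  have nz: "v i \<noteq> 0" if "i \<in> {1..r}" for i using o[OF that that] by auto
  have inj: "inj_on v {1..r}"
  proof (rule inj_onI)
    fix i j assume "i \<in> {1..r}" "j \<in> {1..r}" "v i = v j"
    then show "i = j" using o[of i j] o[of j j] by (auto split: if_splits)
  qed
  have "pairwise orthogonal (v ` {1..r})"
    using o by (auto simp: pairwise_def orthogonal_def)
  then have "independent (v ` {1..r})" using nz by (intro pairwise_orthogonal_independent) auto
  then have "dim (span (v ` {1..r})) = card (v ` {1..r})" by (rule dim_span_eq_card_independent)
  then have dV: "dim (K\<^sup>\<bottom>) = r" unfolding sp using card_image[OF inj] by simp
  have "{y \<in> UNIV. \<forall>x\<in>K. orthogonal x y} = K\<^sup>\<bottom>"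
    by (auto simp: orthogonal_comp_def orthogonal_commute)
  then have "dim (K\<^sup>\<bottom>) + dim K = CARD('n)"
    using dim_subspace_orthogonal_to_vectors[OF K subspace_UNIV] by simp
  moreover have "card (- I) = CARD('n) - r" using I by (simp add: Compl_eq_Diff_UNIV card_Diff_subset)
  ultimately have "card (- I) = card E" using dV E(4) by simp
  then obtain g where g: "bij_betw g (- I) E" using finite_same_card_bij[of "- I" E] E(1) by auto
  define e where "e i = (if i \<in> I then v (\<iota> i) else g i)" for i
  have eI: "e ` I = v ` {1..r}"
  proof -
    have "e ` I = v ` (\<iota> ` I)" unfolding image_image by (rule image_cong) (auto simp: e_def)
    then show ?thesis by (simp only: bij_betw_imp_surj_on[OF \<iota>])
  qed
  have eC: "e ` (- I) = E"
  proof -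
    have "e ` (- I) = g ` (- I)" by (rule image_cong) (auto simp: e_def)
    then show ?thesis by (simp only: bij_betw_imp_surj_on[OF g])
  qed
  have gE: "g i \<in> K" "g i \<in> E" if "i \<notin> I" for i
  proof -
    show "g i \<in> E" using bij_betwE[OF g] that by auto
    then show "g i \<in> K" using E(3) span_base by metis
  qed
  have vV: "v (\<iota> i) \<in> K\<^sup>\<bottom>" if "i \<in> I" for i
    using sp bij_betwE[OF \<iota>] that span_base[of "v (\<iota> i)" "v ` {1..r}"] by auto
  have "e i \<bullet> e j = (if i = j then 1 else 0)" for i j
  proof (cases "i \<in> I"; cases "j \<in> I")
    assume "i \<in> I" "j \<in> I"
    then show ?thesis
      using o[of "\<iota> i" "\<iota> j"] bij_betwE[OF \<iota>] inj_onD[OF bij_betw_imp_inj_on[OF \<iota>], of i j] by (auto simp: e_def)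
  next
    assume "i \<in> I" "j \<notin> I"
    then show ?thesis using vV[of i] gE[of j]
      by (auto simp: e_def orthogonal_comp_def orthogonal_def inner_commute)
  next
    assume "i \<notin> I" "j \<in> I"
    then show ?thesis using vV[of j] gE[of i]
      by (auto simp: e_def orthogonal_comp_def orthogonal_def inner_commute)
  next
    assume "i \<notin> I" "j \<notin> I"
    then show ?thesis
      using E(6) gE(2) inj_onD[OF bij_betw_imp_inj_on[OF g], of i j] by (auto simp: e_def)
  qed
  then show ?thesis
    using that[OF \<iota>, of e] eI eC sp E(3) by (simp add: e_def)
qed

lemma distr_lebesgue_translate:
  fixes I :: "'n::finite set"
  shows "distr (lborel_PiM I) (lborel_PiM I) (\<lambda>y. \<lambda>i\<in>I. y i + \<omega> i) = lborel_PiM I"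
proof -
  interpret product_sigma_finite "\<lambda>_::'n. lborel :: real measure" by (rule product_sigma_finite_lborel)
  have m[measurable]: "(\<lambda>y. \<lambda>i\<in>I. y i + \<omega> i) \<in> lborel_PiM I \<rightarrow>\<^sub>M lborel_PiM I"
    by (rule measurable_restrict) (use component_measurable in simp)
  show ?thesis
  proof (rule PiM_eqI)
    fix A :: "'n \<Rightarrow> real set" assume A: "\<And>i. i \<in> I \<Longrightarrow> A i \<in> sets lborel"
    have A': "\<And>i. i \<in> I \<Longrightarrow> A i \<in> sets borel" using A by simp
    have pre: "(\<lambda>x. x + \<omega> i) -` A i \<in> sets borel" if "i \<in> I" for i
      using measurable_sets[of "\<lambda>x. x + \<omega> i" borel borel, OF _ A'[OF that]] by simp
    have "emeasure (distr (lborel_PiM I) (lborel_PiM I) (\<lambda>y. \<lambda>i\<in>I. y i + \<omega> i)) (Pi\<^sub>E I A)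
      = emeasure (lborel_PiM I) ((\<lambda>y. \<lambda>i\<in>I. y i + \<omega> i) -` Pi\<^sub>E I A \<inter> space (lborel_PiM I))"
      by (rule emeasure_distr[OF m]) (use A in \<open>auto intro: sets_PiM_I_finite\<close>)
    also have "(\<lambda>y. \<lambda>i\<in>I. y i + \<omega> i) -` Pi\<^sub>E I A \<inter> space (lborel_PiM I) = Pi\<^sub>E I (\<lambda>i. (\<lambda>x. x + \<omega> i) -` A i)"
      by (auto simp: space_PiM PiE_iff)
    also have "emeasure (lborel_PiM I) (Pi\<^sub>E I (\<lambda>i. (\<lambda>x. x + \<omega> i) -` A i)) = (\<Prod>i\<in>I. emeasure lborel ((\<lambda>x. x + \<omega> i) -` A i))"
      by (rule emeasure_PiM) (use pre in auto)
    also have "\<dots> = (\<Prod>i\<in>I. emeasure lborel (A i))"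
    proof (rule prod.cong[OF refl])
      fix i assume i: "i \<in> I"
      have "emeasure lborel (A i) = emeasure (distr lborel borel ((+) (\<omega> i))) (A i)" by (simp only: lborel_distr_plus)
      also have "\<dots> = emeasure lborel ((+) (\<omega> i) -` A i \<inter> space lborel)" by (rule emeasure_distr) (use A'[OF i] in auto)
      also have "(+) (\<omega> i) -` A i \<inter> space lborel = (\<lambda>x. x + \<omega> i) -` A i" by (auto simp: add.commute)
      finally show "emeasure lborel ((\<lambda>x. x + \<omega> i) -` A i) = emeasure lborel (A i)" ..
    qed
    finally show "emeasure (distr (lborel_PiM I) (lborel_PiM I) (\<lambda>y. \<lambda>i\<in>I. y i + \<omega> i)) (Pi\<^sub>E I A) = (\<Prod>i\<in>I. emeasure lborel (A i))" .
  qed auto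
qed

lemma lin_comb_measurable [measurable]:
  fixes b :: "'n::finite \<Rightarrow> real^'n"
  shows "(\<lambda>y. \<Sum>j\<in>J. y j *\<^sub>R b j) \<in> borel_measurable (lborel_PiM J)"
  by (rule borel_measurable_sum, rule borel_measurable_scaleR, rule component_measurable, assumption, rule borel_measurable_const)

text \<open>In any basis, Lebesgue measure on a subspace is a positive multiple of the image of the
  product measure; such a factor changes neither null sets nor finiteness of integrals.\<close>

lemma fibre_integrability_iff:
  fixes b e :: "'n::finite \<Rightarrow> real^'n" and \<phi> :: "real^'n \<Rightarrow> real^'n \<Rightarrow> ennreal"
  assumes b: "\<And>z. (\<Sum>j\<in>J. z j *\<^sub>R b j) = 0 \<Longrightarrow> \<forall>j\<in>J. z j = 0" and L: "span (b ` J) = L"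
    and e: "\<And>z. (\<Sum>j\<in>I. z j *\<^sub>R e j) = 0 \<Longrightarrow> \<forall>j\<in>I. z j = 0" and V: "span (e ` I) = V"
    and m: "(\<lambda>(x, y). \<phi> x y) \<in> borel_measurable (borel \<Otimes>\<^sub>M borel)"
  shows "(AE x2 in subspace_lebesgue L. (\<integral>\<^sup>+x1. \<phi> x1 x2 \<partial>subspace_lebesgue V) < \<infinity>) \<longleftrightarrow>
    (AE z in lborel_PiM J. (\<integral>\<^sup>+y. \<phi> (\<Sum>j\<in>I. y j *\<^sub>R e j) (\<Sum>j\<in>J. z j *\<^sub>R b j) \<partial>lborel_PiM I) < \<infinity>)"
proof -
  interpret I: sigma_finite_measure "lborel_PiM I" by (rule sigma_finite_lborel_PiM) simp
  obtain k where k: "k > 0" "subspace_lebesgue L = density (distr (lborel_PiM J) borel (\<lambda>y. \<Sum>j\<in>J. y j *\<^sub>R b j)) (\<lambda>_. ennreal k)"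
    by (rule subspace_lebesgue_basis[OF b L])
  obtain l where l: "l > 0" "subspace_lebesgue V = density (distr (lborel_PiM I) borel (\<lambda>y. \<Sum>j\<in>I. y j *\<^sub>R e j)) (\<lambda>_. ennreal l)"
    by (rule subspace_lebesgue_basis[OF e V])
  have mx: "(\<lambda>x. \<phi> x y) \<in> borel_measurable borel" for y
    using measurable_compose[OF measurable_Pair2'[of y borel borel] m] by simp
  define N where "N x2 = (\<integral>\<^sup>+y. \<phi> (\<Sum>j\<in>I. y j *\<^sub>R e j) x2 \<partial>lborel_PiM I)" for x2
  have int: "(\<integral>\<^sup>+x1. \<phi> x1 x2 \<partial>subspace_lebesgue V) = ennreal l * N x2" for x2
  proof -
    have "(\<integral>\<^sup>+x1. \<phi> x1 x2 \<partial>subspace_lebesgue V) = (\<integral>\<^sup>+x1. ennreal l * \<phi> x1 x2 \<partial>distr (lborel_PiM I) borel (\<lambda>y. \<Sum>j\<in>I. y j *\<^sub>R e j))"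
      unfolding l(2) by (rule nn_integral_density) (use mx in simp_all)
    also have "\<dots> = ennreal l * (\<integral>\<^sup>+x1. \<phi> x1 x2 \<partial>distr (lborel_PiM I) borel (\<lambda>y. \<Sum>j\<in>I. y j *\<^sub>R e j))"
      by (rule nn_integral_cmult) (use mx in simp)
    also have "(\<integral>\<^sup>+x1. \<phi> x1 x2 \<partial>distr (lborel_PiM I) borel (\<lambda>y. \<Sum>j\<in>I. y j *\<^sub>R e j)) = N x2"
      unfolding N_def by (rule nn_integral_distr[OF lin_comb_measurable]) (use mx in simp)
    finally show ?thesis .
  qed
  have fin: "ennreal l * t < \<infinity> \<longleftrightarrow> t < \<infinity>" for t
    using l(1) by (auto simp: ennreal_mult_less_top)
  have m2: "(\<lambda>(x2, y). \<phi> (\<Sum>j\<in>I. y j *\<^sub>R e j) x2) \<in> borel_measurable (borel \<Otimes>\<^sub>M lborel_PiM I)"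
  proof -
    have "(\<lambda>(x2, y). (\<Sum>j\<in>I. y j *\<^sub>R e j, x2)) \<in> borel \<Otimes>\<^sub>M lborel_PiM I \<rightarrow>\<^sub>M borel \<Otimes>\<^sub>M borel"
      unfolding case_prod_unfold
      by (rule measurable_Pair[OF measurable_compose[OF measurable_snd lin_comb_measurable] measurable_fst])
    from measurable_compose[OF this m] show ?thesis by (simp add: case_prod_unfold)
  qed
  have N: "N \<in> borel_measurable borel"
    unfolding N_def[abs_def] by (rule I.borel_measurable_nn_integral[OF m2])
  have pos: "0 < ennreal k" using k(1) by simp
  have "(AE x2 in subspace_lebesgue L. N x2 < \<infinity>) \<longleftrightarrow> (AE z in lborel_PiM J. N (\<Sum>j\<in>J. z j *\<^sub>R b j) < \<infinity>)"
  proof -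
    have "(AE x2 in subspace_lebesgue L. N x2 < \<infinity>) \<longleftrightarrow>
      (AE x2 in distr (lborel_PiM J) borel (\<lambda>y. \<Sum>j\<in>J. y j *\<^sub>R b j). 0 < ennreal k \<longrightarrow> N x2 < \<infinity>)"
      unfolding k(2) by (rule AE_density) simp
    also have "\<dots> \<longleftrightarrow> (AE z in lborel_PiM J. 0 < ennreal k \<longrightarrow> N (\<Sum>j\<in>J. z j *\<^sub>R b j) < \<infinity>)"
    proof (rule AE_distr_iff)
      have s: "{x \<in> space borel. N x < \<infinity>} \<in> sets borel" by (rule borel_measurable_less[OF N borel_measurable_const])
      show "{x \<in> space borel. 0 < ennreal k \<longrightarrow> N x < \<infinity>} \<in> sets borel"
        using s by (simp only: pos simp_thms)
    qed (rule lin_comb_measurable)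
    finally show ?thesis by (simp only: pos simp_thms)
  qed
  then show ?thesis by (simp only: int fin) (simp only: N_def)
qed

locale symplectic_coordinates =
  fixes A B C D :: "real^'n::finite^'n" and I :: "'n set" and e :: "'n \<Rightarrow> real^'n"
  assumes symplectic: "symplectic_blocks A B C D"
    and orthonormal: "\<And>i j. e i \<bullet> e j = (if i = j then 1 else 0)"
    and range_basis: "span (e ` I) = (mat_ker B)\<^sup>\<bottom>"
    and ker_basis: "span (e ` (- I)) = mat_ker B"
begin

lemmas symp = symplectic_vector_identities[OF symplectic]

definition vpart :: "('n \<Rightarrow> real) \<Rightarrow> real^'n" where "vpart y = (\<Sum>i\<in>I. y i *\<^sub>R e i)"
definition kpart :: "('n \<Rightarrow> real) \<Rightarrow> real^'n" where "kpart z = (\<Sum>i\<in>-I. z i *\<^sub>R e i)"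
text \<open>\<open>X\<close> parametrises the domain and \<open>Y\<close> the target, following the
  two splittings. They share the kernel coordinates: D^T Y c differs from D^T A applied to the
  kernel part only by a vector of ker(B)^\<bottom>, so the operator maps the fibre of a label
  \<open>z\<close> to the fibre with the same label.\<close>

definition X :: "real^'n \<Rightarrow> real^'n" where "X c = vpart (vec_nth c) + transpose D *v (A *v kpart (vec_nth c))"
definition Y :: "real^'n \<Rightarrow> real^'n" where "Y c = B *v vpart (vec_nth c) + A *v kpart (vec_nth c)"

lemma inner_lin_comb: "(\<Sum>i\<in>J. y i *\<^sub>R e i) \<bullet> e j = (if j \<in> J then y j else 0)"
proof -
  have "(\<Sum>i\<in>J. y i *\<^sub>R e i) \<bullet> e j = (\<Sum>i\<in>J. if i = j then y i else 0)"
    unfolding inner_sum_left inner_scaleR_left orthonormal by (intro sum.cong) auto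
  then show ?thesis by simp
qed

lemma vpart_inner: "vpart y \<bullet> vpart y' = (\<Sum>i\<in>I. y i * y' i)"
proof -
  have "vpart y \<bullet> vpart y' = (\<Sum>i\<in>I. (vpart y \<bullet> e i) * y' i)"
    unfolding vpart_def[of y'] inner_sum_right inner_scaleR_right by (simp add: mult.commute)
  also have "\<dots> = (\<Sum>i\<in>I. y i * y' i)" unfolding vpart_def inner_lin_comb by simp
  finally show ?thesis .
qed

lemma ker_kpart: "B *v kpart z = 0"
proof -
  have "kpart z \<in> mat_ker B"
    unfolding kpart_def ker_basis[symmetric] by (intro span_sum span_scale span_base) auto
  then show ?thesis by (simp add: mat_ker_def)
qed

lemma vpart_orth: "vpart y \<in> (mat_ker B)\<^sup>\<bottom>"
  unfolding vpart_def range_basis[symmetric] by (intro span_sum span_scale span_base) auto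

lemma vpart_eq_transpose: "\<exists>z. vpart y = transpose B *v z"
  using vpart_orth[of y] unfolding orthogonal_comp_mat_ker .

lemma transpose_eq_vpart: "transpose B *v z = vpart (\<lambda>i. (transpose B *v z) \<bullet> e i)"
proof -
  let ?w = "transpose B *v z"
  let ?d = "?w - vpart (\<lambda>i. ?w \<bullet> e i)"
  have "?w \<in> (mat_ker B)\<^sup>\<bottom>" unfolding orthogonal_comp_mat_ker by auto
  then have "?d \<in> span (e ` I)"
    using vpart_orth[of "\<lambda>i. ?w \<bullet> e i"] unfolding range_basis[symmetric] by (rule span_diff)
  moreover have "orthogonal ?d y" if "y \<in> e ` I" for y
    using that by (auto simp: orthogonal_def inner_diff_left vpart_def inner_lin_comb)
  ultimately have "orthogonal ?d ?d" by (rule orthogonal_to_span)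
  then show ?thesis by (simp add: orthogonal_self)
qed

lemma vpart_ker_orth: "B *v k = 0 \<Longrightarrow> vpart y \<bullet> k = 0"
  using vpart_orth[of y] by (auto simp: orthogonal_comp_def orthogonal_def mat_ker_def inner_commute)

lemma vpart_zero: "vpart y = 0 \<Longrightarrow> i \<in> I \<Longrightarrow> y i = 0"
  using inner_lin_comb[where J = I and y = y and j = i] by (simp add: vpart_def)

lemma kpart_zero: "kpart z = 0 \<Longrightarrow> i \<notin> I \<Longrightarrow> z i = 0"
  using inner_lin_comb[where J = "- I" and y = z and j = i] by (simp add: kpart_def)

lemma range_plus_ker:
  assumes "transpose B *v z + k = 0" "B *v k = 0"
  shows "k = 0" "transpose B *v z = 0"
proof -
  have "(transpose B *v z) \<bullet> k = 0" using assms(2) by (simp add: inner_matrix_transpose(1)[of "transpose B"])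
  moreover have "transpose B *v z = - k" using assms(1) by (rule eq_neg_iff_add_eq_0[THEN iffD2])
  ultimately have "k \<bullet> k = 0" by simp
  then show "k = 0" by simp
  then show "transpose B *v z = 0" using assms(1) by simp
qed

text \<open>By the symplectic relation D^T A k = k + B^T C k, the sum is a vector of the range of
  B^T plus the kernel vector k; these two spaces are orthogonal.\<close>

lemma X_parts_zero:
  assumes "vpart y + transpose D *v (A *v kpart z) = 0"
  shows "vpart y = 0" "kpart z = 0"
proof -
  obtain u where u: "vpart y = transpose B *v u" using vpart_eq_transpose by blast
  have "transpose B *v (u + C *v kpart z) + kpart z = 0"
    using assms unfolding symp(3) u by (simp add: matrix_vector_right_distrib add_ac)
  then have "kpart z = 0" by (rule range_plus_ker(1)) (rule ker_kpart)
  then show "kpart z = 0" "vpart y = 0" using assms by auto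
qed

text \<open>Applying D^T and D^T B = B^T D reduces the kernel part to the same orthogonality. Then B
  annihilates a vector orthogonal to its kernel.\<close>

lemma Y_parts_zero:
  assumes "B *v vpart y + A *v kpart z = 0"
  shows "vpart y = 0" "kpart z = 0"
proof -
  have "transpose D *v (B *v vpart y) + transpose D *v (A *v kpart z) = 0"
    using arg_cong[OF assms, of "\<lambda>x. transpose D *v x"] by (simp add: matrix_vector_right_distrib)
  then have "transpose B *v (D *v vpart y + C *v kpart z) + kpart z = 0"
    unfolding symp(3) symp(1)[symmetric] by (simp add: matrix_vector_right_distrib add_ac)
  then show k: "kpart z = 0" by (rule range_plus_ker(1)) (rule ker_kpart)
  then have "B *v vpart y = 0" using assms by simp
  from vpart_ker_orth[OF this, of y] show "vpart y = 0" by simp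
qed

lemma linear_parts: "vpart (vec_nth (x + y)) = vpart (vec_nth x) + vpart (vec_nth y)"
  "vpart (vec_nth (t *\<^sub>R x)) = t *\<^sub>R vpart (vec_nth x)"
  "kpart (vec_nth (x + y)) = kpart (vec_nth x) + kpart (vec_nth y)"
  "kpart (vec_nth (t *\<^sub>R x)) = t *\<^sub>R kpart (vec_nth x)"
  by (simp_all add: vpart_def kpart_def scaleR_left_distrib sum.distrib scaleR_sum_right)

lemma linear_X: "linear X" and linear_Y: "linear Y"
  unfolding X_def Y_def
  by (rule linearI; simp add: linear_parts matrix_vector_right_distrib matrix_vector_mult_scaleR scaleR_right_distrib)+

lemma inj_X: "inj X"
proof (rule linear_injective_0[OF linear_X, THEN iffD2], intro allI impI)
  fix c assume "X c = 0"
  from X_parts_zero[OF this[unfolded X_def]] vpart_zero kpart_zero show "c = 0"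
    by (metis vec_eq_iff zero_index)
qed

lemma inj_Y: "inj Y"
proof (rule linear_injective_0[OF linear_Y, THEN iffD2], intro allI impI)
  fix c assume "Y c = 0"
  from Y_parts_zero[OF this[unfolded Y_def]] vpart_zero kpart_zero show "c = 0"
    by (metis vec_eq_iff zero_index)
qed

lemma vpart_join [simp]: "vpart (vec_nth (join I z y)) = vpart y" and kpart_join [simp]: "kpart (vec_nth (join I z y)) = kpart z"
  unfolding vpart_def kpart_def by (auto intro: sum.cong)

text \<open>The part of the exponent that stays with the input after the substitution: its terms
  involve the integration variable and the kernel coordinates, but no frequency.\<close>

definition chirp :: "real^'n \<Rightarrow> real" where
  "chirp c = pi * (((moore_penrose B ** A) *v vpart (vec_nth c)) \<bullet> vpart (vec_nth c))
     + 2 * pi * ((transpose C *v (A *v kpart (vec_nth c))) \<bullet> vpart (vec_nth c))"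

text \<open>The terms of the exponent free of the integration variable. \<open>W\<close> is the
  shift in the substitution, and the last two summands arise from it.\<close>

definition phase :: "real^'n \<Rightarrow> real" where
  "phase c = (let W = transpose B *v (D *v vpart (vec_nth c)) in
     pi * (((D ** transpose C) *v Y c) \<bullet> Y c) + pi * (((moore_penrose B ** A) *v W) \<bullet> W)
     - 2 * pi * ((transpose C *v Y c) \<bullet> W))"

lemma vpart_measurable [measurable]: "vpart \<in> borel_measurable (lborel_PiM I)"
  unfolding vpart_def[abs_def] by measurable

lemma linear_vpart: "linear (\<lambda>c::real^'n. vpart (vec_nth c))" and linear_kpart: "linear (\<lambda>c::real^'n. kpart (vec_nth c))"
  by (rule linearI; simp add: linear_parts)+

lemma X_measurable [measurable]: "X \<in> borel_measurable borel" and Y_measurable [measurable]: "Y \<in> borel_measurable borel"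
  using linear_X linear_Y by (auto intro!: borel_measurable_continuous_onI linear_continuous_on simp: linear_conv_bounded_linear)

lemma matrix_measurable: "(\<lambda>x. (M::real^'n^'n) *v x) \<in> borel_measurable borel"
  by (intro borel_measurable_continuous_onI linear_continuous_on)
    (simp add: linear_conv_bounded_linear[symmetric])

lemma chirp_measurable [measurable]: "chirp \<in> borel_measurable borel"
  and phase_measurable [measurable]: "phase \<in> borel_measurable borel"
proof -
  have v[measurable]: "(\<lambda>c::real^'n. vpart (vec_nth c)) \<in> borel_measurable borel" "(\<lambda>c::real^'n. kpart (vec_nth c)) \<in> borel_measurable borel"
    using linear_vpart linear_kpart by (auto intro!: borel_measurable_continuous_onI linear_continuous_on simp: linear_conv_bounded_linear)
  note [measurable (raw)] = measurable_compose[OF _ matrix_measurable]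
  show "chirp \<in> borel_measurable borel" unfolding chirp_def[abs_def] by measurable
  show "phase \<in> borel_measurable borel" unfolding phase_def[abs_def] Let_def by measurable
qed

text \<open>A B^T = B A^T brings B^+ B to the front, which is symmetric and acts as the identity on
  the range of B^T.\<close>

lemma moore_penrose_form:
  "((moore_penrose B ** A) *v (transpose B *v z)) \<bullet> (transpose B *v z') = z \<bullet> (A *v (transpose B *v z'))"
proof -
  let ?M = "moore_penrose B"
  have "((?M ** A) *v (transpose B *v z)) = ?M *v (B *v (transpose A *v z))"
    by (simp add: matrix_vector_mul_assoc[symmetric] symp(4))
  also have "\<dots> \<bullet> (transpose B *v z') = (transpose A *v z) \<bullet> (?M *v (B *v (transpose B *v z')))"
    using moore_penrose_equations(2)[of B] inner_matrix_transpose(1)[of "?M ** B" "transpose A *v z" "transpose B *v z'"]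
    by (simp add: matrix_vector_mul_assoc matrix_mul_assoc)
  also have "\<dots> = (transpose A *v z) \<bullet> (transpose B *v z')" by (simp only: moore_penrose_range_transpose)
  also have "\<dots> = z \<bullet> (A *v (transpose B *v z'))" by (simp add: inner_matrix_transpose(2))
  finally show ?thesis .
qed

text \<open>B^+ A itself need not be symmetric; on ker(B)^\<bottom> its form is that of A B^T, which
  is.\<close>

lemma moore_penrose_form_symmetric:
  "((moore_penrose B ** A) *v vpart y) \<bullet> vpart y' = ((moore_penrose B ** A) *v vpart y') \<bullet> vpart y"
proof -
  obtain z z' where z: "vpart y = transpose B *v z" "vpart y' = transpose B *v z'"
    using vpart_eq_transpose by metis
  have "z \<bullet> (A *v (transpose B *v z')) = (transpose A *v z) \<bullet> (transpose B *v z')" by (simp add: inner_matrix_transpose(2))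
  also have "\<dots> = (B *v (transpose A *v z)) \<bullet> z'" by (simp add: inner_matrix_transpose(1))
  also have "\<dots> = z' \<bullet> (A *v (transpose B *v z))" by (simp add: symp(4) inner_commute)
  finally show ?thesis unfolding z moore_penrose_form .
qed

text \<open>The cross term of the quadratic form under the shift. The relation A^T D = 1 + C^T B
  splits off u \<bullet> vpart y, from which the Fourier kernel arises.\<close>

lemma moore_penrose_form_shift:
  "((moore_penrose B ** A) *v (transpose B *v (D *v u))) \<bullet> vpart y = u \<bullet> vpart y + (transpose C *v (B *v u)) \<bullet> vpart y"
proof -
  obtain z where z: "vpart y = transpose B *v z" using vpart_eq_transpose by metis
  have "((moore_penrose B ** A) *v (transpose B *v (D *v u))) \<bullet> vpart y = (transpose A *v (D *v u)) \<bullet> vpart y"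
    unfolding z moore_penrose_form by (simp add: inner_matrix_transpose(2))
  then show ?thesis by (simp add: symp(2) inner_left_distrib)
qed

text \<open>Substituting $y' = y + D^T B c_1$ turns the integral over the orthogonal complement of the
  kernel into a Fourier integral in the coordinates: the terms bilinear in $c_1$ and $y'$ reduce
  to $-2\pi c_1 \cdot y'$ by the symplectic relations.\<close>

lemma metaplectic_formula_coordinates:
  assumes k: "subspace_lebesgue ((mat_ker B)\<^sup>\<bottom>) = density (distr (lborel_PiM I) borel vpart) (\<lambda>_. ennreal k)" "k > 0"
    and f[measurable]: "f \<in> borel_measurable borel"
  shows "metaplectic_formula A B C D f (Y c) =
    of_real (mu_S A B * k) * cis (phase c) * partial_fourier I (\<lambda>c. f (X c) * cis (chirp c)) c"
proof -
  let ?M = "moore_penrose B ** A"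
  let ?p = "vpart (vec_nth c)" and ?k = "kpart (vec_nth c)" and ?x = "Y c"
  \<comment> \<open>The component of D^T x in ker(B)^\<bottom>, hence a translation of the
    integration variable; the other component lies in D^T A (ker B) and is the fibre label.\<close>
  define W where "W = transpose B *v (D *v ?p)"
  define \<omega> where "\<omega> i = W \<bullet> e i" for i
  have W: "W = vpart \<omega>" unfolding W_def \<omega>_def[abs_def] by (rule transpose_eq_vpart)
  have Dx: "transpose D *v ?x = W + transpose D *v (A *v ?k)"
    unfolding Y_def W_def symp(1) by (simp add: matrix_vector_right_distrib)
  note [measurable (raw)] = measurable_compose[OF _ matrix_measurable]
  define h where "h y = f (y + transpose D *v ?x) * cis (pi * ((?M *v y) \<bullet> y)) * cis (2 * pi * ((transpose C *v ?x) \<bullet> y))" for y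
  have hm[measurable]: "h \<in> borel_measurable borel" unfolding h_def[abs_def] by measurable
  define G where "G y = f (vpart y + transpose D *v (A *v ?k)) * cis (pi * ((?M *v (vpart y - W)) \<bullet> (vpart y - W)))
      * cis (2 * pi * ((transpose C *v ?x) \<bullet> (vpart y - W)))" for y
  have Gm[measurable]: "G \<in> borel_measurable (lborel_PiM I)" unfolding G_def[abs_def] by measurable
  have hG: "h (vpart y) = G (\<lambda>i\<in>I. y i + \<omega> i)" for y
  proof -
    have "vpart (\<lambda>i\<in>I. y i + \<omega> i) = vpart y + W"
      unfolding W by (simp add: vpart_def scaleR_left_distrib sum.distrib)
    then show ?thesis by (simp add: h_def G_def Dx add.assoc)
  qed
  have tm: "(\<lambda>y. \<lambda>i\<in>I. y i + \<omega> i) \<in> lborel_PiM I \<rightarrow>\<^sub>M lborel_PiM I"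
    by (rule measurable_restrict) (use component_measurable in simp)
  have "(LINT y|subspace_lebesgue ((mat_ker B)\<^sup>\<bottom>). h y) = (LINT y|distr (lborel_PiM I) borel vpart. k *\<^sub>R h y)"
    unfolding k(1) by (rule integral_density) (use k(2) in auto)
  also have "\<dots> = k *\<^sub>R (LINT y|lborel_PiM I. h (vpart y))"
    by (simp add: integral_distr)
  also have "(LINT y|lborel_PiM I. h (vpart y)) = (LINT y|distr (lborel_PiM I) (lborel_PiM I) (\<lambda>y. \<lambda>i\<in>I. y i + \<omega> i). G y)"
    unfolding hG by (rule integral_distr[OF tm Gm, symmetric])
  also have "\<dots> = (LINT y|lborel_PiM I. G y)" by (simp only: distr_lebesgue_translate)
  also have "(\<lambda>y. G y) = (\<lambda>y. cis (pi * ((?M *v W) \<bullet> W) - 2 * pi * ((transpose C *v ?x) \<bullet> W)) *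
      (f (X (join I (vec_nth c) y)) * cis (chirp (join I (vec_nth c) y)) * cis (- 2 * pi * (\<Sum>i\<in>I. c $ i * y i))))"
  proof
    fix y
    have q: "(?M *v (vpart y - W)) \<bullet> (vpart y - W) = (?M *v vpart y) \<bullet> vpart y
        - 2 * ((\<Sum>i\<in>I. c $ i * y i) + (transpose C *v (B *v ?p)) \<bullet> vpart y) + (?M *v W) \<bullet> W"
    proof -
      have 1: "(?M *v vpart y) \<bullet> W = (?M *v W) \<bullet> vpart y" unfolding W by (rule moore_penrose_form_symmetric)
      have 2: "(?M *v W) \<bullet> vpart y = (\<Sum>i\<in>I. c $ i * y i) + (transpose C *v (B *v ?p)) \<bullet> vpart y"
        unfolding W_def moore_penrose_form_shift vpart_inner ..
      show ?thesis
        by (simp only: matrix_vector_mult_diff_distrib inner_diff_left inner_diff_right 1 2) simp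
    qed
    have l: "(transpose C *v ?x) \<bullet> (vpart y - W) = (transpose C *v (B *v ?p)) \<bullet> vpart y
        + (transpose C *v (A *v ?k)) \<bullet> vpart y - (transpose C *v ?x) \<bullet> W"
      by (simp add: inner_diff_right Y_def matrix_vector_right_distrib inner_left_distrib)
    \<comment> \<open>The terms with C^T B applied to \<open>?p\<close> in \<open>q\<close> and
      \<open>l\<close> cancel, leaving the Fourier kernel.\<close>
    have "pi * ((?M *v (vpart y - W)) \<bullet> (vpart y - W)) + 2 * pi * ((transpose C *v ?x) \<bullet> (vpart y - W))
      = (pi * ((?M *v W) \<bullet> W) - 2 * pi * ((transpose C *v ?x) \<bullet> W)) + chirp (join I (vec_nth c) y) + (- 2 * pi * (\<Sum>i\<in>I. c $ i * y i))"
      unfolding q l chirp_def vpart_join kpart_join by (simp add: algebra_simps)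
    then have "cis (pi * ((?M *v (vpart y - W)) \<bullet> (vpart y - W))) * cis (2 * pi * ((transpose C *v ?x) \<bullet> (vpart y - W)))
      = cis (pi * ((?M *v W) \<bullet> W) - 2 * pi * ((transpose C *v ?x) \<bullet> W)) * cis (chirp (join I (vec_nth c) y)) * cis (- 2 * pi * (\<Sum>i\<in>I. c $ i * y i))"
      by (simp only: cis_mult)
    then show "G y = cis (pi * ((?M *v W) \<bullet> W) - 2 * pi * ((transpose C *v ?x) \<bullet> W)) *
      (f (X (join I (vec_nth c) y)) * cis (chirp (join I (vec_nth c) y)) * cis (- 2 * pi * (\<Sum>i\<in>I. c $ i * y i)))"
      unfolding G_def X_def vpart_join kpart_join by (simp only: mult_ac)
  qed
  also have "(LINT y|lborel_PiM I. cis (pi * ((?M *v W) \<bullet> W) - 2 * pi * ((transpose C *v ?x) \<bullet> W)) *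
      (f (X (join I (vec_nth c) y)) * cis (chirp (join I (vec_nth c) y)) * cis (- 2 * pi * (\<Sum>i\<in>I. c $ i * y i))))
    = cis (pi * ((?M *v W) \<bullet> W) - 2 * pi * ((transpose C *v ?x) \<bullet> W)) * partial_fourier I (\<lambda>c. f (X c) * cis (chirp c)) c"
    unfolding partial_fourier_def by (rule integral_mult_right_zero)
  finally have int: "(LINT y|subspace_lebesgue ((mat_ker B)\<^sup>\<bottom>). h y) =
    k *\<^sub>R (cis (pi * ((?M *v W) \<bullet> W) - 2 * pi * ((transpose C *v ?x) \<bullet> W)) * partial_fourier I (\<lambda>c. f (X c) * cis (chirp c)) c)" .
  have ph: "cis (pi * (((D ** transpose C) *v ?x) \<bullet> ?x)) * cis (pi * ((?M *v W) \<bullet> W) - 2 * pi * ((transpose C *v ?x) \<bullet> W)) = cis (phase c)"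
    unfolding cis_mult phase_def Let_def W_def[symmetric] by (simp add: add_diff_eq)
  have "metaplectic_formula A B C D f ?x = of_real (mu_S A B) * cis (pi * (((D ** transpose C) *v ?x) \<bullet> ?x))
     * (LINT y|subspace_lebesgue ((mat_ker B)\<^sup>\<bottom>). h y)"
    unfolding metaplectic_formula_def h_def cis_conv_exp ..
  also have "\<dots> = of_real (mu_S A B * k) * (cis (pi * (((D ** transpose C) *v ?x) \<bullet> ?x)) * cis (pi * ((?M *v W) \<bullet> W) - 2 * pi * ((transpose C *v ?x) \<bullet> W)))
      * partial_fourier I (\<lambda>c. f (X c) * cis (chirp c)) c"
    unfolding int by (simp add: scaleR_conv_of_real mult_ac)
  finally show ?thesis unfolding ph .
qed

end

section \<open>Metaplectic operators in coordinates\<close>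

lemma L2_linear:
  fixes S :: "real^'n::finite \<Rightarrow> real^'n"
  assumes S: "linear S" "inj S"
  obtains k where "k > 0" "\<And>F. F \<in> L2 \<Longrightarrow> (\<lambda>x. F (S x)) \<in> L2"
    "\<And>F. F \<in> L2 \<Longrightarrow> (LINT x|lborel. (norm (F (S x)))\<^sup>2) = k * (LINT x|lborel. (norm (F x))\<^sup>2)"
proof -
  obtain k where k: "k > 0" "distr lborel borel S = density lborel (\<lambda>_. ennreal k)"
    by (rule distr_lborel_linear[OF S])
  have Sm: "S \<in> borel_measurable borel"
    using S by (auto intro!: borel_measurable_continuous_onI linear_continuous_on simp: linear_conv_bounded_linear)
  have Sm': "S \<in> lborel \<rightarrow>\<^sub>M borel" using Sm by simp
  have *: "(\<lambda>x. F (S x)) \<in> L2 \<and> (LINT x|lborel. (norm (F (S x)))\<^sup>2) = k * (LINT x|lborel. (norm (F x))\<^sup>2)"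
    if F: "F \<in> L2" for F
  proof -
    have Fm: "F \<in> borel_measurable borel" by (rule L2_measurable[OF F])
    have Nm: "(\<lambda>x. (norm (F x))\<^sup>2) \<in> borel_measurable borel" using Fm by measurable
    have "integrable lborel (\<lambda>x. k *\<^sub>R (norm (F x))\<^sup>2)" using F by (simp add: L2_def)
    then have "integrable (distr lborel borel S) (\<lambda>x. (norm (F x))\<^sup>2)"
      unfolding k(2) by (subst integrable_density) (use Nm k(1) in simp_all)
    then have i: "integrable lborel (\<lambda>x. (norm (F (S x)))\<^sup>2)" by (rule integrable_distr[OF Sm'])
    have "(LINT x|lborel. (norm (F (S x)))\<^sup>2) = (LINT x|distr lborel borel S. (norm (F x))\<^sup>2)"
      by (rule integral_distr[OF Sm' Nm, symmetric])
    also have "\<dots> = (LINT x|lborel. k *\<^sub>R (norm (F x))\<^sup>2)"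
      unfolding k(2) by (rule integral_density) (use Nm k(1) in simp_all)
    also have "\<dots> = k * (LINT x|lborel. (norm (F x))\<^sup>2)" by simp
    finally show ?thesis using i measurable_compose[OF Sm Fm] by (simp add: L2_def)
  qed
  then show ?thesis using that[OF k(1)] by simp
qed

lemma L2_compose_linear:
  fixes S :: "real^'n::finite \<Rightarrow> real^'n"
  assumes "linear S" "inj S" "F \<in> L2"
  shows "(\<lambda>x. F (S x)) \<in> L2"
  by (rule L2_linear[OF assms(1,2)]) (use assms(3) in simp)

lemma AE_linear:
  fixes S :: "real^'n::finite \<Rightarrow> real^'n"
  assumes S: "linear S" "inj S" and P: "AE x in lborel. P x"
  shows "AE x in lborel. P (S x)"
proof -
  obtain k where k: "k > 0" "distr lborel borel S = density lborel (\<lambda>_. ennreal k)"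
    by (rule distr_lborel_linear[OF S])
  have Sm: "S \<in> lborel \<rightarrow>\<^sub>M borel"
    using S by (auto intro!: borel_measurable_continuous_onI linear_continuous_on simp: linear_conv_bounded_linear)
  have "AE x in density lborel (\<lambda>_. ennreal k). P x"
    by (subst AE_density) (use P in auto)
  then show ?thesis unfolding k(2)[symmetric] by (rule AE_distrD[OF Sm])
qed

lemma L2_unimodular:
  assumes "F \<in> L2" "\<theta> \<in> borel_measurable borel"
  shows "(\<lambda>x. F x * cis (\<theta> x)) \<in> L2"
proof (rule L2_bound[OF assms(1)])
  show "(\<lambda>x. F x * cis (\<theta> x)) \<in> borel_measurable borel"
    using L2_measurable[OF assms(1)] assms(2) by measurable
qed (simp add: norm_mult)

lemma L2_unitary_norm:
  assumes T: "L2_unitary T" and f: "f \<in> L2"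
  shows "(LINT x|lborel. (norm (T f x))\<^sup>2) = (LINT x|lborel. (norm (f x))\<^sup>2)"
proof -
  have e: "L2_inner g g = of_real (LINT x|lborel. (norm (g x))\<^sup>2)" for g :: "real^'a \<Rightarrow> complex"
    unfolding L2_inner_def complex_norm_square[symmetric] by (rule integral_complex_of_real)
  have "L2_inner (T f) (T f) = L2_inner f f" using T f by (simp add: L2_unitary_def)
  then show ?thesis unfolding e of_real_eq_iff .
qed

lemma L2_norm_zero:
  assumes f: "f \<in> L2"
  shows "(LINT x|lborel. (norm (f x))\<^sup>2) = 0 \<longleftrightarrow> (AE x in lborel. f x = 0)"
proof -
  have "integrable lborel (\<lambda>x. (norm (f x))\<^sup>2)" using f by (simp add: L2_def)
  from integral_nonneg_eq_0_iff_AE[OF this] show ?thesis by simp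
qed

lemma L2_unitary_zero:
  assumes T: "L2_unitary T" and f: "f \<in> L2" and z: "AE x in lborel. T f x = 0"
  shows "AE x in lborel. f x = 0"
proof -
  have "T f \<in> L2" using T f by (simp add: L2_unitary_def)
  then show ?thesis using L2_norm_zero[of "T f"] L2_norm_zero[OF f] L2_unitary_norm[OF T f] z by simp
qed

locale metaplectic_coordinates = symplectic_coordinates A B C D I e
  for A B C D :: "real^'n::finite^'n" and I and e +
  fixes T :: "(real^'n \<Rightarrow> complex) \<Rightarrow> (real^'n \<Rightarrow> complex)"
  assumes metaplectic: "metaplectic_op A B C D T"
begin

lemma unitary: "L2_unitary T"
  using metaplectic by (simp add: metaplectic_op_def)

definition Xi :: "real^'n \<Rightarrow> real^'n" where "Xi = inv X"
definition Yi :: "real^'n \<Rightarrow> real^'n" where "Yi = inv Y"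

lemma Xi_X [simp]: "Xi (X c) = c" and Yi_Y [simp]: "Yi (Y c) = c"
  unfolding Xi_def Yi_def using inj_X inj_Y by (auto intro: inv_f_f)

lemma X_Xi [simp]: "X (Xi x) = x" and Y_Yi [simp]: "Y (Yi x) = x"
  unfolding Xi_def Yi_def
  using linear_injective_imp_surjective[OF linear_X inj_X] linear_injective_imp_surjective[OF linear_Y inj_Y]
  by (auto intro: surj_f_inv_f)

lemma linear_Xi: "linear Xi" and linear_Yi: "linear Yi"
  unfolding Xi_def Yi_def
  by (rule inj_linear_imp_inv_linear[OF linear_X inj_X], rule inj_linear_imp_inv_linear[OF linear_Y inj_Y])

lemma inj_Xi: "inj Xi" and inj_Yi: "inj Yi"
  by (rule inj_on_inverseI[of _ X], simp, rule inj_on_inverseI[of _ Y], simp)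

lemma Xi_measurable [measurable]: "Xi \<in> borel_measurable borel"
  using linear_Xi by (auto intro!: borel_measurable_continuous_onI linear_continuous_on simp: linear_conv_bounded_linear)

definition pull :: "(real^'n \<Rightarrow> complex) \<Rightarrow> real^'n \<Rightarrow> complex" where
  "pull F x = F (Xi x) * cis (- chirp (Xi x))"

definition push :: "(real^'n \<Rightarrow> complex) \<Rightarrow> real^'n \<Rightarrow> complex" where
  "push f c = f (X c) * cis (chirp c)"

text \<open>The operator \<open>T\<close> in the coordinates \<open>X\<close> and \<open>Y\<close>,
  with the chirp put on the input and the phase removed from the output. On Gaussians times
  characters only a constant times the partial Fourier transform remains.\<close>

definition U :: "(real^'n \<Rightarrow> complex) \<Rightarrow> real^'n \<Rightarrow> complex" where
  "U F c = cis (- phase c) * T (pull F) (Y c)"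

lemma cis_cancel: "cis a * cis (- a) = 1" "cis (- a) * cis a = 1" "z * cis a * cis (- a) = z" "z * cis (- a) * cis a = z"
  by (simp_all add: cis_mult mult.assoc)

lemma pull_push [simp]: "pull (push f) = f" and push_pull [simp]: "push (pull F) = F"
  by (auto simp: pull_def push_def cis_cancel)

lemma push_L2: "f \<in> L2 \<Longrightarrow> push f \<in> L2"
  unfolding push_def[abs_def] by (rule L2_unimodular[OF L2_compose_linear[OF linear_X inj_X] chirp_measurable])

lemma pull_L2:
  assumes "F \<in> L2" shows "pull F \<in> L2"
  unfolding pull_def[abs_def]
proof (rule L2_unimodular)
  show "(\<lambda>x. F (Xi x)) \<in> L2" by (rule L2_compose_linear[OF linear_Xi inj_Xi assms])
qed measurable

lemma norm_U: "norm (U (push f) c) = norm (T f (Y c))"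
  by (simp add: U_def norm_mult)

lemma U_L2:
  assumes "F \<in> L2" shows "U F \<in> L2"
proof -
  have "T (pull F) \<in> L2" using unitary pull_L2[OF assms] by (simp add: L2_unitary_def)
  then have "(\<lambda>c. T (pull F) (Y c)) \<in> L2" by (rule L2_compose_linear[OF linear_Y inj_Y])
  then have "(\<lambda>c. T (pull F) (Y c) * cis (- phase c)) \<in> L2" by (rule L2_unimodular) measurable
  then show ?thesis unfolding U_def[abs_def] by (simp only: mult.commute)
qed

lemma U_add:
  assumes "F \<in> L2" "G \<in> L2"
  shows "AE c in lborel. U (\<lambda>x. F x + G x) c = U F c + U G c"
proof -
  have eq: "pull (\<lambda>x. F x + G x) = (\<lambda>x. pull F x + pull G x)" by (simp add: pull_def fun_eq_iff distrib_right)
  have "AE x in lborel. T (\<lambda>x. pull F x + pull G x) x = T (pull F) x + T (pull G) x"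
    using unitary pull_L2 assms by (simp add: L2_unitary_def)
  then have "AE c in lborel. T (\<lambda>x. pull F x + pull G x) (Y c) = T (pull F) (Y c) + T (pull G) (Y c)"
    by (rule AE_linear[OF linear_Y inj_Y])
  then show ?thesis unfolding U_def eq by eventually_elim (simp add: distrib_left)
qed

lemma U_scale:
  assumes "F \<in> L2"
  shows "AE c in lborel. U (\<lambda>x. a * F x) c = a * U F c"
proof -
  have eq: "pull (\<lambda>x. a * F x) = (\<lambda>x. a * pull F x)" by (simp add: pull_def fun_eq_iff mult.assoc)
  have "AE x in lborel. T (\<lambda>x. a * pull F x) x = a * T (pull F) x"
    using unitary pull_L2 assms by (simp add: L2_unitary_def)
  then have "AE c in lborel. T (\<lambda>x. a * pull F x) (Y c) = a * T (pull F) (Y c)"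
    by (rule AE_linear[OF linear_Y inj_Y])
  then show ?thesis unfolding U_def eq by eventually_elim (simp add: mult.left_commute)
qed

lemma U_bounded:
  obtains K where "\<And>F. F \<in> L2 \<Longrightarrow> (LINT c|lborel. (norm (U F c))\<^sup>2) \<le> K * (LINT c|lborel. (norm (F c))\<^sup>2)"
proof -
  obtain k where k: "\<And>F. F \<in> L2 \<Longrightarrow> (LINT x|lborel. (norm (F (Xi x)))\<^sup>2) = k * (LINT x|lborel. (norm (F x))\<^sup>2)"
    by (rule L2_linear[OF linear_Xi inj_Xi]) (rule that)
  obtain l where l: "\<And>F. F \<in> L2 \<Longrightarrow> (LINT x|lborel. (norm (F (Y x)))\<^sup>2) = l * (LINT x|lborel. (norm (F x))\<^sup>2)"
    by (rule L2_linear[OF linear_Y inj_Y]) (rule that)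
  have "(LINT c|lborel. (norm (U F c))\<^sup>2) = l * k * (LINT c|lborel. (norm (F c))\<^sup>2)" if F: "F \<in> L2" for F
  proof -
    have TL: "T (pull F) \<in> L2" using unitary pull_L2[OF F] by (simp add: L2_unitary_def)
    have "(LINT c|lborel. (norm (U F c))\<^sup>2) = (LINT c|lborel. (norm (T (pull F) (Y c)))\<^sup>2)"
      by (simp add: U_def norm_mult)
    also have "\<dots> = l * (LINT x|lborel. (norm (pull F x))\<^sup>2)"
      unfolding l[OF TL] L2_unitary_norm[OF unitary pull_L2[OF F]] ..
    also have "(LINT x|lborel. (norm (pull F x))\<^sup>2) = k * (LINT c|lborel. (norm (F c))\<^sup>2)"
      unfolding k[OF F, symmetric] by (simp add: pull_def norm_mult)
    finally show ?thesis by simp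
  qed
  then show ?thesis using that[of "l * k"] by simp
qed

definition weight :: "real^'n \<Rightarrow> complex" where "weight = push (gauss_char 0)"

text \<open>A character in the coordinates \<open>c\<close> is a character in x = X c, with
  frequency given by the adjoint of the inverse. The family \<open>gauss_char\<close> therefore
  covers the weight times every character.\<close>

lemma weight_cis: "(\<lambda>c. weight c * cis (s \<bullet> c)) = push (gauss_char (adjoint Xi s))"
proof
  fix c
  have "adjoint Xi s \<bullet> X c = s \<bullet> c"
    using adjoint_works[OF linear_Xi, of "X c" s] by (simp add: inner_commute)
  then show "weight c * cis (s \<bullet> c) = push (gauss_char (adjoint Xi s)) c"
    by (simp add: weight_def push_def gauss_char_eq mult_ac)
qed

lemma range_independent: "(\<Sum>j\<in>I. y j *\<^sub>R e j) = 0 \<Longrightarrow> \<forall>j\<in>I. y j = 0"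
  using vpart_zero[of y] unfolding vpart_def by blast

text \<open>Gaussians times characters are Schwartz functions, so the integral formula holds for
  them almost everywhere; in coordinates it is the partial Fourier transform, since chirp and phase
  cancel.\<close>

lemma ex_partial_fourier_op: "\<exists>\<kappa> K. partial_fourier_op I U \<kappa> weight K"
proof -
  obtain cc where cc: "norm cc = 1" "\<And>f. f \<in> schwartz \<Longrightarrow> AE x in lborel. T f x = cc * metaplectic_formula A B C D f x"
    using metaplectic unfolding metaplectic_op_def by metis
  obtain k where k: "k > 0" "subspace_lebesgue ((mat_ker B)\<^sup>\<bottom>) = density (distr (lborel_PiM I) borel vpart) (\<lambda>_. ennreal k)"
    unfolding vpart_def[abs_def] by (rule subspace_lebesgue_basis[OF range_independent range_basis])
  define \<kappa> where "\<kappa> = cc * of_real (mu_S A B * k)"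
  obtain K where K: "\<And>F. F \<in> L2 \<Longrightarrow> (LINT c|lborel. (norm (U F c))\<^sup>2) \<le> K * (LINT c|lborel. (norm (F c))\<^sup>2)"
    by (rule U_bounded) (rule that)
  have gm: "gauss_char s \<in> borel_measurable borel" for s :: "real^'n" by (rule L2_measurable[OF gauss_char_L2(1)])
  have char: "AE c in lborel. U (push (gauss_char s)) c = \<kappa> * partial_fourier I (push (gauss_char s)) c" for s
  proof -
    have "AE c in lborel. T (gauss_char s) (Y c) = cc * metaplectic_formula A B C D (gauss_char s) (Y c)"
      by (rule AE_linear[OF linear_Y inj_Y cc(2)[OF gauss_char_schwartz]])
    then show ?thesis
    proof eventually_elim
      fix c
      assume t: "T (gauss_char s) (Y c) = cc * metaplectic_formula A B C D (gauss_char s) (Y c)"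
      have m: "metaplectic_formula A B C D (gauss_char s) (Y c) = of_real (mu_S A B * k) * cis (phase c) * partial_fourier I (push (gauss_char s)) c"
        unfolding metaplectic_formula_coordinates[OF k(2,1) gm] push_def[abs_def] ..
      have "U (push (gauss_char s)) c = cis (- phase c) * (cc * (of_real (mu_S A B * k) * cis (phase c) * partial_fourier I (push (gauss_char s)) c))"
        unfolding U_def pull_push t m ..
      also have "\<dots> = \<kappa> * partial_fourier I (push (gauss_char s)) c * (cis (phase c) * cis (- phase c))"
        by (simp only: \<kappa>_def mult_ac)
      finally show "U (push (gauss_char s)) c = \<kappa> * partial_fourier I (push (gauss_char s)) c"
        by (simp only: cis_cancel mult_1_right)
    qed
  qed
  \<comment> \<open>If \<kappa> were 0, then \<open>T\<close> would annihilate a Gaussian, against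
    unitarity.\<close>
  have nz: "\<kappa> \<noteq> 0"
  proof
    assume "\<kappa> = 0"
    then have "AE c in lborel. U (push (gauss_char 0)) c = 0" using char[of 0] by simp
    then have "AE c in lborel. T (gauss_char 0) (Y c) = 0"
      by eventually_elim (metis norm_U norm_eq_zero)
    then have "AE x in lborel. T (gauss_char 0) (Y (Yi x)) = 0" by (rule AE_linear[OF linear_Yi inj_Yi])
    then have "AE x in lborel. T (gauss_char 0) x = 0" by simp
    then have "AE x in lborel. gauss_char (0::real^'n) x = 0"
      by (rule L2_unitary_zero[OF unitary gauss_char_L2(1)])
    then have "AE x in (lborel :: (real^'n) measure). False"
      by eventually_elim (simp add: gauss_char_def)
    then have "emeasure lborel (UNIV :: (real^'n) set) = 0"
      using AE_iff_measurable[of UNIV "lborel :: (real^'n) measure" "\<lambda>_. False"] by simp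
    then show False by simp
  qed
  have "partial_fourier_op I U \<kappa> weight K"
  proof
    show "weight \<in> L2" unfolding weight_def by (rule push_L2[OF gauss_char_L2(1)])
    show "AE c in lborel. weight c \<noteq> 0"
      by (auto simp: weight_def push_def gauss_char_def)
    show "integrable lborel weight"
    proof -
      obtain l where l: "l > 0" "distr lborel borel X = density lborel (\<lambda>_. ennreal l)"
        by (rule distr_lborel_linear[OF linear_X inj_X])
      have "integrable (distr lborel borel X) (gauss_char 0 :: real^'n \<Rightarrow> complex)"
        unfolding l(2) by (subst integrable_density) (use gauss_char_L2(2) l(1) gm in auto)
      then have i: "integrable lborel (\<lambda>x. gauss_char 0 (X x))" by (rule integrable_distr[rotated]) simp
      show ?thesis
      proof (rule Bochner_Integration.integrable_bound[OF i])
        show "weight \<in> borel_measurable lborel" unfolding weight_def push_def[abs_def] using gm by measurable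
      qed (simp add: weight_def push_def norm_mult)
    qed
    show "AE c in lborel. U (\<lambda>x. weight x * cis (s \<bullet> x)) c = \<kappa> * partial_fourier I (\<lambda>x. weight x * cis (s \<bullet> x)) c" for s
      unfolding weight_cis by (rule char)
  qed (use U_L2 U_add U_scale K nz in auto)
  then show ?thesis by blast
qed

lemma U_partial_fourier:
  obtains \<kappa> where "\<kappa> \<noteq> 0" "\<And>F. F \<in> L2 \<Longrightarrow>
    (AE z in lborel_PiM (- I). integrable (lborel_PiM I) (\<lambda>y. F (join I z y))) \<Longrightarrow>
    AE c in lborel. U F c = \<kappa> * partial_fourier I F c"
proof -
  obtain \<kappa> K where op: "partial_fourier_op I U \<kappa> weight K" using ex_partial_fourier_op by blast
  show ?thesis
    by (rule that[of \<kappa>]) (use partial_fourier_op.eq_partial_fourier[OF op] partial_fourier_op.\<kappa>[OF op] in auto)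
qed

lemma coordinates_independent:
  "(\<Sum>j\<in>-I. z j *\<^sub>R (transpose D *v (A *v e j))) = 0 \<Longrightarrow> \<forall>j\<in>-I. z j = 0"
  "(\<Sum>j\<in>-I. z j *\<^sub>R (A *v e j)) = 0 \<Longrightarrow> \<forall>j\<in>-I. z j = 0"
proof -
  have s: "A *v kpart z = (\<Sum>j\<in>-I. z j *\<^sub>R (A *v e j))"
    "transpose D *v (A *v kpart z) = (\<Sum>j\<in>-I. z j *\<^sub>R (transpose D *v (A *v e j)))" for z
    by (simp_all add: kpart_def linear_sum[OF matrix_vector_mul_linear] matrix_vector_mult_scaleR)
  have v0: "vpart (\<lambda>_. 0) = 0" by (simp add: vpart_def)
  { assume "(\<Sum>j\<in>-I. z j *\<^sub>R (transpose D *v (A *v e j))) = 0"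
    then have "kpart z = 0" by (intro X_parts_zero(2)[of "\<lambda>_. 0"]) (simp only: s(2) v0 add_0_left)
    then show "\<forall>j\<in>-I. z j = 0" using kpart_zero by blast }
  { assume "(\<Sum>j\<in>-I. z j *\<^sub>R (A *v e j)) = 0"
    then have "kpart z = 0" by (intro Y_parts_zero(2)[of "\<lambda>_. 0"]) (simp only: s(1) v0 add_0_left matrix_vector_mult_0_right)
    then show "\<forall>j\<in>-I. z j = 0" using kpart_zero by blast }
qed

lemma X_join: "(\<Sum>j\<in>I. y j *\<^sub>R e j) + (\<Sum>j\<in>-I. z j *\<^sub>R (transpose D *v (A *v e j))) = X (join I z y)"
  and Y_join: "B *v (\<Sum>j\<in>I. y j *\<^sub>R e j) + (\<Sum>j\<in>-I. z j *\<^sub>R (A *v e j)) = Y (join I z y)"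
  unfolding X_def Y_def vpart_join kpart_join unfolding vpart_def kpart_def
  by (simp_all add: linear_sum[OF matrix_vector_mul_linear] matrix_vector_mult_scaleR)

text \<open>The images of the kernel basis under D^T A form a basis of the second summand. The
  component of x1 along \<open>e j\<close> is the coordinate \<open>y j\<close>, so the weight needs
  no transformation.\<close>

lemma decay_f_iff:
  assumes j: "j \<in> I" and f[measurable]: "f \<in> borel_measurable borel"
  shows "decay_f A B D (e j) p a f \<longleftrightarrow> (AE z in lborel_PiM (- I).
    (\<integral>\<^sup>+y. ennreal (norm (f (X (join I z y))) * exp (2 * pi * a powr p / p * \<bar>y j\<bar> powr p)) \<partial>lborel_PiM I) < \<infinity>)"
proof -
  have L: "span ((\<lambda>j. transpose D *v (A *v e j)) ` (- I)) = (\<lambda>x. (transpose D ** A) *v x) ` mat_ker B"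
  proof -
    have "span ((\<lambda>x. (transpose D ** A) *v x) ` (e ` (- I))) = (\<lambda>x. (transpose D ** A) *v x) ` span (e ` (- I))"
      by (rule linear_span_image[OF matrix_vector_mul_linear])
    then show ?thesis unfolding ker_basis by (simp add: image_image matrix_vector_mul_assoc)
  qed
  have m: "(\<lambda>(x1, x2). ennreal (norm (f (x1 + x2)) * exp (2 * pi * a powr p / p * \<bar>x1 \<bullet> e j\<bar> powr p)))
      \<in> borel_measurable (borel \<Otimes>\<^sub>M borel)"
    by measurable
  show ?thesis
    using fibre_integrability_iff[OF coordinates_independent(1) L range_independent range_basis m] j
    unfolding decay_f_def X_join inner_lin_comb by simp
qed

lemma decay_Sf_iff:
  assumes j: "j \<in> I" and f[measurable]: "f \<in> borel_measurable borel"
  shows "decay_Sf A B (e j) q b f \<longleftrightarrow> (AE z in lborel_PiM (- I).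
    (\<integral>\<^sup>+y. ennreal (norm (f (Y (join I z y))) * exp (2 * pi * b powr q / q * \<bar>y j\<bar> powr q)) \<partial>lborel_PiM I) < \<infinity>)"
proof -
  have L: "span ((\<lambda>j. A *v e j) ` (- I)) = (\<lambda>x. A *v x) ` mat_ker B"
  proof -
    have "span ((\<lambda>x. A *v x) ` (e ` (- I))) = (\<lambda>x. A *v x) ` span (e ` (- I))"
      by (rule linear_span_image[OF matrix_vector_mul_linear])
    then show ?thesis unfolding ker_basis by (simp add: image_image)
  qed
  note [measurable (raw)] = measurable_compose[OF _ matrix_measurable]
  have m: "(\<lambda>(x1, x2). ennreal (norm (f (B *v x1 + x2)) * exp (2 * pi * b powr q / q * \<bar>x1 \<bullet> e j\<bar> powr q)))
      \<in> borel_measurable (borel \<Otimes>\<^sub>M borel)"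
    by measurable
  show ?thesis
    using fibre_integrability_iff[OF coordinates_independent(2) L range_independent range_basis m] j
    unfolding decay_Sf_def Y_join inner_lin_comb by simp
qed

end

section \<open>Uniqueness: Morgan's theorem in one of several variables\<close>

lemma insert_fibre:
  fixes I' :: "'n::finite set"
  assumes "j \<notin> I'" and f: "f \<in> borel_measurable (lborel_PiM (insert j I'))"
  shows "(\<integral>\<^sup>+y. f y \<partial>lborel_PiM (insert j I')) = (\<integral>\<^sup>+y. (\<integral>\<^sup>+s. f (y(j := s)) \<partial>lborel) \<partial>lborel_PiM I')"
    and "(\<lambda>y. \<integral>\<^sup>+s. f (y(j := s)) \<partial>lborel) \<in> borel_measurable (lborel_PiM I')"
proof -
  interpret product_sigma_finite "\<lambda>_::'n. lborel :: real measure" by (rule product_sigma_finite_lborel)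
  show "(\<integral>\<^sup>+y. f y \<partial>lborel_PiM (insert j I')) = (\<integral>\<^sup>+y. (\<integral>\<^sup>+s. f (y(j := s)) \<partial>lborel) \<partial>lborel_PiM I')"
    by (rule product_nn_integral_insert[OF _ assms]) simp
  have "(\<lambda>x. f ((fst x)(j := snd x))) \<in> borel_measurable (lborel_PiM I' \<Otimes>\<^sub>M lborel)"
    using measurable_compose[OF measurable_add_dim f] by (simp add: case_prod_unfold)
  then show "(\<lambda>y. \<integral>\<^sup>+s. f (y(j := s)) \<partial>lborel) \<in> borel_measurable (lborel_PiM I')"
    by (intro lborel.borel_measurable_nn_integral) (simp add: case_prod_unfold)
qed

lemma coord_powr_measurable:
  assumes "j \<in> I"
  shows "(\<lambda>y. \<bar>y j\<bar> powr p) \<in> borel_measurable (lborel_PiM I)"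
proof -
  note [measurable] = component_measurable[OF assms]
  show ?thesis by measurable
qed

text \<open>Only the frequency in direction \<open>j\<close> varies. The other frequencies x' are
  frozen and their characters, being unimodular, are absorbed into \<open>h\<close>, while all
  position variables remain integrated; the one-variable theorem then applies with \<open>Y\<close>
  the j-th coordinate.\<close>

lemma morgan_fourier_indices:
  fixes I :: "'n::finite set" and h :: "('n \<Rightarrow> real) \<Rightarrow> complex"
  assumes p: "1 < p" "p < 2" "1 / p + 1 / q = 1" and ab: "a > 0" "b > 0"
    and abc: "a * b > \<bar>cos (p * pi / 2)\<bar> powr (1 / p)" and j: "j \<in> I"
    and h: "h \<in> borel_measurable (lborel_PiM I)"
    and int: "(\<integral>\<^sup>+y. ennreal (norm (h y) * exp (2 * pi * a powr p / p * \<bar>y j\<bar> powr p)) \<partial>lborel_PiM I) < \<infinity>"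
    and H: "H = (\<lambda>x. LINT y|lborel_PiM I. h y * cis (- 2 * pi * (\<Sum>i\<in>I. x i * y i)))"
    and Hm: "H \<in> borel_measurable (lborel_PiM I)"
    and fint: "(\<integral>\<^sup>+x. ennreal (norm (H x) * exp (2 * pi * b powr q / q * \<bar>x j\<bar> powr q)) \<partial>lborel_PiM I) < \<infinity>"
  shows "AE x in lborel_PiM I. H x = 0"
proof -
  define I' where "I' = I - {j}"
  have I: "insert j I' = I" "j \<notin> I'" using j by (auto simp: I'_def)
  note comp = component_measurable[where J = I]
  let ?E = "\<lambda>x. ennreal (norm (H x) * exp (2 * pi * b powr q / q * \<bar>x j\<bar> powr q))"
  have Em: "?E \<in> borel_measurable (lborel_PiM I)"
    using Hm coord_powr_measurable[OF j, of q] by measurable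
  \<comment> \<open>Tonelli: the weighted integral over all frequencies is finite, so it is finite
    on almost every line parallel to the j-th axis.\<close>
  have "AE x' in lborel_PiM I'. (\<integral>\<^sup>+s. ?E (x'(j := s)) \<partial>lborel) \<noteq> \<infinity>"
  proof (rule nn_integral_PInf_AE)
    show "(\<lambda>x'. \<integral>\<^sup>+s. ?E (x'(j := s)) \<partial>lborel) \<in> borel_measurable (lborel_PiM I')"
      by (rule insert_fibre(2)[OF I(2)]) (use Em I(1) in simp)
    have "(\<integral>\<^sup>+x'. (\<integral>\<^sup>+s. ?E (x'(j := s)) \<partial>lborel) \<partial>lborel_PiM I') = (\<integral>\<^sup>+x. ?E x \<partial>lborel_PiM I)"
      using insert_fibre(1)[OF I(2), of ?E] Em unfolding I(1) by simp
    then show "(\<integral>\<^sup>+x'. (\<integral>\<^sup>+s. ?E (x'(j := s)) \<partial>lborel) \<partial>lborel_PiM I') \<noteq> \<infinity>"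
      using fint by simp
  qed
  then have fib0: "AE x' in lborel_PiM I'. (\<integral>\<^sup>+s. ennreal (norm (H (x'(j := s)))) \<partial>lborel) = 0"
  proof eventually_elim
    fix x'
    assume fin: "(\<integral>\<^sup>+s. ?E (x'(j := s)) \<partial>lborel) \<noteq> \<infinity>"
    define h' where "h' y = h y * cis (- 2 * pi * (\<Sum>i\<in>I'. x' i * y i))" for y
    have sm: "(\<lambda>y. \<Sum>i\<in>I'. x' i * y i) \<in> borel_measurable (lborel_PiM I)"
      by (rule borel_measurable_sum, rule borel_measurable_times, rule borel_measurable_const, rule comp) (simp add: I'_def)
    have h'm: "h' \<in> borel_measurable (lborel_PiM I)"
      unfolding h'_def[abs_def] using h sm by measurable
    have nh': "norm (h' y) = norm (h y)" for y by (simp add: h'_def norm_mult)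
    have hat: "(\<lambda>s. H (x'(j := s))) = (\<lambda>s. LINT y|lborel_PiM I. h' y * cis (- 2 * pi * s * y j))"
    proof
      fix s
      have "(\<Sum>i\<in>I. (x'(j := s)) i * y i) = s * y j + (\<Sum>i\<in>I'. x' i * y i)" for y
      proof -
        have "(\<Sum>i\<in>I'. (x'(j := s)) i * y i) = (\<Sum>i\<in>I'. x' i * y i)" using I(2) by (intro sum.cong) auto
        then show ?thesis unfolding I(1)[symmetric] using I(2) by (subst sum.insert) auto
      qed
      then have "h y * cis (- 2 * pi * (\<Sum>i\<in>I. (x'(j := s)) i * y i)) = h' y * cis (- 2 * pi * s * y j)" for y
        unfolding h'_def mult.assoc cis_mult by (simp add: algebra_simps)
      then show "H (x'(j := s)) = (LINT y|lborel_PiM I. h' y * cis (- 2 * pi * s * y j))"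
        unfolding H by simp
    qed
    have hi: "integrable (lborel_PiM I) (\<lambda>y. norm (h' y) * exp (2 * pi * a powr p / p * \<bar>y j\<bar> powr p))"
    proof (rule integrableI_nonneg)
      show "(\<lambda>y. norm (h' y) * exp (2 * pi * a powr p / p * \<bar>y j\<bar> powr p)) \<in> borel_measurable (lborel_PiM I)"
        using h'm coord_powr_measurable[OF j, of p] by measurable
    qed (use int in \<open>auto simp: nh'\<close>)
    have "H (x'(j := s)) = 0" if "s \<noteq> 0" for s
      by (rule morgan_fourier[OF p ab abc h'm comp[OF j] hi hat _ that]) (use fin in \<open>simp add: top.not_eq_extremum\<close>)
    then have "AE s in lborel. ennreal (norm (H (x'(j := s)))) = 0"
      by (intro AE_I'[of "{0}"]) auto
    then have "(\<integral>\<^sup>+s. ennreal (norm (H (x'(j := s)))) \<partial>lborel) = (\<integral>\<^sup>+s. 0 \<partial>(lborel :: real measure))"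
      by (rule nn_integral_cong_AE)
    then show "(\<integral>\<^sup>+s. ennreal (norm (H (x'(j := s)))) \<partial>lborel) = 0" by simp
  qed
  let ?N = "\<lambda>x. ennreal (norm (H x))"
  have Nm: "?N \<in> borel_measurable (lborel_PiM I)" using Hm by measurable
  have "(\<integral>\<^sup>+x. ?N x \<partial>lborel_PiM I) = (\<integral>\<^sup>+x'. (\<integral>\<^sup>+s. ?N (x'(j := s)) \<partial>lborel) \<partial>lborel_PiM I')"
    using insert_fibre(1)[OF I(2), of ?N] Nm unfolding I(1) by simp
  also have "\<dots> = (\<integral>\<^sup>+x'. 0 \<partial>lborel_PiM I')" by (rule nn_integral_cong_AE[OF fib0])
  finally have "(\<integral>\<^sup>+x. ?N x \<partial>lborel_PiM I) = 0" by simp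
  then have "AE x in lborel_PiM I. ?N x = 0" using nn_integral_0_iff_AE[OF Nm] by simp
  then show ?thesis by eventually_elim simp
qed

lemma integrable_of_weighted:
  fixes h :: "'b \<Rightarrow> complex"
  assumes h: "h \<in> borel_measurable M" and c: "\<And>y. 0 \<le> c y"
    and i: "(\<integral>\<^sup>+y. ennreal (norm (h y) * exp (c y)) \<partial>M) < \<infinity>"
  shows "integrable M h"
proof (rule integrableI_bounded[OF h])
  have "(\<integral>\<^sup>+y. ennreal (norm (h y)) \<partial>M) \<le> (\<integral>\<^sup>+y. ennreal (norm (h y) * exp (c y)) \<partial>M)"
  proof (intro nn_integral_mono ennreal_leI)
    fix y show "norm (h y) \<le> norm (h y) * exp (c y)"
      using c[of y] mult_left_mono[of 1 "exp (c y)" "norm (h y)"] by simp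
  qed
  then show "(\<integral>\<^sup>+y. ennreal (norm (h y)) \<partial>M) < \<infinity>" using i by (rule order.strict_trans1)
qed

context metaplectic_coordinates
begin

theorem morgan_uniqueness:
  assumes p: "1 < p" "p < 2" "1 / p + 1 / q = 1" and ab: "a > 0" "b > 0"
    and abc: "a * b > \<bar>cos (p * pi / 2)\<bar> powr (1 / p)" and j: "j \<in> I"
    and f: "f \<in> L2" and d1: "decay_f A B D (e j) p a f" and d2: "decay_Sf A B (e j) q b (T f)"
  shows "AE x in lborel. f x = 0"
proof -
  define F where "F = push f"
  have F: "F \<in> L2" unfolding F_def by (rule push_L2[OF f])
  have Fm: "F \<in> borel_measurable borel" by (rule L2_measurable[OF F])
  have fm: "f \<in> borel_measurable borel" by (rule L2_measurable[OF f])
  have Tf: "T f \<in> L2" using unitary f by (simp add: L2_unitary_def)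
  have Tm: "T f \<in> borel_measurable borel" by (rule L2_measurable[OF Tf])
  have q: "q > 0" using p by (smt (verit) divide_less_eq_1_pos divide_nonneg_nonpos)
  let ?P = "lborel_PiM I"
  have Fz: "(\<lambda>y. F (join I z y)) \<in> borel_measurable ?P" for z
    by (rule measurable_compose[OF measurable_join_snd Fm])
  have A1: "AE z in lborel_PiM (- I).
    (\<integral>\<^sup>+y. ennreal (norm (F (join I z y)) * exp (2 * pi * a powr p / p * \<bar>y j\<bar> powr p)) \<partial>?P) < \<infinity>"
    using d1 unfolding decay_f_iff[OF j fm] by (simp add: F_def push_def norm_mult)
  have A2: "AE z in lborel_PiM (- I).
    (\<integral>\<^sup>+y. ennreal (norm (T f (Y (join I z y))) * exp (2 * pi * b powr q / q * \<bar>y j\<bar> powr q)) \<partial>?P) < \<infinity>"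
    using d2 unfolding decay_Sf_iff[OF j Tm] .
  obtain \<kappa> where k: "\<kappa> \<noteq> 0" "\<And>F. F \<in> L2 \<Longrightarrow>
    (AE z in lborel_PiM (- I). integrable ?P (\<lambda>y. F (join I z y))) \<Longrightarrow>
    AE c in lborel. U F c = \<kappa> * partial_fourier I F c"
    by (rule U_partial_fourier) (rule that)
  have "AE z in lborel_PiM (- I). integrable ?P (\<lambda>y. F (join I z y))"
    using A1
  proof eventually_elim
    case (elim z)
    show ?case by (rule integrable_of_weighted[OF Fz _ elim]) (use p ab in simp)
  qed
  from k(2)[OF F this] have UF: "AE c in lborel. U F c = \<kappa> * partial_fourier I F c" .
  have pm: "partial_fourier I F \<in> borel_measurable borel" by (rule partial_fourier_measurable[OF Fm])
  have A3: "AE z in lborel_PiM (- I). AE y in ?P. U F (join I z y) = \<kappa> * partial_fourier I F (join I z y)"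
    by (rule AE_join[OF UF])
  have "AE z in lborel_PiM (- I). AE y in ?P. partial_fourier I F (join I z y) = 0"
    using A1 A2 A3
  proof eventually_elim
    case (elim z)
    let ?H = "\<lambda>x. partial_fourier I F (join I z x)"
    have Hm: "?H \<in> borel_measurable ?P" by (rule measurable_compose[OF measurable_join_snd pm])
    have "(\<integral>\<^sup>+y. ennreal (norm (T f (Y (join I z y))) * exp (2 * pi * b powr q / q * \<bar>y j\<bar> powr q)) \<partial>?P)
      = (\<integral>\<^sup>+y. ennreal (norm \<kappa>) * ennreal (norm (?H y) * exp (2 * pi * b powr q / q * \<bar>y j\<bar> powr q)) \<partial>?P)"
    proof (rule nn_integral_cong_AE)
      show "AE y in ?P. ennreal (norm (T f (Y (join I z y))) * exp (2 * pi * b powr q / q * \<bar>y j\<bar> powr q))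
        = ennreal (norm \<kappa>) * ennreal (norm (?H y) * exp (2 * pi * b powr q / q * \<bar>y j\<bar> powr q))"
        using elim(3)
      proof eventually_elim
        case (elim y)
        have "norm (T f (Y (join I z y))) = norm \<kappa> * norm (?H y)"
          using norm_U[of f "join I z y"] elim by (simp add: F_def norm_mult)
        then show ?case by (simp add: ennreal_mult'[symmetric] mult.assoc)
      qed
    qed
    also have "\<dots> = ennreal (norm \<kappa>) * (\<integral>\<^sup>+y. ennreal (norm (?H y) * exp (2 * pi * b powr q / q * \<bar>y j\<bar> powr q)) \<partial>?P)"
      by (rule nn_integral_cmult) (use Hm coord_powr_measurable[OF j, of q] in measurable)
    finally have "ennreal (norm \<kappa>) * (\<integral>\<^sup>+y. ennreal (norm (?H y) * exp (2 * pi * b powr q / q * \<bar>y j\<bar> powr q)) \<partial>?P) < \<infinity>"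
      using elim(2) by simp
    then have fint: "(\<integral>\<^sup>+y. ennreal (norm (?H y) * exp (2 * pi * b powr q / q * \<bar>y j\<bar> powr q)) \<partial>?P) < \<infinity>"
      using k(1) by (auto simp: ennreal_mult_less_top)
    show ?case
      by (rule morgan_fourier_indices[OF p ab abc j Fz elim(1) _ Hm fint]) (simp only: partial_fourier_join)
  qed
  then have "AE c in lborel. partial_fourier I F c = 0"
    by (subst AE_join_iff) (use pm in measurable)
  with UF have "AE c in lborel. T f (Y c) = 0"
  proof eventually_elim
    case (elim c)
    then have "norm (U F c) = 0" by simp
    then show ?case unfolding F_def norm_U by simp
  qed
  then have "AE x in lborel. T f (Y (Yi x)) = 0" by (rule AE_linear[OF linear_Yi inj_Yi])
  then have "AE x in lborel. T f x = 0" by simp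
  then show ?thesis by (rule L2_unitary_zero[OF unitary f])
qed

end

section \<open>Density: weighted estimates for products of extremal functions\<close>

lemma nn_integral_exp_powr_finite:
  fixes \<delta> q s :: real
  assumes d: "\<delta> > 0" and q: "q \<ge> 1"
  shows "(\<integral>\<^sup>+x. ennreal (exp (- \<delta> * \<bar>x - s\<bar> powr q)) \<partial>lborel) < \<infinity>"
proof -
  let ?E = "\<lambda>x. ennreal (exponential_density \<delta> x)"
  interpret prob_space "density lborel (exponential_density \<delta>)" by (rule prob_space_exponential_density[OF d])
  have E1: "(\<integral>\<^sup>+x. ?E x \<partial>lborel) = 1"
    using emeasure_space_1 by (simp add: emeasure_density)
  have Em: "?E \<in> borel_measurable borel" by measurable
  have E2: "(\<integral>\<^sup>+x. ?E (- s + 1 * x) \<partial>lborel) = 1"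
    using nn_integral_real_affine[OF Em, of 1 "- s"] E1 by simp
  have E3: "(\<integral>\<^sup>+x. ?E (s + (- 1) * x) \<partial>lborel) = 1"
    using nn_integral_real_affine[OF Em, of "- 1" s] E1 by simp
  have le: "exp (- \<delta> * \<bar>x - s\<bar> powr q) \<le> exp \<delta> / \<delta> * (exponential_density \<delta> (- s + 1 * x) + exponential_density \<delta> (s + (- 1) * x))" for x
  proof -
    \<comment> \<open>As q \<ge> 1, the integrand is at most a multiple of exp (- \<delta> |x - s|),
      which is dominated by two exponential densities, one on each side of \<open>s\<close>.\<close>
    have "\<bar>x - s\<bar> - 1 \<le> \<bar>x - s\<bar> powr q"
    proof (cases "\<bar>x - s\<bar> \<ge> 1")
      case True
      then show ?thesis using powr_mono[OF q True] by simp
    next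
      case False
      then show ?thesis using powr_ge_zero[of "\<bar>x - s\<bar>" q] by linarith
    qed
    then have "\<delta> * (\<bar>x - s\<bar> - 1) \<le> \<delta> * \<bar>x - s\<bar> powr q" using d by (intro mult_left_mono) auto
    then have "exp (- \<delta> * \<bar>x - s\<bar> powr q) \<le> exp (\<delta> + - \<delta> * \<bar>x - s\<bar>)" by (simp add: right_diff_distrib)
    also have "\<dots> = exp \<delta> * exp (- (\<bar>x - s\<bar> * \<delta>))" by (simp only: exp_add) (simp add: mult.commute)
    also have "\<dots> \<le> exp \<delta> / \<delta> * (exponential_density \<delta> (- s + 1 * x) + exponential_density \<delta> (s + (- 1) * x))"
      using d by (cases "x = s"; cases "x < s") (auto simp: exponential_density_def field_simps)
    finally show ?thesis .
  qed
  have "(\<integral>\<^sup>+x. ennreal (exp (- \<delta> * \<bar>x - s\<bar> powr q)) \<partial>lborel)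
      \<le> (\<integral>\<^sup>+x. ennreal (exp \<delta> / \<delta>) * (?E (- s + 1 * x) + ?E (s + (- 1) * x)) \<partial>lborel)"
  proof (rule nn_integral_mono)
    fix x
    have "ennreal (exp (- \<delta> * \<bar>x - s\<bar> powr q)) \<le> ennreal (exp \<delta> / \<delta> * (exponential_density \<delta> (- s + 1 * x) + exponential_density \<delta> (s + (- 1) * x)))"
      by (rule ennreal_leI[OF le])
    also have "\<dots> = ennreal (exp \<delta> / \<delta>) * (?E (- s + 1 * x) + ?E (s + (- 1) * x))"
      using d by (subst ennreal_mult) (auto simp: exponential_density_nonneg intro!: ennreal_plus add_nonneg_nonneg)
    finally show "ennreal (exp (- \<delta> * \<bar>x - s\<bar> powr q)) \<le> ennreal (exp \<delta> / \<delta>) * (?E (- s + 1 * x) + ?E (s + (- 1) * x))" .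
  qed
  also have "\<dots> = ennreal (exp \<delta> / \<delta>) * ((\<integral>\<^sup>+x. ?E (- s + 1 * x) \<partial>lborel) + (\<integral>\<^sup>+x. ?E (s + (- 1) * x) \<partial>lborel))"
    by (subst nn_integral_cmult, measurable, subst nn_integral_add, measurable)
  also have "\<dots> < \<infinity>" unfolding E2 E3 by (simp add: ennreal_mult_less_top)
  finally show ?thesis .
qed

text \<open>A character shifts the transform, so decay centred at \<open>s\<close> has to beat a
  weight centred at 0. With an intermediate rate k \<mu>^q = k2 < k', either |y| \<le> \<mu> |y -
  s|, or |y| is at most \<open>R0\<close>, which costs only the constant \<open>R\<close>.\<close>

lemma powr_shift_bound:
  fixes k k' q s :: real
  assumes k: "0 < k" "k < k'" and q: "q > 0"
  obtains \<delta> R where "\<delta> > 0" "\<And>y. k * \<bar>y\<bar> powr q \<le> (k' - \<delta>) * \<bar>y - s\<bar> powr q + R"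
proof -
  define k2 where "k2 = (k + k') / 2"
  have k2: "k < k2" "k2 < k'" using k by (auto simp: k2_def)
  define \<mu> where "\<mu> = (k2 / k) powr (1 / q)"
  have mu: "\<mu> > 1" "k * \<mu> powr q = k2"
    using k k2 q by (auto simp: \<mu>_def powr_powr gr_one_powr)
  define R0 where "R0 = \<bar>s\<bar> / (1 - 1 / \<mu>)"
  have b: "\<bar>y\<bar> powr q \<le> \<mu> powr q * \<bar>y - s\<bar> powr q + R0 powr q" for y
  proof (cases "\<bar>y\<bar> \<le> \<mu> * \<bar>y - s\<bar>")
    case True
    then have "\<bar>y\<bar> powr q \<le> (\<mu> * \<bar>y - s\<bar>) powr q" using q by (intro powr_mono2) auto
    then show ?thesis using mu by (simp add: powr_mult add_increasing2)
  next
    case False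
    then have "\<bar>y - s\<bar> \<le> \<bar>y\<bar> / \<mu>" using mu by (simp add: field_simps)
    then have "\<bar>y\<bar> * (1 - 1 / \<mu>) \<le> \<bar>s\<bar>" by (simp add: right_diff_distrib)
    then have "\<bar>y\<bar> \<le> R0" using mu unfolding R0_def by (subst pos_le_divide_eq) auto
    then have "\<bar>y\<bar> powr q \<le> R0 powr q" using q by (intro powr_mono2) auto
    then show ?thesis using mu by (simp add: add_increasing)
  qed
  have "k * \<bar>y\<bar> powr q \<le> (k' - (k' - k2)) * \<bar>y - s\<bar> powr q + k * R0 powr q" for y
    using mult_left_mono[OF b[of y], of k] k mu by (simp add: distrib_left mult.assoc[symmetric])
  then show ?thesis by (intro that[of "k' - k2" "k * R0 powr q"]) (use k2 in auto)
qed

lemma weighted_nn_integral_finite: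
  fixes g :: "real \<Rightarrow> complex"
  assumes k: "0 < k" "k < k'" and q: "q \<ge> 1"
    and g: "\<And>y. norm (g y) \<le> C * exp (- k' * \<bar>y - s\<bar> powr q)"
  shows "(\<integral>\<^sup>+y. ennreal (norm (g y) * exp (k * \<bar>y\<bar> powr q)) \<partial>lborel) < \<infinity>"
    and "(\<integral>\<^sup>+y. ennreal (norm (g y)) \<partial>lborel) < \<infinity>"
proof -
  obtain \<delta> R where d: "\<delta> > 0" "\<And>y. k * \<bar>y\<bar> powr q \<le> (k' - \<delta>) * \<bar>y - s\<bar> powr q + R"
    by (rule powr_shift_bound[OF k, of q s]) (use q in auto)
  have C: "C \<ge> 0"
  proof -
    have "0 \<le> C * exp (- k' * \<bar>0 - s\<bar> powr q)" using g[of 0] norm_ge_zero[of "g 0"] by linarith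
    then show ?thesis by (simp add: zero_le_mult_iff)
  qed
  have "(\<integral>\<^sup>+y. ennreal (norm (g y) * exp (k * \<bar>y\<bar> powr q)) \<partial>lborel)
      \<le> (\<integral>\<^sup>+y. ennreal (C * exp R) * ennreal (exp (- \<delta> * \<bar>y - s\<bar> powr q)) \<partial>lborel)"
  proof (rule nn_integral_mono)
    fix y
    have "norm (g y) * exp (k * \<bar>y\<bar> powr q) \<le> (C * exp (- k' * \<bar>y - s\<bar> powr q)) * exp ((k' - \<delta>) * \<bar>y - s\<bar> powr q + R)"
      using g[of y] d(2)[of y] C by (intro mult_mono) auto
    also have "\<dots> = (C * exp R) * exp (- \<delta> * \<bar>y - s\<bar> powr q)"
      by (simp add: mult.assoc exp_add[symmetric] algebra_simps)
    finally show "ennreal (norm (g y) * exp (k * \<bar>y\<bar> powr q)) \<le> ennreal (C * exp R) * ennreal (exp (- \<delta> * \<bar>y - s\<bar> powr q))"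
      using C by (subst ennreal_mult[symmetric]) (auto intro: ennreal_leI)
  qed
  also have "\<dots> = ennreal (C * exp R) * (\<integral>\<^sup>+y. ennreal (exp (- \<delta> * \<bar>y - s\<bar> powr q)) \<partial>lborel)"
    by (rule nn_integral_cmult) measurable
  also have "\<dots> < \<infinity>" using nn_integral_exp_powr_finite[OF d(1) q, of s] by (simp add: ennreal_mult_less_top)
  finally show 1: "(\<integral>\<^sup>+y. ennreal (norm (g y) * exp (k * \<bar>y\<bar> powr q)) \<partial>lborel) < \<infinity>" .
  have "(\<integral>\<^sup>+y. ennreal (norm (g y)) \<partial>lborel) \<le> (\<integral>\<^sup>+y. ennreal (norm (g y) * exp (k * \<bar>y\<bar> powr q)) \<partial>lborel)"
  proof (intro nn_integral_mono ennreal_leI)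
    fix y show "norm (g y) \<le> norm (g y) * exp (k * \<bar>y\<bar> powr q)"
      using k mult_left_mono[of 1 "exp (k * \<bar>y\<bar> powr q)" "norm (g y)"] by simp
  qed
  then show "(\<integral>\<^sup>+y. ennreal (norm (g y)) \<partial>lborel) < \<infinity>" using 1 by (rule order.strict_trans1)
qed

lemma prod_less_top_ennreal:
  fixes f :: "'i \<Rightarrow> ennreal"
  shows "finite I \<Longrightarrow> (\<And>i. i \<in> I \<Longrightarrow> f i < \<infinity>) \<Longrightarrow> (\<Prod>i\<in>I. f i) < \<infinity>"
  by (induction I rule: finite_induct) (auto simp: ennreal_mult_less_top)

lemma weighted_prod_nn_integral_finite:
  fixes I :: "'n::finite set" and \<phi> :: "'n \<Rightarrow> real \<Rightarrow> complex"
  assumes k: "0 < k" "k < k'" and q: "q \<ge> 1" and j: "j \<in> I"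
    and m: "\<And>i. \<phi> i \<in> borel_measurable borel"
    and \<phi>: "\<And>i y. norm (\<phi> i y) \<le> C * exp (- k' * \<bar>y - s i\<bar> powr q)"
  shows "(\<integral>\<^sup>+y. ennreal (norm (\<Prod>i\<in>I. \<phi> i (y i)) * exp (k * \<bar>y j\<bar> powr q)) \<partial>lborel_PiM I) < \<infinity>"
proof -
  interpret product_sigma_finite "\<lambda>_::'n. lborel :: real measure" by (rule product_sigma_finite_lborel)
  define u where "u i t = ennreal (norm (\<phi> i t) * (if i = j then exp (k * \<bar>t\<bar> powr q) else 1))" for i t
  have um: "u i \<in> borel_measurable lborel" for i
    unfolding u_def[abs_def] using m[of i] by (cases "i = j") simp_all
  have fin: "integral\<^sup>N lborel (u i) < \<infinity>" for i
    using weighted_nn_integral_finite[OF k q \<phi>[of i]] by (cases "i = j") (simp_all add: u_def[abs_def])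
  have eq: "ennreal (norm (\<Prod>i\<in>I. \<phi> i (y i)) * exp (k * \<bar>y j\<bar> powr q)) = (\<Prod>i\<in>I. u i (y i))" for y
  proof -
    have "(\<Prod>i\<in>I. if i = j then exp (k * \<bar>y i\<bar> powr q) else 1) = exp (k * \<bar>y j\<bar> powr q)"
      using j by simp
    then have "norm (\<Prod>i\<in>I. \<phi> i (y i)) * exp (k * \<bar>y j\<bar> powr q)
        = (\<Prod>i\<in>I. norm (\<phi> i (y i)) * (if i = j then exp (k * \<bar>y i\<bar> powr q) else 1))"
      by (simp only: prod.distrib prod_norm)
    then show ?thesis unfolding u_def by (subst prod_ennreal) auto
  qed
  have "(\<integral>\<^sup>+y. ennreal (norm (\<Prod>i\<in>I. \<phi> i (y i)) * exp (k * \<bar>y j\<bar> powr q)) \<partial>lborel_PiM I) = (\<Prod>i\<in>I. integral\<^sup>N lborel (u i))"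
    unfolding eq by (rule product_nn_integral_prod) (use um in auto)
  also have "\<dots> < \<infinity>" by (rule prod_less_top_ennreal) (use fin in auto)
  finally show ?thesis .
qed

lemma AE_coordinate:
  fixes P :: "real \<Rightarrow> bool" and i :: "'n::finite"
  assumes P: "AE x in lborel. P x" and m: "Measurable.pred borel P"
  shows "AE c in (lborel :: (real^'n) measure). P (c $ i)"
proof -
  interpret product_sigma_finite "\<lambda>_::'n. lborel :: real measure" by (rule product_sigma_finite_lborel)
  have "AE x in distr (lborel_PiM {i}) lborel (\<lambda>y. y i). P x" using P by (simp only: distr_singleton)
  then have "AE y in lborel_PiM {i}. P (y i)"
    by (rule AE_distrD[rotated]) (use component_measurable[of i "{i}"] in simp)
  then have "AE z in lborel_PiM (- {i}). AE y in lborel_PiM {i}. P (join {i} z y $ i)" by simp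
  moreover have "Measurable.pred borel (\<lambda>c::real^'n. P (c $ i))"
    by (rule measurable_compose[OF borel_measurable_vec_nth m])
  ultimately show ?thesis by (subst AE_join_iff[where I = "{i}"]) auto
qed

context metaplectic_coordinates
begin

lemma T_L2: "f \<in> L2 \<Longrightarrow> T f \<in> L2"
  using unitary by (simp add: L2_unitary_def)

text \<open>Decay of the image is first shown for single characters, whose shifts differ; closure
  under sums and multiples carries it to trigonometric polynomials.\<close>

lemma decay_Sf_add:
  assumes j: "j \<in> I" and f: "f \<in> L2" "decay_Sf A B (e j) q b (T f)" and g: "g \<in> L2" "decay_Sf A B (e j) q b (T g)"
  shows "decay_Sf A B (e j) q b (T (\<lambda>x. f x + g x))"
proof -
  let ?P = "lborel_PiM I"
  let ?c = "\<lambda>y. 2 * pi * b powr q / q * \<bar>y j\<bar> powr q"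
  have fg: "(\<lambda>x. f x + g x) \<in> L2" by (rule L2_add[OF f(1) g(1)])
  note m = L2_measurable[OF T_L2[OF f(1)]] L2_measurable[OF T_L2[OF g(1)]] L2_measurable[OF T_L2[OF fg]]
  have mY: "(\<lambda>y. ennreal (norm (h (Y (join I z y))) * exp (?c y))) \<in> borel_measurable ?P" if "h \<in> borel_measurable borel" for h :: "real^'n \<Rightarrow> complex" and z
    using measurable_compose[OF measurable_join_snd measurable_compose[OF Y_measurable that]] coord_powr_measurable[OF j, of q] by measurable
  have "AE x in lborel. T (\<lambda>x. f x + g x) x = T f x + T g x"
    using unitary f g by (simp add: L2_unitary_def)
  then have "AE c in lborel. T (\<lambda>x. f x + g x) (Y c) = T f (Y c) + T g (Y c)" by (rule AE_linear[OF linear_Y inj_Y])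
  then have "AE z in lborel_PiM (- I). AE y in ?P. T (\<lambda>x. f x + g x) (Y (join I z y)) = T f (Y (join I z y)) + T g (Y (join I z y))"
    by (rule AE_join)
  with f(2) g(2) show ?thesis
    unfolding decay_Sf_iff[OF j m(1)] decay_Sf_iff[OF j m(2)] decay_Sf_iff[OF j m(3)]
  proof eventually_elim
    case (elim z)
    have "(\<integral>\<^sup>+y. ennreal (norm (T (\<lambda>x. f x + g x) (Y (join I z y))) * exp (?c y)) \<partial>?P)
      \<le> (\<integral>\<^sup>+y. ennreal (norm (T f (Y (join I z y))) * exp (?c y)) + ennreal (norm (T g (Y (join I z y))) * exp (?c y)) \<partial>?P)"
    proof (rule nn_integral_mono_AE)
      show "AE y in ?P. ennreal (norm (T (\<lambda>x. f x + g x) (Y (join I z y))) * exp (?c y))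
        \<le> ennreal (norm (T f (Y (join I z y))) * exp (?c y)) + ennreal (norm (T g (Y (join I z y))) * exp (?c y))"
        using elim(3)
      proof eventually_elim
        case (elim y)
        have "norm (T (\<lambda>x. f x + g x) (Y (join I z y))) * exp (?c y) \<le> (norm (T f (Y (join I z y))) + norm (T g (Y (join I z y)))) * exp (?c y)"
          unfolding elim by (intro mult_right_mono norm_triangle_ineq) simp
        then have "ennreal (norm (T (\<lambda>x. f x + g x) (Y (join I z y))) * exp (?c y))
          \<le> ennreal (norm (T f (Y (join I z y))) * exp (?c y) + norm (T g (Y (join I z y))) * exp (?c y))"
          unfolding distrib_right by (rule ennreal_leI)
        also have "\<dots> = ennreal (norm (T f (Y (join I z y))) * exp (?c y)) + ennreal (norm (T g (Y (join I z y))) * exp (?c y))"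
          by (rule ennreal_plus) auto
        finally show ?case .
      qed
    qed
    also have "\<dots> = (\<integral>\<^sup>+y. ennreal (norm (T f (Y (join I z y))) * exp (?c y)) \<partial>?P) + (\<integral>\<^sup>+y. ennreal (norm (T g (Y (join I z y))) * exp (?c y)) \<partial>?P)"
      by (rule nn_integral_add[OF mY[OF m(1)] mY[OF m(2)]])
    also have "\<dots> < \<infinity>" using elim(1,2) by simp
    finally show ?case .
  qed
qed

lemma decay_Sf_scale:
  assumes j: "j \<in> I" and f: "f \<in> L2" "decay_Sf A B (e j) q b (T f)"
  shows "decay_Sf A B (e j) q b (T (\<lambda>x. a * f x))"
proof -
  let ?P = "lborel_PiM I"
  let ?c = "\<lambda>y. 2 * pi * b powr q / q * \<bar>y j\<bar> powr q"
  note m = L2_measurable[OF T_L2[OF f(1)]] L2_measurable[OF T_L2[OF L2_cmult[OF f(1), of a]]]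
  have mY: "(\<lambda>y. ennreal (norm (T f (Y (join I z y))) * exp (?c y))) \<in> borel_measurable ?P" for z
    using measurable_compose[OF measurable_join_snd measurable_compose[OF Y_measurable m(1)]] coord_powr_measurable[OF j, of q] by measurable
  have "AE x in lborel. T (\<lambda>x. a * f x) x = a * T f x"
    using unitary f by (simp add: L2_unitary_def)
  then have "AE c in lborel. T (\<lambda>x. a * f x) (Y c) = a * T f (Y c)" by (rule AE_linear[OF linear_Y inj_Y])
  then have "AE z in lborel_PiM (- I). AE y in ?P. T (\<lambda>x. a * f x) (Y (join I z y)) = a * T f (Y (join I z y))"
    by (rule AE_join)
  with f(2) show ?thesis
    unfolding decay_Sf_iff[OF j m(1)] decay_Sf_iff[OF j m(2)]
  proof eventually_elim
    case (elim z)
    have "(\<integral>\<^sup>+y. ennreal (norm (T (\<lambda>x. a * f x) (Y (join I z y))) * exp (?c y)) \<partial>?P)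
      = (\<integral>\<^sup>+y. ennreal (norm a) * ennreal (norm (T f (Y (join I z y))) * exp (?c y)) \<partial>?P)"
    proof (rule nn_integral_cong_AE)
      show "AE y in ?P. ennreal (norm (T (\<lambda>x. a * f x) (Y (join I z y))) * exp (?c y))
        = ennreal (norm a) * ennreal (norm (T f (Y (join I z y))) * exp (?c y))"
        using elim(2) by eventually_elim (simp add: norm_mult ennreal_mult'[symmetric] mult.assoc)
    qed
    also have "\<dots> = ennreal (norm a) * (\<integral>\<^sup>+y. ennreal (norm (T f (Y (join I z y))) * exp (?c y)) \<partial>?P)"
      by (rule nn_integral_cmult[OF mY])
    also have "\<dots> < \<infinity>" using elim(1) by (simp add: ennreal_mult_less_top)
    finally show ?case .
  qed
qed

end

locale extremal_window = metaplectic_coordinates A B C D I e T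
  for A B C D :: "real^'n::finite^'n" and I e T +
  fixes g :: "real \<Rightarrow> complex" and K a b a' b' p q :: real
  assumes pq: "p \<ge> 1" "q \<ge> 1" and ab: "0 < a" "a < a'" "0 < b" "b < b'"
    and g_measurable: "g \<in> borel_measurable borel"
    and g_le: "\<And>x. norm (g x) \<le> K * exp (- (2 * pi * a' powr p / p) * \<bar>x\<bar> powr p)"
    and g_hat_le: "\<And>s. norm (LINT x|lborel. g x * cis (- 2 * pi * s * x)) \<le> K * exp (- (2 * pi * b' powr q / q) * \<bar>s\<bar> powr q)"
    and g_nonzero: "AE x in lborel. g x \<noteq> 0"
begin

text \<open>Decay is required only in the directions of \<open>I\<close>. In the others a Gaussian
  keeps the product square-integrable and without zeros.\<close>

definition window :: "'n \<Rightarrow> real \<Rightarrow> complex" where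
  "window i = (if i \<in> I then g else (\<lambda>x. of_real (exp (- 1 * x\<^sup>2))))"

definition W :: "real^'n \<Rightarrow> complex" where "W c = (\<Prod>i\<in>UNIV. window i (c $ i))"

lemma rates: "0 < 2 * pi * a powr p / p" "2 * pi * a powr p / p < 2 * pi * a' powr p / p"
  "0 < 2 * pi * b powr q / q" "2 * pi * b powr q / q < 2 * pi * b' powr q / q"
  using pq ab by (auto intro!: divide_strict_right_mono mult_strict_left_mono powr_less_mono2)

lemma integrable_g: "integrable lborel g"
  by (rule integrableI_bounded)
    (use g_measurable weighted_nn_integral_finite(2)[OF rates(1,2) pq(1), of g K 0] g_le in auto)

lemma integrable_g_sq: "integrable lborel (\<lambda>x. (norm (g x))\<^sup>2)"
proof (rule Bochner_Integration.integrable_bound)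
  show "integrable lborel (\<lambda>x. K * norm (g x))" using integrable_g by simp
  show "(\<lambda>x. (norm (g x))\<^sup>2) \<in> borel_measurable lborel" using g_measurable by measurable
  have le: "(norm (g x))\<^sup>2 \<le> K * norm (g x)" for x
  proof -
    have "K \<ge> 0" using g_le[of 0] norm_ge_zero[of "g 0"] by (simp add: order_trans[of 0 "norm (g 0)"])
    then have "K * exp (- (2 * pi * a' powr p / p) * \<bar>x\<bar> powr p) \<le> K * 1" using pq by (intro mult_left_mono) auto
    then have "norm (g x) \<le> K" using g_le[of x] by linarith
    then show ?thesis unfolding power2_eq_square by (intro mult_right_mono) auto
  qed
  have "norm ((norm (g x))\<^sup>2) \<le> norm (K * norm (g x))" for x
    using order_trans[OF le[of x] abs_ge_self] by simp
  then show "AE x in lborel. norm ((norm (g x))\<^sup>2) \<le> norm (K * norm (g x))" by simp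
qed

lemma window_measurable: "window i \<in> borel_measurable borel"
  using g_measurable by (simp add: window_def)

lemma integrable_window: "integrable lborel (window i)" "integrable lborel (\<lambda>x. (norm (window i x))\<^sup>2)"
proof -
  have 1: "integrable lborel (\<lambda>x::real. exp (- 1 * x\<^sup>2))" by (rule integrable_gaussian) simp
  have "integrable lborel (\<lambda>x::real. exp (- 2 * x\<^sup>2))" by (rule integrable_gaussian) simp
  moreover have "(exp (- 1 * x\<^sup>2))\<^sup>2 = exp (- 2 * x\<^sup>2)" for x :: real
    by (simp add: exp_double[symmetric])
  ultimately have 2: "integrable lborel (\<lambda>x::real. (exp (- 1 * x\<^sup>2))\<^sup>2)" by simp
  show "integrable lborel (window i)" "integrable lborel (\<lambda>x. (norm (window i x))\<^sup>2)"
    using integrable_g integrable_g_sq 1 2 by (simp_all add: window_def)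
qed

lemma W_measurable: "W \<in> borel_measurable borel"
  unfolding W_def[abs_def]
  by (intro borel_measurable_prod measurable_compose[OF borel_measurable_vec_nth window_measurable])

lemma W_L2: "W \<in> L2"
proof -
  have "integrable lborel (\<lambda>c::real^'n. \<Prod>i\<in>UNIV. (norm (window i (c $ i)))\<^sup>2)"
    by (rule integrable_prod_coordinates) (rule integrable_window(2))
  moreover have "(norm (W c))\<^sup>2 = (\<Prod>i\<in>UNIV. (norm (window i (c $ i)))\<^sup>2)" for c
    by (simp add: W_def prod_norm[symmetric] prod_power_distrib)
  ultimately show ?thesis using W_measurable by (simp add: L2_def)
qed

lemma W_nonzero: "AE c in lborel. W c \<noteq> 0"
proof -
  have "AE c in lborel. window i (c $ i) \<noteq> 0" for i
  proof (rule AE_coordinate)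
    show "AE x in lborel. window i x \<noteq> 0" using g_nonzero by (simp add: window_def)
    show "Measurable.pred borel (\<lambda>x. window i x \<noteq> 0)" using window_measurable[of i] by measurable
  qed
  then have "AE c in lborel. \<forall>i\<in>UNIV. window i (c $ i) \<noteq> 0" by (intro AE_finite_allI) auto
  then show ?thesis by eventually_elim (simp add: W_def)
qed

lemma W_join: "W (join I z y) = (\<Prod>i\<in>-I. window i (z i)) * (\<Prod>i\<in>I. g (y i))"
proof -
  have "W (join I z y) = (\<Prod>i\<in>-I. window i (join I z y $ i)) * (\<Prod>i\<in>I. window i (join I z y $ i))"
    using prod.union_disjoint[of "-I" I "\<lambda>i. window i (join I z y $ i)"] by (simp add: W_def Compl_partition2)
  also have "(\<Prod>i\<in>-I. window i (join I z y $ i)) = (\<Prod>i\<in>-I. window i (z i))" by (intro prod.cong) auto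
  also have "(\<Prod>i\<in>I. window i (join I z y $ i)) = (\<Prod>i\<in>I. g (y i))" by (intro prod.cong) (auto simp: window_def)
  finally show ?thesis .
qed

lemma cis_sum: "finite J \<Longrightarrow> cis (\<Sum>i\<in>J. f i) = (\<Prod>i\<in>J. cis (f i))"
  by (induction J rule: finite_induct) (auto simp: cis_mult[symmetric])

lemma W_cis_join:
  "W (join I z y) * cis (s \<bullet> join I z y) = (\<Prod>i\<in>-I. window i (z i) * cis (s $ i * z i)) * (\<Prod>i\<in>I. g (y i) * cis (s $ i * y i))"
proof -
  have "s \<bullet> join I z y = (\<Sum>i\<in>-I. s $ i * join I z y $ i) + (\<Sum>i\<in>I. s $ i * join I z y $ i)"
    using sum.union_disjoint[of "-I" I "\<lambda>i. s $ i * join I z y $ i"] by (simp add: inner_vec_def Compl_partition2)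
  also have "(\<Sum>i\<in>-I. s $ i * join I z y $ i) = (\<Sum>i\<in>-I. s $ i * z i)" by (intro sum.cong) auto
  also have "(\<Sum>i\<in>I. s $ i * join I z y $ i) = (\<Sum>i\<in>I. s $ i * y i)" by (intro sum.cong) auto
  finally have "cis (s \<bullet> join I z y) = (\<Prod>i\<in>-I. cis (s $ i * z i)) * (\<Prod>i\<in>I. cis (s $ i * y i))"
    by (simp add: cis_mult[symmetric] cis_sum)
  then show ?thesis unfolding W_join prod.distrib by (simp only: mult_ac)
qed

lemma integrable_g_cis: "integrable lborel (\<lambda>x. g x * cis (t * x))"
proof (rule Bochner_Integration.integrable_bound[OF integrable_g])
  show "(\<lambda>x. g x * cis (t * x)) \<in> borel_measurable lborel" using g_measurable by measurable
qed (simp add: norm_mult)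

lemma W_cis_fibre_integrable:
  "integrable (lborel_PiM I) (\<lambda>y. W (join I z y) * cis (s \<bullet> join I z y))"
proof -
  interpret product_sigma_finite "\<lambda>_::'n. lborel :: real measure" by (rule product_sigma_finite_lborel)
  have "integrable (lborel_PiM I) (\<lambda>y. \<Prod>i\<in>I. g (y i) * cis (s $ i * y i))"
    by (rule product_integrable_prod) (use integrable_g_cis in auto)
  then show ?thesis unfolding W_cis_join by (rule integrable_mult_right)
qed

definition g_hat :: "real \<Rightarrow> complex" where "g_hat s = (LINT x|lborel. g x * cis (- 2 * pi * s * x))"

lemma g_hat_measurable: "g_hat \<in> borel_measurable borel"
proof -
  have "(\<lambda>(s, x). g x * cis (- 2 * pi * s * x)) \<in> borel_measurable (borel \<Otimes>\<^sub>M lborel)"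
    using g_measurable by measurable
  then show ?thesis unfolding g_hat_def[abs_def] by (rule lborel.borel_measurable_lebesgue_integral)
qed

text \<open>The transform of a product is a product, and the character moves the i-th factor by
  \<open>s $ i / (2 * pi)\<close>; decay at a rate above the required one survives such
  shifts.\<close>

lemma partial_fourier_W_cis:
  "partial_fourier I (\<lambda>c. W c * cis (s \<bullet> c)) (join I z x)
    = (\<Prod>i\<in>-I. window i (z i) * cis (s $ i * z i)) * (\<Prod>i\<in>I. g_hat (x i - s $ i / (2 * pi)))"
proof -
  interpret product_sigma_finite "\<lambda>_::'n. lborel :: real measure" by (rule product_sigma_finite_lborel)
  have t: "W (join I z y) * cis (s \<bullet> join I z y) * cis (- 2 * pi * (\<Sum>i\<in>I. x i * y i))
    = (\<Prod>i\<in>-I. window i (z i) * cis (s $ i * z i)) * (\<Prod>i\<in>I. g (y i) * cis (- 2 * pi * (x i - s $ i / (2 * pi)) * y i))" for y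
  proof -
    have "cis (- 2 * pi * (\<Sum>i\<in>I. x i * y i)) = (\<Prod>i\<in>I. cis (- 2 * pi * (x i * y i)))"
      unfolding sum_distrib_left by (rule cis_sum) simp
    then have "(\<Prod>i\<in>I. g (y i) * cis (s $ i * y i)) * cis (- 2 * pi * (\<Sum>i\<in>I. x i * y i))
      = (\<Prod>i\<in>I. g (y i) * cis (s $ i * y i) * cis (- 2 * pi * (x i * y i)))" by (simp only: prod.distrib)
    also have "\<dots> = (\<Prod>i\<in>I. g (y i) * cis (- 2 * pi * (x i - s $ i / (2 * pi)) * y i))"
    proof (rule prod.cong[OF refl])
      fix i
      have "s $ i * y i + - 2 * pi * (x i * y i) = - 2 * pi * (x i - s $ i / (2 * pi)) * y i"
        by (simp add: field_simps)
      then show "g (y i) * cis (s $ i * y i) * cis (- 2 * pi * (x i * y i)) = g (y i) * cis (- 2 * pi * (x i - s $ i / (2 * pi)) * y i)"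
        by (simp only: mult.assoc cis_mult)
    qed
    finally show ?thesis unfolding W_cis_join by (simp only: mult.assoc)
  qed
  have "(LINT y|lborel_PiM I. (\<Prod>i\<in>I. g (y i) * cis (- 2 * pi * (x i - s $ i / (2 * pi)) * y i)))
    = (\<Prod>i\<in>I. g_hat (x i - s $ i / (2 * pi)))"
    unfolding g_hat_def by (rule product_integral_prod, simp, rule integrable_g_cis)
  then show ?thesis unfolding partial_fourier_join t by (simp only: integral_mult_right_zero)
qed

lemma pull_W_trig_L2: "t \<in> trig_poly \<Longrightarrow> (\<lambda>x. pull W x * t x) \<in> L2"
proof -
  assume t: "t \<in> trig_poly"
  obtain M where M: "\<And>x. norm (t x) \<le> M" using trig_poly_bounded[OF t] by blast
  have w: "pull W \<in> L2" by (rule pull_L2[OF W_L2])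
  show ?thesis
  proof (rule L2_bound[OF L2_cmult[OF w, of "of_real M"]])
    show "(\<lambda>x. pull W x * t x) \<in> borel_measurable borel"
      using L2_measurable[OF w] trig_poly_measurable[OF t] by measurable
    show "norm (pull W x * t x) \<le> norm (of_real M * pull W x)" for x
    proof -
      have "norm (pull W x * t x) \<le> norm (pull W x) * \<bar>M\<bar>"
        unfolding norm_mult using M[of x] by (intro mult_left_mono) auto
      then show ?thesis by (simp add: norm_mult mult.commute)
    qed
  qed
qed

text \<open>The chirp is unimodular and \<open>t\<close> is bounded, so the weighted integral is at
  most a constant times that of the product of copies of \<open>g\<close>; here all trigonometric
  polynomials are handled at once.\<close>

lemma decay_f_window:
  assumes j: "j \<in> I" and t: "t \<in> trig_poly"
  shows "decay_f A B D (e j) p a (\<lambda>x. pull W x * t x)"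
proof -
  let ?P = "lborel_PiM I"
  let ?c = "\<lambda>y. 2 * pi * a powr p / p * \<bar>y j\<bar> powr p"
  obtain M where M: "\<And>x. norm (t x) \<le> M" using trig_poly_bounded[OF t] by blast
  have fin: "(\<integral>\<^sup>+y. ennreal (norm (\<Prod>i\<in>I. g (y i)) * exp (?c y)) \<partial>?P) < \<infinity>"
    by (rule weighted_prod_nn_integral_finite[OF rates(1,2) pq(1) j, where C = K and s = "\<lambda>_. 0"])
      (use g_measurable g_le in auto)
  have pm: "(\<lambda>y. ennreal (norm (\<Prod>i\<in>I. g (y i)) * exp (?c y))) \<in> borel_measurable ?P"
  proof -
    have "(\<lambda>y. \<Prod>i\<in>I. g (y i)) \<in> borel_measurable ?P"
      by (rule borel_measurable_prod) (rule measurable_compose[OF component_measurable g_measurable])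
    then show ?thesis using coord_powr_measurable[OF j, of p] by measurable
  qed
  have "(\<integral>\<^sup>+y. ennreal (norm (pull W (X (join I z y)) * t (X (join I z y))) * exp (?c y)) \<partial>?P) < \<infinity>" for z
  proof -
    define L where "L = \<bar>M\<bar> * norm (\<Prod>i\<in>-I. window i (z i))"
    have L: "L \<ge> 0" by (simp add: L_def)
    have "(\<integral>\<^sup>+y. ennreal (norm (pull W (X (join I z y)) * t (X (join I z y))) * exp (?c y)) \<partial>?P)
      \<le> (\<integral>\<^sup>+y. ennreal L * ennreal (norm (\<Prod>i\<in>I. g (y i)) * exp (?c y)) \<partial>?P)"
    proof (rule nn_integral_mono)
      fix y
      have "norm (pull W (X (join I z y)) * t (X (join I z y))) \<le> norm (W (join I z y)) * \<bar>M\<bar>"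
        unfolding norm_mult using M[of "X (join I z y)"] by (intro mult_mono) (auto simp: pull_def norm_mult)
      also have "\<dots> = L * norm (\<Prod>i\<in>I. g (y i))" by (simp add: W_join norm_mult L_def mult_ac)
      finally have "norm (pull W (X (join I z y)) * t (X (join I z y))) * exp (?c y) \<le> L * norm (\<Prod>i\<in>I. g (y i)) * exp (?c y)"
        by (rule mult_right_mono) simp
      then show "ennreal (norm (pull W (X (join I z y)) * t (X (join I z y))) * exp (?c y))
        \<le> ennreal L * ennreal (norm (\<Prod>i\<in>I. g (y i)) * exp (?c y))"
        using L by (subst ennreal_mult[symmetric]) (auto intro: ennreal_leI simp: mult.assoc)
    qed
    also have "\<dots> = ennreal L * (\<integral>\<^sup>+y. ennreal (norm (\<Prod>i\<in>I. g (y i)) * exp (?c y)) \<partial>?P)" by (rule nn_integral_cmult[OF pm])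
    also have "\<dots> < \<infinity>" using fin by (simp add: ennreal_mult_less_top)
    finally show ?thesis .
  qed
  then show ?thesis unfolding decay_f_iff[OF j L2_measurable[OF pull_W_trig_L2[OF t]]] by simp
qed

lemma decay_Sf_window_char:
  assumes j: "j \<in> I"
  shows "decay_Sf A B (e j) q b (T (\<lambda>x. pull W x * cis (s \<bullet> x)))"
proof -
  let ?P = "lborel_PiM I"
  let ?c = "\<lambda>y. 2 * pi * b powr q / q * \<bar>y j\<bar> powr q"
  let ?f = "\<lambda>x. pull W x * cis (s \<bullet> x)"
  \<comment> \<open>The frequency of the given character in the coordinates \<open>c\<close>;
    pulling back and pushing forward cancel the chirp.\<close>
  define s' where "s' = adjoint X s"
  define F where "F c = W c * cis (s' \<bullet> c)" for c
  have fL: "?f \<in> L2" by (rule pull_W_trig_L2[OF trig_poly.char])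
  have pf: "push ?f = F"
  proof
    fix c
    have "s' \<bullet> c = s \<bullet> X c" using adjoint_works[OF linear_X, of c s] by (simp add: s'_def inner_commute)
    moreover have "push ?f c = W c * cis (s \<bullet> X c) * (cis (- chirp c) * cis (chirp c))"
      unfolding push_def pull_def Xi_X by (simp only: mult_ac)
    ultimately show "push ?f c = F c" unfolding cis_cancel F_def by simp
  qed
  have FL: "F \<in> L2" unfolding pf[symmetric] by (rule push_L2[OF fL])
  obtain \<kappa> where k: "\<kappa> \<noteq> 0" "\<And>F. F \<in> L2 \<Longrightarrow>
    (AE z in lborel_PiM (- I). integrable ?P (\<lambda>y. F (join I z y))) \<Longrightarrow>
    AE c in lborel. U F c = \<kappa> * partial_fourier I F c"
    by (rule U_partial_fourier) (rule that)
  have "AE c in lborel. U F c = \<kappa> * partial_fourier I F c"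
    by (rule k(2)[OF FL]) (simp add: F_def W_cis_fibre_integrable)
  then have AEj: "AE z in lborel_PiM (- I). AE y in ?P. U F (join I z y) = \<kappa> * partial_fourier I F (join I z y)"
    by (rule AE_join)
  define \<phi> where "\<phi> i x = g_hat (x - s' $ i / (2 * pi))" for i x
  have \<phi>m: "\<phi> i \<in> borel_measurable borel" for i
    unfolding \<phi>_def[abs_def] by (rule measurable_compose[OF _ g_hat_measurable]) measurable
  have fin: "(\<integral>\<^sup>+y. ennreal (norm (\<Prod>i\<in>I. \<phi> i (y i)) * exp (?c y)) \<partial>?P) < \<infinity>"
    by (rule weighted_prod_nn_integral_finite[OF rates(3,4) pq(2) j \<phi>m, where C = K and s = "\<lambda>i. s' $ i / (2 * pi)"])
      (unfold \<phi>_def g_hat_def, rule g_hat_le)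
  have pm: "(\<lambda>y. ennreal (norm (\<Prod>i\<in>I. \<phi> i (y i)) * exp (?c y))) \<in> borel_measurable ?P"
  proof -
    have "(\<lambda>y. \<Prod>i\<in>I. \<phi> i (y i)) \<in> borel_measurable ?P"
      by (rule borel_measurable_prod) (rule measurable_compose[OF component_measurable \<phi>m])
    then show ?thesis using coord_powr_measurable[OF j, of q] by measurable
  qed
  show ?thesis unfolding decay_Sf_iff[OF j L2_measurable[OF T_L2[OF fL]]]
    using AEj
  proof eventually_elim
    case (elim z)
    define L where "L = norm \<kappa> * norm (\<Prod>i\<in>-I. window i (z i) * cis (s' $ i * z i))"
    have L: "L \<ge> 0" by (simp add: L_def)
    have "(\<integral>\<^sup>+y. ennreal (norm (T ?f (Y (join I z y))) * exp (?c y)) \<partial>?P)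
      = (\<integral>\<^sup>+y. ennreal L * ennreal (norm (\<Prod>i\<in>I. \<phi> i (y i)) * exp (?c y)) \<partial>?P)"
    proof (rule nn_integral_cong_AE)
      show "AE y in ?P. ennreal (norm (T ?f (Y (join I z y))) * exp (?c y))
        = ennreal L * ennreal (norm (\<Prod>i\<in>I. \<phi> i (y i)) * exp (?c y))"
        using elim
      proof eventually_elim
        case (elim y)
        have "norm (T ?f (Y (join I z y))) = norm \<kappa> * norm (partial_fourier I F (join I z y))"
          using norm_U[of ?f "join I z y"] elim unfolding pf by (simp add: norm_mult)
        also have "\<dots> = L * norm (\<Prod>i\<in>I. \<phi> i (y i))"
          unfolding F_def[abs_def] partial_fourier_W_cis L_def \<phi>_def norm_mult by (simp only: mult.assoc)
        finally have "norm (T ?f (Y (join I z y))) * exp (?c y) = L * (norm (\<Prod>i\<in>I. \<phi> i (y i)) * exp (?c y))"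
          by (simp only: mult.assoc)
        then show ?case using L by (simp only: ennreal_mult')
      qed
    qed
    also have "\<dots> = ennreal L * (\<integral>\<^sup>+y. ennreal (norm (\<Prod>i\<in>I. \<phi> i (y i)) * exp (?c y)) \<partial>?P)" by (rule nn_integral_cmult[OF pm])
    also have "\<dots> < \<infinity>" using fin by (simp add: ennreal_mult_less_top)
    finally show ?case .
  qed
qed

lemma decay_Sf_window:
  assumes j: "j \<in> I"
  shows "t \<in> trig_poly \<Longrightarrow> decay_Sf A B (e j) q b (T (\<lambda>x. pull W x * t x))"
proof (induction rule: trig_poly.induct)
  case (char s)
  show ?case by (rule decay_Sf_window_char[OF j])
next
  case (add f g)
  from decay_Sf_add[OF j pull_W_trig_L2[OF add.hyps(1)] add.IH(1) pull_W_trig_L2[OF add.hyps(2)] add.IH(2)]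
  show ?case by (simp only: distrib_left)
next
  case (scale f c)
  from decay_Sf_scale[OF j pull_W_trig_L2[OF scale.hyps] scale.IH, of c]
  show ?case by (simp only: mult.left_commute)
qed

lemma dense_window: "L2_dense {\<lambda>x. pull W x * t x | t. t \<in> trig_poly}"
  unfolding L2_dense_def
proof (intro conjI ballI allI impI)
  show "{\<lambda>x. pull W x * t x | t. t \<in> trig_poly} \<subseteq> L2" using pull_W_trig_L2 by auto
  fix h :: "real^'n \<Rightarrow> complex" and \<epsilon> :: real
  assume h: "h \<in> L2" and eps: "\<epsilon> > 0"
  have "AE x in lborel. W (Xi x) \<noteq> 0" by (rule AE_linear[OF linear_Xi inj_Xi W_nonzero])
  then have nz: "AE x in lborel. pull W x \<noteq> 0" by eventually_elim (simp add: pull_def)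
  have e2: "\<epsilon>\<^sup>2 > 0" using eps by simp
  obtain t where t: "t \<in> trig_poly" "(LINT c|lborel. (norm (h c - pull W c * t c))\<^sup>2) < \<epsilon>\<^sup>2"
    by (rule weighted_trig_poly_dense[OF pull_L2[OF W_L2] nz h e2])
  have "L2_norm (\<lambda>x. pull W x * t x - h x) < \<epsilon>"
    using real_sqrt_less_mono[OF t(2)] eps unfolding L2_norm_def by (simp add: norm_minus_commute)
  then show "\<exists>f\<in>{\<lambda>x. pull W x * t x | t. t \<in> trig_poly}. L2_norm (\<lambda>x. f x - h x) < \<epsilon>"
    using t(1) by (intro bexI[of _ "\<lambda>x. pull W x * t x"]) auto
qed

end

context metaplectic_coordinates
begin

theorem morgan_dense:
  assumes p: "1 < p" "p < 2" "1 / p + 1 / q = 1" and ab: "a > 0" "b > 0"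
    and abc: "a * b < \<bar>cos (p * pi / 2)\<bar> powr (1 / p)"
  shows "\<exists>G. L2_dense G \<and> (\<forall>f\<in>G. \<forall>j\<in>I. decay_f A B D (e j) p a f \<and> decay_Sf A B (e j) q b (T f))"
proof -
  obtain g a' b' K where g: "a' > a" "b' > b" "g \<in> borel_measurable borel"
    "\<And>x. norm (g x) \<le> K * exp (- (2 * pi * a' powr p / p) * \<bar>x\<bar> powr p)"
    "\<And>s. norm (LINT x|lborel. g x * cis (- 2 * pi * s * x)) \<le> K * exp (- (2 * pi * b' powr q / q) * \<bar>s\<bar> powr q)"
    "AE x in lborel. g x \<noteq> 0"
    by (rule morgan_extremal[OF p ab abc]) (rule that)
  have q: "q \<ge> 1"
  proof -
    have "1 / q = (p - 1) / p" using p by (simp add: field_simps)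
    then have "1 / (1 / q) = p / (p - 1)" by simp
    then have "q = p / (p - 1)" by simp
    then show ?thesis using p by (simp add: pos_le_divide_eq)
  qed
  interpret extremal_window A B C D I e T g K a b a' b' p q
    by standard (use p q ab g in auto)
  show ?thesis
    by (rule exI[of _ "{\<lambda>x. pull W x * t x | t. t \<in> trig_poly}"])
      (use dense_window decay_f_window decay_Sf_window in auto)
qed

end

theorem theorem4p2:
  fixes A B C D :: "real^'n^'n"
    and S_hat :: "(real^'n \<Rightarrow> complex) \<Rightarrow> (real^'n \<Rightarrow> complex)"
    and v :: "nat \<Rightarrow> real^'n"
    and r :: nat
    and p q :: real
  assumes "symplectic_blocks A B C D"
    and "metaplectic_op A B C D S_hat"
    and "r = rank B" and "1 \<le> r" and "r \<le> CARD('n)"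
    and "\<forall>i\<in>{1..r}. \<forall>j\<in>{1..r}. v i \<bullet> v j = (if i = j then 1 else 0)"
    and "span (v ` {1..r}) = (mat_ker B)\<^sup>\<bottom>"
    and "1 < p" and "p < 2" and "1 / p + 1 / q = 1"
  shows "(\<forall>f\<in>L2. \<forall>j\<in>{1..r}. \<forall>a>0. \<forall>b>0.
            a * b > \<bar>cos (p * pi / 2)\<bar> powr (1 / p) \<longrightarrow>
            decay_f A B D (v j) p a f \<longrightarrow>
            decay_Sf A B (v j) q b (S_hat f) \<longrightarrow>
            (AE x in lborel. f x = 0))
       \<and> (\<forall>a>0. \<forall>b>0.
            a * b < \<bar>cos (p * pi / 2)\<bar> powr (1 / p) \<longrightarrow>
            (\<exists>G. L2_dense G \<and>
               (\<forall>f\<in>G. \<forall>j\<in>{1..r}.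
                  decay_f A B D (v j) p a f \<and> decay_Sf A B (v j) q b (S_hat f))))"
proof -
  note p = assms(8-10)
  obtain I \<iota> and e :: "'n \<Rightarrow> real^'n" where \<iota>: "bij_betw \<iota> I {1..r}" and ev: "\<And>i. i \<in> I \<Longrightarrow> e i = v (\<iota> i)"
    and e: "\<And>i j. e i \<bullet> e j = (if i = j then 1 else 0)" "span (e ` I) = (mat_ker B)\<^sup>\<bottom>" "span (e ` (- I)) = mat_ker B"
  proof (rule adapted_basis[where v = v and r = r and K = "mat_ker B"])
    show "v i \<bullet> v j = (if i = j then 1 else 0)" if "i \<in> {1..r}" "j \<in> {1..r}" for i j
      using assms(6) that by blast
  qed (use assms(5,7) subspace_mat_ker in auto)
  interpret metaplectic_coordinates A B C D I e S_hat
    by standard (use assms(1,2) e in auto)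
  have ex: "\<exists>i\<in>I. v j = e i" if j: "j \<in> {1..r}" for j
  proof -
    have "j \<in> \<iota> ` I" using bij_betw_imp_surj_on[OF \<iota>] j by simp
    then show ?thesis using ev by auto
  qed
  show ?thesis
  proof (intro conjI ballI allI impI)
    fix f :: "real^'n \<Rightarrow> complex" and j :: nat and a b :: real
    assume f: "f \<in> L2" and j: "j \<in> {1..r}" and a: "0 < a" and b: "0 < b"
      and ab: "\<bar>cos (p * pi / 2)\<bar> powr (1 / p) < a * b"
      and d: "decay_f A B D (v j) p a f" "decay_Sf A B (v j) q b (S_hat f)"
    obtain i where i: "i \<in> I" "v j = e i" using ex[OF j] by blast
    show "AE x in lborel. f x = 0"
      by (rule morgan_uniqueness[OF p a b ab i(1) f d[unfolded i(2)]])
  next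
    fix a b :: real
    assume a: "0 < a" and b: "0 < b" and ab: "a * b < \<bar>cos (p * pi / 2)\<bar> powr (1 / p)"
    obtain G where G: "L2_dense G"
      "\<And>f i. f \<in> G \<Longrightarrow> i \<in> I \<Longrightarrow> decay_f A B D (e i) p a f \<and> decay_Sf A B (e i) q b (S_hat f)"
      using morgan_dense[OF p a b ab] by blast
    have "decay_f A B D (v j) p a f \<and> decay_Sf A B (v j) q b (S_hat f)" if fG: "f \<in> G" and jr: "j \<in> {1..r}" for f j
    proof -
      obtain i where i: "i \<in> I" "v j = e i" using ex[OF jr] by blast
      show ?thesis unfolding i(2) by (rule G(2)[OF fG i(1)])
    qed
    then show "\<exists>G. L2_dense G \<and> (\<forall>f\<in>G. \<forall>j\<in>{1..r}.
                  decay_f A B D (v j) p a f \<and> decay_Sf A B (v j) q b (S_hat f))"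
      using G(1) by blast
  qed
qed

end
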